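(* Let $F\in\mathrm{Diff}(\mathbb{C}^2,0)$ be a germ with the finite orbits property and with $\mathrm{Spec}(D_0F)=\{1,\lambda\}$, where $\lambda$ is not a root of unity. Then: \begin{itemize} \item $\lambda$ is not a Bruno number; \item $\mathrm{Fix}(F)$ is a smooth curve through the origin; \item $F$ is formally conjugated to $(x,y)\mapsto(\lambda x,y)$ by a formal diffeomorphism that is transversally formal along $\mathrm{Fix}(F)$; \item there exists a divergent smooth invariant curve through any point $p\in\mathrm{Fix}(F)$. \end{itemize}
   Context: $\mathrm{Diff}(\mathbb{C}^2,0)$ is the group of germs at $0$ of biholomorphisms of $\mathbb{C}^2$ fixing $0$. For a representative $F:U\to V$ (a biholomorphism between open neighborhoods of $0$ with $F(0)=0$), $A\subset U\cap V$ and $p\in A$, put $O^+_{F,A}(p)=\{F^j(p): j\ge 0,\ F^k(p)\in A\text{ for all }0\le k\le j\}$ and $O_{F,A}(p)=O^+_{F,A}(p)\cup O^+_{F^{-1},A}(p)$. $F$ has the finite orbits property in $A$ if $O_{F,A}(p)$ is finite for all $p\in A$. A germ $F$ has the finite orbits property if there exist a representative $F:U\to V$ and a neighborhood $A\subset U\cap V$ of $0$ such that $F$ has the finite orbits property in $A$. A number $\lambda\in\mathbb{C}$ is a Bruno number if $|\lambda|=1$ and there is a sequence of integers $1<q_1<q_2<\cdots$ such that $\sum_{k=1}^\infty\frac{1}{q_k}\log\frac{1}{\Omega_\lambda(q_{k+1})}<+\infty$, where $\Omega_\lambda(m)=\min_{2\le k\le m}|\lambda^k-\lambda|$ for $m\ge2$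 (with $\log(1/0)=+\infty$). $\mathrm{Fix}(F)$ is the germ at $0$ of the set of fixed points of $F$; points $p\in\mathrm{Fix}(F)$ are taken in a sufficiently small neighborhood of $0$. A formal diffeomorphism at $0\in\mathbb{C}^2$ is a pair of formal power series without constant term and with invertible linear part. $F$ is formally conjugated to $L(x,y)=(\lambda x,y)$ by the formal diffeomorphism $H$ if $H\circ F\circ H^{-1}=L$. $H$ is transversally formal along a smooth germ of curve $S$ at $0$ if for some $\psi\in\mathrm{Diff}(\mathbb{C}^2,0)$ with $\psi(S)=\{u=0\}$, in the coordinates $(u,v)$, the components of $H\circ\psi^{-1}(u,v)$ are of the form $\sum_{j\ge0}h_j(v)u^j$ with all $h_j$ holomorphic in a common neighborhood of $0\in\mathbb{C}$. A smooth formal curve at $p$ is an ideal $(f)$ of the ring of formal power series centered at $p$ with $f(p)=0$ and non-zero linear part at $p$; it is invariant by $F$ (with $F(p)=p$) if $f$ divides $f\circ F$, and it is divergent if it is not generated by a convergent power series. *)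

theory Defs
  imports "HOL-Complex_Analysis.Complex_Analysis"
begin

type_synonym complex2 = "complex \<times> complex"

definition cscale :: "complex \<Rightarrow> complex2 \<Rightarrow> complex2" where
  "cscale c z = (c * fst z, c * snd z)"

definition holomorphic2_on :: "(complex2 \<Rightarrow> complex2) \<Rightarrow> complex2 set \<Rightarrow> bool" where
  "holomorphic2_on F U \<longleftrightarrow> open U \<and>
     (\<forall>p\<in>U. \<exists>D. (F has_derivative D) (at p) \<and> (\<forall>c z. D (cscale c z) = cscale c (D z)))"

text \<open>A representative of a germ in Diff(C^2,0); the values of \<open>F\<close> outside \<open>U\<close> are irrelevant,
  and its inverse is \<open>inv_into U F\<close> on \<open>V\<close>.\<close>

definition representative :: "(complex2 \<Rightarrow> complex2) \<Rightarrow> complex2 set \<Rightarrow> complex2 set \<Rightarrow> bool" where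
  "representative F U V \<longleftrightarrow> open U \<and> open V \<and> 0 \<in> U \<and> F 0 = 0 \<and> bij_betw F U V \<and>
     holomorphic2_on F U \<and> holomorphic2_on (inv_into U F) V"

text \<open>A germ is given by any function defining it near 0; two functions define the same germ
  iff they agree eventually in \<open>nhds 0\<close>.\<close>

definition Diff0 :: "(complex2 \<Rightarrow> complex2) set" where
  "Diff0 = {F. \<exists>U V. representative F U V}"

definition Spec :: "(complex2 \<Rightarrow> complex2) \<Rightarrow> complex set" where
  "Spec T = {\<mu>. \<exists>v. v \<noteq> 0 \<and> T v = cscale \<mu> v}"

definition Fix :: "(complex2 \<Rightarrow> complex2) \<Rightarrow> complex2 set" where
  "Fix F = {p. F p = p}"

definition pos_orbit :: "(complex2 \<Rightarrow> complex2) \<Rightarrow> complex2 set \<Rightarrow> complex2 \<Rightarrow> complex2 set" where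
  "pos_orbit F A p = {(F ^^ j) p | j. \<forall>k\<le>j. (F ^^ k) p \<in> A}"

definition finite_orbits_in ::
    "(complex2 \<Rightarrow> complex2) \<Rightarrow> complex2 set \<Rightarrow> complex2 set \<Rightarrow> bool" where
  "finite_orbits_in F U A \<longleftrightarrow>
     (\<forall>p\<in>A. finite (pos_orbit F A p \<union> pos_orbit (inv_into U F) A p))"

definition finite_orbits_property :: "(complex2 \<Rightarrow> complex2) \<Rightarrow> bool" where
  "finite_orbits_property F \<longleftrightarrow>
     (\<exists>G U V A. representative G U V \<and> (\<forall>\<^sub>F p in nhds 0. G p = F p) \<and>
        A \<subseteq> U \<inter> V \<and> 0 \<in> interior A \<and> finite_orbits_in G U A)"

definition Omega :: "complex \<Rightarrow> nat \<Rightarrow> real" where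
  "Omega lam m = Min ((\<lambda>k. cmod (lam ^ k - lam)) ` {2..m})"

definition log_inverse :: "real \<Rightarrow> ereal" where
  "log_inverse x = (if x = 0 then \<infinity> else ereal (ln (1 / x)))"

text \<open>The sequence \<open>q\<close> is indexed from 0. For \<open>cmod lam = 1\<close> only finitely many
  terms of the series can be negative, so it always has a sum in \<open>ereal\<close>.\<close>

definition Bruno :: "complex \<Rightarrow> bool" where
  "Bruno lam \<longleftrightarrow> cmod lam = 1 \<and>
     (\<exists>q :: nat \<Rightarrow> nat. 1 < q 0 \<and> strict_mono q \<and>
        (\<exists>S. (\<lambda>k. ereal (1 / real (q k)) * log_inverse (Omega lam (q (Suc k)))) sums S \<and> S < \<infinity>))"

text \<open>\<open>C[[x,y]]\<close> is realized as \<open>C[[y]][[x]]\<close>: the outer index is the exponent of the first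
  variable.\<close>

type_synonym fps2 = "complex fps fps"

abbreviation coeff2 :: "fps2 \<Rightarrow> nat \<Rightarrow> nat \<Rightarrow> complex" where
  "coeff2 f i j \<equiv> fps_nth (fps_nth f i) j"

text \<open>The substitution \<open>f(g\<^sub>1, g\<^sub>2)\<close>, meaningful when \<open>g\<^sub>1\<close> and \<open>g\<^sub>2\<close> have no constant term:
  then \<open>g\<^sub>1^i * g\<^sub>2^j\<close> has order at least \<open>i + j\<close>, so the truncated sum contains all
  contributions.\<close>

definition compose2 :: "fps2 \<Rightarrow> fps2 \<times> fps2 \<Rightarrow> fps2" where
  "compose2 f g = Abs_fps (\<lambda>m. Abs_fps (\<lambda>n.
     \<Sum>i\<le>m + n. \<Sum>j\<le>m + n - i. coeff2 f i j * coeff2 (fst g ^ i * snd g ^ j) m n))"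

definition compose_map :: "fps2 \<times> fps2 \<Rightarrow> fps2 \<times> fps2 \<Rightarrow> fps2 \<times> fps2" where
  "compose_map H G = (compose2 (fst H) G, compose2 (snd H) G)"

definition id_map :: "fps2 \<times> fps2" where
  "id_map = (fps_X, fps_const fps_X)"

definition formal_diffeo :: "fps2 \<times> fps2 \<Rightarrow> bool" where
  "formal_diffeo H \<longleftrightarrow> coeff2 (fst H) 0 0 = 0 \<and> coeff2 (snd H) 0 0 = 0 \<and>
     coeff2 (fst H) 1 0 * coeff2 (snd H) 0 1 - coeff2 (fst H) 0 1 * coeff2 (snd H) 1 0 \<noteq> 0"

definition taylor2 :: "(complex2 \<Rightarrow> complex) \<Rightarrow> complex2 \<Rightarrow> fps2" where
  "taylor2 f p = Abs_fps (\<lambda>i. Abs_fps (\<lambda>j.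
     (deriv ^^ i) (\<lambda>x. (deriv ^^ j) (\<lambda>y. f (x, y)) (snd p)) (fst p) / (fact i * fact j)))"

text \<open>The Taylor expansion of \<open>F\<close> at \<open>p\<close>, in coordinates centered at \<open>p\<close> in the source and at
  \<open>F p\<close> in the target.\<close>

definition taylor_map :: "(complex2 \<Rightarrow> complex2) \<Rightarrow> complex2 \<Rightarrow> fps2 \<times> fps2" where
  "taylor_map F p = (taylor2 (\<lambda>z. fst (F z - F p)) p, taylor2 (\<lambda>z. snd (F z - F p)) p)"

definition convergent2 :: "fps2 \<Rightarrow> bool" where
  "convergent2 f \<longleftrightarrow> (\<exists>r>0. \<forall>x y. cmod x < r \<and> cmod y < r \<longrightarrow>
     (\<lambda>(i, j). coeff2 f i j * x ^ i * y ^ j) summable_on UNIV)"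

definition formally_conjugated_by ::
    "fps2 \<times> fps2 \<Rightarrow> fps2 \<times> fps2 \<Rightarrow> fps2 \<times> fps2 \<Rightarrow> bool" where
  "formally_conjugated_by H F L \<longleftrightarrow>
     (\<exists>K. formal_diffeo K \<and> compose_map H K = id_map \<and> compose_map K H = id_map \<and>
        compose_map (compose_map H F) K = L)"

text \<open>\<open>\<psi>(S) = {u = 0}\<close> as germs at 0, for \<open>\<psi> \<in> Diff0\<close>\<close>

definition straightens :: "(complex2 \<Rightarrow> complex2) \<Rightarrow> complex2 set \<Rightarrow> bool" where
  "straightens \<psi> S \<longleftrightarrow> (\<forall>\<^sub>F p in nhds 0. p \<in> S \<longleftrightarrow> fst (\<psi> p) = 0)"

definition smooth_curve_germ :: "complex2 set \<Rightarrow> bool" where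
  "smooth_curve_germ S \<longleftrightarrow> (\<exists>\<psi>\<in>Diff0. straightens \<psi> S)"

text \<open>For a series in the variables \<open>(u, v)\<close>, the coefficient \<open>fps_nth f j\<close> is the series in
  \<open>v\<close> that multiplies \<open>u^j\<close>.\<close>

definition transversally_convergent :: "fps2 \<Rightarrow> bool" where
  "transversally_convergent f \<longleftrightarrow>
     (\<exists>W h. open W \<and> 0 \<in> W \<and>
        (\<forall>j. h j holomorphic_on W \<and> fps_nth f j = fps_expansion (h j) 0))"

definition transversally_formal :: "fps2 \<times> fps2 \<Rightarrow> complex2 set \<Rightarrow> bool" where
  "transversally_formal H S \<longleftrightarrow>
     (\<exists>\<psi> U V. representative \<psi> U V \<and> straightens \<psi> S \<and>
        (let G = compose_map H (taylor_map (inv_into U \<psi>) 0)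
         in transversally_convergent (fst G) \<and> transversally_convergent (snd G)))"

text \<open>A formal curve at \<open>p\<close> is an ideal of the ring of power series in coordinates centered at
  \<open>p\<close>.\<close>

definition principal_ideal :: "fps2 \<Rightarrow> fps2 set" where
  "principal_ideal f = {f * h | h. True}"

definition smooth_formal_curve :: "fps2 set \<Rightarrow> bool" where
  "smooth_formal_curve C \<longleftrightarrow>
     (\<exists>f. C = principal_ideal f \<and> coeff2 f 0 0 = 0 \<and> (coeff2 f 1 0 \<noteq> 0 \<or> coeff2 f 0 1 \<noteq> 0))"

definition invariant_curve_at :: "(complex2 \<Rightarrow> complex2) \<Rightarrow> complex2 \<Rightarrow> fps2 set \<Rightarrow> bool" where
  "invariant_curve_at F p C \<longleftrightarrow> F p = p \<and>
     (\<forall>f. C = principal_ideal f \<longrightarrow> f dvd compose2 f (taylor_map F p))"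

definition divergent_curve :: "fps2 set \<Rightarrow> bool" where
  "divergent_curve C \<longleftrightarrow> \<not> (\<exists>g. convergent2 g \<and> C = principal_ideal g)"

end

theory Submission
  imports Defs
begin

text \<open>In the coordinates \<open>\<psi>(p) = (\<ell>\<^sub>1(F p - p) / (\<lambda> - 1), \<ell>\<^sub>2 p)\<close>, with \<open>\<ell>\<^sub>1\<close>, \<open>\<ell>\<^sub>2\<close> dual to
  the eigenvectors, fixed points lie on \<open>{x = 0}\<close> and \<open>F(0, y) = (O(c(y)), y + c(y))\<close>. If
  \<open>c(y) = \<beta> y^(k+1) + \<dots>\<close> with \<open>\<beta> \<noteq> 0\<close>, then \<open>F\<close> or its inverse has an attracting direction in \<open>y\<close>
  along which the transverse multiplier has modulus at least \<open>1 - O(|y|^k)\<close>. Near an approximate invariant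
  curve the map then expands \<open>x / y^M\<close>, and the points that are never expelled from a thin sector have
  infinite orbits. So \<open>{x = 0}\<close> consists of fixed points; its multiplier has modulus 1, since otherwise \<open>F\<close>
  or its inverse contracts towards it, and hence equals \<open>\<lambda>\<close>. The homological equations, with divisors
  \<open>\<lambda>^n - 1\<close>, now have solutions whose coefficients are holomorphic in \<open>y\<close>.

  For a Bruno number \<open>\<lambda>\<close> one invariant curve \<open>t \<mapsto> (t \<xi>(t), \<eta>(t))\<close> on which \<open>F\<close> is the rotation
  \<open>t \<mapsto> \<lambda> t\<close> converges, and a rotation has infinite orbits. If a formal invariant curve \<open>Y = const\<close> converges,
  then \<open>F\<close> restricts to a one-dimensional germ with multiplier \<open>\<lambda>\<close>; the points whose orbits stay in a small
  disc contain a continuum reaching its boundary, hence uncountably many points, but only countably many are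
  periodic.\<close>

subsection \<open>Holomorphic functions of two variables\<close>

text \<open>The sector argument compares two rates. Along an attracting direction |y| loses about
  the fraction |y|^k per step, so |y|^M loses about M |y|^k, more than the transverse multiplier can
  take from x once M is large. An invariant curve need not converge, but a polynomial curve with
  defect O(|y|^(M + k + 1)) suffices: this error is smaller than the gain. The obstacle is a
  multiplier \<lambda> (1 + a y^j + ...) with 0 < j < k: the real part of a y^j may vanish in every
  attracting direction of F, where the leading term decides nothing. The attracting directions of
  the inverse interlace with those of F and carry the coefficient -a, and the 2 k candidates cannot
  all fail because a sum of roots of unity vanishes.

  Identities between formal composites are not derived from coefficient sums: they are read off,
  modulo high order, from Taylor series of composites of polynomial maps. Osgood's lemma reduces
  holomorphy of limits and quotients in two variables to one-variable facts and continuity. Small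
  divisors are absorbed into a weight on the coefficients that accumulates their logarithms yet
  grows only linearly in the degree.\<close>

lemma cauchy_coeff_bound:
  assumes "g holomorphic_on S" "open S" "cball a r \<subseteq> S" "0 < r"
    "\<And>z. z \<in> cball a r \<Longrightarrow> cmod (g z) \<le> M"
  shows "cmod ((deriv ^^ n) g a / fact n) \<le> M / r ^ n"
proof -
  have "cmod ((deriv ^^ n) g a) \<le> fact n * M / r ^ n"
  proof (rule Cauchy_inequality)
    show "g holomorphic_on ball a r" using assms by (meson ball_subset_cball holomorphic_on_subset)
    show "continuous_on (cball a r) g"
      using assms by (meson holomorphic_on_imp_continuous_on continuous_on_subset)
  qed (use assms in \<open>auto simp: dist_norm\<close>)
  then show ?thesis using assms(4) by (simp add: norm_divide field_simps)
qed

text \<open>Cauchy's estimates bound the tail by a geometric series of ratio |h| / r. This ratio is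
  at most 1/2, so the series is at most twice its first term, whence the factor 2.\<close>

lemma taylor_remainder:
  assumes "g holomorphic_on S" "open S" "cball a r \<subseteq> S" "0 < r"
    "\<And>z. z \<in> cball a r \<Longrightarrow> cmod (g z) \<le> M" "cmod h \<le> r / 2"
  shows "cmod (g (a + h) - (\<Sum>k<N. (deriv ^^ k) g a / fact k * h ^ k)) \<le> 2 * M * (cmod h / r) ^ N"
proof -
  let ?c = "\<lambda>k. (deriv ^^ k) g a / fact k"
  have hol: "g holomorphic_on ball a r" using assms by (meson ball_subset_cball holomorphic_on_subset)
  have M: "M \<ge> 0" using assms(4) order_trans[OF norm_ge_zero assms(5)[of a]] by simp
  have "a + h \<in> ball a r" using assms by (auto simp: dist_norm)
  from holomorphic_power_series[OF hol this]
  have "(\<lambda>k. ?c k * h ^ k) sums g (a + h)" by simp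
  then have s: "(\<lambda>k. ?c (k + N) * h ^ (k + N)) sums (g (a + h) - (\<Sum>k<N. ?c k * h ^ k))"
    by (rule sums_split_initial_segment)
  define q where "q = cmod h / r"
  have q: "0 \<le> q" "q \<le> 1/2" using assms by (auto simp: q_def field_simps)
  have b: "cmod (?c (k + N) * h ^ (k + N)) \<le> M * q ^ N * q ^ k" for k
  proof -
    have "cmod (?c (k + N) * h ^ (k + N)) = cmod (?c (k + N)) * cmod h ^ (k + N)"
      by (simp add: norm_mult norm_power norm_divide)
    also have "\<dots> \<le> M / r ^ (k + N) * cmod h ^ (k + N)"
      by (intro mult_right_mono cauchy_coeff_bound[OF assms(1-5)]) auto
    also have "\<dots> = M * q ^ N * q ^ k" by (simp add: q_def power_add power_divide mult_ac)
    finally show ?thesis .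
  qed
  have g: "(\<lambda>k. M * q ^ N * q ^ k) sums (M * q ^ N * (1 / (1 - q)))"
    using q by (intro sums_mult geometric_sums) auto
  have "cmod (g (a + h) - (\<Sum>k<N. ?c k * h ^ k)) \<le> M * q ^ N * (1 / (1 - q))"
    using norm_suminf_le[OF b sums_summable[OF g]] s g by (simp add: sums_iff)
  also have "\<dots> \<le> M * q ^ N * 2"
    using q M by (intro mult_left_mono) (auto simp: field_simps)
  finally show ?thesis by (simp add: q_def mult_ac)
qed

text \<open>The scalar counterpart of \<open>holomorphic2_on\<close>: complex linearity of the
  derivative is built in through the coefficients \<open>a\<close> and \<open>b\<close>, which turn
  out to be \<open>dx f p\<close> and \<open>dy f p\<close>.\<close>

definition hol2 :: "(complex2 \<Rightarrow> complex) \<Rightarrow> complex2 set \<Rightarrow> bool" where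
  "hol2 f U \<longleftrightarrow> open U \<and> (\<forall>p\<in>U. \<exists>a b. (f has_derivative (\<lambda>h. a * fst h + b * snd h)) (at p))"

definition dx :: "(complex2 \<Rightarrow> complex) \<Rightarrow> complex2 \<Rightarrow> complex" where
  "dx f p = deriv (\<lambda>x. f (x, snd p)) (fst p)"

definition dy :: "(complex2 \<Rightarrow> complex) \<Rightarrow> complex2 \<Rightarrow> complex" where
  "dy f p = deriv (\<lambda>y. f (fst p, y)) (snd p)"

lemma hol2_open: "hol2 f U \<Longrightarrow> open U" by (simp add: hol2_def)

lemma hol2_subset: "hol2 f U \<Longrightarrow> open V \<Longrightarrow> V \<subseteq> U \<Longrightarrow> hol2 f V"
  by (auto simp: hol2_def)

lemma has_derivative_slice_x:
  assumes "(f has_derivative (\<lambda>h. a * fst h + b * snd h)) (at (x, y))"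
  shows "((\<lambda>x. f (x, y)) has_field_derivative a) (at x)"
proof -
  have "((\<lambda>x. (x, y)) has_derivative (\<lambda>h. (h, 0))) (at x)"
    by (auto intro!: derivative_eq_intros)
  from has_derivative_compose[OF this assms] show ?thesis
    by (simp add: has_field_derivative_def)
qed

lemma has_derivative_slice_y:
  assumes "(f has_derivative (\<lambda>h. a * fst h + b * snd h)) (at (x, y))"
  shows "((\<lambda>y. f (x, y)) has_field_derivative b) (at y)"
proof -
  have "((\<lambda>y. (x, y)) has_derivative (\<lambda>h. (0, h))) (at y)"
    by (auto intro!: derivative_eq_intros)
  from has_derivative_compose[OF this assms] show ?thesis
    by (simp add: has_field_derivative_def)
qed

lemma hol2_has_derivative:
  assumes "hol2 f U" "p \<in> U"
  shows "(f has_derivative (\<lambda>h. dx f p * fst h + dy f p * snd h)) (at p)"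
proof -
  obtain a b where d: "(f has_derivative (\<lambda>h. a * fst h + b * snd h)) (at p)"
    using assms by (auto simp: hol2_def)
  obtain x y where p: "p = (x, y)" by (cases p)
  have "dx f p = a" "dy f p = b"
    using DERIV_imp_deriv[OF has_derivative_slice_x[OF d[unfolded p]]]
      DERIV_imp_deriv[OF has_derivative_slice_y[OF d[unfolded p]]] by (simp_all add: dx_def dy_def p)
  with d show ?thesis by simp
qed

lemma has_derivative_dx_dy:
  assumes "(f has_derivative (\<lambda>h. a * fst h + b * snd h)) (at p)"
  shows "dx f p = a" "dy f p = b"
proof -
  obtain x y where p: "p = (x, y)" by (cases p)
  show "dx f p = a" "dy f p = b"
    using DERIV_imp_deriv[OF has_derivative_slice_x[OF assms[unfolded p]]]
      DERIV_imp_deriv[OF has_derivative_slice_y[OF assms[unfolded p]]] by (simp_all add: dx_def dy_def p)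
qed

lemma hol2_continuous_on: "hol2 f U \<Longrightarrow> continuous_on U f"
  by (meson hol2_has_derivative has_derivative_continuous continuous_at_imp_continuous_on)

lemma open_slice_x: "open U \<Longrightarrow> open {x. (x, y) \<in> U}"
  using open_vimage[of U "\<lambda>x. (x, y)"] by (simp add: vimage_def continuous_intros)

lemma open_slice_y: "open U \<Longrightarrow> open {y. (x, y) \<in> U}"
  using open_vimage[of U "\<lambda>y. (x, y)"] by (simp add: vimage_def continuous_intros)

lemma hol2_slice_x: "hol2 f U \<Longrightarrow> (\<lambda>x. f (x, y)) holomorphic_on {x. (x, y) \<in> U}"
  using has_derivative_slice_x[OF hol2_has_derivative[of f U]]
  by (force simp: holomorphic_on_open[OF open_slice_x[OF hol2_open]])

lemma hol2_slice_y: "hol2 f U \<Longrightarrow> (\<lambda>y. f (x, y)) holomorphic_on {y. (x, y) \<in> U}"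
  using has_derivative_slice_y[OF hol2_has_derivative[of f U]]
  by (force simp: holomorphic_on_open[OF open_slice_y[OF hol2_open]])

lemma hol2_const [intro, simp]: "open U \<Longrightarrow> hol2 (\<lambda>_. c) U"
  unfolding hol2_def by (auto intro!: exI[of _ 0])

lemma hol2_fst [intro, simp]: "open U \<Longrightarrow> hol2 fst U"
  unfolding hol2_def by (intro conjI ballI exI[of _ 1] exI[of _ 0]) (auto intro!: derivative_eq_intros)

lemma hol2_snd [intro, simp]: "open U \<Longrightarrow> hol2 snd U"
  unfolding hol2_def by (intro conjI ballI exI[of _ 0] exI[of _ 1]) (auto intro!: derivative_eq_intros)

lemma hol2_add: assumes "hol2 f U" "hol2 g U" shows "hol2 (\<lambda>p. f p + g p) U"
  unfolding hol2_def
proof (intro conjI ballI)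
  fix p assume "p \<in> U"
  from has_derivative_add[OF hol2_has_derivative[OF assms(1) this] hol2_has_derivative[OF assms(2) this]]
  show "\<exists>a b. ((\<lambda>p. f p + g p) has_derivative (\<lambda>h. a * fst h + b * snd h)) (at p)"
    by (intro exI[of _ "dx f p + dx g p"] exI[of _ "dy f p + dy g p"]) (simp add: algebra_simps)
qed (use assms hol2_open in blast)

lemma hol2_mult: assumes "hol2 f U" "hol2 g U" shows "hol2 (\<lambda>p. f p * g p) U"
  unfolding hol2_def
proof (intro conjI ballI)
  fix p assume "p \<in> U"
  from has_derivative_mult[OF hol2_has_derivative[OF assms(1) this] hol2_has_derivative[OF assms(2) this]]
  show "\<exists>a b. ((\<lambda>p. f p * g p) has_derivative (\<lambda>h. a * fst h + b * snd h)) (at p)"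
    by (intro exI[of _ "f p * dx g p + dx f p * g p"] exI[of _ "f p * dy g p + dy f p * g p"])
      (simp add: algebra_simps)
qed (use assms hol2_open in blast)

lemma hol2_minus: assumes "hol2 f U" shows "hol2 (\<lambda>p. - f p) U"
  using hol2_mult[OF hol2_const[OF hol2_open[OF assms], of "-1"] assms] by simp

lemma hol2_diff: assumes "hol2 f U" "hol2 g U" shows "hol2 (\<lambda>p. f p - g p) U"
  using hol2_add[OF assms(1) hol2_minus[OF assms(2)]] by simp

lemma hol2_power: assumes "hol2 f U" shows "hol2 (\<lambda>p. f p ^ n) U"
  by (induction n) (auto intro: hol2_mult assms hol2_open[OF assms])

lemma hol2_sum: assumes "open U" "\<And>i. i \<in> I \<Longrightarrow> hol2 (f i) U" shows "hol2 (\<lambda>p. \<Sum>i\<in>I. f i p) U"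
  using assms(2) by (induction I rule: infinite_finite_induct) (auto intro: hol2_add assms(1))

lemma hol2_compose_hol:
  assumes "hol2 f U" "g holomorphic_on S" "open S" "\<And>p. p \<in> U \<Longrightarrow> f p \<in> S"
  shows "hol2 (\<lambda>p. g (f p)) U"
  unfolding hol2_def
proof (intro conjI ballI)
  fix p assume p: "p \<in> U"
  have "(g has_field_derivative deriv g (f p)) (at (f p))"
    using assms p by (meson holomorphic_derivI)
  then have "(g has_derivative (\<lambda>h. deriv g (f p) * h)) (at (f p))" by (simp add: has_field_derivative_def)
  from has_derivative_compose[OF hol2_has_derivative[OF assms(1) p] this]
  show "\<exists>a b. ((\<lambda>p. g (f p)) has_derivative (\<lambda>h. a * fst h + b * snd h)) (at p)"
    by (intro exI[of _ "deriv g (f p) * dx f p"] exI[of _ "deriv g (f p) * dy f p"])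
      (simp add: algebra_simps)
qed (use assms hol2_open in blast)

lemma has_derivative_compose_pair:
  fixes f :: "complex2 \<Rightarrow> complex"
  assumes "(g1 has_derivative (\<lambda>h. a1 * fst h + b1 * snd h)) (at p)"
    "(g2 has_derivative (\<lambda>h. a2 * fst h + b2 * snd h)) (at p)"
    "(f has_derivative (\<lambda>h. a * fst h + b * snd h)) (at (g1 p, g2 p))"
  shows "((\<lambda>p. f (g1 p, g2 p)) has_derivative
     (\<lambda>h. (a * a1 + b * a2) * fst h + (a * b1 + b * b2) * snd h)) (at p)"
proof -
  have "(\<lambda>h. a * (a1 * fst h + b1 * snd h) + b * (a2 * fst h + b2 * snd h)) =
      (\<lambda>h. (a * a1 + b * a2) * fst h + (a * b1 + b * b2) * snd h)"
    by (auto simp: algebra_simps)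
  then show ?thesis
    using has_derivative_compose[OF has_derivative_Pair[OF assms(1,2)] assms(3)] by simp
qed

lemma hol2_compose:
  assumes "hol2 f V" "hol2 g1 U" "hol2 g2 U" "\<And>p. p \<in> U \<Longrightarrow> (g1 p, g2 p) \<in> V"
  shows "hol2 (\<lambda>p. f (g1 p, g2 p)) U"
  unfolding hol2_def
proof (intro conjI ballI)
  fix p assume p: "p \<in> U"
  from has_derivative_compose_pair[OF hol2_has_derivative[OF assms(2) p] hol2_has_derivative[OF assms(3) p]
    hol2_has_derivative[OF assms(1) assms(4)[OF p]]]
  show "\<exists>a b. ((\<lambda>p. f (g1 p, g2 p)) has_derivative (\<lambda>h. a * fst h + b * snd h)) (at p)" by blast
qed (use assms hol2_open in blast)

lemma hol2_divide:
  assumes "hol2 f U" "hol2 g U" "\<And>p. p \<in> U \<Longrightarrow> g p \<noteq> 0"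
  shows "hol2 (\<lambda>p. f p / g p) U"
proof -
  have "hol2 (\<lambda>p. inverse (g p)) U"
    by (rule hol2_compose_hol[OF assms(2), of _ "-{0}"]) (use assms(3) in \<open>auto intro!: holomorphic_intros\<close>)
  from hol2_mult[OF assms(1) this] show ?thesis by (simp add: field_simps)
qed

lemma hol2_cong: assumes "hol2 f U" "\<And>p. p \<in> U \<Longrightarrow> f p = g p" shows "hol2 g U"
  unfolding hol2_def
proof (intro conjI ballI)
  fix p assume p: "p \<in> U"
  have "(g has_derivative (\<lambda>h. dx f p * fst h + dy f p * snd h)) (at p)"
    by (rule has_derivative_transform_within_open[OF hol2_has_derivative[OF assms(1) p] hol2_open[OF assms(1)] p assms(2)])
  then show "\<exists>a b. (g has_derivative (\<lambda>h. a * fst h + b * snd h)) (at p)" by blast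
qed (use assms hol2_open in blast)

lemma hol_compose_hol2:
  assumes "hol2 f U" "g1 holomorphic_on S" "g2 holomorphic_on S" "open S" "\<And>t. t \<in> S \<Longrightarrow> (g1 t, g2 t) \<in> U"
  shows "(\<lambda>t. f (g1 t, g2 t)) holomorphic_on S"
  unfolding holomorphic_on_open[OF assms(4)]
proof (intro ballI)
  fix t assume t: "t \<in> S"
  have "(g1 has_field_derivative deriv g1 t) (at t)" "(g2 has_field_derivative deriv g2 t) (at t)"
    using assms t by (meson holomorphic_derivI)+
  then have "((\<lambda>t. (g1 t, g2 t)) has_derivative (\<lambda>h. (deriv g1 t * h, deriv g2 t * h))) (at t)"
    by (intro has_derivative_Pair) (simp_all add: has_field_derivative_def)
  from has_derivative_compose[OF this hol2_has_derivative[OF assms(1) assms(5)[OF t]]]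
  have "((\<lambda>t. f (g1 t, g2 t)) has_field_derivative
     (dx f (g1 t, g2 t) * deriv g1 t + dy f (g1 t, g2 t) * deriv g2 t)) (at t)"
    unfolding has_field_derivative_def
    by (rule has_derivative_eq_rhs) (auto simp: algebra_simps)
  then show "\<exists>f'. ((\<lambda>t. f (g1 t, g2 t)) has_field_derivative f') (at t)" by blast
qed

lemma bidisc_in_open:
  fixes p :: complex2
  assumes "open U" "p \<in> U"
  obtains r where "r > 0" "cball (fst p) r \<times> cball (snd p) r \<subseteq> U"
proof -
  obtain A B where AB: "open A" "open B" "p \<in> A \<times> B" "A \<times> B \<subseteq> U"
    using open_prod_elim[OF assms] by blast
  obtain r1 r2 where r: "r1 > 0" "cball (fst p) r1 \<subseteq> A" "r2 > 0" "cball (snd p) r2 \<subseteq> B"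
    using AB open_contains_cball by (metis mem_Times_iff)
  show ?thesis
  proof (rule that[of "min r1 r2"])
    show "cball (fst p) (min r1 r2) \<times> cball (snd p) (min r1 r2) \<subseteq> U"
      using r AB(4) by (auto simp: subset_iff)
  qed (use r in auto)
qed

section \<open>Osgood's lemma\<close>

definition sephol :: "(complex2 \<Rightarrow> complex) \<Rightarrow> complex2 set \<Rightarrow> bool" where
  "sephol f U \<longleftrightarrow> open U \<and> continuous_on U f \<and>
     (\<forall>y. (\<lambda>x. f (x, y)) holomorphic_on {x. (x, y) \<in> U}) \<and>
     (\<forall>x. (\<lambda>y. f (x, y)) holomorphic_on {y. (x, y) \<in> U})"

lemma hol2_imp_sephol: "hol2 f U \<Longrightarrow> sephol f U"
  by (simp add: sephol_def hol2_open hol2_continuous_on hol2_slice_x hol2_slice_y)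

lemma sephol_bidisc:
  assumes "sephol f U" "p \<in> U"
  obtains r M where "r > 0" "M > 0" "cball (fst p) (2*r) \<times> cball (snd p) (2*r) \<subseteq> U"
    "\<And>x y. x \<in> cball (fst p) (2*r) \<Longrightarrow> y \<in> cball (snd p) (2*r) \<Longrightarrow> cmod (f (x, y)) \<le> M"
proof -
  obtain s where s: "s > 0" "cball (fst p) s \<times> cball (snd p) s \<subseteq> U"
    using bidisc_in_open[of U p] assms by (auto simp: sephol_def)
  have "compact (f ` (cball (fst p) s \<times> cball (snd p) s))"
    using assms s by (intro compact_continuous_image compact_Times compact_cball)
      (auto simp: sephol_def intro: continuous_on_subset)
  then obtain M where M: "M > 0" "\<And>z. z \<in> f ` (cball (fst p) s \<times> cball (snd p) s) \<Longrightarrow> cmod z \<le> M"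
    using compact_imp_bounded bounded_pos by (metis (mono_tags, lifting))
  show ?thesis by (rule that[of "s/2" M]) (use s M in auto)
qed

text \<open>The constant does not depend on y. This uniformity is what makes difference quotients in
  x converge uniformly in both variables.\<close>

lemma sephol_dx_estimate:
  assumes "sephol f U" "cball a (2*r) \<times> cball b (2*r) \<subseteq> U" "r > 0"
    "\<And>x y. x \<in> cball a (2*r) \<Longrightarrow> y \<in> cball b (2*r) \<Longrightarrow> cmod (f (x, y)) \<le> M"
    "x \<in> cball a r" "y \<in> cball b (2*r)" "cmod h \<le> r / 2"
  shows "cmod (f (x + h, y) - f (x, y) - dx f (x, y) * h) \<le> 2 * M * (cmod h / r)^2"
proof -
  have sub: "cball x r \<subseteq> cball a (2*r)"
  proof
    fix z assume "z \<in> cball x r"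
    then show "z \<in> cball a (2*r)" using assms(5) dist_triangle[of a z x] by simp
  qed
  have "cmod (f (x + h, y) - (\<Sum>k<2. (deriv ^^ k) (\<lambda>x. f (x, y)) x / fact k * h ^ k)) \<le> 2 * M * (cmod h / r) ^ 2"
  proof (rule taylor_remainder[where S = "{x. (x, y) \<in> U}" and g = "\<lambda>x. f (x, y)"])
    show "(\<lambda>x. f (x, y)) holomorphic_on {x. (x, y) \<in> U}" using assms(1) by (auto simp: sephol_def)
    show "open {x. (x, y) \<in> U}" using assms(1) by (auto simp: sephol_def open_slice_x)
    show "cball x r \<subseteq> {x. (x, y) \<in> U}" using sub assms by auto
    show "\<And>z. z \<in> cball x r \<Longrightarrow> cmod (f (z, y)) \<le> M" using sub assms by auto
  qed (use assms in auto)
  then show ?thesis by (simp add: numeral_2_eq_2 dx_def algebra_simps)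
qed

text \<open>The difference quotients in x are continuous and holomorphic in y, and they converge
  uniformly on a bidisc. Their limit \<open>dx f\<close> inherits both properties; holomorphy in x
  is the one-variable fact about \<open>deriv\<close>.\<close>

lemma sephol_dx: assumes "sephol f U" shows "sephol (dx f) U"
proof -
  have o: "open U" and cf: "continuous_on U f" using assms by (auto simp: sephol_def)
  have loc: "\<exists>r>0. continuous_on (ball (fst p) r \<times> ball (snd p) r) (dx f) \<and>
      ball (fst p) r \<times> ball (snd p) r \<subseteq> U \<and>
     (\<forall>x\<in>ball (fst p) r. (\<lambda>y. dx f (x, y)) holomorphic_on ball (snd p) r)" if p: "p \<in> U" for p
  proof -
    obtain r M where r: "r > 0" "M > 0" "cball (fst p) (2*r) \<times> cball (snd p) (2*r) \<subseteq> U"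
      "\<And>x y. x \<in> cball (fst p) (2*r) \<Longrightarrow> y \<in> cball (snd p) (2*r) \<Longrightarrow> cmod (f (x, y)) \<le> M"
      by (rule sephol_bidisc[OF assms p]) (rule that; assumption)
    define h where "h n = complex_of_real (r / (2 * real (Suc n)))" for n
    have h: "h n \<noteq> 0" "cmod (h n) \<le> r / 2" "cmod (h n) = r / (2 * real (Suc n))" for n
      using r by (auto simp: h_def norm_divide divide_simps simp del: of_nat_Suc)
    define q where "q n p = (f (fst p + h n, snd p) - f p) / h n" for n and p :: complex2
    have est: "cmod (q n (x, y) - dx f (x, y)) \<le> 2 * M * (cmod (h n) / r^2)"
      if "x \<in> cball (fst p) r" "y \<in> cball (snd p) (2*r)" for x y n
    proof -
      have "cmod (f (x + h n, y) - f (x, y) - dx f (x, y) * h n) \<le> 2 * M * (cmod (h n) / r)^2"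
        by (rule sephol_dx_estimate[OF assms r(3,1,4) that h(2)])
      moreover have "q n (x, y) - dx f (x, y) = (f (x + h n, y) - f (x, y) - dx f (x, y) * h n) / h n"
        using h(1) by (simp add: q_def field_simps)
      ultimately have "cmod (q n (x, y) - dx f (x, y)) \<le> 2 * M * (cmod (h n) / r)^2 / cmod (h n)"
        by (simp add: norm_divide divide_right_mono)
      also have "\<dots> = 2 * M * (cmod (h n) / r^2)" using h(1)[of n] by (simp add: power2_eq_square)
      finally show ?thesis .
    qed
    have hlim: "(\<lambda>n. 2 * M * (cmod (h n) / r^2)) \<longlonglongrightarrow> 0"
    proof -
      have "(\<lambda>n. 2 * M * (r / 2 / r^2) * inverse (real (Suc n))) \<longlonglongrightarrow> 2 * M * (r / 2 / r^2) * 0"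
        by (intro tendsto_mult tendsto_const LIMSEQ_inverse_real_of_nat)
      then show ?thesis by (simp add: h(3) field_simps del: of_nat_Suc)
    qed
    have ul: "uniform_limit (cball (fst p) r \<times> cball (snd p) (2*r)) q (dx f) sequentially"
    proof (rule uniform_limitI)
      fix e :: real assume "e > 0"
      from order_tendstoD(2)[OF hlim this]
      show "\<forall>\<^sub>F n in sequentially. \<forall>x\<in>cball (fst p) r \<times> cball (snd p) (2*r). dist (q n x) (dx f x) < e"
          by eventually_elim (use order.strict_trans1[OF est] in \<open>auto simp: dist_norm\<close>)
    qed
    have inU: "(x + h n, y) \<in> U" "(x, y) \<in> U" if "x \<in> cball (fst p) r" "y \<in> cball (snd p) (2*r)" for x y n
    proof -
      have "dist (fst p) (x + h n) \<le> dist (fst p) x + dist x (x + h n)" by (rule dist_triangle)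
      also have "\<dots> \<le> r + r / 2" using that h(2)[of n] by (intro add_mono) (auto simp: dist_norm)
      finally show "(x + h n, y) \<in> U" "(x, y) \<in> U" using that r(1,3) by auto
    qed
    have cq: "continuous_on (cball (fst p) r \<times> cball (snd p) (2*r)) (q n)" for n
      unfolding q_def
      by (intro continuous_intros continuous_on_compose2[OF cf] h) (use inU h in \<open>auto\<close>)
    have c: "continuous_on (cball (fst p) r \<times> cball (snd p) (2*r)) (dx f)"
      by (rule uniform_limit_theorem[OF _ ul]) (use cq in auto)
    have hol: "(\<lambda>y. dx f (x, y)) holomorphic_on ball (snd p) r" if x: "x \<in> ball (fst p) r" for x
    proof -
      have "uniform_limit (cball (snd p) r) (\<lambda>n y. q n (x, y)) (\<lambda>y. dx f (x, y)) sequentially"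
        using ul x r(1) unfolding uniform_limit_iff by (fastforce elim: eventually_mono)
      moreover have "continuous_on (cball (snd p) r) (\<lambda>y. q n (x, y)) \<and> (\<lambda>y. q n (x, y)) holomorphic_on ball (snd p) r" for n
      proof
        show "continuous_on (cball (snd p) r) (\<lambda>y. q n (x, y))"
          by (rule continuous_on_compose2[OF cq]) (use x r in \<open>auto intro!: continuous_intros\<close>)
        have "(\<lambda>y. f (x', y)) holomorphic_on ball (snd p) r" if "\<And>y. y \<in> ball (snd p) r \<Longrightarrow> (x', y) \<in> U" for x'
          using assms that unfolding sephol_def by (blast intro: holomorphic_on_subset)
        then show "(\<lambda>y. q n (x, y)) holomorphic_on ball (snd p) r"
          unfolding q_def using h inU x r by (intro holomorphic_intros) (auto)
      qed
      ultimately show ?thesis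
        using holomorphic_uniform_limit[of "snd p" r "\<lambda>n y. q n (x, y)" sequentially "\<lambda>y. dx f (x, y)"] by auto
    qed
    have "continuous_on (ball (fst p) r \<times> ball (snd p) r) (dx f)"
      by (rule continuous_on_subset[OF c]) (use r in auto)
    moreover have "ball (fst p) r \<times> ball (snd p) r \<subseteq> U" using inU r(1) by fastforce
    ultimately show ?thesis using hol r(1) by blast
  qed
  show ?thesis unfolding sephol_def
  proof (intro conjI allI)
    show "open U" by fact
    show "continuous_on U (dx f)"
    proof (rule continuous_at_imp_continuous_on, rule ballI)
      fix p assume "p \<in> U"
      from loc[OF this] obtain r where r: "r > 0" "continuous_on (ball (fst p) r \<times> ball (snd p) r) (dx f)" by blast
      then show "isCont (dx f) p"
        by (subst (asm) continuous_on_eq_continuous_at) (cases p; auto simp: open_Times)+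
    qed
    fix y
    have "deriv (\<lambda>x. f (x, y)) holomorphic_on {x. (x, y) \<in> U}"
      by (rule holomorphic_deriv) (use assms o in \<open>auto simp: sephol_def open_slice_x\<close>)
    then show "(\<lambda>x. dx f (x, y)) holomorphic_on {x. (x, y) \<in> U}" by (simp add: dx_def)
  next
    fix x
    have "(\<lambda>y. dx f (x, y)) field_differentiable at y" if "(x, y) \<in> U" for y
    proof -
      from loc[OF that] obtain r where r: "r > 0" "(\<lambda>y. dx f (x, y)) holomorphic_on ball y r" by auto
      then show ?thesis by (intro holomorphic_on_imp_differentiable_at[of _ "ball y r"]) auto
    qed
    then show "(\<lambda>y. dx f (x, y)) holomorphic_on {y. (x, y) \<in> U}"
      by (auto simp: holomorphic_on_def intro: field_differentiable_at_within)
  qed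
qed

text \<open>Go from (a, b) to (x, y) through (a, y). The horizontal leg has a quadratic error
  uniform in y; replacing \<open>dx f (a, y)\<close> by \<open>dx f (a, b)\<close> costs o(1) by
  continuity; the vertical leg is one-variable differentiability.\<close>

theorem osgood: assumes "sephol f U" shows "hol2 f U"
  unfolding hol2_def
proof (intro conjI ballI)
  show "open U" using assms by (simp add: sephol_def)
  fix p assume p: "p \<in> U"
  obtain a b where pab: "p = (a, b)" by (cases p)
  obtain r M where r: "r > 0" "M > 0" "cball a (2*r) \<times> cball b (2*r) \<subseteq> U"
      "\<And>x y. x \<in> cball a (2*r) \<Longrightarrow> y \<in> cball b (2*r) \<Longrightarrow> cmod (f (x, y)) \<le> M"
    by (rule sephol_bidisc[OF assms p, unfolded pab fst_conv snd_conv]) (rule that; assumption)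
  have contdx: "isCont (dx f) (a, b)"
    using sephol_dx[OF assms] p pab by (auto simp: sephol_def continuous_on_eq_continuous_at)
  have dy: "((\<lambda>y. f (a, y)) has_field_derivative dy f (a, b)) (at b)"
  proof -
    have "(\<lambda>y. f (a, y)) holomorphic_on {y. (a, y) \<in> U}" "open {y. (a, y) \<in> U}"
      using assms by (auto simp: sephol_def open_slice_y)
    then show ?thesis using p pab holomorphic_derivI[of _ "{y. (a, y) \<in> U}" b] by (simp add: dy_def)
  qed
  have "(f has_derivative (\<lambda>h. dx f p * fst h + dy f p * snd h)) (at p)"
  \<comment> \<open>The last summand is the error of the difference quotient in y. Division by 0
    gives 0, so at \<open>snd z = b\<close> the modulus of \<open>dy f (a, b)\<close> would be left
    over; the factor 0 removes it.\<close>
  proof (rule has_derivativeI_sandwich[where e = "r/2" and H = "\<lambda>z. 2 * M / r^2 * norm (z - p)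
        + cmod (dx f (a, snd z) - dx f (a, b)) + cmod ((f (a, snd z) - f (a, b)) / (snd z - b) - dy f (a, b)) * (if snd z = b then 0 else 1)"])
    show "bounded_linear (\<lambda>h. dx f p * fst h + dy f p * snd h)"
      by (intro bounded_linear_add bounded_linear_const_mult bounded_linear_fst bounded_linear_snd)
    show "0 < r / 2" using r by auto
    let ?E = "\<lambda>y. cmod ((f (a, y) - f (a, b)) / (y - b) - dy f (a, b)) * (if y = b then 0 else 1)"
    have "((\<lambda>y. (f (a, y) - f (a, b)) / (y - b)) \<longlongrightarrow> dy f (a, b)) (at b)"
      using dy by (simp add: has_field_derivative_iff)
    then have "((\<lambda>y. cmod ((f (a, y) - f (a, b)) / (y - b) - dy f (a, b))) \<longlongrightarrow> 0) (at b)"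
      using tendsto_norm_zero[OF LIM_zero] by blast
    then have "(?E \<longlongrightarrow> 0) (at b)"
      by (rule Lim_transform_eventually) (auto simp: eventually_at_filter)
    then have "isCont ?E b" by (simp add: isCont_def)
    then have cE: "isCont (\<lambda>z::complex2. ?E (snd z)) p"
      unfolding pab by (intro isCont_o2[of "(a, b)" snd ?E]) auto
    have "isCont (\<lambda>z::complex2. dx f (a, snd z)) p"
      using contdx pab by (intro isCont_o2[of p "\<lambda>z. (a, snd z)" "dx f"]) (auto intro!: continuous_intros)
    then have "isCont (\<lambda>z::complex2. 2 * M / r^2 * norm (z - p)
        + cmod (dx f (a, snd z) - dx f (a, b)) + ?E (snd z)) p"
      by (intro continuous_intros cE)
    then show "((\<lambda>z. 2 * M / r^2 * norm (z - p)
        + cmod (dx f (a, snd z) - dx f (a, b)) + ?E (snd z)) \<longlongrightarrow> 0) (at p)"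
      by (simp add: isCont_def pab)
    fix z :: complex2 assume z: "z \<noteq> p" "dist z p < r / 2"
    obtain x y where zxy: "z = (x, y)" by (cases z)
    have dxy: "cmod (x - a) \<le> norm (z - p)" "cmod (y - b) \<le> norm (z - p)"
      using norm_fst_le[of "x - a" "y - b"] norm_snd_le[of "y - b" "x - a"] by (auto simp: zxy pab)
    have np: "norm (z - p) > 0" "norm (z - p) < r / 2" using z by (auto simp: dist_norm)
    have yb: "y \<in> cball b (2*r)" using dxy np r(1) by (simp add: dist_norm norm_minus_commute)
    have e1: "cmod (f (a + (x - a), y) - f (a, y) - dx f (a, y) * (x - a)) \<le> 2 * M * (cmod (x - a) / r)^2"
      by (rule sephol_dx_estimate[OF assms r(3,1,4)]) (use dxy np r yb in auto)
    have e2: "f (a, y) - f (a, b) - dy f (a, b) * (y - b) = ((f (a, y) - f (a, b)) / (y - b) - dy f (a, b)) * (if y = b then 0 else 1) * (y - b)"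
      by (auto simp: field_simps)
    have "f z - f p - (dx f p * fst (z - p) + dy f p * snd (z - p)) =
       (f (a + (x - a), y) - f (a, y) - dx f (a, y) * (x - a)) + (dx f (a, y) - dx f (a, b)) * (x - a)
       + (f (a, y) - f (a, b) - dy f (a, b) * (y - b))"
      by (simp add: zxy pab algebra_simps)
    then have "norm (f z - f p - (dx f p * fst (z - p) + dy f p * snd (z - p))) \<le>
       2 * M * (cmod (x - a) / r)^2 + cmod (dx f (a, y) - dx f (a, b)) * cmod (x - a) + ?E y * cmod (y - b)"
    proof -
      have t: "norm (u + v * w + s) \<le> A + norm v * norm w + B" if "norm u \<le> A" "norm s \<le> B"
        for u v w s :: complex and A B
        using that norm_triangle_ineq[of "u + v * w" s] norm_triangle_ineq[of u "v * w"] by (simp add: norm_mult)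
      have "norm (f (a, y) - f (a, b) - dy f (a, b) * (y - b)) \<le> ?E y * cmod (y - b)"
        unfolding e2 by (auto simp: norm_mult)
      from t[OF e1 this] show ?thesis using \<open>f z - f p - _ = _\<close> by simp
    qed
    also have "\<dots> \<le> 2 * M * (norm (z - p) / r)^2 + cmod (dx f (a, y) - dx f (a, b)) * norm (z - p) + ?E y * norm (z - p)"
      using dxy r by (intro add_mono mult_left_mono power_mono divide_right_mono) auto
    also have "\<dots> = (2 * M / r^2 * norm (z - p) + cmod (dx f (a, y) - dx f (a, b)) + ?E y) * norm (z - p)"
      by (simp add: field_simps power2_eq_square)
    finally show "norm (f z - f p - (dx f p * fst (z - p) + dy f p * snd (z - p))) / norm (z - p) \<le>
       2 * M / r^2 * norm (z - p) + cmod (dx f (a, snd z) - dx f (a, b)) + ?E (snd z)"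
      using np by (simp add: zxy divide_le_eq)
  qed
  then show "\<exists>a b. (f has_derivative (\<lambda>h. a * fst h + b * snd h)) (at p)" by blast
qed

lemma hol2_iff_sephol: "hol2 f U \<longleftrightarrow> sephol f U"
  using osgood hol2_imp_sephol by blast

lemma hol2_dx: "hol2 f U \<Longrightarrow> hol2 (dx f) U"
  using sephol_dx by (simp add: hol2_iff_sephol)

lemma hol2_swap: assumes "hol2 f U" shows "hol2 (\<lambda>p. f (snd p, fst p)) (prod.swap ` U)"
proof -
  have eq: "prod.swap ` U = {p. (snd p, fst p) \<in> U}" by force
  have "open (prod.swap ` U)" unfolding eq
    using open_vimage[OF hol2_open[OF assms], of "\<lambda>p. (snd p, fst p)"] by (simp add: vimage_def continuous_intros)
  then show ?thesis by (intro hol2_compose[OF assms]) auto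
qed

lemma hol2_dy: assumes "hol2 f U" shows "hol2 (dy f) U"
proof -
  have "hol2 (\<lambda>p. dx (\<lambda>p. f (snd p, fst p)) (snd p, fst p)) (prod.swap ` prod.swap ` U)"
    by (rule hol2_swap[OF hol2_dx[OF hol2_swap[OF assms]]])
  then show ?thesis by (simp add: image_image dx_def dy_def[abs_def])
qed

subsection \<open>Taylor series and formal composition\<close>

lemma iter_dy: "(dy ^^ j) f p = (deriv ^^ j) (\<lambda>y. f (fst p, y)) (snd p)"
  by (induction j arbitrary: p) (simp_all add: dy_def)

lemma iter_dx: "(dx ^^ i) f p = (deriv ^^ i) (\<lambda>x. f (x, snd p)) (fst p)"
  by (induction i arbitrary: p) (simp_all add: dx_def)

lemma taylor2_nth: "coeff2 (taylor2 f p) i j = (dx ^^ i) ((dy ^^ j) f) p / (fact i * fact j)"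
  by (simp add: taylor2_def iter_dx iter_dy)

lemma hol2_iter_dy: "hol2 f U \<Longrightarrow> hol2 ((dy ^^ j) f) U"
  by (induction j) (auto intro: hol2_dy)

lemma iter_dx_add:
  assumes "hol2 f U" "hol2 g U" "p \<in> U"
  shows "(dx ^^ i) (\<lambda>p. f p + g p) p = (dx ^^ i) f p + (dx ^^ i) g p"
  unfolding iter_dx using hol2_slice_x[OF assms(1)] hol2_slice_x[OF assms(2)] assms
  by (intro higher_deriv_add[of _ "{x. (x, snd p) \<in> U}"]) (auto simp: open_slice_x[OF hol2_open])

lemma iter_dx_mult:
  assumes "hol2 f U" "hol2 g U" "p \<in> U"
  shows "(dx ^^ i) (\<lambda>p. f p * g p) p =
    (\<Sum>k=0..i. of_nat (i choose k) * (dx ^^ k) f p * (dx ^^ (i - k)) g p)"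
  unfolding iter_dx using hol2_slice_x[OF assms(1)] hol2_slice_x[OF assms(2)] assms
  by (intro higher_deriv_mult[of _ "{x. (x, snd p) \<in> U}"]) (auto simp: open_slice_x[OF hol2_open])

lemma iter_dy_add:
  assumes "hol2 f U" "hol2 g U" "p \<in> U"
  shows "(dy ^^ i) (\<lambda>p. f p + g p) p = (dy ^^ i) f p + (dy ^^ i) g p"
  unfolding iter_dy using hol2_slice_y[OF assms(1)] hol2_slice_y[OF assms(2)] assms
  by (intro higher_deriv_add[of _ "{y. (fst p, y) \<in> U}"]) (auto simp: open_slice_y[OF hol2_open])

lemma iter_dy_mult:
  assumes "hol2 f U" "hol2 g U" "p \<in> U"
  shows "(dy ^^ i) (\<lambda>p. f p * g p) p =
    (\<Sum>k=0..i. of_nat (i choose k) * (dy ^^ k) f p * (dy ^^ (i - k)) g p)"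
  unfolding iter_dy using hol2_slice_y[OF assms(1)] hol2_slice_y[OF assms(2)] assms
  by (intro higher_deriv_mult[of _ "{y. (fst p, y) \<in> U}"]) (auto simp: open_slice_y[OF hol2_open])

lemma iter_dx_cong:
  assumes "open U" "\<And>q. q \<in> U \<Longrightarrow> f q = g q" "p \<in> U"
  shows "(dx ^^ i) f p = (dx ^^ i) g p"
  unfolding iter_dx
proof (rule higher_deriv_cong_ev)
  have "\<forall>\<^sub>F x in nhds (fst p). x \<in> {x. (x, snd p) \<in> U}"
    using assms by (intro eventually_nhds_in_open open_slice_x) auto
  then show "\<forall>\<^sub>F x in nhds (fst p). f (x, snd p) = g (x, snd p)"
    by eventually_elim (use assms in auto)
qed simp

lemma iter_dy_cong:
  assumes "open U" "\<And>q. q \<in> U \<Longrightarrow> f q = g q" "p \<in> U"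
  shows "(dy ^^ i) f p = (dy ^^ i) g p"
  unfolding iter_dy
proof (rule higher_deriv_cong_ev)
  have "\<forall>\<^sub>F y in nhds (snd p). y \<in> {y. (fst p, y) \<in> U}"
    using assms by (intro eventually_nhds_in_open open_slice_y) auto
  then show "\<forall>\<^sub>F y in nhds (snd p). f (fst p, y) = g (fst p, y)"
    by eventually_elim (use assms in auto)
qed simp

lemma iter_dx_sum:
  assumes "open U" "\<And>k. k \<in> I \<Longrightarrow> hol2 (f k) U" "p \<in> U"
  shows "(dx ^^ i) (\<lambda>p. \<Sum>k\<in>I. f k p) p = (\<Sum>k\<in>I. (dx ^^ i) (f k) p)"
  using assms(2)
proof (induction I rule: infinite_finite_induct)
  case (insert x F)
  then show ?case
    by (simp add: iter_dx_add[where U = U] hol2_sum assms(1,3))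
qed (auto simp: iter_dx)

lemma fps2_eqI: "(\<And>i j. coeff2 a i j = coeff2 b i j) \<Longrightarrow> a = b"
  by (intro fps_ext)

lemma taylor2_cong:
  assumes "\<forall>\<^sub>F z in nhds p. f z = g z"
  shows "taylor2 f p = taylor2 g p"
proof -
  obtain U where U: "open U" "p \<in> U" "\<And>q. q \<in> U \<Longrightarrow> f q = g q"
    using assms by (auto simp: eventually_nhds)
  show ?thesis
    by (rule fps2_eqI) (simp add: taylor2_nth iter_dx_cong[OF U(1) iter_dy_cong[OF U(1,3)] U(2)])
qed

lemma taylor2_add:
  assumes "hol2 f U" "hol2 g U" "p \<in> U"
  shows "taylor2 (\<lambda>p. f p + g p) p = taylor2 f p + taylor2 g p"
proof (rule fps2_eqI)
  fix i j
  have "(dx ^^ i) ((dy ^^ j) (\<lambda>p. f p + g p)) p = (dx ^^ i) (\<lambda>p. (dy ^^ j) f p + (dy ^^ j) g p) p"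
    by (rule iter_dx_cong[OF hol2_open[OF assms(1)] iter_dy_add[OF assms(1,2)] assms(3)])
  then show "coeff2 (taylor2 (\<lambda>p. f p + g p) p) i j = coeff2 (taylor2 f p + taylor2 g p) i j"
    by (simp add: taylor2_nth iter_dx_add[OF hol2_iter_dy hol2_iter_dy, OF assms] add_divide_distrib)
qed

lemma coeff2_mult:
  "coeff2 (a * b) i j = (\<Sum>k=0..i. \<Sum>l=0..j. coeff2 a k l * coeff2 b (i - k) (j - l))"
  by (simp add: fps_mult_nth fps_sum_nth)

lemma taylor2_mult:
  assumes "hol2 f U" "hol2 g U" "p \<in> U"
  shows "taylor2 (\<lambda>p. f p * g p) p = taylor2 f p * taylor2 g p"
proof (rule fps2_eqI)
  fix i j
  note o = hol2_open[OF assms(1)]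
  have "(dx ^^ i) ((dy ^^ j) (\<lambda>p. f p * g p)) p = (dx ^^ i) (\<lambda>p. \<Sum>l=0..j. of_nat (j choose l) * ((dy ^^ l) f p * (dy ^^ (j - l)) g p)) p"
    by (rule iter_dx_cong[OF o _ assms(3)]) (simp add: iter_dy_mult[OF assms(1,2)] mult_ac)
  also have "\<dots> = (\<Sum>l=0..j. (dx ^^ i) (\<lambda>p. of_nat (j choose l) * ((dy ^^ l) f p * (dy ^^ (j - l)) g p)) p)"
    by (rule iter_dx_sum[OF o _ assms(3)]) (intro hol2_mult hol2_const o hol2_iter_dy assms)
  also have "\<dots> = (\<Sum>l=0..j. of_nat (j choose l) * (\<Sum>k=0..i. of_nat (i choose k) * (dx ^^ k) ((dy ^^ l) f) p * (dx ^^ (i - k)) ((dy ^^ (j - l)) g) p))"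
  proof (rule sum.cong[OF refl])
    fix l
    have h: "hol2 (\<lambda>p. (dy ^^ l) f p * (dy ^^ (j - l)) g p) U" by (intro hol2_mult hol2_iter_dy assms)
    have "(dx ^^ i) (\<lambda>p. of_nat (j choose l) * ((dy ^^ l) f p * (dy ^^ (j - l)) g p)) p =
      of_nat (j choose l) * (dx ^^ i) (\<lambda>p. (dy ^^ l) f p * (dy ^^ (j - l)) g p) p"
      unfolding iter_dx using hol2_slice_x[OF h] o assms(3)
      by (subst higher_deriv_cmult[where A = "{x. (x, snd p) \<in> U}"]) (auto intro: open_slice_x)
    then show "(dx ^^ i) (\<lambda>p. of_nat (j choose l) * ((dy ^^ l) f p * (dy ^^ (j - l)) g p)) p =
      of_nat (j choose l) * (\<Sum>k=0..i. of_nat (i choose k) * (dx ^^ k) ((dy ^^ l) f) p * (dx ^^ (i - k)) ((dy ^^ (j - l)) g) p)"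
      by (simp add: iter_dx_mult[OF hol2_iter_dy hol2_iter_dy, OF assms])
  qed
  finally have e: "(dx ^^ i) ((dy ^^ j) (\<lambda>p. f p * g p)) p = \<dots>" .
  have "coeff2 (taylor2 (\<lambda>p. f p * g p) p) i j =
    (\<Sum>l=0..j. \<Sum>k=0..i. of_nat (j choose l) * of_nat (i choose k) * ((dx ^^ k) ((dy ^^ l) f) p * (dx ^^ (i - k)) ((dy ^^ (j - l)) g) p) / (fact i * fact j))"
    by (simp add: taylor2_nth e sum_distrib_left sum_divide_distrib mult_ac)
  also have "\<dots> = (\<Sum>l=0..j. \<Sum>k=0..i. coeff2 (taylor2 f p) k l * coeff2 (taylor2 g p) (i - k) (j - l))"
    by (intro sum.cong refl) (simp add: taylor2_nth binomial_fact field_simps)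
  also have "\<dots> = coeff2 (taylor2 f p * taylor2 g p) i j"
    unfolding coeff2_mult by (rule sum.swap)
  finally show "coeff2 (taylor2 (\<lambda>p. f p * g p) p) i j = coeff2 (taylor2 f p * taylor2 g p) i j" .
qed

lemma taylor2_const: "taylor2 (\<lambda>_. c) p = fps_const (fps_const c)"
proof -
  have "(dy ^^ j) (\<lambda>_. c) = (\<lambda>_. if j = 0 then c else 0)" for j
    by (rule ext) (simp add: iter_dy)
  then show ?thesis by (intro fps2_eqI) (simp add: taylor2_nth iter_dx)
qed

lemma taylor2_fst: "taylor2 (\<lambda>z. fst z) p = fps_const (fps_const (fst p)) + fps_X"
proof -
  have "(dy ^^ j) fst = (\<lambda>q. if j = 0 then fst q else 0)" for j
    by (rule ext) (simp add: iter_dy)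
  moreover have "(deriv ^^ i) (\<lambda>x. x) (z::complex) = (if i = 0 then z else if i = 1 then 1 else 0)" for i z
    by simp
  ultimately show ?thesis by (intro fps2_eqI) (auto simp: taylor2_nth iter_dx fps_X_def split: if_splits)
qed

lemma taylor2_snd: "taylor2 (\<lambda>z. snd z) p = fps_const (fps_const (snd p) + fps_X)"
proof -
  have *: "(deriv ^^ i) (\<lambda>x. x) (z::complex) = (if i = 0 then z else if i = 1 then 1 else 0)" for i z
    by simp
  have "(dy ^^ j) snd = (\<lambda>q. if j = 0 then snd q else if j = 1 then 1 else 0)" for j
    by (rule ext) (simp add: iter_dy)
  then show ?thesis by (intro fps2_eqI) (auto simp: taylor2_nth iter_dx fps_X_def split: if_splits)
qed

lemma taylor2_shift: "taylor2 f p = taylor2 (\<lambda>z. f (p + z)) 0"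
proof (rule fps2_eqI)
  fix i j
  obtain a b where p: "p = (a, b)" by (cases p)
  have "(deriv ^^ i) (\<lambda>x. (deriv ^^ j) (\<lambda>y. f (x, y)) b) a = (deriv ^^ i) (\<lambda>x. (deriv ^^ j) (\<lambda>y. f (a + x, b + y)) 0) 0"
    by (subst higher_deriv_shift_0, subst higher_deriv_shift_0) (simp add: o_def)
  then show "coeff2 (taylor2 f p) i j = coeff2 (taylor2 (\<lambda>z. f (p + z)) 0) i j"
    by (simp add: taylor2_def p)
qed

lemma taylor2_cmult:
  assumes "hol2 f U" "p \<in> U"
  shows "taylor2 (\<lambda>p. c * f p) p = fps_const (fps_const c) * taylor2 f p"
  using taylor2_mult[OF hol2_const[OF hol2_open[OF assms(1)]] assms] by (simp add: taylor2_const)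

lemma taylor2_sum:
  assumes "open U" "\<And>k. k \<in> I \<Longrightarrow> hol2 (f k) U" "p \<in> U"
  shows "taylor2 (\<lambda>p. \<Sum>k\<in>I. f k p) p = (\<Sum>k\<in>I. taylor2 (f k) p)"
  using assms(2)
proof (induction I rule: infinite_finite_induct)
  case (insert x F)
  then show ?case
    by (simp add: taylor2_add[where U = U] hol2_sum assms(1,3))
qed (auto simp: taylor2_const)

lemma taylor2_power:
  assumes "hol2 f U" "p \<in> U"
  shows "taylor2 (\<lambda>p. f p ^ n) p = taylor2 f p ^ n"
  by (induction n) (auto simp: taylor2_const taylor2_mult[OF assms(1) hol2_power] assms)

lemma taylor2_diff:
  assumes "hol2 f U" "hol2 g U" "p \<in> U"
  shows "taylor2 (\<lambda>p. f p - g p) p = taylor2 f p - taylor2 g p"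
  using taylor2_add[OF assms(1) hol2_minus[OF assms(2)] assms(3)] taylor2_cmult[OF assms(2,3), of "-1"]
  by (simp flip: fps_const_neg)

lemma coeff2_taylor2_00: "coeff2 (taylor2 f p) 0 0 = f p"
  by (simp add: taylor2_def)

lemma coeff2_taylor2_10: "coeff2 (taylor2 f p) 1 0 = dx f p"
  by (simp add: taylor2_nth)

lemma coeff2_taylor2_01: "coeff2 (taylor2 f p) 0 1 = dy f p"
  by (simp add: taylor2_nth)

lemma taylor2_bound:
  assumes "hol2 f U" "cball (fst p) r \<times> cball (snd p) r \<subseteq> U" "r > 0"
    "\<And>x y. x \<in> cball (fst p) r \<Longrightarrow> y \<in> cball (snd p) r \<Longrightarrow> cmod (f (x, y)) \<le> M"
  shows "cmod (coeff2 (taylor2 f p) i j) \<le> M / r ^ (i + j)"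
proof -
  note o = hol2_open[OF assms(1)]
  let ?B = "\<lambda>x. (dy ^^ j) f (x, snd p) / fact j"
  have B: "cmod (?B x) \<le> M / r ^ j" if "x \<in> cball (fst p) r" for x
    unfolding iter_dy fst_conv snd_conv
    by (rule cauchy_coeff_bound[OF hol2_slice_y[OF assms(1)] open_slice_y[OF o] _ assms(3)])
      (use assms that in auto)
  have "?B holomorphic_on {x. (x, snd p) \<in> U}"
    by (intro holomorphic_intros hol2_slice_x hol2_iter_dy assms) auto
  then have "cmod ((deriv ^^ i) ?B (fst p) / fact i) \<le> (M / r ^ j) / r ^ i"
    by (rule cauchy_coeff_bound[OF _ open_slice_x[OF o] _ assms(3) B]) (use assms in auto)
  moreover have "(deriv ^^ i) ?B (fst p) = (deriv ^^ i) (\<lambda>x. (dy ^^ j) f (x, snd p)) (fst p) / fact j"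
  proof -
    have "(deriv ^^ i) (\<lambda>x. inverse (fact j) * (dy ^^ j) f (x, snd p)) (fst p) = inverse (fact j) * (deriv ^^ i) (\<lambda>x. (dy ^^ j) f (x, snd p)) (fst p)"
      using hol2_slice_x[OF hol2_iter_dy[OF assms(1)]] o subsetD[OF assms(2), of p] assms(3)
      by (intro higher_deriv_cmult[where A = "{x. (x, snd p) \<in> U}"]) (auto intro: open_slice_x simp: mem_Times_iff)
    then show ?thesis by (simp add: field_simps)
  qed
  ultimately show ?thesis by (simp add: taylor2_nth iter_dx power_add mult_ac)
qed

section \<open>Taylor polynomials with remainder\<close>

definition pol :: "nat \<Rightarrow> fps2 \<Rightarrow> complex2 \<Rightarrow> complex" where
  "pol N a z = (\<Sum>i<N. \<Sum>j<N - i. coeff2 a i j * (fst z ^ i * snd z ^ j))"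

text \<open>Congruence modulo the N-th power of the maximal ideal. Formal identities are proved
  modulo every such power, with series replaced by polynomials.\<close>

definition agree :: "nat \<Rightarrow> fps2 \<Rightarrow> fps2 \<Rightarrow> bool" where
  "agree N a b \<longleftrightarrow> (\<forall>i j. i + j < N \<longrightarrow> coeff2 a i j = coeff2 b i j)"

lemma hol2_pol [intro]: "open U \<Longrightarrow> hol2 (pol N a) U"
  unfolding pol_def by (intro hol2_sum hol2_mult hol2_const hol2_power hol2_fst hol2_snd)

lemma norm_pair_bounds: "cmod (fst z) \<le> norm z" "cmod (snd z) \<le> norm (z::complex2)"
  by (metis norm_fst_le prod.collapse) (metis norm_snd_le prod.collapse)

text \<open>Expand in y to order N, and the j-th coefficient in x only to order N - j: each of the N
  + 1 remainders is then at most 2 M (|z| / r)^N, so that total degree is what counts.\<close>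

lemma taylor2_remainder:
  assumes "hol2 f U" "cball 0 r \<times> cball 0 r \<subseteq> U" "r > 0"
    "\<And>x y. x \<in> cball 0 r \<Longrightarrow> y \<in> cball 0 r \<Longrightarrow> cmod (f (x, y)) \<le> M"
    "norm z \<le> r / 2"
  shows "cmod (f z - pol N (taylor2 f 0) z) \<le> 2 * M * (real N + 1) * (norm z / r) ^ N"
proof -
  note o = hol2_open[OF assms(1)]
  obtain x y where z: "z = (x, y)" by (cases z)
  have xy: "cmod x \<le> norm z" "cmod y \<le> norm z" using norm_pair_bounds[of z] by (auto simp: z)
  have M: "M \<ge> 0" using assms(3) order_trans[OF norm_ge_zero assms(4)[of 0 0]] by simp
  let ?B = "\<lambda>j x. (dy ^^ j) f (x, 0) / fact j"
  have holB: "?B j holomorphic_on {x. (x, 0) \<in> U}" for j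
    by (intro holomorphic_intros hol2_slice_x hol2_iter_dy assms) auto
  have derB: "(deriv ^^ i) (?B j) 0 / fact i = coeff2 (taylor2 f 0) i j" for i j
  proof -
    have "(deriv ^^ i) (\<lambda>x. inverse (fact j) * (dy ^^ j) f (x, 0)) 0 = inverse (fact j) * (deriv ^^ i) (\<lambda>x. (dy ^^ j) f (x, 0)) 0"
      using hol2_slice_x[OF hol2_iter_dy[OF assms(1)]] o assms(2,3)
      by (intro higher_deriv_cmult[where A = "{x. (x, 0) \<in> U}"]) (auto intro: open_slice_x)
    then show ?thesis by (simp add: field_simps taylor2_nth iter_dx)
  qed
  have B: "cmod (?B j x) \<le> M / r ^ j" if "x \<in> cball 0 r" for x j
    unfolding iter_dy fst_conv snd_conv
    by (rule cauchy_coeff_bound[OF hol2_slice_y[OF assms(1)] open_slice_y[OF o] _ assms(3)])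
      (use assms that in auto)
  have 1: "cmod (f (x, 0 + y) - (\<Sum>j<N. (deriv ^^ j) (\<lambda>y. f (x, y)) 0 / fact j * y ^ j)) \<le> 2 * M * (cmod y / r) ^ N"
    by (rule taylor_remainder[OF hol2_slice_y[OF assms(1)] open_slice_y[OF o] _ assms(3)])
      (use assms xy in auto)
  have 2: "cmod (?B j (0 + x) - (\<Sum>i<N - j. (deriv ^^ i) (?B j) 0 / fact i * x ^ i)) \<le> 2 * (M / r ^ j) * (cmod x / r) ^ (N - j)" for j
    by (rule taylor_remainder[OF holB open_slice_x[OF o] _ assms(3)])
      (use assms xy B in auto)
  have pol: "pol N (taylor2 f 0) z = (\<Sum>j<N. (\<Sum>i<N - j. coeff2 (taylor2 f 0) i j * x ^ i) * y ^ j)"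
  proof -
    have "pol N (taylor2 f 0) z = (\<Sum>(i,j)\<in>Sigma {..<N} (\<lambda>i. {..<N - i}). coeff2 (taylor2 f 0) i j * (x ^ i * y ^ j))"
      by (simp add: pol_def z sum.Sigma)
    also have "\<dots> = (\<Sum>(j,i)\<in>Sigma {..<N} (\<lambda>i. {..<N - i}). coeff2 (taylor2 f 0) i j * (x ^ i * y ^ j))"
      by (rule sum.reindex_bij_witness[of _ prod.swap prod.swap]) auto
    also have "\<dots> = (\<Sum>j<N. (\<Sum>i<N - j. coeff2 (taylor2 f 0) i j * x ^ i) * y ^ j)"
      by (simp add: sum.Sigma[symmetric] sum_distrib_left mult_ac)
    finally show ?thesis .
  qed
  have "f z - pol N (taylor2 f 0) z = (f (x, y) - (\<Sum>j<N. ?B j x * y ^ j)) + (\<Sum>j<N. (?B j x - (\<Sum>i<N - j. coeff2 (taylor2 f 0) i j * x ^ i)) * y ^ j)"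
    unfolding pol by (simp add: z sum_subtractf left_diff_distrib)
  also have "cmod \<dots> \<le> 2 * M * (cmod y / r) ^ N + (\<Sum>j<N. 2 * (M / r ^ j) * (cmod x / r) ^ (N - j) * cmod y ^ j)"
  proof (intro order_trans[OF norm_triangle_ineq] add_mono order_trans[OF norm_sum] sum_mono)
    show "cmod (f (x, y) - (\<Sum>j<N. ?B j x * y ^ j)) \<le> 2 * M * (cmod y / r) ^ N"
      using 1 by (simp add: iter_dy)
    fix j
    show "cmod ((?B j x - (\<Sum>i<N - j. coeff2 (taylor2 f 0) i j * x ^ i)) * y ^ j) \<le> 2 * (M / r ^ j) * (cmod x / r) ^ (N - j) * cmod y ^ j"
      using mult_right_mono[OF 2[of j, unfolded derB], of "cmod y ^ j"] by (simp add: norm_mult norm_power)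
  qed
  also have "\<dots> \<le> 2 * M * (norm z / r) ^ N + (\<Sum>j<N. 2 * M * (norm z / r) ^ N)"
  proof (intro add_mono sum_mono)
    show "2 * M * (cmod y / r) ^ N \<le> 2 * M * (norm z / r) ^ N"
      using xy M assms(3) by (intro mult_left_mono power_mono divide_right_mono) auto
    fix j assume j: "j \<in> {..<N}"
    have "2 * (M / r ^ j) * (cmod x / r) ^ (N - j) * cmod y ^ j = 2 * M * ((cmod x / r) ^ (N - j) * (cmod y / r) ^ j)"
      by (simp add: power_divide field_simps)
    also have "\<dots> \<le> 2 * M * ((norm z / r) ^ (N - j) * (norm z / r) ^ j)"
      using xy M assms(3) by (intro mult_left_mono mult_mono power_mono divide_right_mono) auto
    also have "\<dots> = 2 * M * (norm z / r) ^ N" using j by (simp add: power_add[symmetric])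
    finally show "2 * (M / r ^ j) * (cmod x / r) ^ (N - j) * cmod y ^ j \<le> 2 * M * (norm z / r) ^ N" .
  qed
  also have "\<dots> = 2 * M * (real N + 1) * (norm z / r) ^ N" by (simp add: algebra_simps)
  finally show ?thesis .
qed

lemma hol2_bidisc:
  assumes "hol2 f U" "p \<in> U"
  obtains r M where "r > 0" "M > 0" "cball (fst p) r \<times> cball (snd p) r \<subseteq> U"
    "\<And>x y. x \<in> cball (fst p) r \<Longrightarrow> y \<in> cball (snd p) r \<Longrightarrow> cmod (f (x, y)) \<le> M"
proof (rule sephol_bidisc[OF hol2_imp_sephol[OF assms(1)] assms(2)])
  fix r M assume "r > 0" "M > 0" "cball (fst p) (2*r) \<times> cball (snd p) (2*r) \<subseteq> U"
    "\<And>x y. x \<in> cball (fst p) (2*r) \<Longrightarrow> y \<in> cball (snd p) (2*r) \<Longrightarrow> cmod (f (x, y)) \<le> M"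
  then show thesis by (intro that[of "2 * r" M]) auto
qed

lemma taylor2_bigo:
  assumes "hol2 f U" "0 \<in> U"
  shows "\<exists>C. \<forall>\<^sub>F z in nhds 0. cmod (f z - pol N (taylor2 f 0) z) \<le> C * norm z ^ N"
proof -
  obtain r M where r: "r > 0" "M > 0" "cball 0 r \<times> cball 0 r \<subseteq> U"
    "\<And>x y. x \<in> cball 0 r \<Longrightarrow> y \<in> cball 0 r \<Longrightarrow> cmod (f (x, y)) \<le> M"
    by (rule hol2_bidisc[OF assms, unfolded zero_prod_def fst_conv snd_conv]) (rule that; assumption)
  have "\<forall>\<^sub>F z in nhds 0. z \<in> ball (0::complex2) (r / 2)"
    using r by (intro eventually_nhds_in_open) auto
  then have "\<forall>\<^sub>F z in nhds 0. cmod (f z - pol N (taylor2 f 0) z) \<le> (2 * M * (real N + 1) / r ^ N) * norm z ^ N"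
    by eventually_elim (use taylor2_remainder[OF assms(1) r(3,1,4)] in \<open>force simp: power_divide\<close>)
  then show ?thesis by blast
qed

text \<open>Cauchy's estimate on a bidisc of radius s bounds the coefficient by a constant times
  s^(N - i - j), which tends to 0 with s.\<close>

lemma taylor2_small_vanish:
  assumes "hol2 f U" "0 \<in> U" "\<forall>\<^sub>F z in nhds 0. cmod (f z) \<le> C * norm z ^ N" "i + j < N"
  shows "coeff2 (taylor2 f 0) i j = 0"
proof (rule ccontr)
  assume nz: "coeff2 (taylor2 f 0) i j \<noteq> 0"
  obtain e where e: "e > 0" "\<And>z. norm z < e \<Longrightarrow> cmod (f z) \<le> C * norm z ^ N"
    using assms(3) by (auto simp: eventually_nhds_metric)
  obtain r0 where r0: "r0 > 0" "cball 0 r0 \<times> cball 0 r0 \<subseteq> U"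
    using bidisc_in_open[OF hol2_open[OF assms(1)] assms(2)] by auto
  define c where "c = cmod (coeff2 (taylor2 f 0) i j)"
  have C: "C \<ge> 0 \<or> True" by simp
  have bound: "c \<le> (\<bar>C\<bar> * 2 ^ N) * s" if s: "0 < s" "s < e / 2" "s \<le> r0" "s < 1" for s
  proof -
    have "c \<le> (\<bar>C\<bar> * (2 * s) ^ N) / s ^ (i + j)"
      unfolding c_def
    proof (rule taylor2_bound[OF assms(1)])
      show "cball (fst 0) s \<times> cball (snd 0) s \<subseteq> U" using r0 s by (auto simp: subset_iff)
      fix x y :: complex assume "x \<in> cball (fst 0) s" "y \<in> cball (snd 0) s"
      then have n: "norm (x, y) \<le> 2 * s" using norm_Pair_le[of x y] by auto
      then have "cmod (f (x, y)) \<le> C * norm (x, y) ^ N" using e(2) s by simp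
      also have "\<dots> \<le> \<bar>C\<bar> * (2 * s) ^ N" using n by (intro mult_mono power_mono) auto
      finally show "cmod (f (x, y)) \<le> \<bar>C\<bar> * (2 * s) ^ N" .
    qed (use s in auto)
    also have "\<dots> = \<bar>C\<bar> * 2 ^ N * s ^ (N - (i + j))" using s assms(4) by (simp add: power_mult_distrib power_diff)
    also have "\<dots> \<le> \<bar>C\<bar> * 2 ^ N * s" using s assms(4) power_decreasing[of 1 "N - (i + j)" s]
      by (intro mult_left_mono) auto
    finally show ?thesis .
  qed
  define D where "D = \<bar>C\<bar> * 2 ^ N + 1"
  have D: "D > 0" by (simp add: D_def add_nonneg_pos)
  have c: "c > 0" using nz by (simp add: c_def)
  \<comment> \<open>Small enough for the estimate to apply, and such that it would yield c \<le> c /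
    2.\<close>
  define s where "s = Min {e / 4, r0, 1 / 2, c / (2 * D)}"
  have s: "0 < s" "s < e / 2" "s \<le> r0" "s < 1" "s \<le> c / (2 * D)" using e(1) r0(1) c D
    by (auto simp: s_def min_less_iff_disj)
  have "c \<le> (\<bar>C\<bar> * 2 ^ N) * s" by (rule bound) (use s in auto)
  also have "\<dots> \<le> D * (c / (2 * D))" using s D by (intro mult_mono) (auto simp: D_def)
  also have "\<dots> = c / 2" using D by simp
  finally show False using c by simp
qed

section \<open>Agreement of formal series up to a given order\<close>

lemma agree_refl [simp]: "agree N a a" by (simp add: agree_def)
lemma agree_sym: "agree N a b \<Longrightarrow> agree N b a" by (simp add: agree_def)
lemma agree_trans: "agree N a b \<Longrightarrow> agree N b c \<Longrightarrow> agree N a c" by (simp add: agree_def)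
lemma agree_mono: "agree N a b \<Longrightarrow> M \<le> N \<Longrightarrow> agree M a b" by (simp add: agree_def)

lemma agree_mult: "agree N a a' \<Longrightarrow> agree N b b' \<Longrightarrow> agree N (a * b) (a' * b')"
  unfolding agree_def coeff2_mult
  by (intro allI impI sum.cong refl arg_cong2[where f = "(*)"]) auto

lemma agree_power: "agree N a b \<Longrightarrow> agree N (a ^ n) (b ^ n)"
  by (induction n) (auto intro: agree_mult)

lemma agree_imp_eq: "(\<And>N. agree N a b) \<Longrightarrow> a = b"
  by (rule fps2_eqI) (meson agree_def lessI)

definition agree_map :: "nat \<Rightarrow> fps2 \<times> fps2 \<Rightarrow> fps2 \<times> fps2 \<Rightarrow> bool" where
  "agree_map N G H \<longleftrightarrow> agree N (fst G) (fst H) \<and> agree N (snd G) (snd H)"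

lemma agree_map_refl [simp]: "agree_map N a a" by (simp add: agree_map_def)
lemma agree_map_sym: "agree_map N a b \<Longrightarrow> agree_map N b a" by (simp add: agree_map_def agree_sym)
lemma agree_map_trans: "agree_map N a b \<Longrightarrow> agree_map N b c \<Longrightarrow> agree_map N a c"
  by (auto simp: agree_map_def intro: agree_trans)
lemma agree_map_mono: "agree_map N a b \<Longrightarrow> M \<le> N \<Longrightarrow> agree_map M a b"
  by (auto simp: agree_map_def intro: agree_mono)

lemma agree_map_imp_eq: "(\<And>N. agree_map N a b) \<Longrightarrow> a = b"
  by (auto simp: agree_map_def intro!: prod_eqI agree_imp_eq)

text \<open>The sum defining a coefficient of a composite stops at its total degree m + n, so
  truncation commutes with substitution below any given order.\<close>

lemma agree_compose2:
  assumes "agree N f f'" "agree_map N G G'"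
  shows "agree N (compose2 f G) (compose2 f' G')"
proof -
  have p: "agree N (fst G ^ i * snd G ^ j) (fst G' ^ i * snd G' ^ j)" for i j
    using assms by (intro agree_mult agree_power) (auto simp: agree_map_def)
  show ?thesis
    unfolding agree_def compose2_def fps_nth_Abs_fps
  proof (intro allI impI sum.cong refl arg_cong2[where f = "(*)"])
    fix m n i j assume "m + n < N" "i \<in> {..m + n}" "j \<in> {..m + n - i}"
    then show "coeff2 f i j = coeff2 f' i j" using assms(1) by (auto simp: agree_def)
  qed (use p in \<open>auto simp: agree_def\<close>)
qed

lemma agree_compose_map:
  assumes "agree_map N H H'" "agree_map N G G'"
  shows "agree_map N (compose_map H G) (compose_map H' G')"
  using assms by (simp add: agree_map_def[of N "compose_map H G"] compose_map_def agree_compose2)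
    (simp add: agree_map_def agree_compose2)

lemma coeff2_monomial: "coeff2 (fps_X ^ i * fps_const fps_X ^ j) m n = (if m = i \<and> n = j then 1 else 0)"
  by (auto simp: fps_X_power_mult_nth fps_X_power_nth)

lemma taylor2_monomial: "taylor2 (\<lambda>z. c * (fst z ^ i * snd z ^ j)) 0 = fps_const (fps_const c) * (fps_X ^ i * fps_const fps_X ^ j)"
proof -
  have "taylor2 (\<lambda>z. fst z ^ i * snd z ^ j) 0 = fps_X ^ i * fps_const fps_X ^ j"
    using taylor2_mult[of "\<lambda>z. fst z ^ i" UNIV "\<lambda>z. snd z ^ j" 0]
    by (simp add: hol2_power taylor2_power[of _ UNIV] taylor2_fst taylor2_snd)
  then show ?thesis
    using taylor2_cmult[of "\<lambda>z. fst z ^ i * snd z ^ j" UNIV 0 c]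
    by (simp add: hol2_power hol2_mult)
qed

lemma taylor2_pol: "agree N (taylor2 (pol N a) 0) a"
  unfolding agree_def
proof (intro allI impI)
  fix m n assume mn: "m + n < N"
  have h: "hol2 (\<lambda>z. c * (fst z ^ i * snd z ^ j)) UNIV" for c i j
    by (intro hol2_mult hol2_power) auto
  have "taylor2 (pol N a) 0 = (\<Sum>i<N. \<Sum>j<N - i. taylor2 (\<lambda>z. coeff2 a i j * (fst z ^ i * snd z ^ j)) 0)"
    unfolding pol_def
    by (subst taylor2_sum[of UNIV] | intro hol2_sum h sum.cong refl | simp)+
  then have "coeff2 (taylor2 (pol N a) 0) m n = (\<Sum>i<N. \<Sum>j<N - i. coeff2 a i j * (if m = i \<and> n = j then 1 else 0))"
    by (simp add: taylor2_monomial fps_sum_nth coeff2_monomial del: fps_const_power)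
  also have "\<dots> = (\<Sum>i<N. if m = i then (\<Sum>j<N - i. if n = j then coeff2 a i j else 0) else 0)"
    by (intro sum.cong refl) (auto simp: if_distrib cong: if_cong)
  also have "\<dots> = coeff2 a m n" using mn by (simp add: sum.delta)
  finally show "coeff2 (taylor2 (pol N a) 0) m n = coeff2 a m n" .
qed

lemma pol_0: "N > 0 \<Longrightarrow> pol N a 0 = coeff2 a 0 0"
  using coeff2_taylor2_00[of "pol N a" 0] taylor2_pol[of N a] by (simp add: agree_def)

lemma hol2_linear_bound:
  assumes "hol2 g U" "0 \<in> U" "g 0 = 0"
  shows "\<exists>C\<ge>0. \<forall>\<^sub>F z in nhds 0. cmod (g z) \<le> C * norm z"
proof -
  have "pol 1 (taylor2 g 0) z = 0" for z using assms by (simp add: pol_def coeff2_taylor2_00)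
  then obtain C where "\<forall>\<^sub>F z in nhds 0. cmod (g z) \<le> C * norm z"
    using taylor2_bigo[OF assms(1,2), of 1] by auto
  then have "\<forall>\<^sub>F z in nhds 0. cmod (g z) \<le> \<bar>C\<bar> * norm z"
    by eventually_elim (smt (verit) mult_right_mono norm_ge_zero)
  then show ?thesis by (intro exI[of _ "\<bar>C\<bar>"]) auto
qed

lemma open_preimage_pair:
  assumes "hol2 g1 U" "hol2 g2 U" "open V"
  shows "open {z \<in> U. (g1 z, g2 z) \<in> V}"
proof -
  have "continuous_on U (\<lambda>z. (g1 z, g2 z))"
    by (intro continuous_intros hol2_continuous_on assms)
  from continuous_open_preimage[OF this hol2_open[OF assms(1)] assms(3)]
  show ?thesis by (simp add: vimage_def Int_def)
qed

text \<open>Split f into its Taylor polynomial of degree m + n and a remainder. For the polynomial,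
  the formula of \<open>compose2\<close> is additivity and multiplicativity of
  \<open>taylor2\<close>; the remainder, evaluated at functions of size O(|z|), is O(|z|^N) and
  cannot contribute in degree m + n.\<close>

lemma taylor2_compose0:
  assumes "hol2 f V" "hol2 g1 U" "hol2 g2 U" "0 \<in> U" "g1 0 = 0" "g2 0 = 0" "0 \<in> V"
  shows "taylor2 (\<lambda>z. f (g1 z, g2 z)) 0 = compose2 (taylor2 f 0) (taylor2 g1 0, taylor2 g2 0)"
proof (rule fps2_eqI)
  fix m n
  define N where "N = Suc (m + n)"
  define a where "a = taylor2 f 0"
  define W where "W = {z \<in> U. (g1 z, g2 z) \<in> V}"
  have W: "open W" "0 \<in> W" "W \<subseteq> U"
    using open_preimage_pair[OF assms(2,3) hol2_open[OF assms(1)]] assms by (auto simp: W_def zero_prod_def)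
  have g: "hol2 g1 W" "hol2 g2 W" using assms W hol2_subset by blast+
  have hpg: "hol2 (\<lambda>z. pol N a (g1 z, g2 z)) W"
    by (rule hol2_compose[of _ UNIV, OF _ g]) auto
  define R where "R z = f z - pol N a z" for z
  have R: "hol2 R V" unfolding R_def by (intro hol2_diff assms hol2_pol hol2_open[OF assms(1)])
  have hRg: "hol2 (\<lambda>z. R (g1 z, g2 z)) W" by (rule hol2_compose[OF R g]) (auto simp: W_def)
  obtain C where C: "\<forall>\<^sub>F z in nhds 0. cmod (R z) \<le> C * norm z ^ N"
    using taylor2_bigo[OF assms(1,7), of N] by (auto simp: R_def a_def)
  obtain C1 C2 where C12: "\<forall>\<^sub>F z in nhds 0. cmod (g1 z) \<le> C1 * norm z" "\<forall>\<^sub>F z in nhds 0. cmod (g2 z) \<le> C2 * norm z"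
    using hol2_linear_bound[OF assms(2,4,5)] hol2_linear_bound[OF assms(3,4,6)] by blast
  have "isCont (\<lambda>z. (g1 z, g2 z)) 0"
    using hol2_continuous_on[OF g(1)] hol2_continuous_on[OF g(2)] W
    by (intro continuous_intros) (auto simp: continuous_on_eq_continuous_at)
  then have lim: "filterlim (\<lambda>z. (g1 z, g2 z)) (nhds 0) (nhds 0)"
    using tendsto_at_iff_tendsto_nhds[of "\<lambda>z. (g1 z, g2 z)" 0] assms(5,6) by (simp add: isCont_def zero_prod_def)
  have "\<forall>\<^sub>F z in nhds 0. cmod (R (g1 z, g2 z)) \<le> (\<bar>C\<bar> * (C1 + C2) ^ N) * norm z ^ N"
    using eventually_compose_filterlim[OF C lim] C12
  proof eventually_elim
    case (elim z)
    have "norm (g1 z, g2 z) \<le> (C1 + C2) * norm z"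
      using norm_Pair_le[of "g1 z" "g2 z"] elim by (simp add: algebra_simps)
    then have "\<bar>C\<bar> * norm (g1 z, g2 z) ^ N \<le> \<bar>C\<bar> * ((C1 + C2) * norm z) ^ N"
      by (intro mult_left_mono power_mono) auto
    moreover have "C * norm (g1 z, g2 z) ^ N \<le> \<bar>C\<bar> * norm (g1 z, g2 z) ^ N" by (intro mult_right_mono) auto
    ultimately show ?case using elim(1) by (simp add: power_mult_distrib mult_ac)
  qed
  from taylor2_small_vanish[OF hRg W(2) this]
  have v: "coeff2 (taylor2 (\<lambda>z. R (g1 z, g2 z)) 0) m n = 0" by (simp add: N_def)
  have "(\<lambda>z. f (g1 z, g2 z)) = (\<lambda>z. pol N a (g1 z, g2 z) + R (g1 z, g2 z))" by (simp add: R_def)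
  then have "coeff2 (taylor2 (\<lambda>z. f (g1 z, g2 z)) 0) m n = coeff2 (taylor2 (\<lambda>z. pol N a (g1 z, g2 z)) 0) m n"
    using v taylor2_add[OF hpg hRg W(2)] by simp
  also have "taylor2 (\<lambda>z. pol N a (g1 z, g2 z)) 0 =
     (\<Sum>i<N. \<Sum>j<N - i. fps_const (fps_const (coeff2 a i j)) * (taylor2 g1 0 ^ i * taylor2 g2 0 ^ j))"
  proof -
    have h: "hol2 (\<lambda>z. g1 z ^ i * g2 z ^ j) W" for i j by (intro hol2_mult hol2_power g)
    have t: "taylor2 (\<lambda>z. c * (g1 z ^ i * g2 z ^ j)) 0 = fps_const (fps_const c) * (taylor2 g1 0 ^ i * taylor2 g2 0 ^ j)" for c i j
      by (simp add: taylor2_cmult[OF h W(2)] taylor2_mult[OF hol2_power hol2_power, OF g W(2)]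
        taylor2_power[OF g(1) W(2)] taylor2_power[OF g(2) W(2)])
    have "taylor2 (\<lambda>z. pol N a (g1 z, g2 z)) 0 = (\<Sum>i<N. \<Sum>j<N - i. taylor2 (\<lambda>z. coeff2 a i j * (g1 z ^ i * g2 z ^ j)) 0)"
      unfolding pol_def fst_conv snd_conv
      by (subst taylor2_sum[of W] | intro hol2_sum hol2_mult hol2_const hol2_power g W sum.cong refl)+
    then show ?thesis by (simp add: t)
  qed
  also have "coeff2 \<dots> m n = (\<Sum>i<N. \<Sum>j<N - i. coeff2 a i j * coeff2 (taylor2 g1 0 ^ i * taylor2 g2 0 ^ j) m n)"
    by (simp add: fps_sum_nth)
  also have "\<dots> = coeff2 (compose2 a (taylor2 g1 0, taylor2 g2 0)) m n"
    unfolding compose2_def N_def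
    by (simp add: lessThan_Suc_atMost) (intro sum.cong refl; auto simp: Suc_diff_le lessThan_Suc_atMost)
  finally show "coeff2 (taylor2 (\<lambda>z. f (g1 z, g2 z)) 0) m n = coeff2 (compose2 (taylor2 f 0) (taylor2 g1 0, taylor2 g2 0)) m n"
    by (simp add: a_def)
qed

lemma hol2_shift: assumes "hol2 f U" shows "hol2 (\<lambda>z. f (p + z)) {z. p + z \<in> U}"
proof -
  have "open {z. p + z \<in> U}" using open_vimage[OF hol2_open[OF assms], of "\<lambda>z. p + z"]
    by (simp add: vimage_def continuous_intros)
  then have "hol2 (\<lambda>z. f (fst p + fst z, snd p + snd z)) {z. p + z \<in> U}"
    by (intro hol2_compose[OF assms] hol2_add) (auto simp: plus_prod_def)
  then show ?thesis by (simp add: plus_prod_def)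
qed

lemma taylor2_compose:
  assumes "hol2 f V" "hol2 g1 U" "hol2 g2 U" "p \<in> U" "(g1 p, g2 p) \<in> V"
  shows "taylor2 (\<lambda>z. f (g1 z, g2 z)) p =
    compose2 (taylor2 f (g1 p, g2 p)) (taylor2 (\<lambda>z. g1 z - g1 p) p, taylor2 (\<lambda>z. g2 z - g2 p) p)"
proof -
  let ?U = "{z. p + z \<in> U}"
  have o: "open ?U" using hol2_open[OF hol2_shift[OF assms(2)]] .
  have "taylor2 (\<lambda>z. (\<lambda>w. f ((g1 p, g2 p) + w)) (g1 (p + z) - g1 p, g2 (p + z) - g2 p)) 0 =
    compose2 (taylor2 (\<lambda>w. f ((g1 p, g2 p) + w)) 0) (taylor2 (\<lambda>z. g1 (p + z) - g1 p) 0, taylor2 (\<lambda>z. g2 (p + z) - g2 p) 0)"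
    by (rule taylor2_compose0[OF hol2_shift[OF assms(1)], of _ ?U])
      (use assms o hol2_open[OF assms(2)] in \<open>auto simp: zero_prod_def[symmetric] intro!: hol2_diff hol2_shift hol2_const\<close>)
  then show ?thesis
    by (simp add: taylor2_shift[of f "(g1 p, g2 p)"] taylor2_shift[of "\<lambda>z. g1 z - g1 p" p]
      taylor2_shift[of "\<lambda>z. g2 z - g2 p" p] taylor2_shift[of "\<lambda>z. f (g1 z, g2 z)" p])
qed

section \<open>Holomorphic maps of the plane\<close>

definition hol2m :: "(complex2 \<Rightarrow> complex2) \<Rightarrow> complex2 set \<Rightarrow> bool" where
  "hol2m F U \<longleftrightarrow> hol2 (\<lambda>z. fst (F z)) U \<and> hol2 (\<lambda>z. snd (F z)) U"

lemma hol2m_open: "hol2m F U \<Longrightarrow> open U" by (simp add: hol2m_def hol2_def)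

lemma hol2m_subset: "hol2m F U \<Longrightarrow> open V \<Longrightarrow> V \<subseteq> U \<Longrightarrow> hol2m F V"
  by (auto simp: hol2m_def intro: hol2_subset)

lemma hol2m_continuous_on: assumes "hol2m F U" shows "continuous_on U F"
proof -
  have "continuous_on U (\<lambda>z. (fst (F z), snd (F z)))"
    using assms by (intro continuous_on_Pair hol2_continuous_on) (auto simp: hol2m_def)
  then show ?thesis by simp
qed

lemma hol2_compose_map: "hol2 f V \<Longrightarrow> hol2m G U \<Longrightarrow> (\<And>p. p \<in> U \<Longrightarrow> G p \<in> V) \<Longrightarrow> hol2 (\<lambda>p. f (G p)) U"
  using hol2_compose[of f V "\<lambda>z. fst (G z)" U "\<lambda>z. snd (G z)"] by (simp add: hol2m_def)

lemma hol2m_compose: "hol2m F V \<Longrightarrow> hol2m G U \<Longrightarrow> (\<And>p. p \<in> U \<Longrightarrow> G p \<in> V) \<Longrightarrow> hol2m (\<lambda>p. F (G p)) U"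
  using hol2_compose_map[of "\<lambda>z. fst (F z)" V G U] hol2_compose_map[of "\<lambda>z. snd (F z)" V G U]
  by (simp add: hol2m_def)

lemma hol2m_has_derivative:
  assumes "hol2m F U" "p \<in> U"
  shows "(F has_derivative (\<lambda>h. (dx (\<lambda>z. fst (F z)) p * fst h + dy (\<lambda>z. fst (F z)) p * snd h,
     dx (\<lambda>z. snd (F z)) p * fst h + dy (\<lambda>z. snd (F z)) p * snd h))) (at p)"
  using has_derivative_Pair[OF hol2_has_derivative[of "\<lambda>z. fst (F z)" U p] hol2_has_derivative[of "\<lambda>z. snd (F z)" U p]] assms
  by (simp add: hol2m_def)

text \<open>A real derivative that commutes with complex scalars is determined by its values at (1,
  0) and (0, 1), which supply the coefficients.\<close>

lemma holomorphic2_on_iff: "holomorphic2_on F U \<longleftrightarrow> hol2m F U"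
proof
  assume F: "holomorphic2_on F U"
  have "\<exists>a b. ((\<lambda>z. fst (F z)) has_derivative (\<lambda>h. a * fst h + b * snd h)) (at p)"
       "\<exists>a b. ((\<lambda>z. snd (F z)) has_derivative (\<lambda>h. a * fst h + b * snd h)) (at p)" if p: "p \<in> U" for p
  proof -
    obtain D where D: "(F has_derivative D) (at p)" "\<And>c z. D (cscale c z) = cscale c (D z)"
      using F p by (auto simp: holomorphic2_on_def)
    have lin: "linear D" using D(1) has_derivative_linear by blast
    have "D h = (fst (D (1, 0)) * fst h + fst (D (0, 1)) * snd h, snd (D (1, 0)) * fst h + snd (D (0, 1)) * snd h)" for h
    proof -
      have "h = cscale (fst h) (1, 0) + cscale (snd h) (0, 1)" by (simp add: cscale_def prod_eq_iff)
      then have "D h = cscale (fst h) (D (1, 0)) + cscale (snd h) (D (0, 1))"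
        using linear_add[OF lin] D(2) by metis
      then show ?thesis by (simp add: cscale_def mult.commute)
    qed
    then have e: "(\<lambda>h. fst (D h)) = (\<lambda>h. fst (D (1, 0)) * fst h + fst (D (0, 1)) * snd h)"
      "(\<lambda>h. snd (D h)) = (\<lambda>h. snd (D (1, 0)) * fst h + snd (D (0, 1)) * snd h)"
      by (metis fst_conv, metis snd_conv)
    show "\<exists>a b. ((\<lambda>z. fst (F z)) has_derivative (\<lambda>h. a * fst h + b * snd h)) (at p)"
      using has_derivative_fst[OF D(1)] unfolding e by blast
    show "\<exists>a b. ((\<lambda>z. snd (F z)) has_derivative (\<lambda>h. a * fst h + b * snd h)) (at p)"
      using has_derivative_snd[OF D(1)] unfolding e by blast
  qed
  with F show "hol2m F U" by (auto simp: hol2m_def hol2_def holomorphic2_on_def)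
next
  assume F: "hol2m F U"
  show "holomorphic2_on F U" unfolding holomorphic2_on_def
  proof (intro conjI ballI)
    show "open U" using F hol2m_open by blast
    fix p assume "p \<in> U"
    from hol2m_has_derivative[OF F this]
    show "\<exists>D. (F has_derivative D) (at p) \<and> (\<forall>c z. D (cscale c z) = cscale c (D z))"
      by (intro exI conjI) (auto simp: cscale_def algebra_simps)
  qed
qed

lemma taylor_map_compose:
  assumes "hol2m F V" "hol2m G U" "p \<in> U" "G p \<in> V"
  shows "taylor_map (\<lambda>z. F (G z)) p = compose_map (taylor_map F (G p)) (taylor_map G p)"
proof -
  have "taylor2 (\<lambda>z. f (G z) - f (G p)) p = compose2 (taylor2 (\<lambda>z. f z - f (G p)) (G p)) (taylor_map G p)"
    if "hol2 f V" for f
    using taylor2_compose[of "\<lambda>z. f z - f (G p)" V "\<lambda>z. fst (G z)" U "\<lambda>z. snd (G z)" p] assms that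
    by (simp add: hol2m_def taylor_map_def hol2_diff hol2_open)
  from this[of "\<lambda>z. fst (F z)"] this[of "\<lambda>z. snd (F z)"] show ?thesis
    using assms by (simp add: taylor_map_def[of F] taylor_map_def[of "\<lambda>z. F (G z)"] compose_map_def hol2m_def)
qed

lemma taylor2_compose_map:
  assumes "hol2 f V" "hol2m G U" "p \<in> U" "G p \<in> V"
  shows "taylor2 (\<lambda>z. f (G z)) p = compose2 (taylor2 f (G p)) (taylor_map G p)"
  using taylor2_compose[of f V "\<lambda>z. fst (G z)" U "\<lambda>z. snd (G z)" p] assms
  by (simp add: hol2m_def taylor_map_def)

section \<open>Formal substitution\<close>

definition zc :: "fps2 \<times> fps2 \<Rightarrow> bool" where
  "zc G \<longleftrightarrow> coeff2 (fst G) 0 0 = 0 \<and> coeff2 (snd G) 0 0 = 0"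

definition polm :: "nat \<Rightarrow> fps2 \<times> fps2 \<Rightarrow> complex2 \<Rightarrow> complex2" where
  "polm N G z = (pol N (fst G) z, pol N (snd G) z)"

lemma hol2m_polm [intro, simp]: "open U \<Longrightarrow> hol2m (polm N G) U"
  by (auto simp: hol2m_def polm_def)

lemma polm_0: "zc G \<Longrightarrow> N > 0 \<Longrightarrow> polm N G 0 = 0"
  by (simp add: polm_def zc_def pol_0) (simp add: zero_prod_def)

lemma taylor_map_polm: assumes "zc G" "N > 0" shows "agree_map N (taylor_map (polm N G) 0) G"
  using polm_0[OF assms] taylor2_pol[of N "fst G"] taylor2_pol[of N "snd G"]
  by (simp add: agree_map_def taylor_map_def polm_def)

lemma zc_taylor_map [simp]: "zc (taylor_map F p)"
  by (simp add: zc_def taylor_map_def coeff2_taylor2_00)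

lemma zc_compose_map: "zc H \<Longrightarrow> zc (compose_map H G)"
  by (simp add: zc_def compose_map_def compose2_def)

text \<open>For polynomials, with G and H fixing 0, both sides are the Taylor series of the same
  composite function. Truncation at order N changes neither side below order N, so the identity
  passes to all series without touching the coefficient sums.\<close>

lemma compose2_assoc:
  assumes "zc G" "zc H"
  shows "compose2 (compose2 f G) H = compose2 f (compose_map G H)"
proof (rule agree_imp_eq)
  fix N0
  define N where "N = Suc N0"
  let ?f = "pol N f" and ?G = "polm N G" and ?H = "polm N H"
  have N: "N > 0" by (simp add: N_def)
  note G0 = polm_0[OF assms(1) N] and H0 = polm_0[OF assms(2) N]
  note a = taylor2_pol[of N f] taylor_map_polm[OF assms(1) N] taylor_map_polm[OF assms(2) N]
  have 1: "taylor2 (\<lambda>z. ?f (?G (?H z))) 0 = compose2 (compose2 (taylor2 ?f 0) (taylor_map ?G 0)) (taylor_map ?H 0)"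
    using taylor2_compose_map[of "\<lambda>z. ?f (?G z)" UNIV ?H UNIV 0] taylor2_compose_map[of ?f UNIV ?G UNIV 0]
    by (simp add: G0 H0 hol2_compose_map[of _ UNIV] hol2_pol)
  have 2: "taylor2 (\<lambda>z. ?f (?G (?H z))) 0 = compose2 (taylor2 ?f 0) (compose_map (taylor_map ?G 0) (taylor_map ?H 0))"
    using taylor2_compose_map[of ?f UNIV "\<lambda>z. ?G (?H z)" UNIV 0] taylor_map_compose[of ?G UNIV ?H UNIV 0]
    by (simp add: G0 H0 hol2m_compose[of _ UNIV] hol2_pol)
  have "agree N (compose2 (compose2 f G) H) (compose2 (compose2 (taylor2 ?f 0) (taylor_map ?G 0)) (taylor_map ?H 0))"
    by (intro agree_compose2 a(1)[THEN agree_sym] a(2,3)[THEN agree_map_sym])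
  moreover have "agree N (compose2 (taylor2 ?f 0) (compose_map (taylor_map ?G 0) (taylor_map ?H 0))) (compose2 f (compose_map G H))"
    by (intro agree_compose2 agree_compose_map a)
  ultimately have "agree N (compose2 (compose2 f G) H) (compose2 f (compose_map G H))"
    unfolding 1[symmetric] 2[symmetric] by (rule agree_trans)
  then show "agree N0 (compose2 (compose2 f G) H) (compose2 f (compose_map G H))"
    by (rule agree_mono) (simp add: N_def)
qed

lemma compose_map_assoc:
  "zc G \<Longrightarrow> zc K \<Longrightarrow> compose_map (compose_map H G) K = compose_map H (compose_map G K)"
  by (simp add: compose_map_def[of H] compose_map_def[of "(_, _)"] compose2_assoc)

lemma compose2_mult:
  assumes "zc G"
  shows "compose2 (a * b) G = compose2 a G * compose2 b G"
proof (rule agree_imp_eq)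
  fix N0
  define N where "N = Suc N0"
  let ?a = "pol N a" and ?b = "pol N b" and ?G = "polm N G"
  have N: "N > 0" by (simp add: N_def)
  note G0 = polm_0[OF assms N]
  note ag = taylor2_pol[of N a] taylor2_pol[of N b] taylor_map_polm[OF assms N]
  have h: "hol2 ?a UNIV" "hol2 ?b UNIV" by auto
  have "taylor2 (\<lambda>z. ?a (?G z) * ?b (?G z)) 0 = compose2 (taylor2 ?a 0 * taylor2 ?b 0) (taylor_map ?G 0)"
    using taylor2_compose_map[of "\<lambda>z. ?a z * ?b z" UNIV ?G UNIV 0]
    by (simp add: G0 hol2_mult h taylor2_mult[OF h])
  moreover have "taylor2 (\<lambda>z. ?a (?G z) * ?b (?G z)) 0 = compose2 (taylor2 ?a 0) (taylor_map ?G 0) * compose2 (taylor2 ?b 0) (taylor_map ?G 0)"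
    using taylor2_compose_map[OF h(1), of ?G UNIV 0] taylor2_compose_map[OF h(2), of ?G UNIV 0]
    by (simp add: G0 taylor2_mult[of _ UNIV] hol2_compose_map[OF h(1)] hol2_compose_map[OF h(2)])
  moreover have "agree N (compose2 (a * b) G) (compose2 (taylor2 ?a 0 * taylor2 ?b 0) (taylor_map ?G 0))"
    by (intro agree_compose2 agree_mult ag(1,2)[THEN agree_sym] ag(3)[THEN agree_map_sym])
  moreover have "agree N (compose2 (taylor2 ?a 0) (taylor_map ?G 0) * compose2 (taylor2 ?b 0) (taylor_map ?G 0)) (compose2 a G * compose2 b G)"
    by (intro agree_compose2 agree_mult ag)
  ultimately have "agree N (compose2 (a * b) G) (compose2 a G * compose2 b G)"
    using agree_trans by simp
  then show "agree N0 (compose2 (a * b) G) (compose2 a G * compose2 b G)"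
    by (rule agree_mono) (simp add: N_def)
qed

lemma compose2_cmult: "compose2 (fps_const (fps_const c) * a) G = fps_const (fps_const c) * compose2 a G"
  by (rule fps2_eqI) (simp add: compose2_def sum_distrib_left mult_ac)

lemma compose2_diff: "compose2 (a - b) G = compose2 a G - compose2 b G"
  by (rule fps2_eqI) (simp add: compose2_def left_diff_distrib sum_subtractf)

lemma taylor_map_id: "taylor_map (\<lambda>z. z) p = id_map"
proof -
  have "taylor2 (\<lambda>z. f z - f p) p = taylor2 f p - fps_const (fps_const (f p))" if "hol2 f UNIV" for f
    using taylor2_diff[OF that, of "\<lambda>_. f p" p] by (simp add: taylor2_const)
  from this[of fst] this[of snd] show ?thesis
    by (simp add: taylor_map_def id_map_def taylor2_fst taylor2_snd)
qed

lemma zc_id_map [simp]: "zc id_map" by (simp add: zc_def id_map_def)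

lemma compose_map_id_left:
  assumes "zc G" shows "compose_map id_map G = G"
proof (rule agree_map_imp_eq)
  fix N0
  define N where "N = Suc N0"
  have N: "N > 0" by (simp add: N_def)
  note ag = taylor_map_polm[OF assms N]
  have "taylor_map (polm N G) 0 = compose_map id_map (taylor_map (polm N G) 0)"
    using taylor_map_compose[of "\<lambda>z. z" UNIV "polm N G" UNIV 0] hol2m_polm[of UNIV N G] by (simp add: taylor_map_id hol2m_def[of "\<lambda>z. z"])
  moreover have "agree_map N (compose_map id_map G) (compose_map id_map (taylor_map (polm N G) 0))"
    by (intro agree_compose_map ag[THEN agree_map_sym] agree_map_refl)
  ultimately have "agree_map N (compose_map id_map G) G"
    using ag agree_map_trans by metis
  then show "agree_map N0 (compose_map id_map G) G"
    by (rule agree_map_mono) (simp add: N_def)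
qed

lemma compose2_id: "compose2 f id_map = f"
proof (rule agree_imp_eq)
  fix N0
  define N where "N = Suc N0"
  have N: "N > 0" by (simp add: N_def)
  have "taylor2 (pol N f) 0 = compose2 (taylor2 (pol N f) 0) id_map"
    using taylor2_compose_map[of "pol N f" UNIV "\<lambda>z. z" UNIV 0] by (simp add: taylor_map_id hol2m_def hol2_pol)
  moreover have "agree N (compose2 f id_map) (compose2 (taylor2 (pol N f) 0) id_map)"
    by (intro agree_compose2 agree_map_refl agree_sym[OF taylor2_pol])
  ultimately have "agree N (compose2 f id_map) f"
    using taylor2_pol[of N f] by (metis agree_trans)
  then show "agree N0 (compose2 f id_map) f"
    by (rule agree_mono) (simp add: N_def)
qed

lemma compose_map_id_right: "compose_map G id_map = G"
  by (simp add: compose_map_def compose2_id)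

lemma compose2_coeff_10:
  "coeff2 (compose2 f G) 1 0 = coeff2 f 1 0 * coeff2 (fst G) 1 0 + coeff2 f 0 1 * coeff2 (snd G) 1 0"
  by (simp add: compose2_def)

lemma compose2_coeff_01:
  "coeff2 (compose2 f G) 0 1 = coeff2 f 1 0 * coeff2 (fst G) 0 1 + coeff2 f 0 1 * coeff2 (snd G) 0 1"
  by (simp add: compose2_def)

subsection \<open>Local inverses and convergent series\<close>

text \<open>The real inverse function theorem supplies a differentiable inverse; its derivative is
  the inverse of a complex linear map and hence complex linear.\<close>

lemma hol2m_local_inverse:
  assumes "hol2m F U" "p \<in> U"
    "dx (\<lambda>z. fst (F z)) p * dy (\<lambda>z. snd (F z)) p - dy (\<lambda>z. fst (F z)) p * dx (\<lambda>z. snd (F z)) p \<noteq> 0"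
  shows "\<exists>U' V'. open U' \<and> U' \<subseteq> U \<and> p \<in> U' \<and> open V' \<and> bij_betw F U' V' \<and> hol2m (inv_into U' F) V'"
proof -
  define a b c d where "a = dx (\<lambda>z. fst (F z))" and "b = dy (\<lambda>z. fst (F z))"
    and "c = dx (\<lambda>z. snd (F z))" and "d = dy (\<lambda>z. snd (F z))"
  define \<Delta> where "\<Delta> = a p * d p - b p * c p"
  have \<Delta>: "\<Delta> \<noteq> 0" using assms(3) by (simp add: \<Delta>_def a_def b_def c_def d_def)
  have cont: "continuous_on U a" "continuous_on U b" "continuous_on U c" "continuous_on U d"
    using assms(1) by (auto simp: hol2m_def a_def b_def c_def d_def intro!: hol2_continuous_on hol2_dx hol2_dy)
  have bl: "bounded_linear (\<lambda>h::complex2. (r * fst h + s * snd h, t * fst h + u * snd h))" for r s t u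
    by (intro bounded_linear_Pair bounded_linear_add bounded_linear_const_mult bounded_linear_fst bounded_linear_snd)
  define F' where "F' z = Blinfun (\<lambda>h. (a z * fst h + b z * snd h, c z * fst h + d z * snd h))" for z
  have F': "blinfun_apply (F' z) h = (a z * fst h + b z * snd h, c z * fst h + d z * snd h)" for z h
    by (simp add: F'_def bounded_linear_Blinfun_apply[OF bl])
  \<comment> \<open>The inverse matrix by Cramer's rule.\<close>
  define J where "J = Blinfun (\<lambda>h. (d p / \<Delta> * fst h + (- b p / \<Delta>) * snd h, (- c p / \<Delta>) * fst h + a p / \<Delta> * snd h))"
  have J: "blinfun_apply J h = (d p / \<Delta> * fst h + (- b p / \<Delta>) * snd h, (- c p / \<Delta>) * fst h + a p / \<Delta> * snd h)" for h
    unfolding J_def by (rule bounded_linear_Blinfun_apply[OF bl, THEN fun_cong])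
  have inv: "J o\<^sub>L F' p = id_blinfun"
  proof (rule blinfun_eqI)
    fix h :: complex2
    have "d p / \<Delta> * (a p * x + b p * y) + (- b p / \<Delta>) * (c p * x + d p * y) = x"
      "(- c p / \<Delta>) * (a p * x + b p * y) + a p / \<Delta> * (c p * x + d p * y) = y" for x y
    proof -
      have "d p / \<Delta> * (a p * x + b p * y) + (- b p / \<Delta>) * (c p * x + d p * y) = \<Delta> * x / \<Delta>"
        by (simp add: \<Delta>_def algebra_simps flip: add_divide_distrib diff_divide_distrib)
      then show "d p / \<Delta> * (a p * x + b p * y) + (- b p / \<Delta>) * (c p * x + d p * y) = x" using \<Delta> by simp
      have "(- c p / \<Delta>) * (a p * x + b p * y) + a p / \<Delta> * (c p * x + d p * y) = \<Delta> * y / \<Delta>"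
        by (simp add: \<Delta>_def algebra_simps flip: add_divide_distrib diff_divide_distrib)
      then show "(- c p / \<Delta>) * (a p * x + b p * y) + a p / \<Delta> * (c p * x + d p * y) = y" using \<Delta> by simp
    qed
    then show "blinfun_apply (J o\<^sub>L F' p) h = blinfun_apply id_blinfun h"
      by (simp add: J F' blinfun_apply_blinfun_compose)
  qed
  have der: "(F has_derivative blinfun_apply (F' z)) (at z)" if "z \<in> U" for z
    using hol2m_has_derivative[OF assms(1) that] by (simp add: a_def b_def c_def d_def F' [abs_def])
  have cF: "continuous_on U F'"
    by (rule continuous_on_blinfun_componentwise)
      (unfold F', intro continuous_intros cont)
  obtain U' V' g g' where IF: "open U'" "U' \<subseteq> U" "p \<in> U'" "open V'" "F p \<in> V'" "homeomorphism U' V' F g"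
    "\<And>y. y \<in> V' \<Longrightarrow> (g has_derivative (g' y)) (at y)"
    "\<And>y. y \<in> V' \<Longrightarrow> g' y = inv (blinfun_apply (F'(g y)))"
    "\<And>y. y \<in> V' \<Longrightarrow> bij (blinfun_apply (F'(g y)))"
    by (rule inverse_function_theorem[OF hol2m_open[OF assms(1)] der cF assms(2) inv], assumption) (rule that; assumption)
  have bij: "bij_betw F U' V'"
    by (rule bij_betw_byWitness[where f' = g]) (use IF(6) in \<open>auto simp: homeomorphism_def\<close>)
  have g: "inv_into U' F y = g y" if "y \<in> V'" for y
    using bij_betw_inv_into_left[OF bij, of "g y"] IF(6) that by (auto simp: homeomorphism_def)
  have "holomorphic2_on (inv_into U' F) V'"
    unfolding holomorphic2_on_def
  proof (intro conjI ballI IF(4))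
    fix y assume y: "y \<in> V'"
    have "(inv_into U' F has_derivative g' y) (at y)"
      by (rule has_derivative_transform_within_open[OF IF(7)[OF y] IF(4) y]) (simp add: g)
    moreover have "g' y (cscale k z) = cscale k (g' y z)" for k z
    proof -
      let ?B = "blinfun_apply (F' (g y))"
      have "?B (cscale k w) = cscale k (?B w)" for w by (simp add: F' cscale_def algebra_simps)
      then have "?B (cscale k (g' y z)) = cscale k z"
        using IF(8,9)[OF y] by (simp add: bij_is_surj surj_f_inv_f)
      then show ?thesis using IF(8,9)[OF y] by (metis bij_inv_eq_iff)
    qed
    ultimately show "\<exists>D. (inv_into U' F has_derivative D) (at y) \<and> (\<forall>c z. D (cscale c z) = cscale c (D z))" by blast
  qed
  then show ?thesis
    by (intro exI[of _ U'] exI[of _ V'] conjI IF(1-4) bij) (simp add: holomorphic2_on_iff)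
qed

lemma representative_iff: "representative F U V \<longleftrightarrow> open U \<and> open V \<and> 0 \<in> U \<and> F 0 = 0 \<and> bij_betw F U V \<and>
     hol2m F U \<and> hol2m (inv_into U F) V"
  by (simp add: representative_def holomorphic2_on_iff)

lemma ex_representative:
  assumes "hol2m F U" "0 \<in> U" "F 0 = 0"
    "dx (\<lambda>z. fst (F z)) 0 * dy (\<lambda>z. snd (F z)) 0 - dy (\<lambda>z. fst (F z)) 0 * dx (\<lambda>z. snd (F z)) 0 \<noteq> 0"
  shows "\<exists>U' V'. U' \<subseteq> U \<and> representative F U' V'"
  using hol2m_local_inverse[OF assms(1,2,4)] hol2m_subset[OF assms(1)] assms(3)
  unfolding representative_iff by blast

lemma representative_inv:
  assumes "representative F U V"
  shows "0 \<in> V" "inv_into U F 0 = 0" "\<And>z. z \<in> U \<Longrightarrow> inv_into U F (F z) = z" "\<And>z. z \<in> V \<Longrightarrow> F (inv_into U F z) = z"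
    "\<And>z. z \<in> U \<Longrightarrow> F z \<in> V" "\<And>z. z \<in> V \<Longrightarrow> inv_into U F z \<in> U"
proof -
  have b: "bij_betw F U V" and z: "0 \<in> U" "F 0 = 0" using assms by (auto simp: representative_def)
  show "0 \<in> V" using b z bij_betwE by fastforce
  show "inv_into U F 0 = 0" using bij_betw_inv_into_left[OF b z(1)] z by simp
  show "\<And>z. z \<in> U \<Longrightarrow> inv_into U F (F z) = z" "\<And>z. z \<in> V \<Longrightarrow> F (inv_into U F z) = z"
    using b bij_betw_inv_into_left bij_betw_inv_into_right by metis+
  show "\<And>z. z \<in> U \<Longrightarrow> F z \<in> V" "\<And>z. z \<in> V \<Longrightarrow> inv_into U F z \<in> U"
    using b bij_betwE bij_betw_inv_into by metis+
qed

lemma taylor_map_cong: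
  assumes "\<forall>\<^sub>F z in nhds p. F z = G z"
  shows "taylor_map F p = taylor_map G p"
proof -
  have "F p = G p" using assms eventually_nhds_x_imp_x by blast
  then have "taylor2 (\<lambda>z. fst (F z - F p)) p = taylor2 (\<lambda>z. fst (G z - G p)) p"
    "taylor2 (\<lambda>z. snd (F z - F p)) p = taylor2 (\<lambda>z. snd (G z - G p)) p"
    using assms by (auto intro!: taylor2_cong elim!: eventually_mono)
  then show ?thesis by (simp add: taylor_map_def)
qed

lemma representative_taylor_map:
  assumes "representative F U V" "p \<in> U"
  shows "compose_map (taylor_map F p) (taylor_map (inv_into U F) (F p)) = id_map"
    "compose_map (taylor_map (inv_into U F) (F p)) (taylor_map F p) = id_map"
proof -
  note r = representative_inv[OF assms(1)]
  have h: "hol2m F U" "hol2m (inv_into U F) V" "open U" "open V" using assms(1) by (auto simp: representative_iff)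
  have "taylor_map (\<lambda>z. F (inv_into U F z)) (F p) = taylor_map (\<lambda>z. z) (F p)"
    by (rule taylor_map_cong) (use r assms(2) h eventually_nhds_in_open[of V "F p"] in \<open>auto elim!: eventually_mono\<close>)
  then show "compose_map (taylor_map F p) (taylor_map (inv_into U F) (F p)) = id_map"
    using taylor_map_compose[OF h(1,2), of "F p"] assms(2) by (simp add: taylor_map_id r)
  have "taylor_map (\<lambda>z. inv_into U F (F z)) p = taylor_map (\<lambda>z. z) p"
    by (rule taylor_map_cong) (use r assms(2) h eventually_nhds_in_open[of U p] in \<open>auto elim!: eventually_mono\<close>)
  then show "compose_map (taylor_map (inv_into U F) (F p)) (taylor_map F p) = id_map"
    using taylor_map_compose[OF h(2,1), of p] assms(2) by (simp add: taylor_map_id r)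
qed

lemma formal_diffeo_zc: "formal_diffeo H \<Longrightarrow> zc H"
  by (simp add: formal_diffeo_def zc_def)

text \<open>Linear parts compose as matrices, so the two Jacobian determinants have product
  1.\<close>

lemma formal_diffeo_left_inverse:
  assumes "zc H" "zc K" "compose_map K H = id_map"
  shows "formal_diffeo H"
proof -
  define a b c d where "a = coeff2 (fst H) 1 0" and "b = coeff2 (fst H) 0 1" and "c = coeff2 (snd H) 1 0" and "d = coeff2 (snd H) 0 1"
  define a' b' c' d' where "a' = coeff2 (fst K) 1 0" and "b' = coeff2 (fst K) 0 1" and "c' = coeff2 (snd K) 1 0" and "d' = coeff2 (snd K) 0 1"
  have e: "fst (compose_map K H) = fps_X" "snd (compose_map K H) = fps_const fps_X"
    using assms(3) by (auto simp: id_map_def)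
  have "a' * a + b' * c = 1" "a' * b + b' * d = 0" "c' * a + d' * c = 0" "c' * b + d' * d = 1"
    using arg_cong[OF e(1), of "\<lambda>f. coeff2 f 1 0"] arg_cong[OF e(1), of "\<lambda>f. coeff2 f 0 1"]
      arg_cong[OF e(2), of "\<lambda>f. coeff2 f 1 0"] arg_cong[OF e(2), of "\<lambda>f. coeff2 f 0 1"]
    by (simp_all add: compose_map_def compose2_coeff_10[unfolded One_nat_def] compose2_coeff_01[unfolded One_nat_def] a_def b_def c_def d_def a'_def b'_def c'_def d'_def)
  then have "(a' * d' - b' * c') * (a * d - b * c) = 1" by algebra
  then have "a * d - b * c \<noteq> 0" by auto
  with assms(1) show ?thesis by (simp add: formal_diffeo_def zc_def a_def b_def c_def d_def)
qed

text \<open>Every truncation of H that keeps the linear part is an invertible analytic germ. The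
  Taylor series of these inverses stabilise in each degree, and their limit inverts H.\<close>

lemma formal_inverse:
  assumes "formal_diffeo H"
  shows "\<exists>K. formal_diffeo K \<and> compose_map H K = id_map \<and> compose_map K H = id_map"
proof -
  note z = formal_diffeo_zc[OF assms]
  define \<eta> where "\<eta> N = taylor_map (polm N H) 0" for N
  have \<eta>: "agree_map N (\<eta> M) H" if "0 < M" "N \<le> M" for N M
    using taylor_map_polm[OF z that(1)] agree_map_mono that(2) unfolding \<eta>_def by blast
  have "\<exists>K. zc K \<and> compose_map (\<eta> N) K = id_map \<and> compose_map K (\<eta> N) = id_map" if N: "N \<ge> 2" for N
  proof -
    have p0: "polm N H 0 = 0" using polm_0[OF z] N by simp
    have "agree_map 2 (\<eta> N) H" using \<eta> N by simp
    then have "coeff2 (fst (\<eta> N)) 1 0 = coeff2 (fst H) 1 0" "coeff2 (fst (\<eta> N)) 0 1 = coeff2 (fst H) 0 1"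
      "coeff2 (snd (\<eta> N)) 1 0 = coeff2 (snd H) 1 0" "coeff2 (snd (\<eta> N)) 0 1 = coeff2 (snd H) 0 1"
      by (auto simp: agree_map_def agree_def)
    then have "dx (\<lambda>z. fst (polm N H z)) 0 * dy (\<lambda>z. snd (polm N H z)) 0 - dy (\<lambda>z. fst (polm N H z)) 0 * dx (\<lambda>z. snd (polm N H z)) 0 \<noteq> 0"
      using assms by (simp add: formal_diffeo_def \<eta>_def taylor_map_def p0 coeff2_taylor2_10[symmetric] coeff2_taylor2_01[symmetric])
    then obtain U V where "representative (polm N H) U V"
      using ex_representative[of "polm N H" UNIV] p0 by auto
    from representative_taylor_map[OF this, of 0] this show ?thesis
      by (intro exI[of _ "taylor_map (inv_into U (polm N H)) 0"]) (auto simp: \<eta>_def p0 representative_def)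
  qed
  then obtain \<kappa> where \<kappa>: "\<And>N. N \<ge> 2 \<Longrightarrow> zc (\<kappa> N)" "\<And>N. N \<ge> 2 \<Longrightarrow> compose_map (\<eta> N) (\<kappa> N) = id_map"
    "\<And>N. N \<ge> 2 \<Longrightarrow> compose_map (\<kappa> N) (\<eta> N) = id_map" by metis
  have z\<eta>: "zc (\<eta> N)" for N by (simp add: \<eta>_def)
  \<comment> \<open>The composite of \<open>\<kappa> N\<close>, \<open>\<eta> N\<close> and
    \<open>\<kappa> M\<close> is exactly \<open>\<kappa> M\<close>. Since \<open>\<eta> N\<close>
    and \<open>\<eta> M\<close> agree below order N, it also agrees with \<open>\<kappa> N\<close>
    below that order.\<close>
  have stab: "agree_map N (\<kappa> M) (\<kappa> N)" if "N \<ge> 2" "M \<ge> N" for M N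
  proof -
    have M: "M \<ge> 2" using that by simp
    have "\<kappa> M = compose_map (\<kappa> N) (compose_map (\<eta> N) (\<kappa> M))"
      using compose_map_assoc[OF z\<eta>[of N] \<kappa>(1)[OF M], of "\<kappa> N"] \<kappa>(3)[OF that(1)] compose_map_id_left[OF \<kappa>(1)[OF M]] by simp
    moreover have "agree_map N (compose_map (\<kappa> N) (compose_map (\<eta> N) (\<kappa> M))) (compose_map (\<kappa> N) (compose_map (\<eta> M) (\<kappa> M)))"
      by (intro agree_compose_map agree_map_refl agree_map_trans[OF \<eta> agree_map_sym[OF \<eta>]]) (use that in auto)
    ultimately show ?thesis using \<kappa>(2)[OF M] by (simp add: compose_map_id_right)
  qed
  \<comment> \<open>The inverses are available for N \<ge> 2, where truncation retains the linear
    part; hence the offset 2 in the index from which a coefficient is read.\<close>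
  define K where "K = (Abs_fps (\<lambda>m. Abs_fps (\<lambda>n. coeff2 (fst (\<kappa> (m + n + 2))) m n)),
     Abs_fps (\<lambda>m. Abs_fps (\<lambda>n. coeff2 (snd (\<kappa> (m + n + 2))) m n)))"
  have K: "agree_map N K (\<kappa> N)" if "N \<ge> 2" for N
    unfolding agree_map_def agree_def
  proof (intro conjI allI impI)
    fix i j assume "i + j < N"
    then have "agree_map (Suc (i + j)) (\<kappa> (i + j + 2)) (\<kappa> N)"
      using agree_map_trans[OF agree_map_mono[OF agree_map_sym[OF stab[of "i + j + 2" "max N (i + j + 2)"]]]
          agree_map_mono[OF stab[of N "max N (i + j + 2)"]], of "Suc (i + j)"] that by simp
    then show "coeff2 (fst K) i j = coeff2 (fst (\<kappa> N)) i j" "coeff2 (snd K) i j = coeff2 (snd (\<kappa> N)) i j"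
      by (auto simp: K_def agree_map_def agree_def)
  qed
  have "compose_map H K = id_map"
  proof (rule agree_map_imp_eq)
    fix N
    have "agree_map (N + 2) (compose_map H K) (compose_map (\<eta> (N + 2)) (\<kappa> (N + 2)))"
      by (intro agree_compose_map agree_map_sym[OF \<eta>] K) auto
    then show "agree_map N (compose_map H K) id_map"
      using \<kappa>(2)[of "N + 2"] by (auto intro: agree_map_mono)
  qed
  moreover have "compose_map K H = id_map"
  proof (rule agree_map_imp_eq)
    fix N
    have "agree_map (N + 2) (compose_map K H) (compose_map (\<kappa> (N + 2)) (\<eta> (N + 2)))"
      by (intro agree_compose_map agree_map_sym[OF \<eta>] K) auto
    then show "agree_map N (compose_map K H) id_map"
      using \<kappa>(3)[of "N + 2"] by (auto intro: agree_map_mono)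
  qed
  moreover have "zc K" using K[of 2] \<kappa>(1)[of 2] by (simp add: agree_map_def agree_def zc_def)
  ultimately show ?thesis using formal_diffeo_left_inverse z by blast
qed

section \<open>Convergent series as holomorphic functions\<close>

lemma hol2_uniform_limit:
  assumes "open U" "\<And>n::nat. hol2 (f n) U" "uniform_limit U f g sequentially"
  shows "hol2 g U"
proof -
  have *: "\<exists>d>0. cball z d \<subseteq> S \<and> uniform_limit (cball z d) (\<lambda>n x. f n (h x)) (\<lambda>x. g (h x)) sequentially"
    if S: "open S" "z \<in> S" "\<And>x. x \<in> S \<Longrightarrow> h x \<in> U" for S :: "complex set" and z h
  proof -
    obtain d where d: "d > 0" "cball z d \<subseteq> S" by (meson open_contains_cball S(1,2))
    have "uniform_limit (cball z d) (\<lambda>n x. f n (h x)) (\<lambda>x. g (h x)) sequentially"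
    proof (rule uniform_limitI)
      fix e :: real assume "e > 0"
      from uniform_limitD[OF assms(3) this]
      show "\<forall>\<^sub>F n in sequentially. \<forall>x\<in>cball z d. dist (f n (h x)) (g (h x)) < e"
        by eventually_elim (use d S(3) in blast)
    qed
    with d show ?thesis by blast
  qed
  show ?thesis
  proof (rule osgood, unfold sephol_def, intro conjI allI assms(1))
    show "continuous_on U g"
      by (rule uniform_limit_theorem[OF _ assms(3)]) (use assms(2) hol2_continuous_on in auto)
    fix y
    show "(\<lambda>x. g (x, y)) holomorphic_on {x. (x, y) \<in> U}"
      by (rule holomorphic_uniform_sequence[where f = "\<lambda>n x. f n (x, y)", OF open_slice_x[OF assms(1)] hol2_slice_x[OF assms(2)]
          *[OF open_slice_x[OF assms(1)], of _ y "\<lambda>x. (x, y)"]]) auto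
  next
    fix x
    show "(\<lambda>y. g (x, y)) holomorphic_on {y. (x, y) \<in> U}"
      by (rule holomorphic_uniform_sequence[where f = "\<lambda>n y. f n (x, y)", OF open_slice_y[OF assms(1)] hol2_slice_y[OF assms(2)]
          *[OF open_slice_y[OF assms(1)], of _ x "\<lambda>y. (x, y)"]]) auto
  qed
qed

text \<open>Cauchy's estimate for the difference of G and \<open>pol N g\<close> compares any fixed
  coefficient, because the polynomial has the coefficient of g once N exceeds its degree.\<close>

lemma taylor2_eqI_uniform:
  assumes "hol2 G U" "0 \<in> U" "uniform_limit U (\<lambda>N. pol N g) G sequentially"
  shows "taylor2 G 0 = g"
proof (rule fps2_eqI)
  fix i j
  obtain r where r: "r > 0" "cball 0 r \<times> cball 0 r \<subseteq> U"
    using bidisc_in_open[OF hol2_open[OF assms(1)] assms(2)] by auto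
  note o = hol2_open[OF assms(1)]
  have "cmod (coeff2 (taylor2 G 0) i j - coeff2 g i j) \<le> e" if e: "e > 0" for e
  proof -
    have "\<forall>\<^sub>F N in sequentially. \<forall>z\<in>U. dist (pol N g z) (G z) < e * r ^ (i + j)"
      using uniform_limitD[OF assms(3)] e r by simp
    then obtain N0 where N0: "\<And>N z. N \<ge> N0 \<Longrightarrow> z \<in> U \<Longrightarrow> dist (pol N g z) (G z) < e * r ^ (i + j)"
      by (auto simp: eventually_sequentially)
    define N where "N = max N0 (Suc (i + j))"
    have N: "N > i + j" "\<And>z. z \<in> U \<Longrightarrow> dist (pol N g z) (G z) < e * r ^ (i + j)"
      using N0[of N] by (auto simp: N_def)
    have "cmod (coeff2 (taylor2 (\<lambda>z. G z - pol N g z) 0) i j) \<le> (e * r ^ (i + j)) / r ^ (i + j)"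
      by (rule taylor2_bound[OF hol2_diff[OF assms(1) hol2_pol[OF o]]])
        (use r N in \<open>auto simp: dist_norm norm_minus_commute less_imp_le subset_iff\<close>)
    then show ?thesis
      using N(1) r taylor2_pol[of N g] by (simp add: taylor2_diff[OF assms(1) hol2_pol[OF o] assms(2)] agree_def)
  qed
  then show "coeff2 (taylor2 G 0) i j = coeff2 g i j"
    using field_le_epsilon[of "cmod (coeff2 (taylor2 G 0) i j - coeff2 g i j)" 0] by simp
qed

text \<open>Summability at the single point (\<rho>, \<rho>) bounds all coefficients geometrically.
  At half that radius the homogeneous part of degree k is at most M (k + 1) / 2^k, so the
  polynomials \<open>pol N g\<close> converge uniformly.\<close>

lemma convergent2_hol2:
  assumes "convergent2 g"
  shows "\<exists>G r. r > 0 \<and> hol2 G (ball 0 r) \<and> taylor2 G 0 = g"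
proof -
  obtain r where r: "r > 0" "\<And>x y. cmod x < r \<Longrightarrow> cmod y < r \<Longrightarrow> (\<lambda>(i, j). coeff2 g i j * x ^ i * y ^ j) summable_on UNIV"
    using assms by (auto simp: convergent2_def)
  define \<rho> where "\<rho> = r / 2"
  have \<rho>: "\<rho> > 0" using r by (simp add: \<rho>_def)
  let ?t = "\<lambda>(i, j). coeff2 g i j * complex_of_real \<rho> ^ i * complex_of_real \<rho> ^ j"
  have "?t summable_on UNIV" using r(2)[of "of_real \<rho>" "of_real \<rho>"] r(1) by (simp add: \<rho>_def)
  then have ts: "(\<lambda>x. cmod (?t x)) summable_on UNIV" by (rule summable_on_iff_abs_summable_on_complex[THEN iffD1])
  define M where "M = infsum (\<lambda>x. cmod (?t x)) UNIV"
  have tb: "cmod (?t (i, j)) \<le> M" for i j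
    unfolding M_def
    using finite_sum_le_infsum[OF ts, of "{(i, j)}"] by simp
  have M: "M \<ge> 0" using tb[of 0 0] norm_ge_zero order_trans by blast
  have cb: "cmod (coeff2 g i j) \<le> M / \<rho> ^ (i + j)" for i j
    using tb[of i j] \<rho> by (simp add: norm_mult norm_power power_add field_simps)
  define Q where "Q k z = (\<Sum>i\<le>k. coeff2 g i (k - i) * (fst z ^ i * snd z ^ (k - i)))" for k z
  have pq: "pol N g = (\<lambda>z. \<Sum>k<N. Q k z)" for N
  proof
    fix z
    have "pol N g z = (\<Sum>(i,j)\<in>Sigma {..<N} (\<lambda>i. {..<N - i}). coeff2 g i j * (fst z ^ i * snd z ^ j))"
      by (simp add: pol_def sum.Sigma)
    also have "Sigma {..<N} (\<lambda>i. {..<N - i}) = {(i, j). i + j < N}" by auto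
    also have "(\<Sum>(i,j)\<in>{(i, j). i + j < N}. coeff2 g i j * (fst z ^ i * snd z ^ j)) = (\<Sum>k<N. Q k z)"
      unfolding Q_def by (rule sum.triangle_reindex)
    finally show "pol N g z = (\<Sum>k<N. Q k z)" .
  qed
  let ?U = "ball (0::complex2) (\<rho> / 2)"
  have Qb: "cmod (Q k z) \<le> M * (real (Suc k) * (1/2) ^ k)" if z: "z \<in> ?U" for k z
  proof -
    have z: "norm z \<le> \<rho> / 2" using z by simp
    have "cmod (Q k z) \<le> (\<Sum>i\<le>k. M / \<rho> ^ k * (\<rho> / 2) ^ k)"
      unfolding Q_def
    proof (rule order_trans[OF norm_sum], rule sum_mono)
      fix i assume i: "i \<in> {..k}"
      have "cmod (fst z ^ i * snd z ^ (k - i)) \<le> (\<rho> / 2) ^ i * (\<rho> / 2) ^ (k - i)"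
        unfolding norm_mult norm_power using norm_pair_bounds[of z] z \<rho>
        by (intro mult_mono power_mono) auto
      also have "\<dots> = (\<rho> / 2) ^ k" using i by (simp flip: power_add)
      finally have 1: "cmod (fst z ^ i * snd z ^ (k - i)) \<le> (\<rho> / 2) ^ k" .
      have "cmod (coeff2 g i (k - i)) \<le> M / \<rho> ^ k" using cb[of i "k - i"] i by simp
      then show "cmod (coeff2 g i (k - i) * (fst z ^ i * snd z ^ (k - i))) \<le> M / \<rho> ^ k * (\<rho> / 2) ^ k"
        unfolding norm_mult[of "coeff2 g i (k - i)"] using 1 M \<rho> by (intro mult_mono) auto
    qed
    also have "\<dots> = M * (real (Suc k) * (1/2) ^ k)" using \<rho> by (simp add: power_divide)
    finally show ?thesis .
  qed
  have "summable (\<lambda>k. M * (real (Suc k) * (1/2) ^ k))"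
  proof (intro summable_mult)
    have "summable (\<lambda>k. real (Suc k) * (1/2::real) ^ k)"
      using geometric_deriv_sums[of "1/2 :: real"] by (simp add: sums_iff)
    then show "summable (\<lambda>k. real (Suc k) * (1/2) ^ k)" .
  qed
  from Weierstrass_m_test[OF Qb this]
  have ul: "uniform_limit ?U (\<lambda>N z. \<Sum>k<N. Q k z) (\<lambda>z. suminf (\<lambda>k. Q k z)) sequentially" .
  then have ul: "uniform_limit ?U (\<lambda>N. pol N g) (\<lambda>z. suminf (\<lambda>k. Q k z)) sequentially" by (simp add: pq)
  have h: "hol2 (\<lambda>z. suminf (\<lambda>k. Q k z)) ?U"
    by (rule hol2_uniform_limit[OF _ _ ul]) auto
  from taylor2_eqI_uniform[OF h _ ul] h \<rho> show ?thesis
    by (intro exI[of _ "\<lambda>z. suminf (\<lambda>k. Q k z)"] exI[of _ "\<rho> / 2"]) auto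
qed

subsection \<open>Indifferent fixed points in one variable\<close>

definition stay :: "('a \<Rightarrow> 'a) \<Rightarrow> 'a set \<Rightarrow> nat \<Rightarrow> 'a set" where
  "stay f B n = {z. \<forall>k\<le>n. (f ^^ k) z \<in> B}"

lemma stay_0 [simp]: "stay f B 0 = B" by (simp add: stay_def)

lemma stay_Suc: "stay f B (Suc n) = {z \<in> stay f B n. (f ^^ Suc n) z \<in> B}"
  by (auto simp: stay_def le_Suc_eq)

lemma stay_antimono: "m \<le> n \<Longrightarrow> stay f B n \<subseteq> stay f B m"
  by (auto simp: stay_def)

lemma stay_holomorphic:
  assumes "f holomorphic_on U" "B \<subseteq> U" "open B"
  shows "open (stay f B n) \<and> (f ^^ Suc n) holomorphic_on stay f B n"
proof (induction n)
  case 0 show ?case using assms holomorphic_on_subset by (auto simp: comp_id)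
next
  case (Suc n)
  then have o: "open (stay f B n)" and h: "(f ^^ Suc n) holomorphic_on stay f B n" by blast+
  have o': "open (stay f B (Suc n))"
    unfolding stay_Suc
    using continuous_open_preimage[OF holomorphic_on_imp_continuous_on[OF h] o assms(3)]
    by (simp add: vimage_def Int_def)
  have "(f \<circ> (f ^^ Suc n)) holomorphic_on stay f B (Suc n)"
  proof (rule holomorphic_on_compose_gen[where t = U])
    show "(f ^^ Suc n) holomorphic_on stay f B (Suc n)"
      by (rule holomorphic_on_subset[OF h]) (simp add: stay_antimono)
    show "(f ^^ Suc n) ` stay f B (Suc n) \<subseteq> U"
      using assms(2) by (auto simp: stay_def simp del: funpow.simps)
  qed (rule assms(1))
  moreover have "f ^^ Suc (Suc n) = f \<circ> (f ^^ Suc n)" by (rule funpow.simps(2))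
  ultimately show ?case using o' by presburger
qed

lemma stay_holomorphic_le:
  assumes "f holomorphic_on U" "B \<subseteq> U" "open B" "k \<le> Suc n"
  shows "(f ^^ k) holomorphic_on stay f B n"
proof (cases k)
  case 0 then show ?thesis by (simp add: holomorphic_on_id)
next
  case (Suc j)
  then show ?thesis
    using stay_holomorphic[OF assms(1-3), of j] stay_antimono[of j n f B] assms(4) holomorphic_on_subset by auto
qed

lemma funpow_fixed: "f x = x \<Longrightarrow> (f ^^ n) x = x"
  by (induction n) auto

lemma deriv_funpow_fixed:
  assumes "f holomorphic_on U" "open U" "0 \<in> U" "f 0 = 0"
  shows "((f ^^ n) has_field_derivative deriv f 0 ^ n) (at 0)"
proof (induction n)
  case 0 show ?case using DERIV_ident by (simp add: id_def)
next
  case (Suc n)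
  have "(f has_field_derivative deriv f 0) (at ((f ^^ n) 0))"
    using assms funpow_fixed[of f 0] by (simp add: holomorphic_derivI)
  from DERIV_chain[OF this Suc] show ?case by (simp add: o_def)
qed

text \<open>The orbit repeats some value; injectivity cancels the common initial steps, so the
  starting point itself returns and is not merely eventually periodic.\<close>

lemma periodic_of_finite_orbit:
  assumes "inj_on f U" "\<And>k. (f ^^ k) z \<in> U" "finite (range (\<lambda>k. (f ^^ k) z))"
  shows "\<exists>n>0. (f ^^ n) z = z"
proof -
  have "\<not> inj (\<lambda>k. (f ^^ k) z)" using assms(3) finite_imageD infinite_UNIV_nat by blast
  then obtain a b where "a \<noteq> b" "(f ^^ a) z = (f ^^ b) z" by (auto simp: inj_def)
  then obtain i j where ij: "i < j" "(f ^^ i) z = (f ^^ j) z"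
    by (metis linorder_neqE_nat)
  have "(f ^^ (i - l)) z = (f ^^ (j - l)) z" if "l \<le> i" for l
    using that
  proof (induction l)
    case (Suc l)
    then have e: "Suc (i - Suc l) = i - l" "Suc (j - Suc l) = j - l" using ij(1) by auto
    have "f ((f ^^ (i - Suc l)) z) = f ((f ^^ (j - Suc l)) z)"
      using Suc e by (metis funpow.simps(2) o_apply Suc_leD)
    then show ?case using inj_onD[OF assms(1)] assms(2) by blast
  qed (use ij in auto)
  from this[of i] show ?thesis using ij by (intro exI[of _ "j - i"]) auto
qed

text \<open>All iterates map W into one bounded set, so Cauchy's estimate at the fixed point bounds
  all powers of the multiplier.\<close>

lemma bounded_away_iterates_contradiction:
  assumes h: "h holomorphic_on W" "open W" "0 \<in> W" "h 0 = 0" "h ` W \<subseteq> W" "W \<subseteq> ball 0 R" "cmod (deriv h 0) > 1"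
  shows False
proof -
  obtain r where r: "r > 0" "cball 0 r \<subseteq> W" using h(2,3) open_contains_cball by blast
  have hW: "(h ^^ k) z \<in> W" if "z \<in> W" for z k using that h(5) by (induction k) auto
  then have W: "stay h W n = W" for n using stay_antimono[of 0 n h W] by (auto simp: stay_def)
  have hol: "(h ^^ n) holomorphic_on W" for n
    using stay_holomorphic_le[OF h(1) order_refl h(2), of n n] W by auto
  have b: "cmod (deriv h 0) ^ n \<le> R / r" for n
  proof -
    have "cmod ((deriv ^^ 1) (h ^^ n) 0 / fact 1) \<le> R / r ^ 1"
    proof (rule cauchy_coeff_bound[OF hol h(2) r(2,1)])
      fix z :: complex assume "z \<in> cball 0 r"
      then have "(h ^^ n) z \<in> W" using r hW by blast
      then show "cmod ((h ^^ n) z) \<le> R" using h(6) by auto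
    qed
    then show ?thesis using DERIV_imp_deriv[OF deriv_funpow_fixed[OF h(1-4)], of n] by (simp add: norm_power)
  qed
  obtain n where "R / r < cmod (deriv h 0) ^ n" using h(7) real_arch_pow by blast
  with b[of n] show False by simp
qed

text \<open>If the component W of 0 had closure inside the open disc, every boundary point of W
  would leave the disc within N steps. This forces W \<subseteq> f(W), so the inverse branch g is a
  self-map of W, and the image of its N-th iterate is relatively compact in W. A slight dilation of
  that iterate is still a self-map, but has multiplier of modulus above 1, which is impossible for a
  bounded domain.\<close>

lemma stay_component_touches_sphere:
  assumes f: "f holomorphic_on U" "open U" "f 0 = 0" "inj_on f U" and R: "0 < R" "cball 0 R \<subseteq> U"
    and mu: "cmod (deriv f 0) = 1"
  shows "\<not> closure (connected_component_set (stay f (ball 0 R) N) 0) \<subseteq> ball 0 R"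
proof
  let ?B = "ball (0::complex) R"
  define A where "A = stay f ?B N"
  define W where "W = connected_component_set A 0"
  assume "closure (connected_component_set (stay f ?B N) 0) \<subseteq> ?B"
  then have cW: "closure W \<subseteq> ?B" by (simp add: W_def A_def)
  have BU: "?B \<subseteq> U" using R by (meson ball_subset_cball subset_trans)
  have U0: "0 \<in> U" using R by auto
  have oA: "open A" using stay_holomorphic[OF f(1) BU open_ball] by (simp add: A_def)
  have A0: "0 \<in> A" using R by (simp add: A_def stay_def funpow_fixed f(3))
  have W: "open W" "connected W" "0 \<in> W" "W \<subseteq> A"
    using oA A0 by (auto simp: W_def open_connected_component connected_component_subset)
  have WB: "W \<subseteq> ?B" using cW closure_subset by blast
  have compC: "compact (closure W)"
    using cW bounded_subset[OF bounded_ball] by (auto simp: compact_eq_bounded_closed)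
  \<comment> \<open>A boundary point that stayed for N steps would lie in the open set A, and a
    small disc around it would enlarge the component W.\<close>
  have exit: "\<exists>k. 0 < k \<and> k \<le> N \<and> (f ^^ k) p \<notin> ?B" if p: "p \<in> closure W" "p \<notin> W" for p
  proof (rule ccontr)
    assume "\<not> ?thesis"
    then have "(f ^^ k) p \<in> ?B" if "k \<le> N" for k using that p cW by (cases "k = 0") auto
    then have "p \<in> A" by (simp add: A_def stay_def)
    then obtain e where e: "e > 0" "ball p e \<subseteq> A" using oA open_contains_ball by blast
    obtain w where w: "w \<in> W" "w \<in> ball p e" using p(1) e(1) by (metis closure_approachable dist_commute mem_ball)
    have "connected (W \<union> ball p e)" using w W(2) by (intro connected_Un) auto
    then have "W \<union> ball p e \<subseteq> W"
      unfolding W_def using W e by (intro connected_component_maximal) (auto simp: W_def)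
    then show False using p(2) e(1) centre_in_ball by blast
  qed
  have contf: "continuous_on (closure W) f"
    using cW BU holomorphic_on_imp_continuous_on[OF f(1)] continuous_on_subset by blast
  have injW: "inj_on f W" using f(4) WB BU inj_on_subset by blast
  have holW: "f holomorphic_on W" using f(1) WB BU holomorphic_on_subset by blast
  have ofW: "open (f ` W)" by (rule open_mapping_thm3[OF holW W(1) injW])
  \<comment> \<open>Otherwise the connected set W meets the frontier of f(W) in a point q = f(p)
    with p on the boundary of W. If p is outside the disc at time k, then q is outside at time k - 1
    < N, although q lies in W.\<close>
  have Wf: "W \<subseteq> f ` W"
  proof (rule ccontr)
    assume "\<not> ?thesis"
    then have "W \<inter> frontier (f ` W) \<noteq> {}"
      using W(3) f(3) by (intro connected_Int_frontier W(2)) (force, blast)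
    then obtain q where q: "q \<in> W" "q \<in> closure (f ` W)" "q \<notin> f ` W"
      using ofW by (auto simp: frontier_def interior_open)
    have "closure (f ` W) \<subseteq> f ` closure W"
      by (intro closure_minimal image_mono closure_subset compact_imp_closed compact_continuous_image contf compC)
    then obtain p where p: "p \<in> closure W" "q = f p" using q by blast
    then obtain k where k: "0 < k" "k \<le> N" "(f ^^ k) p \<notin> ?B" using exit q by blast
    then have "(f ^^ (k - 1)) q \<notin> ?B" using p(2) by (cases k) (auto simp: funpow_swap1)
    moreover have "(f ^^ (k - 1)) q \<in> ?B" using q(1) W(4) k by (auto simp: A_def stay_def)
    ultimately show False by simp
  qed
  obtain g where g: "g holomorphic_on f ` W" "\<And>z. z \<in> W \<Longrightarrow> deriv f z * deriv g (f z) = 1" "\<And>z. z \<in> W \<Longrightarrow> g (f z) = z"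
    using holomorphic_has_inverse[OF holW W(1) injW] by metis
  have gW: "g w \<in> W \<and> f (g w) = w" if "w \<in> W" for w
    using that Wf g(3) by (metis imageE subsetD)
  have holg: "g holomorphic_on W" using g(1) Wf holomorphic_on_subset by blast
  have g0: "g 0 = 0" using g(3)[OF W(3)] f(3) by simp
  have dg: "cmod (deriv g 0) = 1"
    using g(2)[OF W(3)] f(3) mu by (metis norm_mult norm_one mult_1)
  have gk: "(g ^^ k) w \<in> W" if "w \<in> W" for w k using that gW by (induction k) auto
  have holgN: "(g ^^ k) holomorphic_on W" for k
  proof -
    have "stay g W k = W" using gk stay_antimono[of 0 k g W] by (auto simp: stay_def)
    then show ?thesis using stay_holomorphic_le[OF holg order_refl W(1), of k k] by simp
  qed
  have fg: "(f ^^ k) ((g ^^ N) w) = (g ^^ (N - k)) w" if "w \<in> W" "k \<le> N" for w k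
    using that(2)
  proof (induction k)
    case (Suc k)
    then have "(f ^^ Suc k) ((g ^^ N) w) = f ((g ^^ (N - k)) w)" by simp
    also have "N - k = Suc (N - Suc k)" using Suc by simp
    also have "f ((g ^^ Suc (N - Suc k)) w) = (g ^^ (N - Suc k)) w" using gW[OF gk[OF that(1)]] by simp
    finally show ?case .
  qed simp
  \<comment> \<open>A limit point of g^N(W) keeps its first N iterates in the closure of W, inside
    the disc. It is therefore not one of the boundary points that leave, and K is a compact subset
    of W.\<close>
  define K where "K = closure ((g ^^ N) ` W)"
  have K1: "K \<subseteq> closure W" unfolding K_def by (rule closure_mono) (use gk in auto)
  have K2: "\<forall>p\<in>K. (f ^^ k) p \<in> closure W" if "k \<le> N" for k
    using that
  proof (induction k)
    case 0 then show ?case using K1 by auto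
  next
    case (Suc k)
    show ?case
    proof
      fix p assume p: "p \<in> K"
      then obtain s where s: "\<And>n. s n \<in> (g ^^ N) ` W" "s \<longlonglongrightarrow> p" unfolding K_def closure_sequential by blast
      have fs: "(f ^^ j) (s n) \<in> W" if "j \<le> N" for j n
        using s(1)[of n] fg that gk by auto
      have "(\<lambda>n. (f ^^ j) (s n)) \<longlonglongrightarrow> (f ^^ j) p" if "j \<le> Suc k" for j
        using that
      proof (induction j)
        case (Suc j)
        then have 1: "(\<lambda>n. (f ^^ j) (s n)) \<longlonglongrightarrow> (f ^^ j) p" by simp
        have "(\<lambda>n. (f ^^ j) (s n)) \<longlonglongrightarrow> (f ^^ j) p \<and> (f ^^ j) p \<in> closure W"
          using 1 fs[of j] Suc.prems \<open>Suc k \<le> N\<close> unfolding closure_sequential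
          by (intro conjI exI[of _ "\<lambda>n. (f ^^ j) (s n)"]) auto
        then show ?case
          using continuous_on_tendsto_compose[OF contf, of "\<lambda>n. (f ^^ j) (s n)" "(f ^^ j) p" sequentially]
            fs[of j] Suc.prems \<open>Suc k \<le> N\<close> closure_subset[of W] by (auto simp: subset_iff)
      qed (use s in simp)
      from this[of "Suc k"] show "(f ^^ Suc k) p \<in> closure W"
        using fs[of "Suc k"] Suc.prems unfolding closure_sequential
        by (intro exI[of _ "\<lambda>n. (f ^^ Suc k) (s n)"]) (auto simp del: funpow.simps)
    qed
  qed
  have KW: "K \<subseteq> W"
  proof
    fix p assume p: "p \<in> K"
    show "p \<in> W"
    proof (rule ccontr)
      assume "p \<notin> W"
      then obtain k where "0 < k" "k \<le> N" "(f ^^ k) p \<notin> ?B" using exit p K1 by blast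
      then show False using K2[of k] p cW by blast
    qed
  qed
  have compK: "compact K"
    unfolding K_def compact_closure using gk WB by (meson bounded_ball bounded_subset image_subset_iff subset_trans)
  obtain e where e: "e > 0" "(\<Union>p\<in>K. ball p e) \<subseteq> W"
    using compact_subset_open_imp_ball_epsilon_subset[OF compK W(1) KW] by blast
  \<comment> \<open>Multiplication by 1 + \<delta> moves points of norm below R by less than e, the
    room left around K inside W.\<close>
  define \<delta> where "\<delta> = e / (2 * R)"
  have \<delta>: "\<delta> > 0" using e R by (simp add: \<delta>_def)
  define h where "h w = (1 + of_real \<delta>) * (g ^^ N) w" for w
  show False
  proof (rule bounded_away_iterates_contradiction[of h W R])
    show "h holomorphic_on W" unfolding h_def by (intro holomorphic_intros holgN)
    show "h 0 = 0" by (simp add: h_def funpow_fixed g0)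
    show "h ` W \<subseteq> W"
    proof
      fix z assume "z \<in> h ` W"
      then obtain w where w: "w \<in> W" "z = h w" by blast
      define v where "v = (g ^^ N) w"
      have v: "v \<in> K" "v \<in> W" using w gk closure_subset[of "(g ^^ N) ` W"] by (auto simp: v_def K_def)
      have "dist v z = \<delta> * cmod v" using \<delta> w by (simp add: h_def v_def[symmetric] dist_norm algebra_simps norm_mult)
      also have "\<dots> \<le> \<delta> * R" using v WB \<delta> by (intro mult_left_mono) auto
      also have "\<dots> < e" using R e by (simp add: \<delta>_def)
      finally have "z \<in> ball v e" by simp
      then show "z \<in> W" using v(1) e(2) by blast
    qed
    have "((\<lambda>w. (1 + of_real \<delta>) * (g ^^ N) w) has_field_derivative (1 + of_real \<delta>) * deriv g 0 ^ N) (at 0)"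
      by (intro DERIV_cmult deriv_funpow_fixed[OF holg W(1,3) g0])
    then have "deriv h 0 = (1 + of_real \<delta>) * deriv g 0 ^ N"
      unfolding h_def[abs_def] by (rule DERIV_imp_deriv)
    then have "cmod (deriv h 0) = cmod (1 + of_real \<delta>)" by (simp add: norm_mult norm_power dg)
    also have "\<dots> = 1 + \<delta>" using \<delta> by (metis norm_of_real of_real_1 of_real_add abs_of_pos add_pos_pos zero_less_one)
    finally show "cmod (deriv h 0) > 1" using \<delta> by simp
  qed (use W WB in auto)
qed

lemma open_imp_fsigma:
  fixes S :: "complex set"
  assumes "open S" shows "fsigma S"
proof (rule open_Union_compact_subsets[OF assms])
  fix C :: "nat \<Rightarrow> complex set"
  assume "\<And>n. compact (C n)" "\<Union> (range C) = S"
  then show ?thesis unfolding fsigma_Union_compact by (intro exI[of _ C]) auto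
qed

abbreviation infinite_orbit_in :: "('a \<Rightarrow> 'a) \<Rightarrow> 'a set \<Rightarrow> bool" where
  "infinite_orbit_in f S \<equiv> \<exists>p. (\<forall>n. (f ^^ n) p \<in> S) \<and> infinite (range (\<lambda>n. (f ^^ n) p))"

text \<open>The closures of the components that reach the sphere are nested, so they intersect in a
  continuum X from 0 to the sphere. The points of X with f^n(z) = z are countable in number because
  f^n - id has derivative \<open>deriv f 0 ^ n - 1\<close> \<noteq> 0 at 0.\<close>

theorem indifferent_fixed_point_infinite_orbit:
  assumes "f holomorphic_on U" "open U" "0 \<in> U" "f 0 = 0" "cmod (deriv f 0) = 1"
    "\<And>n. n > 0 \<Longrightarrow> deriv f 0 ^ n \<noteq> 1" "e > 0"
  shows "infinite_orbit_in f (ball 0 e)"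
proof -
  have "deriv f 0 \<noteq> 0" using assms(5) by auto
  then obtain r where r: "r > 0" "ball 0 r \<subseteq> U" "inj_on f (ball 0 r)"
    by (rule has_complex_derivative_locally_injective[OF assms(1,3,2)]) (rule that; assumption)
  define R where "R = min r e / 3"
  have R: "R > 0" "2 * R < r" "R < e" using r assms(7) by (auto simp: R_def)
  have holr: "f holomorphic_on ball 0 r" using assms(1) r holomorphic_on_subset by blast
  have cbr: "cball 0 R \<subseteq> ball (0::complex) r" "ball 0 (2*R) \<subseteq> ball (0::complex) r" using R by auto
  let ?B = "ball (0::complex) R" and ?B' = "ball (0::complex) (2 * R)"
  define W where "W n = connected_component_set (stay f ?B n) 0" for n
  have st0: "0 \<in> stay f ?B n" "0 \<in> stay f ?B' n" for n using R by (auto simp: stay_def funpow_fixed assms(4))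
  have W0: "0 \<in> W n" for n using st0 by (simp add: W_def)
  have Wsub: "W n \<subseteq> stay f ?B n" for n by (simp add: W_def connected_component_subset)
  have Wmono: "W n \<subseteq> W m" if "m \<le> n" for m n
    unfolding W_def by (rule connected_component_mono) (rule stay_antimono[OF that])
  have WB: "closure (W n) \<subseteq> cball 0 R" for n
    by (rule closure_minimal) (use Wsub[of n] stay_antimono[of 0 n f ?B] in auto)
  have touch: "closure (W n) \<inter> sphere 0 R \<noteq> {}" for n
  proof -
    have "\<not> closure (W n) \<subseteq> ?B"
      unfolding W_def by (rule stay_component_touches_sphere[OF holr open_ball assms(4) r(3) R(1) cbr(1) assms(5)])
    then show ?thesis using WB[of n] by force
  qed
  define X where "X = \<Inter> (range (\<lambda>n. closure (W n)))"
  have compW: "compact (closure (W n))" for n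
    using WB[of n] bounded_subset[OF bounded_cball] by (auto simp: compact_eq_bounded_closed)
  have "connected (W n)" for n by (simp add: W_def)
  then have connX: "connected X"
    unfolding X_def
    by (intro connected_nest[OF compW] connected_imp_connected_closure closure_mono Wmono)
  have X0: "0 \<in> X" using W0 closure_subset by (auto simp: X_def)
  have "\<Inter> (range (\<lambda>n. closure (W n) \<inter> sphere 0 R)) \<noteq> {}"
    by (rule compact_nest[OF compact_Int_closed[OF compW closed_sphere] touch]) (use closure_mono[OF Wmono] in auto)
  then obtain x where "x \<in> \<Inter> (range (\<lambda>n. closure (W n) \<inter> sphere 0 R))" by blast
  then have x: "x \<in> X" "x \<in> sphere 0 R" unfolding X_def by blast+
  have "uncountable X"
    by (rule connected_uncountable[OF connX X0 x(1)]) (use x R in auto)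
  have Xstay: "(f ^^ k) z \<in> cball 0 R" if z: "z \<in> X" for z k
  proof -
    have "z \<in> closure (W k)" using z by (auto simp: X_def)
    then obtain s where s: "\<And>n. s n \<in> W k" "s \<longlonglongrightarrow> z" unfolding closure_sequential by blast
    have fs: "(f ^^ j) (s n) \<in> ?B" if "j \<le> k" for j n using s(1)[of n] Wsub that by (auto simp: stay_def)
    have "(\<lambda>n. (f ^^ j) (s n)) \<longlonglongrightarrow> (f ^^ j) z \<and> (f ^^ j) z \<in> cball 0 R" if "j \<le> k" for j
      using that
    proof (induction j)
      case 0
      then show ?case using Lim_in_closed_set[OF closed_cball[of 0 R] _ sequentially_bot s(2)] s(2) fs[of 0] by (simp add: less_imp_le)
    next
      case (Suc j)
      then have 1: "(\<lambda>n. (f ^^ j) (s n)) \<longlonglongrightarrow> (f ^^ j) z" "(f ^^ j) z \<in> cball 0 R" by auto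
      have "isCont f ((f ^^ j) z)"
        using 1(2) cbr(1) holomorphic_on_imp_continuous_on[OF holr]
        by (auto simp: continuous_on_eq_continuous_at)
      from isCont_tendsto_compose[OF this 1(1)] have 2: "(\<lambda>n. (f ^^ Suc j) (s n)) \<longlonglongrightarrow> (f ^^ Suc j) z" by simp
      have "(f ^^ Suc j) (s n) \<in> cball 0 R" for n using fs[OF Suc.prems, of n] by (simp add: less_imp_le del: funpow.simps)
      with 2 show ?case
        using Lim_in_closed_set[OF closed_cball[of 0 R] _ sequentially_bot 2] by (simp del: funpow.simps)
    qed
    then show ?thesis by blast
  qed
  show ?thesis
  proof (rule ccontr)
    assume no: "\<not> ?thesis"
    have fin: "finite (range (\<lambda>n. (f ^^ n) z))" if "z \<in> X" for z
    proof -
      have "(f ^^ n) z \<in> ball 0 e" for n using Xstay[OF that, of n] R(3) by simp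
      with no show ?thesis by blast
    qed
    have per: "\<exists>n>0. (f ^^ n) z = z" if "z \<in> X" for z
      by (rule periodic_of_finite_orbit[OF r(3) _ fin[OF that]]) (use Xstay[OF that] cbr(1) in blast)
    \<comment> \<open>Orbits of X may touch the sphere of radius R, outside the open disc that
      defines the components W. The doubled disc gives an open connected set that contains X and on
      which f^n is holomorphic.\<close>
    define V where "V n = connected_component_set (stay f ?B' n) 0" for n
    have oV: "open (V n)" for n
      using stay_holomorphic[OF holr cbr(2) open_ball] by (auto simp: V_def open_connected_component)
    have XV: "X \<subseteq> V n" for n
      unfolding V_def
    proof (rule connected_component_maximal[OF X0 connX])
      show "X \<subseteq> stay f ?B' n"
      proof
        fix z assume "z \<in> X"
        have "(f ^^ k) z \<in> ?B'" for k
          using Xstay[OF \<open>z \<in> X\<close>, of k] R(1) by simp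
        then show "z \<in> stay f ?B' n" by (simp add: stay_def)
      qed
    qed
    have cnt: "countable {z \<in> V n. (f ^^ n) z - z = 0}" if n: "n > 0" for n
    proof (rule holomorphic_countable_zeros)
      have "(f ^^ n) holomorphic_on V n"
        by (rule holomorphic_on_subset[OF stay_holomorphic_le[OF holr cbr(2) open_ball, of n n]])
          (auto simp: V_def connected_component_subset)
      then show hol: "(\<lambda>z. (f ^^ n) z - z) holomorphic_on V n" by (intro holomorphic_intros)
      show "open (V n)" by (rule oV)
      show "connected (V n)" by (simp add: V_def)
      show "fsigma (V n)" by (rule open_imp_fsigma) (rule oV)
      show "\<not> (\<lambda>z. (f ^^ n) z - z) constant_on V n"
      proof
        assume "(\<lambda>z. (f ^^ n) z - z) constant_on V n"
        then obtain c where c: "\<And>z. z \<in> V n \<Longrightarrow> (f ^^ n) z - z = c" by (auto simp: constant_on_def)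
        have "((\<lambda>z. (f ^^ n) z - z) has_field_derivative deriv f 0 ^ n - 1) (at 0)"
          by (intro DERIV_diff deriv_funpow_fixed[OF assms(1-4)] DERIV_ident)
        moreover have "((\<lambda>z. (f ^^ n) z - z) has_field_derivative 0) (at 0)"
          by (rule has_field_derivative_transform_within_open[OF DERIV_const[of c] oV[of n]])
            (use c XV X0 in auto)
        ultimately have "deriv f 0 ^ n - 1 = 0" by (rule DERIV_unique)
        with assms(6)[OF n] show False by simp
      qed
    qed
    have "X \<subseteq> (\<Union>n\<in>{0<..}. {z \<in> V n. (f ^^ n) z - z = 0})"
    proof
      fix z assume z: "z \<in> X"
      then obtain n where n: "n > 0" "(f ^^ n) z = z" using per by blast
      have "z \<in> V n" using z XV by blast
      then show "z \<in> (\<Union>n\<in>{0<..}. {z \<in> V n. (f ^^ n) z - z = 0})" using n by auto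
    qed
    moreover have "countable (\<Union>n\<in>{0<..}. {z \<in> V n. (f ^^ n) z - z = 0})"
      by (intro countable_UN cnt) auto
    ultimately show False using \<open>uncountable X\<close> countable_subset by blast
  qed
qed

subsection \<open>The Bruno condition\<close>

text \<open>A superadditive majorant of the number of elements of \<open>A\<close> up to \<open>n\<close> if these are spaced by at
  least \<open>m\<close> (Davie).\<close>

definition davie :: "nat set \<Rightarrow> nat \<Rightarrow> nat \<Rightarrow> real" where
  "davie A m n = Max (insert 0 (insert (2 * real n / real m - 2) ((\<lambda>a. 2 * real a / real m - 1) ` {a \<in> A. a \<le> n})))"

lemma davie_le_iff:
  "davie A m n \<le> c \<longleftrightarrow> 0 \<le> c \<and> 2 * real n / real m - 2 \<le> c \<and> (\<forall>a\<in>A. a \<le> n \<longrightarrow> 2 * real a / real m - 1 \<le> c)"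
  unfolding davie_def by (subst Max_le_iff) auto

lemma davie_ge: "0 \<le> davie A m n" "2 * real n / real m - 2 \<le> davie A m n"
  "a \<in> A \<Longrightarrow> a \<le> n \<Longrightarrow> 2 * real a / real m - 1 \<le> davie A m n"
  unfolding davie_def by (rule Max_ge; auto)+

lemma davie_mono: "a \<le> b \<Longrightarrow> davie A m a \<le> davie A m b"
proof -
  assume ab: "a \<le> b"
  have "2 * real a / real m - 2 \<le> 2 * real b / real m - 2" using ab by (simp add: divide_right_mono)
  then show ?thesis
    unfolding davie_le_iff[of A m a] using davie_ge(1,2)[where A = A and n = b and m = m] davie_ge(3)[where A = A and n = b and m = m] ab by (meson order_trans)
qed

lemma davie_upper: assumes "m > 0" shows "davie A m n \<le> 2 * real n / real m"
proof -
  have "2 * real a / real m - 1 \<le> 2 * real n / real m" if "a \<le> n" for a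
  proof -
    have "2 * real a / real m \<le> 2 * real n / real m" using that by (simp add: divide_right_mono)
    then show ?thesis by linarith
  qed
  then show ?thesis by (simp add: davie_le_iff)
qed

text \<open>A nonzero value is at most 2 n / m - 1. Two nonzero values thus add up to at most 2 (a +
  b) / m - 2, an entry of the maximum at a + b; if one value is 0, monotonicity suffices.\<close>

lemma davie_superadd:
  assumes "m > 0" shows "davie A m a + davie A m b \<le> davie A m (a + b)"
proof (cases "davie A m a = 0 \<or> davie A m b = 0")
  case True then show ?thesis using davie_mono[of a "a + b" A m] davie_mono[of b "a + b" A m] by auto
next
  case False
  have *: "davie A m n \<le> 2 * real n / real m - 1" if n: "davie A m n \<noteq> 0" for n
  proof -
    have "\<not> davie A m n \<le> 0" using n davie_ge(1)[where A = A and n = n and m = m] by linarith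
    then have "\<not> 2 * real n / real m - 2 \<le> 0 \<or> (\<exists>a\<in>A. a \<le> n \<and> \<not> 2 * real a / real m - 1 \<le> 0)"
      by (auto simp: davie_le_iff)
    moreover have le: "2 * real a / real m \<le> 2 * real n / real m" if "a \<le> n" for a
      using that by (simp add: divide_right_mono)
    ultimately have "2 * real n / real m - 1 \<ge> 0" by fastforce
    then show ?thesis unfolding davie_le_iff using le by auto
  qed
  have "davie A m a + davie A m b \<le> 2 * real (a + b) / real m - 2"
    using *[of a] *[of b] False by (simp add: add_divide_distrib)
  also have "\<dots> \<le> davie A m (a + b)" by (rule davie_ge)
  finally show ?thesis .
qed

text \<open>At a point n of A the value is at least 2 n / m - 1. Just before, it is at most 2 n / m
  - 2, because n exceeds m and earlier elements of A lie more than m below n.\<close>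

lemma davie_step:
  assumes "m > 0" "\<And>a. a \<in> A \<Longrightarrow> m < a" "\<And>a b. a \<in> A \<Longrightarrow> b \<in> A \<Longrightarrow> a < b \<Longrightarrow> m < b - a" "n > 0"
  shows "davie A m (n - 1) + (if n \<in> A then 1 else 0) \<le> davie A m n"
proof (cases "n \<in> A")
  case True
  have up: "2 * real n / real m - 1 \<le> davie A m n" by (rule davie_ge) (use True in auto)
  have "davie A m (n - 1) \<le> 2 * real n / real m - 2"
    unfolding davie_le_iff
  proof (intro conjI ballI impI)
    show "0 \<le> 2 * real n / real m - 2" using assms(2)[OF True] assms(1) by (simp add: field_simps)
    show "2 * real (n - 1) / real m - 2 \<le> 2 * real n / real m - 2" by (simp add: divide_right_mono)
    fix a assume a: "a \<in> A" "a \<le> n - 1"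
    then have "m < n - a" using assms(3)[OF a(1) True] assms(4) by simp
    then have "real a + real m \<le> real n" by linarith
    then have "2 * (real a + real m) / real m \<le> 2 * real n / real m" by (intro divide_right_mono) auto
    moreover have "2 * (real a + real m) / real m = 2 * real a / real m + 2" using assms(1) by (simp add: field_simps)
    ultimately show "2 * real a / real m - 1 \<le> 2 * real n / real m - 2" by linarith
  qed
  with up True show ?thesis by simp
qed (use davie_mono[of "n - 1" n A m] in simp)

lemma davie_eq_0:
  assumes "m > 0" "\<And>a. a \<in> A \<Longrightarrow> m < a" "n \<le> m" shows "davie A m n = 0"
proof -
  have "davie A m n \<le> 0" unfolding davie_le_iff using assms by (force simp: field_simps)
  then show ?thesis using davie_ge(1)[where A = A and n = n and m = m] by simp
qed

text \<open>The divisors in \<open>Omega\<close> are \<lambda>^k - \<lambda> = \<lambda>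
  (\<lambda>^(k - 1) - 1); dropping the unimodular factor lowers the index by one.\<close>

definition omega :: "complex \<Rightarrow> nat \<Rightarrow> real" where
  "omega lam m = Min ((\<lambda>n. cmod (lam ^ n - 1)) ` {1..m})"

lemma omega_le: "1 \<le> n \<Longrightarrow> n \<le> m \<Longrightarrow> omega lam m \<le> cmod (lam ^ n - 1)"
  unfolding omega_def by (intro Min_le) auto

lemma omega_pos: assumes "m > 0" "\<And>n. n > 0 \<Longrightarrow> lam ^ n \<noteq> 1" shows "omega lam m > 0"
  unfolding omega_def using assms by (subst Min_gr_iff) auto

lemma omega_le_2: assumes "cmod lam = 1" "m > 0" shows "omega lam m \<le> 2"
proof -
  have "omega lam m \<le> cmod (lam ^ 1 - 1)" using assms by (intro omega_le) auto
  also have "\<dots> \<le> cmod lam + cmod 1" using norm_triangle_ineq4[of lam 1] by simp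
  finally show ?thesis using assms by simp
qed

lemma Omega_eq_omega:
  assumes "cmod lam = 1" "m \<ge> 2" shows "Omega lam m = omega lam (m - 1)"
proof -
  have "(\<lambda>k. cmod (lam ^ k - lam)) ` {2..m} = (\<lambda>n. cmod (lam ^ n - 1)) ` {1..m - 1}"
  proof -
    have "cmod (lam ^ Suc n - lam) = cmod (lam ^ n - 1)" for n
    proof -
      have "lam ^ Suc n - lam = lam * (lam ^ n - 1)" by (simp add: algebra_simps)
      then show ?thesis using assms by (simp add: norm_mult)
    qed
    then have "(\<lambda>n. cmod (lam ^ n - 1)) ` {1..m - 1} = (\<lambda>k. cmod (lam ^ k - lam)) ` Suc ` {1..m - 1}"
      unfolding image_image by (metis (no_types, lifting) image_cong)
    also have "Suc ` {1..m - 1} = {2..m}" using assms(2) by (simp add: image_Suc_atLeastAtMost numeral_2_eq_2)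
    finally show ?thesis by simp
  qed
  then show ?thesis by (simp add: Omega_def omega_def)
qed

text \<open>Two powers are close by compactness of the circle, and division by the smaller one
  preserves distances.\<close>

lemma unit_powers_return:
  assumes "cmod lam = 1" "e > 0"
  shows "\<exists>n>0. cmod (lam ^ n - 1) < e"
proof -
  have "bounded (range (\<lambda>n. lam ^ n))" using assms by (auto simp: bounded_iff norm_power intro!: exI[of _ 1])
  then obtain l r where r: "strict_mono (r :: nat \<Rightarrow> nat)" "((\<lambda>n. lam ^ n) \<circ> r) \<longlonglongrightarrow> l"
    using bounded_imp_convergent_subsequence by blast
  then have "Cauchy ((\<lambda>n. lam ^ n) \<circ> r)" by (simp add: LIMSEQ_imp_Cauchy)
  then obtain N where N: "\<And>m n. m \<ge> N \<Longrightarrow> n \<ge> N \<Longrightarrow> dist (lam ^ r m) (lam ^ r n) < e"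
    using assms(2) unfolding Cauchy_def o_def by blast
  have lt: "r N < r (Suc N)" using r(1) by (simp add: strict_mono_def)
  have "lam ^ r (Suc N) - lam ^ r N = lam ^ r N * (lam ^ (r (Suc N) - r N) - 1)"
    using lt by (simp add: algebra_simps flip: power_add)
  then have "cmod (lam ^ (r (Suc N) - r N) - 1) = cmod (lam ^ r (Suc N) - lam ^ r N)"
    using assms(1) by (simp add: norm_mult norm_power)
  also have "\<dots> < e" using N[of "Suc N" N] by (simp add: dist_norm)
  finally show ?thesis using lt by (intro exI[of _ "r (Suc N) - r N"]) auto
qed

text \<open>From N on the partial sums increase, and the limit S < \<infinity> lets a real number
  bound them.\<close>

lemma summable_of_ereal_sums:
  fixes f :: "nat \<Rightarrow> real"
  assumes "(\<lambda>n. ereal (f n)) sums S" "S < \<infinity>" "\<And>n. n \<ge> N \<Longrightarrow> f n \<ge> 0"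
  shows "summable f"
proof -
  obtain B where B: "S < ereal B"
    using assms(2) by (metis ereal_dense2)
  have "(\<lambda>n. ereal (\<Sum>i<n. f i)) \<longlonglongrightarrow> S" using assms(1) by (simp add: sums_def)
  from order_tendstoD(2)[OF this B] obtain M where M: "\<And>n. n \<ge> M \<Longrightarrow> (\<Sum>i<n. f i) < B"
    by (auto simp: eventually_sequentially)
  have "summable (\<lambda>n. f (n + N))"
  proof (rule summableI_nonneg_bounded)
    fix n
    have split: "(\<Sum>i<k + N. f i) = (\<Sum>i<N. f i) + (\<Sum>i<k. f (i + N))" for k
      by (induction k) (auto simp: algebra_simps)
    have "(\<Sum>i<n. f (i + N)) \<le> (\<Sum>i<n + M. f (i + N))"
      by (rule sum_mono2) (use assms(3) in auto)
    also have "\<dots> = (\<Sum>i<n + M + N. f i) - (\<Sum>i<N. f i)" using split[of "n + M"] by simp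
    also have "\<dots> \<le> B - (\<Sum>i<N. f i)" using M[of "n + M + N"] by simp
    finally show "(\<Sum>i<n. f (i + N)) \<le> B - (\<Sum>i<N. f i)" .
  qed (use assms(3) in auto)
  then show ?thesis by (simp add: summable_iff_shift)
qed

text \<open>A normalisation that makes every term nonnegative: q - 1 replaces q, and 2 / omega
  replaces 1 / omega. Once omega is below 1/2, the added ln 2 is at most ln (1 / omega), and q \<le>
  2 (q - 1), so the new terms are eventually at most 4 times the old ones.\<close>

lemma Bruno_summable:
  assumes "Bruno lam" "\<And>n. n > 0 \<Longrightarrow> lam ^ n \<noteq> 1"
  shows "cmod lam = 1 \<and> (\<exists>q :: nat \<Rightarrow> nat. 0 < q 0 \<and> strict_mono q \<and>
    summable (\<lambda>k. ln (2 / omega lam (q (Suc k))) / real (q k)))"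
proof -
  have lam: "cmod lam = 1" using assms by (simp add: Bruno_def)
  obtain q :: "nat \<Rightarrow> nat" and S where q: "1 < q 0" "strict_mono q"
    "(\<lambda>k. ereal (1 / real (q k)) * log_inverse (Omega lam (q (Suc k)))) sums S" "S < \<infinity>"
    using assms(1) by (auto simp: Bruno_def)
  have q2: "q k \<ge> 2" for k using q(1) strict_mono_less_eq[OF q(2), of 0 k] by simp
  define p where "p k = q k - 1" for k
  have p: "0 < p 0" "strict_mono p" using q(1,2) q2 by (auto simp: p_def strict_mono_def intro!: diff_less_mono Suc_leD[OF q2[unfolded numeral_2_eq_2]])
  have p0: "p k > 0" for k using q2[of k] by (simp add: p_def)
  have pk: "p k \<ge> Suc k" for k
  proof (induction k)
    case (Suc k) then show ?case using strict_monoD[OF p(2), of k "Suc k"] by simp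
  qed (use p in simp)
  define w where "w k = omega lam (p (Suc k))" for k
  have w: "Omega lam (q (Suc k)) = w k" for k by (simp add: w_def p_def Omega_eq_omega[OF lam q2])
  have wpos: "w k > 0" for k unfolding w_def by (rule omega_pos[OF p0 assms(2)])
  obtain n0 where n0: "n0 > 0" "cmod (lam ^ n0 - 1) < 1/2" using unit_powers_return[OF lam, of "1/2"] by auto
  have wsmall: "w k < 1/2" if "k \<ge> n0" for k
  proof -
    have "w k \<le> cmod (lam ^ n0 - 1)" unfolding w_def using n0 pk[of "Suc k"] that by (intro omega_le) auto
    then show ?thesis using n0 by simp
  qed
  have "(\<lambda>k. ereal (ln (1 / w k) / real (q k))) sums S"
    using q(3) wpos by (simp add: w log_inverse_def less_imp_neq[THEN not_sym] mult.commute)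
  then have s1: "summable (\<lambda>k. ln (1 / w k) / real (q k))"
  proof (rule summable_of_ereal_sums[where N = n0, OF _ q(4)])
    fix k assume "n0 \<le> k"
    then have "1 \<le> 1 / w k" using wsmall[of k] wpos[of k] by (simp add: field_simps)
    then show "0 \<le> ln (1 / w k) / real (q k)" by (intro divide_nonneg_nonneg ln_ge_zero) auto
  qed
  have "summable (\<lambda>k. ln (2 / w k) / real (p k))"
  proof (rule summable_comparison_test)
    show "summable (\<lambda>k. 4 * (ln (1 / w k) / real (q k)))" by (rule summable_mult[OF s1])
    show "\<exists>N. \<forall>n\<ge>N. norm (ln (2 / w n) / real (p n)) \<le> 4 * (ln (1 / w n) / real (q n))"
    proof (intro exI[of _ n0] allI impI)
      fix k assume k: "n0 \<le> k"
      have l: "ln (2 / w k) = ln 2 + ln (1 / w k)" using wpos[of k] by (simp add: ln_div)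
      have "ln 2 \<le> ln (1 / w k)" using wsmall[OF k] wpos[of k] by (subst ln_le_cancel_iff) (auto simp: field_simps)
      then have 1: "ln (2 / w k) \<le> 2 * ln (1 / w k)" "ln (1 / w k) \<ge> 0" "ln (2 / w k) \<ge> 0"
        using l ln_gt_zero[of "2::real"] by linarith+
      have 2: "real (q k) \<le> 2 * real (p k)" using q2[of k] by (simp add: p_def of_nat_diff)
      have "ln (2 / w k) / real (p k) \<le> (2 * ln (1 / w k)) / (real (q k) / 2)"
        using 1 2 p0[of k] q2[of k] by (intro frac_le) auto
      then show "norm (ln (2 / w k) / real (p k)) \<le> 4 * (ln (1 / w k) / real (q k))" using 1 by simp
    qed
  qed
  then show ?thesis using lam p by (auto simp: w_def)
qed

text \<open>K n dominates the logarithm of the products of small divisors that a recursion can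
  accumulate up to degree n. The set A k collects the n whose divisor is below half of
  \<open>omega lam (q k)\<close>; such n are more than q k apart, so \<open>davie\<close> counts
  them superadditively, each at the price c k. Since the count is at most 2 n / q k, the total cost
  is n times the Bruno series, which gives linear growth.\<close>

theorem Bruno_weight:
  assumes "Bruno lam" "\<And>n. n > 0 \<Longrightarrow> lam ^ n \<noteq> 1"
  obtains K :: "nat \<Rightarrow> real" and C where "K 0 = 0" "\<And>n. 0 \<le> K n" "\<And>a b. K a + K b \<le> K (a + b)"
    "\<And>n. n > 0 \<Longrightarrow> K (n - 1) + ln (1 / cmod (lam ^ n - 1)) \<le> K n" "\<And>n. K n \<le> C * real n"
proof -
  obtain q :: "nat \<Rightarrow> nat" where lam: "cmod lam = 1" and q: "0 < q 0" "strict_mono q"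
    "summable (\<lambda>k. ln (2 / omega lam (q (Suc k))) / real (q k))"
    using Bruno_summable[OF assms] by blast
  have qk: "q k \<ge> Suc k" for k
  proof (induction k)
    case (Suc k) then show ?case using strict_monoD[OF q(2), of k "Suc k"] by simp
  qed (use q in simp)
  have q0: "q k > 0" for k using qk[of k] by simp
  define A where "A k = {n. 0 < n \<and> cmod (lam ^ n - 1) < omega lam (q k) / 2}" for k
  define c0 where "c0 = ln (2 / omega lam (q 0))"
  define c where "c k = ln (2 / omega lam (q (Suc k)))" for k
  have wpos: "omega lam (q k) > 0" for k by (rule omega_pos[OF q0 assms(2)])
  have cpos: "ln (2 / omega lam (q k)) \<ge> 0" for k
    using wpos[of k] omega_le_2[OF lam q0[of k]] by simp
  have c: "c k \<ge> 0" "c0 \<ge> 0" for k using cpos by (auto simp: c_def c0_def)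
  have A1: "q k < a" if "a \<in> A k" for a k
  proof (rule ccontr)
    assume "\<not> q k < a"
    then have "omega lam (q k) \<le> cmod (lam ^ a - 1)" using that by (intro omega_le) (auto simp: A_def)
    then show False using that wpos[of k] by (auto simp: A_def)
  qed
  \<comment> \<open>Two very small divisors at a and b produce one at b - a that is below
    \<open>omega lam (q k)\<close>, which is possible only beyond q k.\<close>
  have A2: "q k < b - a" if "a \<in> A k" "b \<in> A k" "a < b" for a b k
  proof (rule ccontr)
    assume "\<not> q k < b - a"
    then have 1: "omega lam (q k) \<le> cmod (lam ^ (b - a) - 1)" using that by (intro omega_le) auto
    have "lam ^ b - lam ^ a = lam ^ a * (lam ^ (b - a) - 1)"
      using that by (simp add: algebra_simps flip: power_add)
    then have "cmod (lam ^ (b - a) - 1) = cmod ((lam ^ b - 1) - (lam ^ a - 1))"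
      using lam by (simp add: norm_mult norm_power)
    also have "\<dots> \<le> cmod (lam ^ b - 1) + cmod (lam ^ a - 1)" by (rule norm_triangle_ineq4)
    also have "\<dots> < omega lam (q k)" using that by (auto simp: A_def)
    finally show False using 1 by simp
  qed
  define g where "g k n = davie (A k) (q k) n" for k n
  have g0: "g k n = 0" if "n \<le> k" for k n
    unfolding g_def using qk[of k] that by (intro davie_eq_0 q0 A1) auto
  \<comment> \<open>Truncation at k < n loses nothing, as g k n = 0 for n \<le> k; the cut-off can
    therefore be raised to a common bound when different n are compared.\<close>
  define K where "K n = c0 * real n + (\<Sum>k<n. c k * g k n)" for n
  have Kext: "K n = c0 * real n + (\<Sum>k<L. c k * g k n)" if "n \<le> L" for n L
    unfolding K_def using that g0 by (intro arg_cong2[where f = "(+)"] refl sum.mono_neutral_left) auto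
  have gp: "g k n \<ge> 0" for k n unfolding g_def by (rule davie_ge)
  show thesis
  proof (rule that[of K "c0 + 2 * (\<Sum>k. c k / real (q k))"])
    show "K 0 = 0" by (simp add: K_def)
    show "0 \<le> K n" for n unfolding K_def using c gp by (intro add_nonneg_nonneg sum_nonneg mult_nonneg_nonneg) auto
    show "K a + K b \<le> K (a + b)" for a b
    proof -
      have "K a + K b = c0 * real (a + b) + (\<Sum>k<a + b. c k * (g k a + g k b))"
        using Kext[of a "a + b"] Kext[of b "a + b"] by (simp add: algebra_simps sum.distrib)
      also have "\<dots> \<le> c0 * real (a + b) + (\<Sum>k<a + b. c k * g k (a + b))"
        unfolding g_def using c by (intro add_mono order_refl sum_mono mult_left_mono davie_superadd q0) auto
      finally show ?thesis by (simp add: K_def)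
    qed
    show "K (n - 1) + ln (1 / cmod (lam ^ n - 1)) \<le> K n" if n: "n > 0" for n
    proof -
      have np: "cmod (lam ^ n - 1) > 0" using assms(2)[OF n] by simp
      have lnle: "ln (1 / cmod (lam ^ n - 1)) \<le> ln (2 / omega lam (q k))" if "n \<notin> A k" for k
      proof -
        have "omega lam (q k) / 2 \<le> cmod (lam ^ n - 1)" using that n by (auto simp: A_def)
        then show ?thesis using wpos[of k] np by (subst ln_le_cancel_iff) (auto simp: field_simps)
      qed
      have l: "ln (1 / cmod (lam ^ n - 1)) \<le> c0 + (\<Sum>k<n. c k * (if n \<in> A k then 1 else 0))"
      proof (cases "n \<in> A 0")
        case False
        then have "ln (1 / cmod (lam ^ n - 1)) \<le> c0" using lnle by (simp add: c0_def)
        also have "\<dots> \<le> c0 + (\<Sum>k<n. c k * (if n \<in> A k then 1 else 0))"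
          using c by (simp add: sum_nonneg)
        finally show ?thesis .
      next
        case True
        have bd: "k < n" if "n \<in> A k" for k using A1[OF that] qk[of k] by simp
        \<comment> \<open>The last level containing n: the divisor is at least half of the next
          omega, so the single price c k pays for it.\<close>
        define k where "k = Max {k. n \<in> A k}"
        have fin: "finite {k. n \<in> A k}" by (rule finite_subset[of _ "{..<n}"]) (use bd in auto)
        have kA: "n \<in> A k" using Max_in[OF fin] True unfolding k_def by blast
        have "n \<notin> A (Suc k)" using Max_ge[OF fin, of "Suc k"] unfolding k_def[symmetric] by auto
        then have "ln (1 / cmod (lam ^ n - 1)) \<le> c k" using lnle by (simp add: c_def)
        also have "\<dots> = c k * (if n \<in> A k then 1 else 0)" using kA by simp
        also have "\<dots> \<le> (\<Sum>k<n. c k * (if n \<in> A k then 1 else 0))"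
          using bd[OF kA] c by (intro member_le_sum) auto
        finally show ?thesis using c by linarith
      qed
      have "K (n - 1) + ln (1 / cmod (lam ^ n - 1)) \<le>
        c0 * real (n - 1) + (\<Sum>k<n. c k * g k (n - 1)) + (c0 + (\<Sum>k<n. c k * (if n \<in> A k then 1 else 0)))"
        using l Kext[of "n - 1" n] by simp
      also have "\<dots> = c0 * real n + (\<Sum>k<n. c k * (g k (n - 1) + (if n \<in> A k then 1 else 0)))"
        using n by (simp add: algebra_simps sum.distrib of_nat_diff)
      also have "\<dots> \<le> c0 * real n + (\<Sum>k<n. c k * g k n)"
        unfolding g_def using c n by (intro add_mono order_refl sum_mono mult_left_mono davie_step q0 A1 A2) auto
      finally show ?thesis by (simp add: K_def)
    qed
    show "K n \<le> (c0 + 2 * (\<Sum>k. c k / real (q k))) * real n" for n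
    proof -
      have "(\<Sum>k<n. c k * g k n) \<le> (\<Sum>k<n. c k * (2 * real n / real (q k)))"
        unfolding g_def using c by (intro sum_mono mult_left_mono davie_upper q0) auto
      also have "\<dots> = 2 * real n * (\<Sum>k<n. c k / real (q k))"
        by (simp add: sum_distrib_left mult_ac)
      also have "\<dots> \<le> 2 * real n * (\<Sum>k. c k / real (q k))"
        using q(3) c unfolding c_def[symmetric] by (intro mult_left_mono sum_le_suminf) auto
      finally show ?thesis unfolding K_def by (simp add: algebra_simps)
    qed
  qed
qed

text \<open>The substitution \<open>c(u(t), v(t))\<close>, for \<open>u\<close> and \<open>v\<close> without constant term.\<close>

definition sub :: "fps2 \<Rightarrow> complex fps \<Rightarrow> complex fps \<Rightarrow> complex fps" where
  "sub c u v = Abs_fps (\<lambda>m. \<Sum>i\<le>m. \<Sum>j\<le>m - i. coeff2 c i j * fps_nth (u ^ i * v ^ j) m)"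

text \<open>A series in t viewed as a series in the first of two variables, so that one-variable
  substitution becomes the part of \<open>compose2\<close> with second exponent 0.\<close>

definition emb :: "complex fps \<Rightarrow> fps2" where
  "emb u = Abs_fps (\<lambda>i. fps_const (fps_nth u i))"

lemma coeff2_emb: "coeff2 (emb u) i j = (if j = 0 then fps_nth u i else 0)"
  by (simp add: emb_def)

lemma emb_mult: "emb (u * v) = emb u * emb v"
proof (rule fps2_eqI)
  fix i j
  show "coeff2 (emb (u * v)) i j = coeff2 (emb u * emb v) i j"
    unfolding coeff2_mult
    by (cases "j = 0") (auto simp: coeff2_emb fps_mult_nth intro!: sum.neutral sym[OF sum.neutral])
qed

lemma emb_1: "emb 1 = 1"
  by (rule fps2_eqI) (auto simp: coeff2_emb)

lemma emb_power: "emb (u ^ n) = emb u ^ n"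
  by (induction n) (auto simp: emb_1 emb_mult)

lemma coeff2_compose2_emb: "coeff2 (compose2 c (emb u, emb v)) m 0 = fps_nth (sub c u v) m"
  by (simp add: compose2_def sub_def coeff2_emb flip: emb_mult emb_power)

text \<open>Functions of t are read as functions of the first of two variables, where
  \<open>taylor2_compose0\<close> identifies the coefficients.\<close>

lemma has_fps_expansion_sub:
  assumes c: "hol2 c V" "0 \<in> V" and g: "g1 has_fps_expansion u" "g2 has_fps_expansion v"
    and 0: "fps_nth u 0 = 0" "fps_nth v 0 = 0"
  shows "(\<lambda>t. c (g1 t, g2 t)) has_fps_expansion sub (taylor2 c 0) u v"
proof -
  obtain S1 where S1: "open S1" "0 \<in> S1" "g1 holomorphic_on S1" by (rule has_fps_expansion_imp_holomorphic[OF g(1)])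
  obtain S2 where S2: "open S2" "0 \<in> S2" "g2 holomorphic_on S2" by (rule has_fps_expansion_imp_holomorphic[OF g(2)])
  define S where "S = S1 \<inter> S2"
  have S: "open S" "0 \<in> S" "g1 holomorphic_on S" "g2 holomorphic_on S"
    using S1 S2 by (auto simp: S_def intro: holomorphic_on_subset)
  have v0: "g1 0 = 0" "g2 0 = 0"
    using g 0 by (auto simp: has_fps_expansion_imp_0_eq_fps_nth_0)
  define U where "U = S \<times> (UNIV :: complex set)"
  have U: "open U" "0 \<in> U" using S by (auto simp: U_def open_Times zero_prod_def)
  have h: "hol2 (\<lambda>z. g1 (fst z)) U" "hol2 (\<lambda>z. g2 (fst z)) U"
    using U by (auto intro!: hol2_compose_hol[OF hol2_fst S(3) S(1)] hol2_compose_hol[OF hol2_fst S(4) S(1)] simp: U_def)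
  have t: "taylor2 (\<lambda>z. g (fst z)) 0 = emb w" if "g has_fps_expansion w" for g w
  proof -
    have "(dy ^^ j) (\<lambda>z. g (fst z)) = (\<lambda>z. if j = 0 then g (fst z) else 0)" for j
      by (rule ext) (simp add: iter_dy)
    then show ?thesis
      by (intro fps2_eqI) (auto simp: taylor2_nth iter_dx coeff2_emb fps_nth_fps_expansion[OF that])
  qed
  have "taylor2 (\<lambda>z. c (g1 (fst z), g2 (fst z))) 0 = compose2 (taylor2 c 0) (emb u, emb v)"
    using taylor2_compose0[OF c(1) h U(2) _ _ c(2)] v0 by (simp add: t[OF g(1)] t[OF g(2)])
  from arg_cong[OF this, of "\<lambda>f. coeff2 f m 0" for m]
  have e: "(deriv ^^ m) (\<lambda>t. c (g1 t, g2 t)) 0 / fact m = fps_nth (sub (taylor2 c 0) u v) m" for m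
    by (simp add: coeff2_compose2_emb taylor2_nth iter_dx)
  have oW: "open {t \<in> S. (g1 t, g2 t) \<in> V}"
  proof -
    have "continuous_on S (\<lambda>t. (g1 t, g2 t))"
      using S by (intro continuous_intros holomorphic_on_imp_continuous_on)
    from continuous_open_preimage[OF this S(1) hol2_open[OF c(1)]] show ?thesis by (simp add: vimage_def Int_def)
  qed
  have "(\<lambda>t. c (g1 t, g2 t)) holomorphic_on {t \<in> S. (g1 t, g2 t) \<in> V}"
    by (rule hol_compose_hol2[OF c(1) _ _ oW]) (use S in \<open>auto intro: holomorphic_on_subset\<close>)
  then have "(\<lambda>t. c (g1 t, g2 t)) has_fps_expansion fps_expansion (\<lambda>t. c (g1 t, g2 t)) 0"
    using oW S(2) v0 c(2) by (intro has_fps_expansion_fps_expansion[OF oW]) (auto simp: zero_prod_def)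
  moreover have "fps_expansion (\<lambda>t. c (g1 t, g2 t)) 0 = sub (taylor2 c 0) u v"
    by (rule fps_ext) (simp add: fps_expansion_def e)
  ultimately show ?thesis by simp
qed

text \<open>Degree n is included, unlike in \<open>agree\<close>: one step of the recursion computes
  coefficient n + 1 from those up to n.\<close>

definition eqto :: "nat \<Rightarrow> complex fps \<Rightarrow> complex fps \<Rightarrow> bool" where
  "eqto n u v \<longleftrightarrow> (\<forall>k\<le>n. fps_nth u k = fps_nth v k)"

lemma eqto_mult: "eqto n u u' \<Longrightarrow> eqto n v v' \<Longrightarrow> eqto n (u * v) (u' * v')"
  by (auto simp: eqto_def fps_mult_nth intro!: sum.cong)

lemma eqto_power: "eqto n u u' \<Longrightarrow> eqto n (u ^ k) (u' ^ k)"
  by (induction k) (auto intro: eqto_mult, simp add: eqto_def)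

lemma eqto_refl [simp]: "eqto n u u" by (simp add: eqto_def)

lemma eqto_sub: assumes "eqto n u u'" "eqto n v v'" shows "eqto n (sub c u v) (sub c u' v')"
proof -
  have "eqto n (u ^ i * v ^ j) (u' ^ i * v' ^ j)" for i j
    using assms by (intro eqto_mult eqto_power)
  then show ?thesis by (auto simp: eqto_def sub_def)
qed

text \<open>Multiplicative weights \<open>exp (- K k)\<close> with \<open>K\<close> superadditive make this a submultiplicative
  seminorm.\<close>

definition wnorm :: "(nat \<Rightarrow> real) \<Rightarrow> real \<Rightarrow> nat \<Rightarrow> complex fps \<Rightarrow> real" where
  "wnorm K \<tau> n u = (\<Sum>k\<le>n. cmod (fps_nth u k) * exp (- K k) * \<tau> ^ k)"

lemma wnorm_nonneg: "\<tau> \<ge> 0 \<Longrightarrow> wnorm K \<tau> n u \<ge> 0"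
  unfolding wnorm_def by (intro sum_nonneg) auto

lemma wnorm_mult:
  assumes "\<And>a b. K a + K b \<le> K (a + b)" "\<tau> \<ge> 0"
  shows "wnorm K \<tau> n (u * v) \<le> wnorm K \<tau> n u * wnorm K \<tau> n v"
proof -
  let ?f = "\<lambda>u k. cmod (fps_nth u k) * exp (- K k) * \<tau> ^ k"
  have "wnorm K \<tau> n (u * v) \<le> (\<Sum>k\<le>n. \<Sum>i\<le>k. ?f u i * ?f v (k - i))"
    unfolding wnorm_def
  proof (rule sum_mono)
    fix k assume "k \<in> {..n}"
    have "cmod (fps_nth (u * v) k) * exp (- K k) * \<tau> ^ k \<le> (\<Sum>i\<le>k. cmod (fps_nth u i) * cmod (fps_nth v (k - i))) * exp (- K k) * \<tau> ^ k"
      unfolding fps_mult_nth atLeast0AtMost using assms(2)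
      by (intro mult_right_mono order_trans[OF norm_sum] sum_mono) (auto simp: norm_mult)
    also have "\<dots> = (\<Sum>i\<le>k. cmod (fps_nth u i) * cmod (fps_nth v (k - i)) * \<tau> ^ k * exp (- K k))"
      by (simp add: sum_distrib_left mult_ac)
    also have "\<dots> \<le> (\<Sum>i\<le>k. cmod (fps_nth u i) * cmod (fps_nth v (k - i)) * \<tau> ^ k * (exp (- K i) * exp (- K (k - i))))"
    proof (intro sum_mono mult_left_mono)
      fix i assume "i \<in> {..k}"
      then have "K i + K (k - i) \<le> K k" using assms(1)[of i "k - i"] by simp
      then show "exp (- K k) \<le> exp (- K i) * exp (- K (k - i))" by (simp flip: exp_add)
    qed (use assms in auto)
    also have "\<dots> = (\<Sum>i\<le>k. ?f u i * ?f v (k - i))"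
      by (intro sum.cong refl) (auto simp: mult_ac simp flip: power_add)
    finally show "cmod (fps_nth (u * v) k) * exp (- K k) * \<tau> ^ k \<le> (\<Sum>i\<le>k. ?f u i * ?f v (k - i))" .
  qed
  also have "\<dots> = (\<Sum>(i,j)\<in>{(i,j). i + j \<le> n}. ?f u i * ?f v j)"
    by (rule sum.triangle_reindex_eq[symmetric])
  also have "\<dots> \<le> (\<Sum>(i,j)\<in>{..n} \<times> {..n}. ?f u i * ?f v j)"
    by (rule sum_mono2) (use assms in auto)
  also have "\<dots> = wnorm K \<tau> n u * wnorm K \<tau> n v"
    by (simp add: wnorm_def sum_product sum.cartesian_product)
  finally show ?thesis .
qed

lemma wnorm_1: "K 0 = 0 \<Longrightarrow> wnorm K \<tau> n 1 = 1"
proof -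
  assume "K 0 = 0"
  have "wnorm K \<tau> n 1 = (\<Sum>k\<le>n. if k = 0 then exp (- K k) else 0)"
    unfolding wnorm_def by (intro sum.cong) auto
  then show ?thesis using \<open>K 0 = 0\<close> by simp
qed

lemma wnorm_power:
  assumes "\<And>a b. K a + K b \<le> K (a + b)" "\<tau> \<ge> 0" "K 0 = 0"
  shows "wnorm K \<tau> n (u ^ i) \<le> wnorm K \<tau> n u ^ i"
proof (induction i)
  case (Suc i)
  have "wnorm K \<tau> n (u * u ^ i) \<le> wnorm K \<tau> n u * wnorm K \<tau> n (u ^ i)" by (rule wnorm_mult[OF assms(1,2)])
  also have "\<dots> \<le> wnorm K \<tau> n u * wnorm K \<tau> n u ^ i" using Suc assms(2) by (intro mult_left_mono wnorm_nonneg)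
  finally show ?case by simp
qed (simp add: wnorm_1 assms)

lemma wnorm_X_mult:
  assumes "\<And>a b. K a + K b \<le> K (a + b)" "\<tau> \<ge> 0" "\<And>n. K n \<ge> 0"
  shows "wnorm K \<tau> n (fps_X * u) \<le> \<tau> * wnorm K \<tau> n u"
proof -
  have "wnorm K \<tau> n (fps_X * u) \<le> wnorm K \<tau> n fps_X * wnorm K \<tau> n u" by (rule wnorm_mult[OF assms(1,2)])
  also have "wnorm K \<tau> n fps_X \<le> \<tau>"
  proof -
    have "wnorm K \<tau> n fps_X = (\<Sum>k\<le>n. if k = 1 then exp (- K k) * \<tau> else 0)"
      unfolding wnorm_def by (intro sum.cong) (auto simp: fps_X_def)
    also have "\<dots> \<le> exp (- K 1) * \<tau>" using assms(2) by (simp add: sum.delta)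
    also have "\<dots> \<le> 1 * \<tau>" using assms by (intro mult_right_mono) auto
    finally show ?thesis by simp
  qed
  finally show ?thesis using wnorm_nonneg[OF assms(2)] by (simp add: mult_right_mono)
qed

text \<open>For arguments of norm at most 1 / (2 s), the term (i, j) has norm at most B / 2^(i + j),
  so the double sum is at most B times the square of a geometric series with sum 2.\<close>

lemma wnorm_sub:
  assumes K: "\<And>a b. K a + K b \<le> K (a + b)" "\<tau> \<ge> 0" "K 0 = 0"
    and c: "\<And>i j. cmod (coeff2 c i j) \<le> B * s ^ (i + j)" "B \<ge> 0" "s > 0"
    and uv: "wnorm K \<tau> n u * s \<le> 1 / 2" "wnorm K \<tau> n v * s \<le> 1 / 2"
  shows "wnorm K \<tau> n (sub c u v) \<le> 4 * B"
proof -
  let ?P = "\<lambda>i j. fps_nth (u ^ i * v ^ j)"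
  have "wnorm K \<tau> n (sub c u v) \<le> (\<Sum>m\<le>n. \<Sum>i\<le>n. \<Sum>j\<le>n. cmod (coeff2 c i j) * (cmod (?P i j m) * exp (- K m) * \<tau> ^ m))"
    unfolding wnorm_def
  proof (rule sum_mono)
    fix m assume m: "m \<in> {..n}"
    have "cmod (fps_nth (sub c u v) m) \<le> (\<Sum>i\<le>m. \<Sum>j\<le>m - i. cmod (coeff2 c i j) * cmod (?P i j m))"
      unfolding sub_def fps_nth_Abs_fps
      by (intro order_trans[OF norm_sum] sum_mono) (simp add: norm_mult)
    also have "\<dots> \<le> (\<Sum>i\<le>m. \<Sum>j\<le>n. cmod (coeff2 c i j) * cmod (?P i j m))"
      using m by (intro sum_mono sum_mono2) auto
    also have "\<dots> \<le> (\<Sum>i\<le>n. \<Sum>j\<le>n. cmod (coeff2 c i j) * cmod (?P i j m))"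
      using m by (intro sum_mono2 sum_nonneg) auto
    finally have "cmod (fps_nth (sub c u v) m) * (exp (- K m) * \<tau> ^ m) \<le> (\<Sum>i\<le>n. \<Sum>j\<le>n. cmod (coeff2 c i j) * cmod (?P i j m)) * (exp (- K m) * \<tau> ^ m)"
      using K(2) by (intro mult_right_mono) auto
    then show "cmod (fps_nth (sub c u v) m) * exp (- K m) * \<tau> ^ m \<le> (\<Sum>i\<le>n. \<Sum>j\<le>n. cmod (coeff2 c i j) * (cmod (?P i j m) * exp (- K m) * \<tau> ^ m))"
      by (simp add: sum_distrib_left mult_ac)
  qed
  also have "\<dots> = (\<Sum>i\<le>n. \<Sum>j\<le>n. cmod (coeff2 c i j) * wnorm K \<tau> n (u ^ i * v ^ j))"
    unfolding wnorm_def sum_distrib_left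
    by (rule trans[OF sum.swap]) (intro sum.cong refl sum.swap)
  also have "\<dots> \<le> (\<Sum>i\<le>n. \<Sum>j\<le>n. B * ((1/2) ^ i * (1/2) ^ j))"
  proof (intro sum_mono)
    fix i j
    have "wnorm K \<tau> n (u ^ i * v ^ j) \<le> wnorm K \<tau> n (u ^ i) * wnorm K \<tau> n (v ^ j)"
      by (rule wnorm_mult[OF K(1,2)])
    also have "\<dots> \<le> wnorm K \<tau> n u ^ i * wnorm K \<tau> n v ^ j"
      by (intro mult_mono wnorm_power K wnorm_nonneg zero_le_power)
    finally have 1: "wnorm K \<tau> n (u ^ i * v ^ j) \<le> wnorm K \<tau> n u ^ i * wnorm K \<tau> n v ^ j" .
    have "cmod (coeff2 c i j) * wnorm K \<tau> n (u ^ i * v ^ j) \<le> (B * s ^ (i + j)) * (wnorm K \<tau> n u ^ i * wnorm K \<tau> n v ^ j)"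
      by (intro mult_mono 1 c wnorm_nonneg K mult_nonneg_nonneg zero_le_power) (use c in auto)
    also have "\<dots> = B * ((wnorm K \<tau> n u * s) ^ i * (wnorm K \<tau> n v * s) ^ j)"
      by (simp add: power_mult_distrib power_add mult_ac)
    also have "\<dots> \<le> B * ((1/2) ^ i * (1/2) ^ j)"
      using uv c wnorm_nonneg[OF K(2)] by (intro mult_left_mono mult_mono power_mono) auto
    finally show "cmod (coeff2 c i j) * wnorm K \<tau> n (u ^ i * v ^ j) \<le> B * ((1/2) ^ i * (1/2) ^ j)" .
  qed
  also have "\<dots> = B * ((\<Sum>i\<le>n. (1/2) ^ i) * (\<Sum>j\<le>n. (1/2) ^ j))"
    unfolding sum_product by (simp add: sum_distrib_left)
  also have "\<dots> \<le> B * (2 * 2)"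
  proof -
    have "(\<Sum>i\<le>n. (1/2::real) ^ i) = 2 - (1/2) ^ n" by (induction n) auto
    then have "(\<Sum>i\<le>n. (1/2::real) ^ i) \<le> 2" by simp
    then show ?thesis using c by (intro mult_left_mono mult_mono sum_nonneg) auto
  qed
  finally show ?thesis by simp
qed

lemma wnorm_Suc_shift:
  "wnorm K \<tau> (Suc n) u = cmod (fps_nth u 0) * exp (- K 0) + (\<Sum>k\<le>n. cmod (fps_nth u (Suc k)) * exp (- K (Suc k)) * \<tau> ^ Suc k)"
  unfolding wnorm_def by (subst sum.atMost_Suc_shift) simp

text \<open>The operators are causal: coefficients up to n of their values depend only on
  coefficients up to n of the arguments. The equations thus determine one further coefficient at a
  time; \<open>W n\<close> is correct up to degree n, and \<open>ext\<close> appends the next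
  coefficient.\<close>

lemma causal_recursion:
  assumes "\<And>n u u' v v'. eqto n u u' \<Longrightarrow> eqto n v v' \<Longrightarrow> eqto n (R1 u v) (R1 u' v')"
    "\<And>n u u' v v'. eqto n u u' \<Longrightarrow> eqto n v v' \<Longrightarrow> eqto n (R2 u v) (R2 u' v')"
  shows "\<exists>u v. fps_nth u 0 = a \<and> fps_nth v 0 = b \<and>
    (\<forall>n. fps_nth u (Suc n) = fps_nth (R1 u v) n / d n \<and> fps_nth v (Suc n) = fps_nth (R2 u v) n / d n)"
proof -
  define ext where "ext n w c = Abs_fps (\<lambda>k. if k \<le> n then fps_nth w k else c)" for n w and c :: complex
  define W where "W = rec_nat (fps_const a, fps_const b)
    (\<lambda>n w. (ext n (fst w) (fps_nth (R1 (fst w) (snd w)) n / d n), ext n (snd w) (fps_nth (R2 (fst w) (snd w)) n / d n)))"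
  have W0: "W 0 = (fps_const a, fps_const b)"
    and WS: "W (Suc n) = (ext n (fst (W n)) (fps_nth (R1 (fst (W n)) (snd (W n))) n / d n),
       ext n (snd (W n)) (fps_nth (R2 (fst (W n)) (snd (W n))) n / d n))" for n
    by (simp_all add: W_def)
  have st: "fps_nth (fst (W n)) k = fps_nth (fst (W k)) k \<and> fps_nth (snd (W n)) k = fps_nth (snd (W k)) k" if "k \<le> n" for k n
    using that
  proof (induction n)
    case (Suc n)
    then show ?case by (cases "k = Suc n") (auto simp: WS ext_def)
  qed simp
  define u v where "u = Abs_fps (\<lambda>n. fps_nth (fst (W n)) n)" and "v = Abs_fps (\<lambda>n. fps_nth (snd (W n)) n)"
  have e: "eqto n (fst (W n)) u" "eqto n (snd (W n)) v" for n
    unfolding eqto_def u_def v_def fps_nth_Abs_fps using st by blast+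
  have "fps_nth u (Suc n) = fps_nth (R1 u v) n / d n \<and> fps_nth v (Suc n) = fps_nth (R2 u v) n / d n" for n
    using assms(1)[OF e, of n] assms(2)[OF e, of n] by (simp add: u_def v_def WS ext_def eqto_def)
  then show ?thesis by (intro exI[of _ u] exI[of _ v]) (auto simp: u_def v_def W0)
qed

lemma fps_conv_radius_pos:
  assumes "\<And>n. cmod (fps_nth u n) \<le> A * B ^ n"
  shows "fps_conv_radius u > 0"
proof -
  define z where "z = 1 / (2 * (\<bar>B\<bar> + 1))"
  have z: "z > 0" "\<bar>B\<bar> * z \<le> 1/2" by (auto simp: z_def field_simps)
  have A: "A \<ge> 0" using order_trans[OF norm_ge_zero assms[of 0]] by simp
  have "summable (\<lambda>n. fps_nth u n * complex_of_real z ^ n)"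
  proof (rule summable_comparison_test)
    show "summable (\<lambda>n. A * (1/2) ^ n)" by (intro summable_mult summable_geometric) auto
    show "\<exists>N. \<forall>n\<ge>N. norm (fps_nth u n * complex_of_real z ^ n) \<le> A * (1/2) ^ n"
    proof (intro exI[of _ 0] allI impI)
      fix n
      have "norm (fps_nth u n * complex_of_real z ^ n) \<le> (A * B ^ n) * z ^ n"
        using assms[of n] z by (simp add: norm_mult norm_power mult_right_mono)
      also have "\<dots> \<le> (A * \<bar>B\<bar> ^ n) * z ^ n"
        using z A by (intro mult_right_mono mult_left_mono) (auto simp flip: power_abs)
      also have "\<dots> = A * (\<bar>B\<bar> * z) ^ n" by (simp add: power_mult_distrib)
      also have "\<dots> \<le> A * (1/2) ^ n" using z A by (intro mult_left_mono power_mono) auto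
      finally show "norm (fps_nth u n * complex_of_real z ^ n) \<le> A * (1/2) ^ n" .
    qed
  qed
  from conv_radius_geI[OF this] z(1) have "ereal z \<le> fps_conv_radius u"
    by (simp add: fps_conv_radius_def)
  moreover have "0 < ereal z" using z(1) by simp
  ultimately show ?thesis by (rule less_le_trans[rotated])
qed

text \<open>Comparing coefficients of t^(n + 1) puts the divisor \<lambda>^(n + 1) - 1 in front of
  coefficient n + 1 of the unknowns, against coefficient n of the factors of t. In the weighted norm
  the step property of K cancels this divisor, and the factor t leaves a factor \<tau> that keeps
  the norms bounded.\<close>

theorem Bruno_curve:
  assumes lam: "Bruno lam" "\<And>n. n > 0 \<Longrightarrow> lam ^ n \<noteq> 1"
    and a: "hol2 a V" and b: "hol2 b V" and V0: "0 \<in> V"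
  shows "\<exists>\<xi> \<eta> r. r > 0 \<and> \<xi> holomorphic_on ball 0 r \<and> \<eta> holomorphic_on ball 0 r \<and> \<xi> 0 = 1 \<and> \<eta> 0 = 0 \<and>
    (\<forall>t\<in>ball 0 r. \<xi> (lam * t) - \<xi> t = t * (\<xi> t ^ 2 * a (t * \<xi> t, \<eta> t)) \<and>
       \<eta> (lam * t) - \<eta> t = t * (\<xi> t * b (t * \<xi> t, \<eta> t)))"
proof -
  obtain K C where K: "K 0 = 0" "\<And>n. 0 \<le> K n" "\<And>a b. K a + K b \<le> K (a + b)"
    "\<And>n. n > 0 \<Longrightarrow> K (n - 1) + ln (1 / cmod (lam ^ n - 1)) \<le> K n" "\<And>n. K n \<le> C * real n"
    by (rule Bruno_weight[OF lam], assumption) (rule that; assumption)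
  obtain \<rho> M where a1: "\<rho> > 0" "M > 0" "cball 0 \<rho> \<times> cball 0 \<rho> \<subseteq> V"
    "\<And>x y. x \<in> cball 0 \<rho> \<Longrightarrow> y \<in> cball 0 \<rho> \<Longrightarrow> cmod (a (x, y)) \<le> M"
    by (rule hol2_bidisc[OF a V0, unfolded zero_prod_def fst_conv snd_conv]) (rule that; assumption)
  obtain \<rho>' M' where b1: "\<rho>' > 0" "M' > 0" "cball 0 \<rho>' \<times> cball 0 \<rho>' \<subseteq> V"
    "\<And>x y. x \<in> cball 0 \<rho>' \<Longrightarrow> y \<in> cball 0 \<rho>' \<Longrightarrow> cmod (b (x, y)) \<le> M'"
    by (rule hol2_bidisc[OF b V0, unfolded zero_prod_def fst_conv snd_conv]) (rule that; assumption)
  define s B where "s = max (1 / \<rho>) (1 / \<rho>')" and "B = max M M'"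
  have s: "s > 0" "1 / \<rho> \<le> s" "1 / \<rho>' \<le> s" and B: "B > 0" "M \<le> B" "M' \<le> B"
    using a1 b1 by (auto simp: s_def B_def less_max_iff_disj)
  define ca cb where "ca = taylor2 a 0" and "cb = taylor2 b 0"
  have ca: "cmod (coeff2 ca i j) \<le> B * s ^ (i + j)" for i j
  proof -
    have "cmod (coeff2 ca i j) \<le> M * (1 / \<rho>) ^ (i + j)"
      using taylor2_bound[OF a, of 0 \<rho> M i j] a1 by (simp add: ca_def power_one_over field_simps)
    also have "\<dots> \<le> B * s ^ (i + j)" using a1 s B by (intro mult_mono power_mono) auto
    finally show ?thesis .
  qed
  have cb: "cmod (coeff2 cb i j) \<le> B * s ^ (i + j)" for i j
  proof -
    have "cmod (coeff2 cb i j) \<le> M' * (1 / \<rho>') ^ (i + j)"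
      using taylor2_bound[OF b, of 0 \<rho>' M' i j] b1 by (simp add: cb_def power_one_over field_simps)
    also have "\<dots> \<le> B * s ^ (i + j)" using b1 s B by (intro mult_mono power_mono) auto
    finally show ?thesis .
  qed
  define R1 R2 where "R1 u v = u ^ 2 * sub ca (fps_X * u) v" and "R2 u v = u * sub cb (fps_X * u) v" for u v
  define d where "d n = lam ^ Suc n - 1" for n
  obtain u v where uv0: "fps_nth u 0 = 1" "fps_nth v 0 = 0"
    and uv: "\<And>n. fps_nth u (Suc n) = fps_nth (R1 u v) n / d n" "\<And>n. fps_nth v (Suc n) = fps_nth (R2 u v) n / d n"
    using causal_recursion[of R1 R2 1 0 d]
    by (auto simp: R1_def R2_def eqto_mult eqto_power eqto_sub)
  have d0: "d n \<noteq> 0" for n using lam(2)[of "Suc n"] by (simp add: d_def)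
  \<comment> \<open>For norms of u and v at most 2 and 1 / (2 s), the three entries reproduce these
    bounds: t u has norm at most 1 / (2 s), R1 has norm at most 16 B and adds at most 1 to the
    constant term 1 of u, and R2 has norm at most 8 B, which gives 1 / (2 s) for v.\<close>
  define \<tau> where "\<tau> = Min {1 / (4 * s), 1 / (16 * B), 1 / (16 * B * s)}"
  have \<tau>: "\<tau> > 0" "\<tau> \<le> 1 / (4 * s)" "\<tau> \<le> 1 / (16 * B)" "\<tau> \<le> 1 / (16 * B * s)" using s B by (auto simp: \<tau>_def)
  let ?N = "wnorm K \<tau>"
  have step: "?N (Suc n) w \<le> cmod (fps_nth w 0) + \<tau> * ?N n R"
    if w: "\<And>n. fps_nth w (Suc n) = fps_nth R n / d n" for w R n
  proof -
    have "cmod (fps_nth w (Suc k)) * exp (- K (Suc k)) * \<tau> ^ Suc k \<le> \<tau> * (cmod (fps_nth R k) * exp (- K k) * \<tau> ^ k)" for k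
    proof -
      have "K k + ln (1 / cmod (d k)) \<le> K (Suc k)" using K(4)[of "Suc k"] by (simp add: d_def)
      then have "exp (- K (Suc k)) \<le> exp (- K k + ln (cmod (d k)))" using d0[of k] by (simp add: ln_div)
      also have "\<dots> = exp (- K k) * cmod (d k)" using d0[of k] unfolding exp_add by simp
      finally have "exp (- K (Suc k)) / cmod (d k) \<le> exp (- K k)" using d0[of k] by (simp add: field_simps)
      then have "(cmod (fps_nth R k) * \<tau> ^ Suc k) * (exp (- K (Suc k)) / cmod (d k)) \<le> (cmod (fps_nth R k) * \<tau> ^ Suc k) * exp (- K k)"
        using \<tau> by (intro mult_left_mono) auto
      then show ?thesis by (simp add: w norm_divide mult_ac)
    qed
    then show ?thesis
      unfolding wnorm_Suc_shift by (simp add: K(1) wnorm_def sum_distrib_left sum_mono)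
  qed
  have bound: "?N n u \<le> 2 \<and> ?N n v \<le> 1 / (2 * s)" for n
  proof (induction n)
    case 0
    then show ?case using s by (simp add: wnorm_def uv0 K(1))
  next
    case (Suc n)
    then have nu: "?N n u \<le> 2" and nv: "?N n v \<le> 1 / (2 * s)" by auto
    have pos: "?N n w \<ge> 0" for w using \<tau> by (intro wnorm_nonneg) auto
    have "?N n (fps_X * u) \<le> \<tau> * ?N n u" using \<tau> K by (intro wnorm_X_mult) auto
    also have "\<dots> \<le> 1 / (4 * s) * 2" using \<tau> nu pos s by (intro mult_mono) auto
    finally have x: "?N n (fps_X * u) * s \<le> 1 / 2" using s by (simp add: field_simps)
    have y: "?N n v * s \<le> 1 / 2" using nv s by (simp add: field_simps)
    have sa: "?N n (sub ca (fps_X * u) v) \<le> 4 * B"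
      using \<tau> B s ca x y by (intro wnorm_sub[OF K(3) _ K(1)]) auto
    have sb: "?N n (sub cb (fps_X * u) v) \<le> 4 * B"
      using \<tau> B s cb x y by (intro wnorm_sub[OF K(3) _ K(1)]) auto
    have "?N n (R1 u v) \<le> ?N n (u ^ 2) * ?N n (sub ca (fps_X * u) v)"
      unfolding R1_def using \<tau> by (intro wnorm_mult K) auto
    also have "\<dots> \<le> (2 ^ 2) * (4 * B)"
      using sa pos nu \<tau> wnorm_power[OF K(3) _ K(1), of \<tau> n u 2] power_mono[OF nu pos, of 2]
      by (intro mult_mono) auto
    finally have r1: "?N n (R1 u v) \<le> 16 * B" by simp
    have "?N n (R2 u v) \<le> ?N n u * ?N n (sub cb (fps_X * u) v)"
      unfolding R2_def using \<tau> by (intro wnorm_mult K) auto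
    also have "\<dots> \<le> 2 * (4 * B)" using sb pos nu by (intro mult_mono) auto
    finally have r2: "?N n (R2 u v) \<le> 8 * B" by simp
    have "?N (Suc n) u \<le> 1 + \<tau> * ?N n (R1 u v)" using step[OF uv(1)] by (simp add: uv0)
    also have "\<dots> \<le> 1 + 1 / (16 * B) * (16 * B)"
      using r1 \<tau> pos B by (intro add_left_mono mult_mono) auto
    finally have 1: "?N (Suc n) u \<le> 2" using B by simp
    have "?N (Suc n) v \<le> \<tau> * ?N n (R2 u v)" using step[OF uv(2)] by (simp add: uv0)
    also have "\<dots> \<le> 1 / (16 * B * s) * (8 * B)"
      using r2 \<tau> pos B s by (intro mult_mono) auto
    also have "\<dots> = 1 / (2 * s)" using B s by simp
    finally show ?case using 1 by simp
  qed
  \<comment> \<open>The weight is undone here: K n \<le> C n turns exp (K n) into a geometric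
    factor, so both series converge.\<close>
  have coef: "cmod (fps_nth w n) \<le> A * (exp C / \<tau>) ^ n" if w: "\<And>n. ?N n w \<le> A" for w A n
  proof -
    have A: "A \<ge> 0" using wnorm_nonneg[of \<tau> K 0 w] w[of 0] \<tau> by linarith
    have "cmod (fps_nth w n) * exp (- K n) * \<tau> ^ n \<le> ?N n w"
      unfolding wnorm_def using \<tau> by (intro member_le_sum) auto
    also have "\<dots> \<le> A" by (rule w)
    finally have 1: "cmod (fps_nth w n) * exp (- K n) * \<tau> ^ n \<le> A" .
    have "cmod (fps_nth w n) = (cmod (fps_nth w n) * exp (- K n) * \<tau> ^ n) * (exp (K n) / \<tau> ^ n)"
      using \<tau> by (simp add: exp_minus field_simps)
    also have "\<dots> \<le> A * (exp (K n) / \<tau> ^ n)" using 1 \<tau> by (intro mult_right_mono) auto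
    also have "\<dots> \<le> A * (exp (C * real n) / \<tau> ^ n)"
      using K(5)[of n] \<tau> A by (intro mult_left_mono divide_right_mono) auto
    also have "exp (C * real n) = exp C ^ n" by (simp add: exp_of_nat2_mult)
    finally show ?thesis by (simp add: power_divide)
  qed
  have cr: "fps_conv_radius u > 0" "fps_conv_radius v > 0"
    using fps_conv_radius_pos[OF coef] bound by blast+
  define \<xi> \<eta> where "\<xi> = eval_fps u" and "\<eta> = eval_fps v"
  have ex: "\<xi> has_fps_expansion u" "\<eta> has_fps_expansion v"
    unfolding \<xi>_def \<eta>_def using cr by (auto intro: eval_fps_has_fps_expansion)
  have lin: "(\<lambda>t. lam * t) has_fps_expansion fps_const lam * fps_X"
    by (intro has_fps_expansion_cmult_left has_fps_expansion_fps_X)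
  have exl: "(\<lambda>t. \<xi> (lam * t)) has_fps_expansion (u oo (fps_const lam * fps_X))"
    "(\<lambda>t. \<eta> (lam * t)) has_fps_expansion (v oo (fps_const lam * fps_X))"
    using has_fps_expansion_compose[OF ex(1) lin] has_fps_expansion_compose[OF ex(2) lin] by (simp_all add: o_def)
  have exX: "(\<lambda>t. t * \<xi> t) has_fps_expansion fps_X * u"
    by (intro has_fps_expansion_mult has_fps_expansion_fps_X ex)
  have exa: "(\<lambda>t. a (t * \<xi> t, \<eta> t)) has_fps_expansion sub ca (fps_X * u) v"
    unfolding ca_def by (rule has_fps_expansion_sub[OF a V0 exX ex(2)]) (auto simp: uv0)
  have exb: "(\<lambda>t. b (t * \<xi> t, \<eta> t)) has_fps_expansion sub cb (fps_X * u) v"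
    unfolding cb_def by (rule has_fps_expansion_sub[OF b V0 exX ex(2)]) (auto simp: uv0)
  have key: "(w oo (fps_const lam * fps_X)) - w = fps_X * R" if w: "\<And>n. fps_nth w (Suc n) = fps_nth R n / d n" for w R
  proof (rule fps_ext)
    fix n show "fps_nth ((w oo (fps_const lam * fps_X)) - w) n = fps_nth (fps_X * R) n"
    proof (cases n)
      case (Suc m)
      have "lam ^ Suc m * fps_nth w (Suc m) - fps_nth w (Suc m) = d m * fps_nth w (Suc m)"
        by (simp add: d_def algebra_simps)
      then show ?thesis using d0[of m] by (simp add: fps_compose_linear Suc w)
    qed (simp add: fps_compose_linear)
  qed
  have "(\<lambda>t. \<xi> (lam * t) - \<xi> t - t * (\<xi> t ^ 2 * a (t * \<xi> t, \<eta> t))) has_fps_expansion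
    (u oo (fps_const lam * fps_X)) - u - fps_X * R1 u v"
    unfolding R1_def by (intro has_fps_expansion_diff has_fps_expansion_mult has_fps_expansion_power has_fps_expansion_fps_X exl ex exa)
  then have ev1: "\<forall>\<^sub>F t in nhds 0. \<xi> (lam * t) - \<xi> t - t * (\<xi> t ^ 2 * a (t * \<xi> t, \<eta> t)) = 0"
    using key[OF uv(1)] by (simp add: has_fps_expansion_0_iff)
  have "(\<lambda>t. \<eta> (lam * t) - \<eta> t - t * (\<xi> t * b (t * \<xi> t, \<eta> t))) has_fps_expansion
    (v oo (fps_const lam * fps_X)) - v - fps_X * R2 u v"
    unfolding R2_def by (intro has_fps_expansion_diff has_fps_expansion_mult has_fps_expansion_fps_X exl ex exb)
  then have ev2: "\<forall>\<^sub>F t in nhds 0. \<eta> (lam * t) - \<eta> t - t * (\<xi> t * b (t * \<xi> t, \<eta> t)) = 0"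
    using key[OF uv(2)] by (simp add: has_fps_expansion_0_iff)
  obtain S1 where S1: "open S1" "0 \<in> S1" "\<xi> holomorphic_on S1" by (rule has_fps_expansion_imp_holomorphic[OF ex(1)])
  obtain S2 where S2: "open S2" "0 \<in> S2" "\<eta> holomorphic_on S2" by (rule has_fps_expansion_imp_holomorphic[OF ex(2)])
  have "\<forall>\<^sub>F t in nhds 0. t \<in> S1 \<inter> S2 \<and> \<xi> (lam * t) - \<xi> t - t * (\<xi> t ^ 2 * a (t * \<xi> t, \<eta> t)) = 0
      \<and> \<eta> (lam * t) - \<eta> t - t * (\<xi> t * b (t * \<xi> t, \<eta> t)) = 0"
    by (intro eventually_conj eventually_nhds_in_open ev1 ev2) (use S1 S2 in auto)
  then obtain r where r: "r > 0" "\<And>t. dist t 0 < r \<Longrightarrow> t \<in> S1 \<inter> S2 \<and> \<xi> (lam * t) - \<xi> t - t * (\<xi> t ^ 2 * a (t * \<xi> t, \<eta> t)) = 0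
      \<and> \<eta> (lam * t) - \<eta> t - t * (\<xi> t * b (t * \<xi> t, \<eta> t)) = 0"
    unfolding eventually_nhds_metric by blast
  have h: "\<xi> holomorphic_on ball 0 r" "\<eta> holomorphic_on ball 0 r"
    using r(2) by (auto intro!: holomorphic_on_subset[OF S1(3)] holomorphic_on_subset[OF S2(3)] simp: dist_commute)
  have z: "\<xi> 0 = 1" "\<eta> 0 = 0"
    using ex uv0 by (auto simp: has_fps_expansion_imp_0_eq_fps_nth_0)
  have m: "\<forall>t\<in>ball 0 r. \<xi> (lam * t) - \<xi> t = t * (\<xi> t ^ 2 * a (t * \<xi> t, \<eta> t)) \<and>
      \<eta> (lam * t) - \<eta> t = t * (\<xi> t * b (t * \<xi> t, \<eta> t))"
  proof
    fix t :: complex assume "t \<in> ball 0 r"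
    then have "dist t 0 < r" by (simp add: dist_commute)
    from r(2)[OF this] show "\<xi> (lam * t) - \<xi> t = t * (\<xi> t ^ 2 * a (t * \<xi> t, \<eta> t)) \<and>
      \<eta> (lam * t) - \<eta> t = t * (\<xi> t * b (t * \<xi> t, \<eta> t))" by simp
  qed
  show ?thesis
    by (intro exI[of _ \<xi>] exI[of _ \<eta>] exI[of _ r] conjI r(1) h z m)
qed

subsection \<open>Transversally formal series\<close>

text \<open>The quotient by x is completed by \<open>dx E\<close> on the axis. It is separately
  holomorphic, in x by the removable singularity and in y because \<open>dx E\<close> is
  holomorphic; continuity at the axis comes from the second-order estimate, and Osgood's lemma
  concludes. The last clause serves to identify transverse multipliers.\<close>

lemma hol2_divide_fst:
  assumes E: "hol2 E U" and 0: "\<And>y. (0, y) \<in> U \<Longrightarrow> E (0, y) = 0"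
  shows "\<exists>E'. hol2 E' U \<and> (\<forall>p\<in>U. E p = fst p * E' p) \<and> (\<forall>y. E' (0, y) = dx E (0, y))"
proof -
  define E' where "E' p = (if fst p = 0 then dx E p else E p / fst p)" for p
  have o: "open U" by (rule hol2_open[OF E])
  have oU: "open (U \<inter> {p. fst p \<noteq> 0})"
  proof -
    have "open {p::complex2. fst p \<noteq> 0}" by (intro open_Collect_neq continuous_intros)
    then show ?thesis using o by blast
  qed
  have h: "hol2 E' (U \<inter> {p. fst p \<noteq> 0})"
  proof (rule hol2_cong)
    show "hol2 (\<lambda>p. E p / fst p) (U \<inter> {p. fst p \<noteq> 0})"
      by (intro hol2_divide hol2_fst hol2_subset[OF E] oU) auto
  qed (simp add: E'_def)
  have cont0: "isCont E' (0, b)" if b: "(0, b) \<in> U" for b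
  proof -
    obtain r M where r: "r > 0" "M > 0" "cball 0 (2*r) \<times> cball b (2*r) \<subseteq> U"
      "\<And>x y. x \<in> cball 0 (2*r) \<Longrightarrow> y \<in> cball b (2*r) \<Longrightarrow> cmod (E (x, y)) \<le> M"
      by (rule sephol_bidisc[OF hol2_imp_sephol[OF E] b, unfolded fst_conv snd_conv]) (rule that; assumption)
    have est: "cmod (E' (x, y) - dx E (0, y)) \<le> 2 * M / r^2 * cmod x" if xy: "cmod x \<le> r / 2" "y \<in> cball b (2*r)" for x y
    proof (cases "x = 0")
      case False
      have "(0, y) \<in> U" using r(1,3) xy by auto
      then have "cmod (E (x, y) - dx E (0, y) * x) \<le> 2 * M * (cmod x / r)^2"
        using sephol_dx_estimate[OF hol2_imp_sephol[OF E] r(3,1,4), of 0 y x] xy r(1) 0 by simp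
      moreover have "E' (x, y) - dx E (0, y) = (E (x, y) - dx E (0, y) * x) / x"
        using False by (simp add: E'_def field_simps)
      ultimately have "cmod (E' (x, y) - dx E (0, y)) \<le> 2 * M * (cmod x / r)^2 / cmod x"
        by (simp add: norm_divide divide_right_mono)
      also have "\<dots> = 2 * M / r^2 * cmod x" using False by (simp add: power2_eq_square)
      finally show ?thesis .
    qed (simp add: E'_def)
    have "isCont (dx E) (0, b)"
      using hol2_continuous_on[OF hol2_dx[OF E]] o b by (simp add: continuous_on_eq_continuous_at)
    then have c1: "isCont (\<lambda>p::complex2. dx E (0, snd p)) (0, b)"
      by (intro isCont_o2[of "(0, b)" "\<lambda>p. (0, snd p)" "dx E"]) (auto intro!: continuous_intros)
    have "((\<lambda>p. 2 * M / r^2 * cmod (fst p)) \<longlongrightarrow> 2 * M / r^2 * cmod (fst (0::complex, b))) (at (0, b))"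
      by (intro tendsto_intros)
    then have t0: "((\<lambda>p. 2 * M / r^2 * cmod (fst p)) \<longlongrightarrow> 0) (at (0, b))" by simp
    have "\<forall>\<^sub>F p in at (0, b). p \<in> ball 0 (r/2) \<times> ball b (2*r)"
      using r by (intro eventually_at_in_open') (auto simp: open_Times)
    then have "\<forall>\<^sub>F p in at (0, b). cmod (E' p - dx E (0, snd p)) \<le> 2 * M / r^2 * cmod (fst p)"
      by eventually_elim (use est in \<open>auto simp: less_imp_le\<close>)
    from Lim_null_comparison[OF this t0]
    have "((\<lambda>p. E' p - dx E (0, snd p)) \<longlongrightarrow> 0) (at (0, b))" .
    moreover have "E' (0, b) = dx E (0, b)" by (simp add: E'_def)
    ultimately show ?thesis using tendsto_add[OF _ c1[unfolded isCont_def]] by (force simp: isCont_def)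
  qed
  have "hol2 E' U"
  proof (rule osgood, unfold sephol_def, intro conjI allI o)
    show "continuous_on U E'"
    proof (rule continuous_at_imp_continuous_on, rule ballI)
      fix p assume p: "p \<in> U"
      show "isCont E' p"
      proof (cases "fst p = 0")
        case True then show ?thesis using cont0[of "snd p"] p by (cases p) auto
      next
        case False
        then have "p \<in> U \<inter> {p. fst p \<noteq> 0}" using p by auto
        then show ?thesis
          using hol2_continuous_on[OF h] continuous_on_eq_continuous_at[OF oU] by blast
      qed
    qed
    fix y
    show "(\<lambda>x. E' (x, y)) holomorphic_on {x. (x, y) \<in> U}"
    proof (cases "(0, y) \<in> U")
      case True
      then have "(if x = 0 then deriv (\<lambda>x. E (x, y)) 0 else (E (x, y) - E (0, y)) / (x - 0)) = E' (x, y)" for x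
        using 0[of y] by (simp add: E'_def dx_def)
      then show ?thesis
        using pole_lemma_open[OF hol2_slice_x[OF E, of y] open_slice_x[OF o, of y], of 0] by simp
    next
      case False
      have "(\<lambda>x. E (x, y) / x) holomorphic_on {x. (x, y) \<in> U}"
        using hol2_slice_x[OF E, of y] False by (intro holomorphic_intros) auto
      then show ?thesis
        by (rule holomorphic_transform) (use False in \<open>auto simp: E'_def\<close>)
    qed
  next
    fix x
    show "(\<lambda>y. E' (x, y)) holomorphic_on {y. (x, y) \<in> U}"
    proof (cases "x = 0")
      case True
      then have "(\<lambda>y. E' (x, y)) = (\<lambda>y. dx E (0, y))" by (simp add: E'_def)
      then show ?thesis using hol2_slice_y[OF hol2_dx[OF E]] True by simp
    next
      case False
      then have "(\<lambda>y. E' (x, y)) = (\<lambda>y. E (x, y) / x)" by (simp add: E'_def)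
      then show ?thesis using hol2_slice_y[OF E, of x] False by (auto intro!: holomorphic_intros)
    qed
  qed
  moreover have "E p = fst p * E' p" if "p \<in> U" for p
    using 0[of "snd p"] that by (cases p) (auto simp: E'_def)
  ultimately show ?thesis by (intro exI[of _ E']) (auto simp: E'_def)
qed

text \<open>The series \<open>\<Sum>j. h\<^sub>j(y) x^j\<close> in coordinates centered at \<open>(0, y0)\<close>.\<close>

definition ser :: "(nat \<Rightarrow> complex \<Rightarrow> complex) \<Rightarrow> complex \<Rightarrow> fps2" where
  "ser h y0 = Abs_fps (\<lambda>j. fps_expansion (h j) y0)"

lemma coeff2_ser: "coeff2 (ser h y0) i j = (deriv ^^ j) (h i) y0 / fact j"
  by (simp add: ser_def fps_expansion_def)

text \<open>Truncated in x only, with full holomorphic coefficients in y, this is an honest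
  function, unlike the series \<open>ser\<close>. Degree N is included.\<close>

definition psum :: "nat \<Rightarrow> (nat \<Rightarrow> complex \<Rightarrow> complex) \<Rightarrow> complex2 \<Rightarrow> complex" where
  "psum N h p = (\<Sum>j\<le>N. h j (snd p) * fst p ^ j)"

lemma hol2_hol_snd:
  assumes "g holomorphic_on W" "open W" shows "hol2 (\<lambda>p. g (snd p)) (UNIV \<times> W)"
  by (rule hol2_compose_hol[OF hol2_snd assms]) (auto simp: open_Times assms)

lemma hol2_psum:
  assumes "\<And>j. j \<le> N \<Longrightarrow> h j holomorphic_on W" "open W" shows "hol2 (psum N h) (UNIV \<times> W)"
  unfolding psum_def
  by (intro hol2_sum hol2_mult hol2_power hol2_fst hol2_hol_snd assms open_Times) auto

lemma taylor2_hol_snd: "taylor2 (\<lambda>p. g (snd p)) p = fps_const (fps_expansion g (snd p))"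
  by (rule fps2_eqI) (simp add: taylor2_def fps_expansion_def)

lemma taylor2_psum:
  assumes "\<And>j. j \<le> N \<Longrightarrow> h j holomorphic_on W" "open W" "y0 \<in> W" "i \<le> N"
  shows "coeff2 (taylor2 (psum N h) (0, y0)) i k = coeff2 (ser h y0) i k"
proof -
  have o: "open ((UNIV::complex set) \<times> W)" using assms by (simp add: open_Times)
  have m: "(0, y0) \<in> (UNIV::complex set) \<times> W" using assms by simp
  have "taylor2 (psum N h) (0, y0) = (\<Sum>j\<le>N. taylor2 (\<lambda>p. h j (snd p) * fst p ^ j) (0, y0))"
    unfolding psum_def
    by (rule taylor2_sum[OF o _ m]) (intro hol2_mult hol2_power hol2_fst hol2_hol_snd assms o; simp add: assms)
  also have "\<dots> = (\<Sum>j\<le>N. fps_const (fps_expansion (h j) y0) * fps_X ^ j)"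
  proof (rule sum.cong[OF refl])
    fix j assume "j \<in> {..N}"
    then have "hol2 (\<lambda>p. h j (snd p)) (UNIV \<times> W)" using assms by (intro hol2_hol_snd) auto
    then show "taylor2 (\<lambda>p. h j (snd p) * fst p ^ j) (0, y0) = fps_const (fps_expansion (h j) y0) * fps_X ^ j"
      using taylor2_mult[OF _ hol2_power[OF hol2_fst[OF o]] m, of "\<lambda>p. h j (snd p)" j]
        taylor2_power[OF hol2_fst[OF o] m, of j]
      by (simp add: taylor2_hol_snd taylor2_fst[where p = "(0, y0)", simplified])
  qed
  finally have "coeff2 (taylor2 (psum N h) (0, y0)) i k = (\<Sum>j\<le>N. if i = j then fps_nth (fps_expansion (h j) y0) k else 0)"
    by (simp add: fps_sum_nth fps_X_power_nth if_distrib cong: if_cong)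
  also have "\<dots> = coeff2 (ser h y0) i k" using assms(4) by (simp add: sum.delta ser_def)
  finally show ?thesis .
qed

text \<open>A fixed coefficient (m, n) sees only a truncation at some N \<ge> m + n, for which the
  relation is an identity of functions up to a multiple of x^(N + 1).\<close>

lemma ser_semiconjugacy:
  assumes h: "\<And>j. h j holomorphic_on W" "open W" "y0 \<in> W"
    and F: "hol2m F D" "(0, y0) \<in> D" "F (0, y0) = (0, y0)" "\<And>p. p \<in> D \<Longrightarrow> snd (F p) \<in> W" "D \<subseteq> UNIV \<times> W"
    and id: "\<And>N. N \<ge> N0 \<Longrightarrow> \<exists>E. hol2 E D \<and> (\<forall>p\<in>D. psum N h (F p) - \<kappa> * psum N h p = fst p ^ Suc N * E p)"
  shows "compose2 (ser h y0) (taylor_map F (0, y0)) = fps_const (fps_const \<kappa>) * ser h y0"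
proof (rule fps2_eqI)
  fix m n
  define N where "N = m + n + N0"
  obtain E where E: "hol2 E D" "\<And>p. p \<in> D \<Longrightarrow> psum N h (F p) - \<kappa> * psum N h p = fst p ^ Suc N * E p"
    using id[of N] by (auto simp: N_def)
  have o: "open D" by (rule hol2_open[OF E(1)])
  have hp: "hol2 (psum N h) (UNIV \<times> W)" by (rule hol2_psum[OF h(1,2)])
  have hpD: "hol2 (psum N h) D" by (rule hol2_subset[OF hp o F(5)])
  have hpF: "hol2 (\<lambda>p. psum N h (F p)) D" by (rule hol2_compose_map[OF hp F(1)]) (use F(4) in \<open>auto simp: mem_Times_iff\<close>)
  have ag: "agree (Suc (m + n)) (taylor2 (psum N h) (0, y0)) (ser h y0)"
    unfolding agree_def using taylor2_psum[of N h W y0] h by (auto simp: N_def)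
  have "taylor2 (\<lambda>p. psum N h (F p) - \<kappa> * psum N h p) (0, y0) = taylor2 (\<lambda>p. fst p ^ Suc N * E p) (0, y0)"
    using eventually_nhds_in_open[OF o F(2)] by (intro taylor2_cong) (auto elim!: eventually_mono simp: E(2))
  also have "\<dots> = fps_X ^ Suc N * taylor2 E (0, y0)"
    using taylor2_mult[OF hol2_power[OF hol2_fst[OF o]] E(1) F(2), of "Suc N"] taylor2_power[OF hol2_fst[OF o] F(2), of "Suc N"]
    by (simp add: taylor2_fst[where p = "(0, y0)", simplified])
  finally have "coeff2 (taylor2 (\<lambda>p. psum N h (F p) - \<kappa> * psum N h p) (0, y0)) m n = 0"
    by (simp add: fps_X_power_mult_nth N_def del: power_Suc)
  then have "coeff2 (taylor2 (\<lambda>p. psum N h (F p)) (0, y0)) m n = \<kappa> * coeff2 (taylor2 (psum N h) (0, y0)) m n"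
    using taylor2_diff[OF hpF hol2_mult[OF hol2_const[OF o] hpD] F(2), of \<kappa>] taylor2_cmult[OF hpD F(2), of \<kappa>] by simp
  moreover have "taylor2 (\<lambda>p. psum N h (F p)) (0, y0) = compose2 (taylor2 (psum N h) (0, y0)) (taylor_map F (0, y0))"
    using taylor2_compose_map[OF hp F(1,2)] F(3) h(3) by simp
  moreover have "agree (Suc (m + n)) (compose2 (taylor2 (psum N h) (0, y0)) (taylor_map F (0, y0))) (compose2 (ser h y0) (taylor_map F (0, y0)))"
    by (intro agree_compose2 ag agree_map_refl)
  ultimately show "coeff2 (compose2 (ser h y0) (taylor_map F (0, y0))) m n = coeff2 (fps_const (fps_const \<kappa>) * ser h y0) m n"
    using ag by (simp add: agree_def)
qed

text \<open>As F fixes the axis with constant multiplier, adding c(y) x^(N + 1) changes the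
  coefficient of x^(N + 1) in the defect by (\<lambda>^(N + 1) - \<kappa>) c(y). The divisor is a
  number independent of y, so all coefficients are holomorphic on the same W, as transversal
  formality requires.\<close>

lemma transversal_series:
  assumes W: "open W" and F: "hol2m F D" "\<And>p. p \<in> D \<Longrightarrow> snd (F p) \<in> W" "D \<subseteq> UNIV \<times> W" "\<And>y. (0, y) \<in> D \<Longrightarrow> F (0, y) = (0, y)"
    "\<And>y. y \<in> W \<Longrightarrow> (0, y) \<in> D"
    and mult: "\<And>y. (0, y) \<in> D \<Longrightarrow> dx (\<lambda>z. fst (F z)) (0, y) = lam"
    and base: "\<And>j. j \<le> N0 \<Longrightarrow> h0 j holomorphic_on W" "hol2 E0 D"
      "\<And>p. p \<in> D \<Longrightarrow> psum N0 h0 (F p) - \<kappa> * psum N0 h0 p = fst p ^ Suc N0 * E0 p"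
    and nonres: "\<And>n. n > N0 \<Longrightarrow> lam ^ n \<noteq> \<kappa>"
  shows "\<exists>h. (\<forall>j\<le>N0. h j = h0 j) \<and> (\<forall>j. h j holomorphic_on W) \<and>
    (\<forall>N\<ge>N0. \<exists>E. hol2 E D \<and> (\<forall>p\<in>D. psum N h (F p) - \<kappa> * psum N h p = fst p ^ Suc N * E p))"
proof -
  have o: "open D" by (rule hol2m_open[OF F(1)])
  have hF: "hol2 (\<lambda>z. fst (F z)) D" "hol2 (\<lambda>z. snd (F z)) D" using F(1) by (auto simp: hol2m_def)
  obtain \<alpha> where \<alpha>: "hol2 \<alpha> D" "\<And>p. p \<in> D \<Longrightarrow> fst (F p) = fst p * \<alpha> p" "\<And>y. (0, y) \<in> D \<Longrightarrow> \<alpha> (0, y) = lam"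
    using hol2_divide_fst[OF hF(1)] F(4) mult by auto
  define P where "P n hE \<longleftrightarrow> (\<forall>j\<le>N0 + n. fst hE j holomorphic_on W) \<and> hol2 (snd hE) D \<and>
    (\<forall>p\<in>D. psum (N0 + n) (fst hE) (F p) - \<kappa> * psum (N0 + n) (fst hE) p = fst p ^ Suc (N0 + n) * snd hE p)"
    for n and hE :: "(nat \<Rightarrow> complex \<Rightarrow> complex) \<times> (complex2 \<Rightarrow> complex)"
  define Q where "Q n hE hE' \<longleftrightarrow> (\<forall>j\<le>N0 + n. fst hE' j = fst hE j)"
    for n and hE hE' :: "(nat \<Rightarrow> complex \<Rightarrow> complex) \<times> (complex2 \<Rightarrow> complex)"
  have step: "\<exists>hE'. P (Suc n) hE' \<and> Q n hE hE'" if "P n hE" for n hE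
  proof -
    obtain h E where hE: "hE = (h, E)" by (cases hE)
    define N where "N = N0 + n"
    have h: "\<And>j. j \<le> N \<Longrightarrow> h j holomorphic_on W" and E: "hol2 E D"
      and id: "\<And>p. p \<in> D \<Longrightarrow> psum N h (F p) - \<kappa> * psum N h p = fst p ^ Suc N * E p"
      using that by (auto simp: P_def hE N_def)
    have nr: "lam ^ Suc N - \<kappa> \<noteq> 0" using nonres[of "Suc N"] by (simp add: N_def)
    \<comment> \<open>The choice for which the new defect B vanishes on the axis and can be divided
      by x once more.\<close>
    define c where "c y = - E (0, y) / (lam ^ Suc N - \<kappa>)" for y
    have c: "c holomorphic_on W"
    proof -
      have "(\<lambda>y. E (0, y)) holomorphic_on W"
        by (rule holomorphic_on_subset[OF hol2_slice_y[OF E]]) (use F(5) in auto)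
      then show ?thesis unfolding c_def using nr by (intro holomorphic_intros) auto
    qed
    define h' where "h' = h(Suc N := c)"
    have ps: "psum (Suc N) h' p = psum N h p + c (snd p) * fst p ^ Suc N" for p
      unfolding psum_def h'_def by (simp cong: sum.cong_simp)
    define B where "B p = E p + c (snd (F p)) * \<alpha> p ^ Suc N - \<kappa> * c (snd p)" for p
    have "hol2 B D"
      unfolding B_def
      by (intro hol2_add hol2_diff hol2_mult hol2_power hol2_const E \<alpha>(1) o
        hol2_compose_hol[OF hF(2) c W] hol2_compose_hol[OF hol2_snd[OF o] c W]) (use F(2,3) in auto)
    moreover have "B (0, y) = 0" if "(0, y) \<in> D" for y
      using nr that by (simp add: B_def F(4) \<alpha>(3) c_def field_simps)
    ultimately obtain E' where E': "hol2 E' D" "\<And>p. p \<in> D \<Longrightarrow> B p = fst p * E' p"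
      using hol2_divide_fst[of B D] by auto
    have "psum (Suc N) h' (F p) - \<kappa> * psum (Suc N) h' p = fst p ^ Suc (Suc N) * E' p" if p: "p \<in> D" for p
    proof -
      have "psum (Suc N) h' (F p) - \<kappa> * psum (Suc N) h' p =
        (psum N h (F p) - \<kappa> * psum N h p) + c (snd (F p)) * fst (F p) ^ Suc N - \<kappa> * c (snd p) * fst p ^ Suc N"
        unfolding ps by (simp add: algebra_simps)
      also have "\<dots> = fst p ^ Suc N * B p"
        unfolding id[OF p] \<alpha>(2)[OF p] B_def by (simp add: power_mult_distrib algebra_simps)
      also have "\<dots> = fst p ^ Suc (Suc N) * E' p" using E'(2)[OF p] by (simp add: mult_ac)
      finally show ?thesis .
    qed
    then have "P (Suc n) (h', E')"
      using h c E'(1) by (auto simp: P_def N_def[symmetric] h'_def le_Suc_eq)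
    moreover have "Q n hE (h', E')" by (simp add: Q_def hE h'_def N_def[symmetric])
    ultimately show ?thesis by blast
  qed
  have "P 0 (h0, E0)" using base by (simp add: P_def)
  then have "\<exists>S. S 0 = (h0, E0) \<and> (\<forall>n. P n (S n) \<and> Q n (S n) (S (Suc n)))"
    using dependent_nat_choice[of "\<lambda>n x. P n x \<and> (n = 0 \<longrightarrow> x = (h0, E0))" Q] step by (metis nat.distinct(1))
  then obtain S where S: "S 0 = (h0, E0)" "\<And>n. P n (S n)" "\<And>n. Q n (S n) (S (Suc n))" by blast
  \<comment> \<open>Beyond N0, coefficient j is settled at stage j - N0 and kept by \<open>Q\<close>
    at all later stages.\<close>
  define h where "h j = (if j \<le> N0 then h0 j else fst (S (j - N0)) j)" for j
  have st: "fst (S n) j = h j" if "j \<le> N0 + n" for n j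
    using that
  proof (induction n)
    case 0 then show ?case by (simp add: h_def S(1))
  next
    case (Suc n)
    then show ?case using S(3)[of n]
      by (cases "j = Suc (N0 + n)") (auto simp: Q_def h_def)
  qed
  have pse: "psum (N0 + n) (fst (S n)) p = psum (N0 + n) h p" for n p
    unfolding psum_def by (intro sum.cong refl) (simp add: st)
  have "\<exists>E. hol2 E D \<and> (\<forall>p\<in>D. psum N h (F p) - \<kappa> * psum N h p = fst p ^ Suc N * E p)" if "N \<ge> N0" for N
    using S(2)[of "N - N0"] that pse[of "N - N0"] by (intro exI[of _ "snd (S (N - N0))"]) (simp add: P_def)
  moreover have "h j holomorphic_on W" for j
  proof -
    have "fst (S j) j holomorphic_on W" using S(2)[of j] by (simp add: P_def)
    moreover have "fst (S j) j = h j" by (rule st) simp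
    ultimately show ?thesis by simp
  qed
  moreover have "h j = h0 j" if "j \<le> N0" for j using that by (simp add: h_def)
  ultimately show ?thesis by blast
qed

subsection \<open>Parabolic sectors\<close>

lemma orbit_map_holomorphic:
  assumes G: "hol2m G U" and p: "p1 holomorphic_on O0" "p2 holomorphic_on O0" "open O0"
  shows "open {t \<in> O0. \<forall>j<n. (G ^^ j) (p1 t, p2 t) \<in> U} \<and>
    (\<lambda>t. fst ((G ^^ n) (p1 t, p2 t))) holomorphic_on {t \<in> O0. \<forall>j<n. (G ^^ j) (p1 t, p2 t) \<in> U} \<and>
    (\<lambda>t. snd ((G ^^ n) (p1 t, p2 t))) holomorphic_on {t \<in> O0. \<forall>j<n. (G ^^ j) (p1 t, p2 t) \<in> U}"
proof (induction n)
  case 0 then show ?case using p by simp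
next
  case (Suc n)
  let ?On = "{t \<in> O0. \<forall>j<n. (G ^^ j) (p1 t, p2 t) \<in> U}"
  let ?On' = "{t \<in> O0. \<forall>j<Suc n. (G ^^ j) (p1 t, p2 t) \<in> U}"
  have o: "open ?On" and h: "(\<lambda>t. fst ((G ^^ n) (p1 t, p2 t))) holomorphic_on ?On" "(\<lambda>t. snd ((G ^^ n) (p1 t, p2 t))) holomorphic_on ?On"
    using Suc by auto
  have eq: "?On' = ?On \<inter> (\<lambda>t. (fst ((G ^^ n) (p1 t, p2 t)), snd ((G ^^ n) (p1 t, p2 t)))) -` U"
    by (auto simp: less_Suc_eq)
  have o': "open ?On'" unfolding eq
    by (intro continuous_open_preimage o hol2m_open[OF G] continuous_intros holomorphic_on_imp_continuous_on h)
  have h': "(\<lambda>t. fst ((G ^^ n) (p1 t, p2 t))) holomorphic_on ?On'" "(\<lambda>t. snd ((G ^^ n) (p1 t, p2 t))) holomorphic_on ?On'"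
    using h by (auto elim!: holomorphic_on_subset)
  have c: "(\<lambda>t. f (fst ((G ^^ n) (p1 t, p2 t)), snd ((G ^^ n) (p1 t, p2 t)))) holomorphic_on ?On'" if "hol2 f U" for f
    by (rule hol_compose_hol2[OF that h' o']) auto
  show ?case
    using o' c[of "\<lambda>z. fst (G z)"] c[of "\<lambda>z. snd (G z)"] G by (simp add: hol2m_def)
qed

text \<open>Follow the disc of points (t y0^M, y0) with |t| \<le> 1. The parameters that survive n
  steps form a compact set K n, on whose frontier |x_n| = |y_n|^M. If x_n has a zero in K n, so has
  x_(n + 1); the maximum principle proves this in place of a degree argument. A zero of x_(n + 1)
  survives that step, so the nested sets K n are nonempty and have a common point.\<close>

lemma expanding_region_orbit:
  fixes G :: "complex2 \<Rightarrow> complex2" and S :: "complex set" and M :: nat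
  defines "P \<equiv> {p. snd p \<in> S \<and> cmod (fst p) \<le> cmod (snd p) ^ M}"
  assumes G: "hol2m G U" "P \<subseteq> U" and A: "A holomorphic_on T" "open T" "S \<subseteq> T" and S0: "0 \<notin> S" "y0 \<in> S"
    and inv: "\<And>p. p \<in> P \<Longrightarrow> snd (G p) \<in> S"
    and expand: "\<And>p. p \<in> P \<Longrightarrow> cmod (fst p) = cmod (snd p) ^ M \<Longrightarrow>
      cmod (fst (G p)) > cmod (snd (G p)) ^ M \<and> cmod (fst (G p) - A (snd p) * fst p) \<le> cmod (fst (G p)) / 2"
  shows "\<exists>p. \<forall>n. (G ^^ n) p \<in> P"
proof -
  define p where "p n t = (G ^^ n) (t * y0 ^ M, y0)" for n t
  have p0: "p 0 t = (t * y0 ^ M, y0)" and pS: "p (Suc n) t = G (p n t)" for n t by (auto simp: p_def)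
  define X where "X n t = fst (p n t)" for n t
  define Y where "Y n t = snd (p n t)" for n t
  have y0: "y0 \<noteq> 0" using S0 by auto
  define O' where "O' n = {t. \<forall>j<n. p j t \<in> U}" for n
  have hol: "open (O' n)" "X n holomorphic_on O' n" "Y n holomorphic_on O' n" for n
  proof -
    have "(\<lambda>t. t * y0 ^ M) holomorphic_on UNIV" by (intro holomorphic_intros)
    from orbit_map_holomorphic[OF G(1) this holomorphic_on_const[of y0] open_UNIV, of n]
    show "open (O' n)" "X n holomorphic_on O' n" "Y n holomorphic_on O' n"
      by (simp_all add: O'_def X_def[abs_def] Y_def[abs_def] p_def)
  qed
  define K where "K n = {t. \<forall>j\<le>n. cmod (X j t) \<le> cmod (Y j t) ^ M}" for n
  have Kmono: "K n \<subseteq> K m" if "m \<le> n" for m n using that by (auto simp: K_def)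
  have KP: "p j t \<in> P" if "t \<in> K n" "j \<le> n" for j n t
    using that(2)
  proof (induction j)
    case 0 then show ?case using that(1) S0 by (auto simp: P_def p0 K_def X_def Y_def)
  next
    case (Suc j)
    then have "p j t \<in> P" by simp
    from inv[OF this] have "Y (Suc j) t \<in> S" by (simp add: Y_def pS)
    then show ?case using that(1) Suc.prems by (auto simp: P_def K_def X_def Y_def)
  qed
  have KO: "K n \<subseteq> O' (Suc n)" for n
    using KP G(2) by (force simp: O'_def less_Suc_eq_le)
  have O'mono: "O' n \<subseteq> O' m" if "m \<le> n" for m n using that by (auto simp: O'_def)
  have hol': "X j holomorphic_on O' n" "Y j holomorphic_on O' n" if "j \<le> n" for j n
    using hol(2,3) O'mono[OF that] holomorphic_on_subset by blast+
  have cont: "continuous_on (K n) (X j)" "continuous_on (K n) (Y j)" if "j \<le> Suc n" for j n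
    using hol'[OF that] KO[of n] by (meson continuous_on_subset holomorphic_on_imp_continuous_on)+
  have Ynz: "Y j t \<noteq> 0" if "t \<in> K n" "j \<le> Suc n" for j n t
  proof (cases j)
    case 0 then show ?thesis using y0 by (simp add: Y_def p0)
  next
    case (Suc i)
    then show ?thesis using inv[OF KP[OF that(1), of i]] that(2) S0 by (auto simp: Y_def pS)
  qed
  have K0: "K 0 = cball 0 1"
    using y0 by (auto simp: K_def X_def Y_def p0 norm_mult norm_power mult_le_cancel_right1)
  have compK: "compact (K n)" for n
  proof (induction n)
    case 0 then show ?case by (simp add: K0)
  next
    case (Suc n)
    have "K (Suc n) = {t \<in> K n. cmod (X (Suc n) t) \<le> cmod (Y (Suc n) t) ^ M}"
      by (auto simp: K_def le_Suc_eq)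
    moreover have "closedin (top_of_set (K n)) {t \<in> K n. cmod (X (Suc n) t) \<le> cmod (Y (Suc n) t) ^ M}"
    proof -
      have "continuous_on (K n) (\<lambda>t. cmod (Y (Suc n) t) ^ M - cmod (X (Suc n) t))"
        by (intro continuous_intros cont) auto
      from continuous_closedin_preimage[OF this closed_atLeast[of 0]] show ?thesis
        by (simp add: vimage_def Int_def)
    qed
    ultimately show ?case using closedin_compact[OF Suc] by simp
  qed
  \<comment> \<open>A point on the edge of the region is expelled at the next step, so survivors are
    strictly inside at all earlier times.\<close>
  have strict: "cmod (X j t) < cmod (Y j t) ^ M" if "t \<in> K n" "j < n" for j n t
  proof (rule ccontr)
    assume "\<not> ?thesis"
    moreover have "cmod (X j t) \<le> cmod (Y j t) ^ M" using that by (auto simp: K_def)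
    ultimately have "cmod (X j t) = cmod (Y j t) ^ M" by simp
    then have "cmod (X (Suc j) t) > cmod (Y (Suc j) t) ^ M"
      using expand[OF KP[OF that(1), of j]] that(2) by (simp add: X_def Y_def pS)
    moreover have "cmod (X (Suc j) t) \<le> cmod (Y (Suc j) t) ^ M" using that by (auto simp: K_def)
    ultimately show False by simp
  qed
  have front: "cmod (X n t) = cmod (Y n t) ^ M" if t: "t \<in> frontier (K n)" for t n
  proof (rule ccontr)
    assume ne: "\<not> ?thesis"
    have tK: "t \<in> K n" using t compK[of n] by (simp add: frontier_def compact_imp_closed)
    have lt: "cmod (X j t) < cmod (Y j t) ^ M" if "j \<le> n" for j
      using strict[OF tK] ne tK that by (cases "j = n") (auto simp: K_def le_less)
    define V where "V = (\<Inter>j\<in>{..n}. {t \<in> O' n. cmod (X j t) < cmod (Y j t) ^ M})"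
    have "open V" unfolding V_def
    proof (intro open_INT ballI)
      fix j assume "j \<in> {..n}"
      then have h: "continuous_on (O' n) (X j)" "continuous_on (O' n) (Y j)"
        using hol' by (auto intro: holomorphic_on_imp_continuous_on)
      have "continuous_on (O' n) (\<lambda>t. cmod (Y j t) ^ M - cmod (X j t))" by (intro continuous_intros h)
      from continuous_open_preimage[OF this hol(1) open_greaterThan[of 0]]
      show "open {t \<in> O' n. cmod (X j t) < cmod (Y j t) ^ M}" by (simp add: vimage_def Int_def)
    qed simp
    moreover have "t \<in> V" using lt KO[of n] tK O'mono[of n "Suc n"] by (auto simp: V_def)
    moreover have "V \<subseteq> K n" by (auto simp: V_def K_def less_imp_le)
    ultimately have "t \<in> interior (K n)" by (meson interior_maximal subsetD)
    then show False using t by (simp add: frontier_def)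
  qed
  have zero: "\<exists>z\<in>K n. X n z = 0" for n
  proof (induction n)
    case 0 then show ?case by (intro bexI[of _ 0]) (auto simp: K0 X_def p0)
  next
    case (Suc n)
    then obtain z where z: "z \<in> K n" "X n z = 0" by blast
    have "\<exists>z'\<in>K n. X (Suc n) z' = 0"
    proof (rule ccontr)
      assume "\<not> ?thesis"
      then have nz: "X (Suc n) t \<noteq> 0" if "t \<in> K n" for t using that by blast
      \<comment> \<open>That is 1 - A(y_n) x_n / x_(n + 1): of modulus at most 1/2 on the frontier
        by \<open>expand\<close>, but equal to 1 at a zero of x_n.\<close>
      define h where "h t = (X (Suc n) t - A (Y n t) * X n t) / X (Suc n) t" for t
      have YT: "Y n t \<in> T" if "t \<in> K n" for t using KP[OF that, of n] A(3) by (auto simp: P_def Y_def)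
      have "cmod (h z) \<le> 1 / 2"
      proof (rule maximum_modulus_frontier[of h "K n" _ z])
        have "X (Suc n) holomorphic_on interior (K n)" "X n holomorphic_on interior (K n)" "Y n holomorphic_on interior (K n)"
          using hol'[of _ "Suc n"] KO[of n] interior_subset[of "K n"] by (meson holomorphic_on_subset order_refl le_SucI order_trans)+
        moreover have "(\<lambda>t. A (Y n t)) holomorphic_on interior (K n)"
          using holomorphic_on_compose_gen[OF calculation(3) A(1)] YT interior_subset[of "K n"] by (auto simp: o_def)
        ultimately show "h holomorphic_on interior (K n)"
          unfolding h_def using nz interior_subset[of "K n"] by (intro holomorphic_intros) auto
        have "continuous_on (K n) (\<lambda>t. A (Y n t))"
          by (rule continuous_on_compose2[OF holomorphic_on_imp_continuous_on[OF A(1)] cont(2)]) (use YT in auto)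
        then show "continuous_on (closure (K n)) h"
          unfolding h_def using nz compact_imp_closed[OF compK[of n]] by (auto intro!: continuous_intros cont)
        show "bounded (K n)" using compK compact_imp_bounded by blast
        fix t assume t: "t \<in> frontier (K n)"
        then have tK: "t \<in> K n" using compK[of n] by (simp add: frontier_def compact_imp_closed)
        have "cmod (X (Suc n) t - A (Y n t) * X n t) \<le> cmod (X (Suc n) t) / 2"
          using expand[OF KP[OF tK, of n]] front[OF t] by (simp add: X_def Y_def pS)
        then show "cmod (h t) \<le> 1 / 2" using nz[OF tK] by (simp add: h_def norm_divide field_simps)
      qed (rule z(1))
      moreover have "h z = 1" using z nz by (simp add: h_def)
      ultimately show False by simp
    qed
    then obtain z' where "z' \<in> K n" "X (Suc n) z' = 0" by blast
    then show ?case by (intro bexI[of _ z']) (auto simp: K_def le_Suc_eq)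
  qed
  have "\<Inter> (range K) \<noteq> {}"
    by (rule compact_nest[OF compK]) (use zero in blast, use Kmono in blast)
  then obtain t where "\<And>n. t \<in> K n" by blast
  then have "(G ^^ n) (t * y0 ^ M, y0) \<in> P" for n using KP[of t n n] by (simp add: p_def)
  then show ?thesis by blast
qed

section \<open>Attracting sectors and trapped orbits\<close>

lemma cos_ge_quadratic: "cos x \<ge> 1 - x\<^sup>2 / 2" for x :: real
proof -
  have "\<bar>sin (x/2)\<bar> \<le> \<bar>x/2\<bar>" by (rule abs_sin_x_le_abs_x)
  then have "(sin (x/2))\<^sup>2 \<le> (x/2)\<^sup>2" unfolding abs_le_square_iff .
  moreover have "cos x = 1 - 2 * (sin (x/2))\<^sup>2" using cos_double_sin[of "x/2"] by simp
  ultimately show ?thesis by (simp add: power2_eq_square)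
qed

text \<open>Write y' = y q with q = 1 - y^k + e. The angle k Arg y is at most 1/2 in modulus, so Re
  (y^k) \<ge> (7/8) |y|^k, which makes |y| decrease. One step turns y by at most \<theta> / 2, so
  only the outer halves of the sector matter; there |Im (y^k)| \<ge> \<sigma> |y|^k exceeds the
  error, and the sign of Im q turns y back towards the real axis.\<close>

lemma parabolic_sector:
  assumes k: "k \<ge> 1" and \<theta>0: "0 < \<theta>" "\<theta> \<le> 1 / (2 * real k)" and \<sigma>: "\<sigma> = sin (real k * \<theta> / 2)"
    and \<delta>: "0 < \<delta>" "\<delta> \<le> \<theta> / 8" "C * \<delta> \<le> \<sigma> / 2" "C * \<delta> \<le> 1 / 10" "C \<ge> 0"
    and y: "y \<noteq> 0" "cmod y < \<delta>" "\<bar>Arg y\<bar> \<le> \<theta>"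
    and y': "cmod (y' - (y - y ^ Suc k)) \<le> C * cmod y ^ (k + 2)"
  shows "y' \<noteq> 0" "cmod y' \<le> cmod y * (1 - cmod y ^ k / 2)" "\<bar>Arg y'\<bar> \<le> \<theta>"
proof -
  define r \<phi> w where "r = cmod y" and "\<phi> = Arg y" and "w = y ^ k"
  have kr: "real k \<ge> 1" using k by simp
  have k\<theta>: "0 < real k * \<theta>" "real k * \<theta> \<le> 1 / 2" using \<theta>0 kr by (auto simp: field_simps)
  have \<sigma>0: "\<sigma> > 0" unfolding \<sigma> using pi_gt3 k\<theta> by (intro sin_gt_zero) auto
  have r: "r > 0" "r < \<delta>" using y by (auto simp: r_def)
  have d16: "\<delta> \<le> 1 / 16"
  proof -
    have "\<theta> * 1 \<le> \<theta> * real k" using kr \<theta>0 by (intro mult_left_mono) auto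
    with \<delta>(2) k\<theta>(2) show ?thesis by (simp add: mult.commute)
  qed
  have wn: "cmod w = r ^ k" by (simp add: w_def r_def norm_power)
  have wpos: "cmod w > 0" using y by (simp add: w_def)
  have wle: "cmod w \<le> r" unfolding wn using power_decreasing[of 1 k r] r d16 k by simp
  have wrcis: "w = rcis (r ^ k) (real k * \<phi>)"
    unfolding w_def using rcis_cmod_Arg[of y] DeMoivre2[of r \<phi> k] by (simp add: r_def \<phi>_def)
  have rew: "Re w = cmod w * cos (real k * \<phi>)" "Im w = cmod w * sin (real k * \<phi>)"
    unfolding wn by (simp_all add: wrcis)
  have k\<phi>: "\<bar>real k * \<phi>\<bar> \<le> 1 / 2"
  proof -
    have "real k * \<bar>\<phi>\<bar> \<le> real k * \<theta>" using y(3) kr unfolding \<phi>_def by (intro mult_left_mono) auto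
    then have "real k * \<bar>\<phi>\<bar> \<le> 1 / 2" using k\<theta>(2) by linarith
    then show ?thesis by (simp add: abs_mult)
  qed
  have "cos (real k * \<phi>) \<ge> 7 / 8"
  proof -
    have "(real k * \<phi>)\<^sup>2 \<le> (1/2)\<^sup>2" using k\<phi> by (metis abs_le_square_iff abs_of_nonneg zero_le_divide_1_iff zero_le_numeral)
    then show ?thesis using cos_ge_quadratic[of "real k * \<phi>"] by (simp add: power2_eq_square)
  qed
  then have Rew: "Re w \<ge> 7 / 8 * cmod w" unfolding rew using wpos by simp
  define q where "q = y' / y"
  have yq: "y' = y * q" using y by (simp add: q_def)
  define e where "e = q - (1 - w)"
  have qe: "q = 1 - w + e" by (simp add: e_def)
  have e: "cmod e \<le> C * r * cmod w"
  proof -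
    have "y * e = y' - (y - y ^ Suc k)" by (simp add: e_def yq w_def algebra_simps)
    then have "r * cmod e \<le> C * r ^ (k + 2)" using y' unfolding r_def by (metis norm_mult)
    also have "\<dots> = r * (C * r * cmod w)" by (simp add: wn)
    finally show ?thesis using r by simp
  qed
  have e1: "cmod e \<le> \<sigma> / 2 * cmod w" "cmod e \<le> 1 / 10 * cmod w"
  proof -
    have "C * r \<le> C * \<delta>" using r \<delta>(5) by (intro mult_left_mono) auto
    then have "C * r * cmod w \<le> \<sigma> / 2 * cmod w" "C * r * cmod w \<le> 1 / 10 * cmod w"
      using \<delta>(3,4) wpos by (auto intro!: mult_right_mono)
    with e show "cmod e \<le> \<sigma> / 2 * cmod w" "cmod e \<le> 1 / 10 * cmod w" by linarith+
  qed
  have q1: "cmod (q - 1) \<le> 2 * cmod w"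
  proof -
    have "cmod (q - 1) = cmod (e - w)" by (simp add: qe)
    also have "\<dots> \<le> cmod e + cmod w" by (rule norm_triangle_ineq4)
    finally show ?thesis using e1(2) wpos by linarith
  qed
  have q1': "cmod (q - 1) \<le> 2 * \<delta>" "cmod (q - 1) < 1/2" using q1 wle r d16 by linarith+
  have q0: "q \<noteq> 0" using q1'(2) by auto
  show y'0: "y' \<noteq> 0" using yq y q0 by simp
  have "cmod (1 - w) \<le> 1 - 7 / 10 * cmod w"
  proof -
    have w16: "cmod w \<le> 1 / 16" using wle r d16 by linarith
    have "(cmod (1 - w))\<^sup>2 = 1 - 2 * Re w + (cmod w)\<^sup>2"
    proof -
      have "(cmod (1 - w))\<^sup>2 = (1 - Re w)\<^sup>2 + (Im w)\<^sup>2" by (simp add: cmod_power2)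
      moreover have "(cmod w)\<^sup>2 = (Re w)\<^sup>2 + (Im w)\<^sup>2" by (simp add: cmod_power2)
      ultimately show ?thesis by (simp add: power2_eq_square algebra_simps)
    qed
    also have "\<dots> \<le> 1 - 7 / 4 * cmod w + (cmod w)\<^sup>2" using Rew by simp
    also have "\<dots> \<le> (1 - 7 / 10 * cmod w)\<^sup>2"
    proof -
      have "0 \<le> cmod w * (7 / 20 - 51 / 100 * cmod w)" using w16 wpos by (intro mult_nonneg_nonneg) auto
      then show ?thesis by (simp add: power2_eq_square algebra_simps)
    qed
    finally show ?thesis by (rule power2_le_imp_le) (use w16 in linarith)
  qed
  then have qn: "cmod q \<le> 1 - cmod w / 2"
    using norm_triangle_ineq[of "1 - w" e] e1(2) wpos unfolding qe by linarith
  have "cmod y' = cmod y * cmod q" by (simp add: yq norm_mult)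
  also have "\<dots> \<le> cmod y * (1 - cmod w / 2)" by (rule mult_left_mono[OF qn norm_ge_zero])
  finally show "cmod y' \<le> cmod y * (1 - cmod y ^ k / 2)" by (simp add: wn r_def)
  have Aq: "\<bar>Arg q\<bar> \<le> \<theta> / 2"
  proof -
    have "\<bar>Arg q\<bar> \<le> cmod (Ln (1 + (q - 1)))" using q0 abs_Im_le_cmod[of "Ln q"] by (simp add: Arg_eq_Im_Ln)
    also have "\<dots> \<le> 2 * cmod (q - 1)" by (rule norm_Ln_le[OF q1'(2)])
    also have "\<dots> \<le> 4 * \<delta>" using q1'(1) by simp
    also have "\<dots> \<le> \<theta> / 2" using \<delta>(2) by simp
    finally show ?thesis .
  qed
  have \<theta>: "\<theta> \<le> 1 / 2"
  proof -
    have "\<theta> * 1 \<le> \<theta> * real k" using kr \<theta>0 by (intro mult_left_mono) auto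
    with k\<theta>(2) show ?thesis by (simp add: mult.commute)
  qed
  have Ay: "\<bar>\<phi>\<bar> \<le> \<theta>" using y(3) by (simp add: \<phi>_def)
  have Ay': "Arg y' = \<phi> + Arg q"
    unfolding yq \<phi>_def
  proof (rule Arg_times)
    have "\<bar>Arg y + Arg q\<bar> \<le> 1" using Ay Aq \<theta> unfolding \<phi>_def by linarith
    then show "Arg y + Arg q \<in> {- pi<..pi}" using pi_gt3 by (auto simp: abs_le_iff)
  qed (use y q0 in auto)
  have Imq: "Im q = - (cmod w * sin (real k * \<phi>)) + Im e" by (simp add: qe rew)
  have Ime: "\<bar>Im e\<bar> \<le> \<sigma> / 2 * cmod w" using abs_Im_le_cmod[of e] e1(1) by linarith
  have \<sigma>w: "\<sigma> * cmod w > 0" using \<sigma>0 wpos by simp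
  consider "\<bar>\<phi>\<bar> \<le> \<theta> / 2" | "\<phi> > \<theta> / 2" | "\<phi> < - (\<theta> / 2)" by linarith
  then show "\<bar>Arg y'\<bar> \<le> \<theta>"
  proof cases
    case 1 then show ?thesis using Ay' Aq \<theta> by linarith
  next
    case 2
    then have "real k * \<phi> \<ge> real k * \<theta> / 2" using kr mult_left_mono[of "\<theta> / 2" \<phi> "real k"] by simp
    then have "sin (real k * \<phi>) \<ge> \<sigma>" unfolding \<sigma> using k\<phi> k\<theta> pi_gt3 by (intro sin_monotone_2pi_le) auto
    then have "cmod w * sin (real k * \<phi>) \<ge> cmod w * \<sigma>" using wpos by simp
    then have "Im q < 0" using Imq Ime \<sigma>w by (simp add: mult.commute)
    then have "Arg q < 0" using Arg_less_0[of q] by linarith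
    then show ?thesis using Ay' Aq Ay 2 \<theta> by linarith
  next
    case 3
    then have "real k * (- \<phi>) \<ge> real k * \<theta> / 2" using kr mult_left_mono[of "\<theta> / 2" "- \<phi>" "real k"] by simp
    then have "sin (real k * (- \<phi>)) \<ge> \<sigma>" unfolding \<sigma> using k\<phi> k\<theta> pi_gt3 by (intro sin_monotone_2pi_le) auto
    then have "cmod w * (- sin (real k * \<phi>)) \<ge> cmod w * \<sigma>" using wpos by (intro mult_left_mono) auto
    then have "Im q > 0" using Imq Ime \<sigma>w by (simp add: mult.commute)
    then have "Arg q \<ge> 0" using Arg_less_0[of q] by linarith
    then show ?thesis using Ay' Aq Ay 3 \<theta> by linarith
  qed
qed

text \<open>An upper companion of Bernoulli's inequality, obtained from it through (1 - v) (1 + v)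
  \<le> 1.\<close>

lemma one_minus_power_bound:
  fixes v :: real assumes "0 \<le> v" "v \<le> 1"
  shows "(1 - v) ^ M * (1 + real M * v) \<le> 1"
proof -
  have "1 + real M * v \<le> (1 + v) ^ M" using assms by (intro Bernoulli_inequality) auto
  then have "(1 - v) ^ M * (1 + real M * v) \<le> (1 - v) ^ M * (1 + v) ^ M"
    using assms by (intro mult_left_mono) auto
  also have "\<dots> = ((1 - v) * (1 + v)) ^ M" by (simp add: power_mult_distrib)
  also have "\<dots> \<le> 1" using assms by (intro power_le_one) (auto simp: algebra_simps mult_le_one)
  finally show ?thesis .
qed

text \<open>On the edge |x| = |y|^M, the modulus of x is multiplied by at least 1 - (C0 + 1/10)
  |y|^k and |y|^M by at most (1 - |y|^k / 2)^M. The choice M \<ge> 2 C0 + 6 makes the second factor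
  smaller, so edge points are expelled and \<open>expanding_region_orbit\<close> yields a trapped
  orbit. It is infinite because |y| decreases strictly.\<close>

theorem petal_orbit:
  fixes G :: "complex2 \<Rightarrow> complex2" and k M :: nat
  assumes G: "hol2m G U" and k: "k \<ge> 1" and \<theta>: "0 < \<theta>" "\<theta> \<le> 1 / (2 * real k)" and A: "A holomorphic_on ball 0 \<rho>" "\<rho> > 0"
    and C: "C \<ge> 0" "C0 \<ge> 0" "real M \<ge> 2 * C0 + 6"
    and reg: "\<And>x y. y \<noteq> 0 \<Longrightarrow> cmod y < \<rho> \<Longrightarrow> \<bar>Arg y\<bar> \<le> \<theta> \<Longrightarrow> cmod x \<le> cmod y ^ M \<Longrightarrow>
      (x, y) \<in> U \<and> cmod (snd (G (x, y)) - (y - y ^ Suc k)) \<le> C * cmod y ^ (k + 2) \<and>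
      cmod (fst (G (x, y)) - A y * x) \<le> C * cmod y ^ (M + k + 1)"
    and Aexp: "\<And>y. y \<noteq> 0 \<Longrightarrow> cmod y < \<rho> \<Longrightarrow> \<bar>Arg y\<bar> \<le> \<theta> \<Longrightarrow> cmod (A y) \<ge> 1 - C0 * cmod y ^ k"
    and \<epsilon>: "\<epsilon> > 0"
  shows "infinite_orbit_in G (ball 0 \<epsilon>)"
proof -
  define \<sigma> :: real where "\<sigma> = sin (real k * \<theta> / 2)"
  have k\<theta>: "0 < real k * \<theta>" "real k * \<theta> \<le> 1 / 2" using \<theta> k by (auto simp: field_simps)
  have \<sigma>0: "\<sigma> > 0" unfolding \<sigma>_def using pi_gt3 k\<theta> by (intro sin_gt_zero) auto
  have M: "M > 0" "real M \<ge> 1" using C by auto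
  \<comment> \<open>The entries secure, in turn, the domain of the estimates, the smallness of the
    orbit, the turning angle of one step, the sign of the imaginary part, the error bounds by 1/10,
    and c M v \<le> 1 below.\<close>
  define \<delta> where "\<delta> = Min {\<rho>, \<epsilon> / 2, \<theta> / 8, \<sigma> / (2 * (C + 1)), 1 / (10 * (C + 1)), 1 / (real M * (C0 + 1))}"
  have "\<delta> > 0" using A(2) \<epsilon> \<theta> \<sigma>0 C M by (simp add: \<delta>_def add_nonneg_pos)
  moreover have "\<delta> \<le> \<rho>" "\<delta> \<le> \<epsilon> / 2" "\<delta> \<le> \<theta> / 8" "\<delta> \<le> \<sigma> / (2 * (C + 1))" "\<delta> \<le> 1 / (10 * (C + 1))"
    "\<delta> \<le> 1 / (real M * (C0 + 1))"
    unfolding \<delta>_def by (rule Min_le; simp)+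
  ultimately have \<delta>: "\<delta> > 0" "\<delta> \<le> \<rho>" "\<delta> \<le> \<epsilon> / 2" "\<delta> \<le> \<theta> / 8" "\<delta> \<le> \<sigma> / (2 * (C + 1))"
    "\<delta> \<le> 1 / (10 * (C + 1))" "\<delta> \<le> 1 / (real M * (C0 + 1))" by blast+
  have C\<delta>: "C * \<delta> \<le> \<sigma> / 2" "C * \<delta> \<le> 1 / 10"
  proof -
    have "C * \<delta> \<le> (C + 1) * \<delta>" using \<delta>(1) by simp
    also have "(C + 1) * \<delta> \<le> (C + 1) * (\<sigma> / (2 * (C + 1)))" using \<delta>(5) C by (intro mult_left_mono) auto
    also have "\<dots> = \<sigma> / 2" using C by (simp add: field_simps)
    finally show "C * \<delta> \<le> \<sigma> / 2" .
    have "C * \<delta> \<le> (C + 1) * \<delta>" using \<delta>(1) by simp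
    also have "(C + 1) * \<delta> \<le> (C + 1) * (1 / (10 * (C + 1)))" using \<delta>(6) C by (intro mult_left_mono) auto
    also have "\<dots> = 1 / 10" using C by (simp add: field_simps)
    finally show "C * \<delta> \<le> 1 / 10" .
  qed
  have d1: "\<delta> \<le> 1 / 16"
  proof -
    have "\<theta> * 1 \<le> \<theta> * real k" using k \<theta> by (intro mult_left_mono) auto
    with \<delta>(4) k\<theta>(2) show ?thesis by (simp add: mult.commute)
  qed
  define S where "S = {y. y \<noteq> 0 \<and> cmod y < \<delta> \<and> \<bar>Arg y\<bar> \<le> \<theta>}"
  define P where "P = {p. snd p \<in> S \<and> cmod (fst p) \<le> cmod (snd p) ^ M}"
  have reg': "p \<in> U" "cmod (snd (G p) - (snd p - snd p ^ Suc k)) \<le> C * cmod (snd p) ^ (k + 2)"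
      "cmod (fst (G p) - A (snd p) * fst p) \<le> C * cmod (snd p) ^ (M + k + 1)" if "p \<in> P" for p
    using reg[of "snd p" "fst p"] that \<delta>(2) by (auto simp: P_def S_def)
  have sec: "snd (G p) \<noteq> 0" "cmod (snd (G p)) \<le> cmod (snd p) * (1 - cmod (snd p) ^ k / 2)" "\<bar>Arg (snd (G p))\<bar> \<le> \<theta>"
    if p: "p \<in> P" for p
    using parabolic_sector[OF k \<theta> \<sigma>_def \<delta>(1,4) C\<delta> C(1) _ _ _ reg'(2)[OF p]] p by (auto simp: P_def S_def)
  have dec: "cmod (snd (G p)) < cmod (snd p)" if p: "p \<in> P" for p
  proof -
    have "cmod (snd p) > 0" using p by (auto simp: P_def S_def)
    then have "cmod (snd p) * (1 - cmod (snd p) ^ k / 2) < cmod (snd p) * 1" by (intro mult_strict_left_mono) auto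
    then show ?thesis using sec(2)[OF p] by linarith
  qed
  have "\<exists>p. \<forall>n. (G ^^ n) p \<in> {p. snd p \<in> S \<and> cmod (fst p) \<le> cmod (snd p) ^ M}"
  proof (rule expanding_region_orbit[OF G _ A(1) open_ball])
    show "{p. snd p \<in> S \<and> cmod (fst p) \<le> cmod (snd p) ^ M} \<subseteq> U" using reg'(1) by (auto simp: P_def)
    show "S \<subseteq> ball 0 \<rho>" using \<delta>(2) by (auto simp: S_def)
    show "0 \<notin> S" by (simp add: S_def)
    have "Arg (complex_of_real (\<delta> / 2)) = 0" unfolding Arg_of_real using \<delta>(1) by simp
    then show "complex_of_real (\<delta> / 2) \<in> S" using \<delta>(1) \<theta> by (simp add: S_def del: of_real_divide)
    fix p assume "p \<in> {p. snd p \<in> S \<and> cmod (fst p) \<le> cmod (snd p) ^ M}"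
    then have p: "p \<in> P" by (simp add: P_def)
    have pS: "snd p \<in> S" using p by (simp add: P_def)
    show "snd (G p) \<in> S" using sec[OF p] dec[OF p] pS by (auto simp: S_def)
    assume xM: "cmod (fst p) = cmod (snd p) ^ M"
    define r v where "r = cmod (snd p)" and "v = r ^ k"
    have r: "0 < r" "r < \<delta>" using pS by (auto simp: r_def S_def)
    have v: "0 < v" "v \<le> r" using r d1 k power_decreasing[of 1 k r] by (auto simp: v_def)
    have Cr: "C * r \<le> 1 / 10" using C\<delta>(2) mult_left_mono[OF less_imp_le[OF r(2)] C(1)] by linarith
    \<comment> \<open>The summand 1/10 pays for the error term, since C r \<le> 1/10.\<close>
    define c where "c = C0 + 1 / 10"
    have rM: "r ^ M > 0" using r by simp
    have err: "cmod (fst (G p) - A (snd p) * fst p) \<le> (1 / 10) * v * r ^ M"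
    proof -
      have "cmod (fst (G p) - A (snd p) * fst p) \<le> C * r ^ (M + k + 1)" using reg'(3)[OF p] by (simp add: r_def)
      also have "\<dots> = (C * r) * (v * r ^ M)" by (simp add: v_def power_add)
      also have "\<dots> \<le> (1 / 10) * (v * r ^ M)" using Cr v rM by (intro mult_right_mono) auto
      finally show ?thesis by simp
    qed
    have "cmod (A (snd p) * fst p) \<ge> (1 - C0 * v) * r ^ M"
      using Aexp[of "snd p"] pS \<delta>(2) rM xM unfolding norm_mult by (auto simp: S_def v_def r_def intro!: mult_right_mono)
    then have lower: "cmod (fst (G p)) \<ge> (1 - c * v) * r ^ M"
      using err norm_triangle_ineq2[of "A (snd p) * fst p" "A (snd p) * fst p - fst (G p)"]
      by (simp add: c_def algebra_simps norm_minus_commute)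
    have cMv: "c * (real M * v) \<le> 1"
    proof -
      have "c * (real M * v) \<le> (C0 + 1) * (real M * (1 / (real M * (C0 + 1))))"
        using v r \<delta>(7) C M by (intro mult_mono) (auto simp: c_def)
      also have "\<dots> = (real M * (C0 + 1)) / (real M * (C0 + 1))" by simp
      also have "\<dots> = 1" by (rule divide_self) (use C M in auto)
      finally show ?thesis .
    qed
    have up: "cmod (snd (G p)) ^ M \<le> (1 - v / 2) ^ M * r ^ M"
    proof -
      have "cmod (snd (G p)) ^ M \<le> (r * (1 - v / 2)) ^ M"
        using sec(2)[OF p] by (intro power_mono) (auto simp: r_def v_def)
      then show ?thesis by (simp add: power_mult_distrib mult.commute)
    qed
    have bern: "(1 - v / 2) ^ M * (1 + real M * (v / 2)) \<le> 1"
      by (rule one_minus_power_bound) (use v r d1 in auto)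
    \<comment> \<open>By c M v \<le> 1 the bracket below is at least M / 2 - c - 1/2, which is
      positive for M \<ge> 2 C0 + 6.\<close>
    have gt: "(1 - c * v) * (1 + real M * (v / 2)) > 1"
    proof -
      have "(1 - c * v) * (1 + real M * (v / 2)) = 1 + v * (real M / 2 - c - c * (real M * v) / 2)"
        by (simp add: field_simps)
      moreover have "real M / 2 - c - c * (real M * v) / 2 > 0" using cMv C unfolding c_def by linarith
      ultimately show ?thesis using v by simp
    qed
    have "(1 - v / 2) ^ M < 1 - c * v"
    proof -
      have pos: "1 + real M * (v / 2) > 0" using v by (simp add: add_pos_nonneg)
      have "(1 - v / 2) ^ M * (1 + real M * (v / 2)) < (1 - c * v) * (1 + real M * (v / 2))" using bern gt by linarith
      then show ?thesis using pos by simp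
    qed
    then have "(1 - v / 2) ^ M * r ^ M < (1 - c * v) * r ^ M" using rM by simp
    then have 1: "cmod (fst (G p)) > cmod (snd (G p)) ^ M" using up lower by linarith
    have cv: "c * v \<le> 1 / 2"
    proof -
      have "2 * (c * v) \<le> c * (real M * v)" using C v M by (simp add: c_def mult_le_cancel_left mult_right_mono)
      then show ?thesis using cMv by linarith
    qed
    have "(1 / 10) * v * r ^ M \<le> (1 - c * v) * r ^ M / 2"
    proof -
      have "(1 - c * v) / 2 \<ge> 1 / 4" using cv by simp
      moreover have "v \<le> 1 / 16" using v r d1 by linarith
      ultimately have "(1 / 10) * v \<le> (1 - c * v) / 2" by linarith
      then show ?thesis using mult_right_mono[OF _ less_imp_le[OF rM], of "(1 / 10) * v" "(1 - c * v) / 2"] by simp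
    qed
    then have "cmod (fst (G p) - A (snd p) * fst p) \<le> cmod (fst (G p)) / 2" using err lower by linarith
    with 1 show "cmod (fst (G p)) > cmod (snd (G p)) ^ M \<and> cmod (fst (G p) - A (snd p) * fst p) \<le> cmod (fst (G p)) / 2" by simp
  qed
  then obtain p where p: "\<And>n. (G ^^ n) p \<in> P" by (auto simp: P_def)
  have "(G ^^ n) p \<in> ball 0 \<epsilon>" for n
  proof -
    define x y where "x = fst ((G ^^ n) p)" and "y = snd ((G ^^ n) p)"
    have y: "cmod y < \<delta>" "cmod x \<le> cmod y ^ M" using p[of n] by (auto simp: P_def S_def x_def y_def)
    have "cmod y ^ M \<le> cmod y" using power_decreasing[of 1 M "cmod y"] y(1) d1 M by simp
    then have "norm (x, y) < \<epsilon>" using norm_Pair_le[of x y] y \<delta>(3) by linarith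
    then show ?thesis by (simp add: x_def y_def)
  qed
  moreover have "infinite (range (\<lambda>n. (G ^^ n) p))"
  proof -
    have "cmod (snd ((G ^^ n) p)) < cmod (snd ((G ^^ m) p))" if "m < n" for m n
      using lift_Suc_mono_less[of "\<lambda>n. - cmod (snd ((G ^^ n) p))", OF _ that] dec[OF p] by simp
    then have "inj (\<lambda>n. (G ^^ n) p)" by (intro injI) (metis linorder_neqE_nat less_irrefl)
    then show ?thesis by (rule range_inj_infinite)
  qed
  ultimately show ?thesis by blast
qed

section \<open>Orders of vanishing and approximate invariant curves\<close>

lemma continuous_on_open_tendsto:
  fixes f :: "'a::t2_space \<Rightarrow> 'b::topological_space"
  assumes "continuous_on S f" "open S" "x \<in> S" shows "(f \<longlongrightarrow> f x) (nhds x)"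
proof -
  have "isCont f x" using assms continuous_on_eq_continuous_at by blast
  then show ?thesis using tendsto_at_iff_tendsto_nhds[of f x] by (simp add: isCont_def)
qed

lemma holomorphic_on_tendsto: "f holomorphic_on S \<Longrightarrow> open S \<Longrightarrow> x \<in> S \<Longrightarrow> (f \<longlongrightarrow> f x) (nhds x)"
  by (rule continuous_on_open_tendsto[OF holomorphic_on_imp_continuous_on])

lemma hol2_lipschitz:
  assumes f: "hol2 f U" "0 \<in> U"
  shows "\<exists>r>0. \<exists>C\<ge>0. \<forall>x x' y y'. cmod x \<le> r \<longrightarrow> cmod x' \<le> r \<longrightarrow> cmod y \<le> r \<longrightarrow> cmod y' \<le> r \<longrightarrow>
    cmod (f (x, y) - f (x', y')) \<le> C * (cmod (x - x') + cmod (y - y'))"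
proof -
  obtain r1 M1 where 1: "r1 > 0" "M1 > 0" "cball 0 r1 \<times> cball 0 r1 \<subseteq> U"
    "\<And>x y. x \<in> cball 0 r1 \<Longrightarrow> y \<in> cball 0 r1 \<Longrightarrow> cmod (dx f (x, y)) \<le> M1"
    by (rule hol2_bidisc[OF hol2_dx[OF f(1)] f(2), unfolded zero_prod_def fst_conv snd_conv]) (rule that; assumption)
  obtain r2 M2 where 2: "r2 > 0" "M2 > 0" "cball 0 r2 \<times> cball 0 r2 \<subseteq> U"
    "\<And>x y. x \<in> cball 0 r2 \<Longrightarrow> y \<in> cball 0 r2 \<Longrightarrow> cmod (dy f (x, y)) \<le> M2"
    by (rule hol2_bidisc[OF hol2_dy[OF f(1)] f(2), unfolded zero_prod_def fst_conv snd_conv]) (rule that; assumption)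
  define r where "r = min r1 r2"
  have r: "r > 0" "r \<le> r1" "r \<le> r2" using 1 2 by (auto simp: r_def)
  have inU: "(x, y) \<in> U" if "cmod x \<le> r" "cmod y \<le> r" for x y using 1(3) that r by auto
  have X: "cmod (f (x, y) - f (x', y)) \<le> M1 * cmod (x - x')" if "cmod x \<le> r" "cmod x' \<le> r" "cmod y \<le> r" for x x' y
  proof (rule field_differentiable_bound[of "cball 0 r" "\<lambda>x. f (x, y)" "\<lambda>x. dx f (x, y)"])
    fix z :: complex assume z: "z \<in> cball 0 r"
    show "((\<lambda>x. f (x, y)) has_field_derivative dx f (z, y)) (at z within cball 0 r)"
      by (rule has_field_derivative_at_within, rule has_derivative_slice_x[OF hol2_has_derivative[OF f(1)]], rule inU) (use z that in auto)
    show "cmod (dx f (z, y)) \<le> M1" using 1(4)[of z y] z that r by auto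
  qed (use that in auto)
  have Y: "cmod (f (x, y) - f (x, y')) \<le> M2 * cmod (y - y')" if "cmod x \<le> r" "cmod y \<le> r" "cmod y' \<le> r" for x y y'
  proof (rule field_differentiable_bound[of "cball 0 r" "\<lambda>y. f (x, y)" "\<lambda>y. dy f (x, y)"])
    fix z :: complex assume z: "z \<in> cball 0 r"
    show "((\<lambda>y. f (x, y)) has_field_derivative dy f (x, z)) (at z within cball 0 r)"
      by (rule has_field_derivative_at_within, rule has_derivative_slice_y[OF hol2_has_derivative[OF f(1)]], rule inU) (use z that in auto)
    show "cmod (dy f (x, z)) \<le> M2" using 2(4)[of x z] z that r by auto
  qed (use that in auto)
  have "cmod (f (x, y) - f (x', y')) \<le> (M1 + M2) * (cmod (x - x') + cmod (y - y'))"
    if "cmod x \<le> r" "cmod x' \<le> r" "cmod y \<le> r" "cmod y' \<le> r" for x x' y y'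
  proof -
    have "f (x, y) - f (x', y') = (f (x, y) - f (x', y)) + (f (x', y) - f (x', y'))" by simp
    also have "cmod \<dots> \<le> M1 * cmod (x - x') + M2 * cmod (y - y')"
      by (rule norm_triangle_mono[OF X Y]) (use that in auto)
    also have "\<dots> \<le> (M1 + M2) * cmod (x - x') + (M1 + M2) * cmod (y - y')"
      using 1 2 by (intro add_mono mult_right_mono) auto
    finally show ?thesis by (simp add: distrib_left)
  qed
  moreover have "M1 + M2 \<ge> 0" using 1 2 by simp
  ultimately show ?thesis using r(1) by blast
qed

text \<open>The mean value theorem is applied to f(z, y) - \<open>dx f (0, y)\<close> z. The
  derivative is taken on the axis and not at x because the expanding model uses a factor that
  depends on y alone.\<close>

lemma hol2_dx_lipschitz:
  assumes f: "hol2 f U" "0 \<in> U"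
  shows "\<exists>r>0. \<exists>C\<ge>0. cball 0 r \<times> cball 0 r \<subseteq> U \<and>
    (\<forall>x h y. cmod x \<le> r \<longrightarrow> cmod (x + h) \<le> r \<longrightarrow> cmod y \<le> r \<longrightarrow>
       cmod (f (x + h, y) - f (x, y) - dx f (0, y) * h) \<le> C * cmod h * (cmod x + cmod h)) \<and>
    (\<forall>y. cmod y \<le> r \<longrightarrow> cmod (dx f (0, y) - dx f (0, 0)) \<le> C * cmod y)"
proof -
  note g = hol2_dx[OF f(1)]
  obtain r1 C where C: "r1 > 0" "C \<ge> 0" "\<And>x x' y y'. cmod x \<le> r1 \<Longrightarrow> cmod x' \<le> r1 \<Longrightarrow> cmod y \<le> r1 \<Longrightarrow> cmod y' \<le> r1 \<Longrightarrow>
      cmod (dx f (x, y) - dx f (x', y')) \<le> C * (cmod (x - x') + cmod (y - y'))"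
    using hol2_lipschitz[OF g f(2)] by blast
  obtain r2 where r2: "r2 > 0" "cball (fst (0::complex2)) r2 \<times> cball (snd (0::complex2)) r2 \<subseteq> U"
    by (rule bidisc_in_open[OF hol2_open[OF f(1)] f(2)]) (rule that; assumption)
  define r where "r = min r1 r2"
  have rC: "r > 0" "C \<ge> 0" "r \<le> r1" "r \<le> r2" using C r2 by (auto simp: r_def)
  have sub: "cball 0 r \<times> cball 0 r \<subseteq> U"
  proof -
    have "cball (0::complex) r \<times> cball (0::complex) r \<subseteq> cball 0 r2 \<times> cball 0 r2" using rC by auto
    with r2(2) show ?thesis by simp
  qed
  have dX: "((\<lambda>x. u (x, y)) has_field_derivative dx u (x, y)) (at x)" if "hol2 u U" "cmod x \<le> r" "cmod y \<le> r" for u x y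
    by (rule has_derivative_slice_x[OF hol2_has_derivative[OF that(1)]]) (use sub that in auto)
  have lx: "cmod (dx f (x, y) - dx f (0, y)) \<le> C * cmod x" if "cmod x \<le> r" "cmod y \<le> r" for x y
    using C(3)[of x 0 y y] that rC by simp
  have ly: "cmod (dx f (0, y) - dx f (0, 0)) \<le> C * cmod y" if "cmod y \<le> r" for y
    using C(3)[of 0 0 y 0] that rC by simp
  have main: "cmod (f (x + h, y) - f (x, y) - dx f (0, y) * h) \<le> C * cmod h * (cmod x + cmod h)"
    if "cmod x \<le> r" "cmod (x + h) \<le> r" "cmod y \<le> r" for x h y
  proof -
    let ?S = "closed_segment x (x + h)"
    have S: "cmod z \<le> r" "cmod z \<le> cmod x + cmod h" if "z \<in> ?S" for z
    proof -
      have "?S \<subseteq> cball 0 r" by (rule closed_segment_subset) (use \<open>cmod x \<le> r\<close> \<open>cmod (x + h) \<le> r\<close> in auto)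
      then show "cmod z \<le> r" using that by auto
      have "?S \<subseteq> cball 0 (cmod x + cmod h)" by (rule closed_segment_subset) (auto intro: norm_triangle_ineq)
      then show "cmod z \<le> cmod x + cmod h" using that by auto
    qed
    have "cmod ((f (x + h, y) - dx f (0, y) * (x + h)) - (f (x, y) - dx f (0, y) * x)) \<le> C * (cmod x + cmod h) * cmod ((x + h) - x)"
    proof (rule field_differentiable_bound[of ?S "\<lambda>z. f (z, y) - dx f (0, y) * z" "\<lambda>z. dx f (z, y) - dx f (0, y)"])
      fix z assume z: "z \<in> ?S"
      have "((\<lambda>z. f (z, y) - dx f (0, y) * z) has_field_derivative dx f (z, y) - dx f (0, y)) (at z)"
        using dX[OF f(1) S(1)[OF z] \<open>cmod y \<le> r\<close>] by (auto intro!: derivative_eq_intros)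
      then show "((\<lambda>z. f (z, y) - dx f (0, y) * z) has_field_derivative dx f (z, y) - dx f (0, y)) (at z within ?S)"
        by (rule has_field_derivative_at_within)
      have "cmod (dx f (z, y) - dx f (0, y)) \<le> C * cmod z" using lx[OF S(1)[OF z] \<open>cmod y \<le> r\<close>] by simp
      also have "\<dots> \<le> C * (cmod x + cmod h)" using S(2)[OF z] rC by (intro mult_left_mono) auto
      finally show "cmod (dx f (z, y) - dx f (0, y)) \<le> C * (cmod x + cmod h)" .
    qed auto
    then show ?thesis by (simp add: algebra_simps)
  qed
  show ?thesis
    by (intro exI[of _ r] conjI rC(1) exI[of _ C] rC(2) sub allI impI main; use ly in simp)
qed

text \<open>The order symbol O(y^N). The neighbourhood contains 0, so N \<ge> 1 forces g 0 =
  0.\<close>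

definition vanishes :: "nat \<Rightarrow> (complex \<Rightarrow> complex) \<Rightarrow> bool" where
  "vanishes N g \<longleftrightarrow> (\<exists>C\<ge>0. \<forall>\<^sub>F y in nhds 0. cmod (g y) \<le> C * cmod y ^ N)"

lemma eventually_cmod_le: "r > 0 \<Longrightarrow> \<forall>\<^sub>F y in nhds (0::complex). cmod y \<le> r"
  unfolding eventually_nhds_metric by (intro exI[of _ r]) auto

lemma eventually_cmod_less: "r > 0 \<Longrightarrow> \<forall>\<^sub>F y in nhds (0::complex). cmod y < r"
  unfolding eventually_nhds_metric by (intro exI[of _ r]) auto

lemma vanishesI: "\<forall>\<^sub>F y in nhds 0. cmod (g y) \<le> C * cmod y ^ N \<Longrightarrow> vanishes N g"
  unfolding vanishes_def
proof (intro exI[of _ "\<bar>C\<bar>"] conjI)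
  assume "\<forall>\<^sub>F y in nhds 0. cmod (g y) \<le> C * cmod y ^ N"
  then show "\<forall>\<^sub>F y in nhds 0. cmod (g y) \<le> \<bar>C\<bar> * cmod y ^ N"
  proof eventually_elim
    case (elim y)
    have "C * cmod y ^ N \<le> \<bar>C\<bar> * cmod y ^ N" by (intro mult_right_mono) auto
    with elim show ?case by linarith
  qed
qed simp

lemma vanishes_add: "vanishes N f \<Longrightarrow> vanishes N g \<Longrightarrow> vanishes N (\<lambda>y. f y + g y)"
proof -
  assume "vanishes N f" "vanishes N g"
  then obtain C D where "\<forall>\<^sub>F y in nhds 0. cmod (f y) \<le> C * cmod y ^ N" "\<forall>\<^sub>F y in nhds 0. cmod (g y) \<le> D * cmod y ^ N"
    by (auto simp: vanishes_def)
  then have "\<forall>\<^sub>F y in nhds 0. cmod (f y + g y) \<le> (C + D) * cmod y ^ N"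
  proof eventually_elim
    case (elim y) then show ?case using norm_triangle_ineq[of "f y" "g y"] by (simp add: algebra_simps)
  qed
  then show ?thesis by (rule vanishesI)
qed

lemma vanishes_cmult: assumes "vanishes N f" shows "vanishes N (\<lambda>y. c * f y)"
proof -
  obtain C where "\<forall>\<^sub>F y in nhds 0. cmod (f y) \<le> C * cmod y ^ N" using assms by (auto simp: vanishes_def)
  then have "\<forall>\<^sub>F y in nhds 0. cmod (c * f y) \<le> (cmod c * C) * cmod y ^ N"
    by eventually_elim (simp add: norm_mult mult_left_mono mult.assoc)
  then show ?thesis by (rule vanishesI)
qed

lemma vanishes_diff: "vanishes N f \<Longrightarrow> vanishes N g \<Longrightarrow> vanishes N (\<lambda>y. f y - g y)"
  using vanishes_add[of N f "\<lambda>y. (-1) * g y"] vanishes_cmult[of N g "-1"] by simp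

lemma vanishes_mono: assumes "vanishes N f" "M \<le> N" shows "vanishes M f"
proof -
  obtain C where C: "C \<ge> 0" "\<forall>\<^sub>F y in nhds 0. cmod (f y) \<le> C * cmod y ^ N" using assms by (auto simp: vanishes_def)
  have "\<forall>\<^sub>F y in nhds 0. cmod (f y) \<le> C * cmod y ^ M"
    using C(2) eventually_cmod_le[OF zero_less_one]
  proof eventually_elim
    case (elim y)
    then have "C * cmod y ^ N \<le> C * cmod y ^ M" using assms(2) C by (intro mult_left_mono power_decreasing) auto
    with elim show ?case by linarith
  qed
  then show ?thesis by (rule vanishesI)
qed

lemma vanishes_cong: "\<forall>\<^sub>F y in nhds 0. f y = g y \<Longrightarrow> vanishes N f \<Longrightarrow> vanishes N g"
proof -
  assume e: "\<forall>\<^sub>F y in nhds 0. f y = g y" and "vanishes N f"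
  then obtain C where "\<forall>\<^sub>F y in nhds 0. cmod (f y) \<le> C * cmod y ^ N" by (auto simp: vanishes_def)
  with e have "\<forall>\<^sub>F y in nhds 0. cmod (g y) \<le> C * cmod y ^ N" by eventually_elim simp
  then show ?thesis by (rule vanishesI)
qed

text \<open>Cauchy's estimate kills the Taylor coefficients below N; c is the N-th one, and the
  Taylor remainder is of order N + 1.\<close>

lemma vanishes_leading:
  assumes g: "g holomorphic_on S" "open S" "0 \<in> S" "vanishes N g"
  shows "\<exists>c. vanishes (Suc N) (\<lambda>y. g y - c * y ^ N)"
proof -
  obtain C where C: "C \<ge> 0" "\<forall>\<^sub>F y in nhds 0. cmod (g y) \<le> C * cmod y ^ N" using g(4) by (auto simp: vanishes_def)
  then obtain d where d: "d > 0" "\<And>y. cmod y < d \<Longrightarrow> cmod (g y) \<le> C * cmod y ^ N"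
    by (auto simp: eventually_nhds_metric)
  obtain r0 where r0: "r0 > 0" "cball 0 r0 \<subseteq> S" using g(2,3) open_contains_cball by blast
  define r where "r = min r0 (min (d / 2) 1)"
  have r: "r > 0" "r \<le> r0" "r < d" "r \<le> 1" using d r0 by (auto simp: r_def)
  have sub: "cball 0 r \<subseteq> S" using r r0 by auto
  define a where "a k = (deriv ^^ k) g 0 / fact k" for k
  have a0: "a k = 0" if k: "k < N" for k
  proof (rule ccontr)
    assume nz: "a k \<noteq> 0"
    have b: "cmod (a k) \<le> C * s" if s: "0 < s" "s \<le> r" for s
    proof -
      have "cmod (a k) \<le> (C * s ^ N) / s ^ k"
        unfolding a_def
      proof (rule cauchy_coeff_bound[OF g(1,2) _ s(1)])
        show "cball 0 s \<subseteq> S" using sub s by auto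
        fix z :: complex assume z: "z \<in> cball 0 s"
        then have "cmod (g z) \<le> C * cmod z ^ N" using d(2)[of z] s r by auto
        also have "\<dots> \<le> C * s ^ N" using z C by (intro mult_left_mono power_mono) auto
        finally show "cmod (g z) \<le> C * s ^ N" .
      qed
      also have "\<dots> = C * s ^ (N - k)" using s k by (simp add: power_diff)
      also have "\<dots> \<le> C * s" using s r k C power_decreasing[of 1 "N - k" s] by (intro mult_left_mono) auto
      finally show ?thesis .
    qed
    define s where "s = min r (cmod (a k) / (2 * (C + 1)))"
    have s: "0 < s" "s \<le> r" "s \<le> cmod (a k) / (2 * (C + 1))" using nz C r by (auto simp: s_def)
    have "cmod (a k) \<le> C * s" by (rule b) (use s in auto)
    also have "\<dots> \<le> (C + 1) * (cmod (a k) / (2 * (C + 1)))" using s C by (intro mult_mono) auto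
    also have "\<dots> = cmod (a k) / 2" using C by (simp add: field_simps)
    finally show False using nz by simp
  qed
  have "\<forall>\<^sub>F y in nhds 0. cmod (g y - a N * y ^ N) \<le> (2 * C / r ^ Suc N) * cmod y ^ Suc N"
    using eventually_cmod_le[OF half_gt_zero[OF r(1)]]
  proof eventually_elim
    case (elim y)
    have "cmod (g (0 + y) - (\<Sum>k<Suc N. (deriv ^^ k) g 0 / fact k * y ^ k)) \<le> 2 * C * (cmod y / r) ^ Suc N"
    proof (rule taylor_remainder[OF g(1,2) sub r(1)])
      fix z :: complex assume z: "z \<in> cball 0 r"
      then have "cmod (g z) \<le> C * cmod z ^ N" using d(2)[of z] r by auto
      also have "\<dots> \<le> C * 1" using z r C by (intro mult_left_mono power_le_one) auto
      finally show "cmod (g z) \<le> C" by simp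
    qed (rule elim)
    moreover have "(\<Sum>k<Suc N. (deriv ^^ k) g 0 / fact k * y ^ k) = a N * y ^ N"
      using a0 by (simp add: a_def)
    ultimately show ?case by (simp add: power_divide)
  qed
  then show ?thesis by (blast intro: vanishesI)
qed

text \<open>Candidates for invariant curves over the y-axis. The factor z^(k + 1) matches the order
  of F1 on the axis and makes the derivative O(|z|^k).\<close>

definition flatpoly :: "nat \<Rightarrow> complex poly \<Rightarrow> complex \<Rightarrow> complex" where
  "flatpoly k p z = z ^ Suc k * poly p z"

lemma flatpoly_bounds:
  "\<exists>L\<ge>0. (\<forall>a. cmod a \<le> 1 \<longrightarrow> cmod (flatpoly k p a) \<le> L * cmod a ^ Suc k) \<and>
    (\<forall>a b R. cmod a \<le> R \<longrightarrow> cmod b \<le> R \<longrightarrow> R \<le> 1 \<longrightarrow> cmod (flatpoly k p a - flatpoly k p b) \<le> L * R ^ k * cmod (a - b))"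
proof -
  have "compact (poly p ` cball 0 1 \<union> poly (pderiv p) ` cball 0 1)"
    by (intro compact_Un compact_continuous_image compact_cball continuous_intros)
  then obtain B where B: "B > 0" "\<And>z. z \<in> poly p ` cball 0 1 \<union> poly (pderiv p) ` cball 0 1 \<Longrightarrow> cmod z \<le> B"
    using compact_imp_bounded bounded_pos by (metis (mono_tags, lifting))
  have b1: "cmod (poly p z) \<le> B" and b2: "cmod (poly (pderiv p) z) \<le> B" if "cmod z \<le> 1" for z
    using B(2) that by auto
  define L where "L = (real k + 2) * B"
  have LB: "B \<le> L" "L \<ge> 0" using B(1) by (auto simp: L_def algebra_simps)
  have d: "(flatpoly k p has_field_derivative (of_nat (Suc k) * z ^ k * poly p z + z ^ Suc k * poly (pderiv p) z)) (at z)" for z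
  proof -
    have "((\<lambda>z. z ^ Suc k) has_field_derivative of_nat (Suc k) * z ^ k) (at z)"
      using DERIV_power[OF DERIV_ident, of "Suc k" z UNIV] by simp
    from DERIV_mult[OF this poly_DERIV[of p z]] show ?thesis
      unfolding flatpoly_def [abs_def] by (simp only: mult.commute add.commute)
  qed
  have db: "cmod (of_nat (Suc k) * z ^ k * poly p z + z ^ Suc k * poly (pderiv p) z) \<le> L * cmod z ^ k" if z: "cmod z \<le> 1" for z
  proof -
    have "cmod (of_nat (Suc k) * z ^ k * poly p z + z ^ Suc k * poly (pderiv p) z) \<le>
      real (Suc k) * cmod z ^ k * cmod (poly p z) + cmod z ^ Suc k * cmod (poly (pderiv p) z)"
      by (rule order_trans[OF norm_triangle_ineq]) (simp add: norm_mult norm_power del: of_nat_Suc)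
    also have "\<dots> \<le> real (Suc k) * cmod z ^ k * B + cmod z ^ k * B"
    proof (intro add_mono mult_mono b1 b2 z)
      show "cmod z ^ Suc k \<le> cmod z ^ k" using z by (intro power_decreasing) auto
    qed (use B in auto)
    also have "\<dots> = L * cmod z ^ k" by (simp add: L_def algebra_simps)
    finally show ?thesis .
  qed
  have "cmod (flatpoly k p a - flatpoly k p b) \<le> L * R ^ k * cmod (a - b)" if "cmod a \<le> R" "cmod b \<le> R" "R \<le> 1" for a b R
  proof (rule field_differentiable_bound[of "cball 0 R" "flatpoly k p"])
    fix z :: complex assume z: "z \<in> cball 0 R"
    show "(flatpoly k p has_field_derivative (of_nat (Suc k) * z ^ k * poly p z + z ^ Suc k * poly (pderiv p) z)) (at z within cball 0 R)"
      by (rule has_field_derivative_at_within[OF d])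
    have "L * cmod z ^ k \<le> L * R ^ k" using z LB by (intro mult_left_mono power_mono) auto
    then show "cmod (of_nat (Suc k) * z ^ k * poly p z + z ^ Suc k * poly (pderiv p) z) \<le> L * R ^ k"
      using db[of z] z that by auto
  qed (use that in auto)
  moreover have "cmod (flatpoly k p a) \<le> L * cmod a ^ Suc k" if "cmod a \<le> 1" for a
  proof -
    have "cmod (flatpoly k p a) = cmod (poly p a) * cmod a ^ Suc k" by (simp add: flatpoly_def norm_mult norm_power)
    also have "\<dots> \<le> L * cmod a ^ Suc k" using b1[OF that] LB by (intro mult_right_mono) auto
    finally show ?thesis .
  qed
  ultimately show ?thesis using LB(2) by blast
qed

lemma flatpoly_holomorphic: "flatpoly k p holomorphic_on S"
  unfolding flatpoly_def [abs_def] by (intro holomorphic_intros)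

lemma flatpoly_0 [simp]: "flatpoly k p 0 = 0" by (simp add: flatpoly_def)

text \<open>Parabolic dynamics on the axis, normalised so that the positive real half-axis attracts
  in y. To leading order a point of the axis moves off it no faster than along it.\<close>

locale center_germ =
  fixes F1 F2 :: "complex2 \<Rightarrow> complex" and U and lam :: complex and k :: nat
  assumes hol: "hol2 F1 U" "hol2 F2 U" and U0: "0 \<in> U" and k: "k \<ge> 1"
    and lam: "dx F1 0 = lam" "lam \<noteq> 1" and dx2: "dx F2 0 = 0"
    and fl1: "vanishes (Suc k) (\<lambda>y. F1 (0, y))"
    and fl2: "vanishes (k + 2) (\<lambda>y. F2 (0, y) - (y - y ^ Suc k))"
begin

lemma estimates:
  obtains r C where "r > 0" "r \<le> 1/2" "C \<ge> 0" "cball 0 r \<times> cball 0 r \<subseteq> U"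
    "\<And>x h y. cmod x \<le> r \<Longrightarrow> cmod (x + h) \<le> r \<Longrightarrow> cmod y \<le> r \<Longrightarrow> cmod (F1 (x + h, y) - F1 (x, y) - dx F1 (0, y) * h) \<le> C * cmod h * (cmod x + cmod h)"
    "\<And>y. cmod y \<le> r \<Longrightarrow> cmod (dx F1 (0, y) - lam) \<le> C * cmod y"
    "\<And>x h y. cmod x \<le> r \<Longrightarrow> cmod (x + h) \<le> r \<Longrightarrow> cmod y \<le> r \<Longrightarrow> cmod (F2 (x + h, y) - F2 (x, y)) \<le> C * cmod h * (cmod x + cmod h + cmod y)"
    "\<And>y. cmod y \<le> r \<Longrightarrow> cmod (F2 (0, y) - (y - y ^ Suc k)) \<le> C * cmod y ^ (k + 2)"
proof -
  from hol2_dx_lipschitz[OF hol(1) U0]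
  obtain r1 C1 where 1: "r1 > 0" "C1 \<ge> 0" "cball 0 r1 \<times> cball 0 r1 \<subseteq> U"
    "\<And>x h y. cmod x \<le> r1 \<Longrightarrow> cmod (x + h) \<le> r1 \<Longrightarrow> cmod y \<le> r1 \<Longrightarrow> cmod (F1 (x + h, y) - F1 (x, y) - dx F1 (0, y) * h) \<le> C1 * cmod h * (cmod x + cmod h)"
    "\<And>y. cmod y \<le> r1 \<Longrightarrow> cmod (dx F1 (0, y) - dx F1 (0, 0)) \<le> C1 * cmod y" by blast
  from hol2_dx_lipschitz[OF hol(2) U0]
  obtain r2 C2 where 2: "r2 > 0" "C2 \<ge> 0" "cball 0 r2 \<times> cball 0 r2 \<subseteq> U"
    "\<And>x h y. cmod x \<le> r2 \<Longrightarrow> cmod (x + h) \<le> r2 \<Longrightarrow> cmod y \<le> r2 \<Longrightarrow> cmod (F2 (x + h, y) - F2 (x, y) - dx F2 (0, y) * h) \<le> C2 * cmod h * (cmod x + cmod h)"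
    "\<And>y. cmod y \<le> r2 \<Longrightarrow> cmod (dx F2 (0, y) - dx F2 (0, 0)) \<le> C2 * cmod y" by blast
  obtain C3 r3 where 3: "C3 \<ge> 0" "r3 > 0" "\<And>y. cmod y < r3 \<Longrightarrow> cmod (F2 (0, y) - (y - y ^ Suc k)) \<le> C3 * cmod y ^ (k + 2)"
    using fl2 unfolding vanishes_def eventually_nhds_metric by auto
  define r C where "r = min (min r1 r2) (min (r3 / 2) (1/2))" and "C = C1 + C2 + C3"
  have r: "r > 0" "r \<le> 1/2" "r \<le> r1" "r \<le> r2" "r < r3" using 1 2 3 by (auto simp: r_def)
  have C: "C \<ge> 0" "C1 \<le> C" "C2 \<le> C" "C3 \<le> C" using 1 2 3 by (auto simp: C_def)
  show thesis
  proof (rule that[OF r(1,2) C(1)])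
    have "cball (0::complex) r \<times> cball (0::complex) r \<subseteq> cball 0 r1 \<times> cball 0 r1" using r by auto
    then show "cball 0 r \<times> cball 0 r \<subseteq> U" using 1(3) by blast
  next
    fix x h y :: complex assume a: "cmod x \<le> r" "cmod (x + h) \<le> r" "cmod y \<le> r"
    have "cmod (F1 (x + h, y) - F1 (x, y) - dx F1 (0, y) * h) \<le> C1 * (cmod h * (cmod x + cmod h))"
      using 1(4)[of x h y] a r by (simp add: mult.assoc)
    also have "\<dots> \<le> C * (cmod h * (cmod x + cmod h))" using C by (intro mult_right_mono) auto
    finally show "cmod (F1 (x + h, y) - F1 (x, y) - dx F1 (0, y) * h) \<le> C * cmod h * (cmod x + cmod h)"
      by (simp add: mult.assoc)
  next
    fix y :: complex assume a: "cmod y \<le> r"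
    have "cmod (dx F1 (0, y) - lam) \<le> C1 * cmod y" using 1(5)[of y] a r lam by (simp add: zero_prod_def)
    also have "\<dots> \<le> C * cmod y" using C by (intro mult_right_mono) auto
    finally show "cmod (dx F1 (0, y) - lam) \<le> C * cmod y" .
  next
    fix x h y :: complex assume a: "cmod x \<le> r" "cmod (x + h) \<le> r" "cmod y \<le> r"
    have i: "cmod (F2 (x + h, y) - F2 (x, y) - dx F2 (0, y) * h) \<le> C2 * cmod h * (cmod x + cmod h)"
      using 2(4)[of x h y] a r by simp
    have ii: "cmod (dx F2 (0, y) * h) \<le> C2 * cmod y * cmod h"
      using 2(5)[of y] a r dx2 by (simp add: zero_prod_def norm_mult mult_right_mono)
    have "cmod (F2 (x + h, y) - F2 (x, y)) \<le> C2 * cmod h * (cmod x + cmod h) + C2 * cmod y * cmod h"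
      using i ii norm_triangle_ineq[of "F2 (x + h, y) - F2 (x, y) - dx F2 (0, y) * h" "dx F2 (0, y) * h"] by simp
    also have "\<dots> = C2 * (cmod h * (cmod x + cmod h + cmod y))" by (simp add: algebra_simps)
    also have "\<dots> \<le> C * (cmod h * (cmod x + cmod h + cmod y))" using C by (intro mult_right_mono) auto
    finally show "cmod (F2 (x + h, y) - F2 (x, y)) \<le> C * cmod h * (cmod x + cmod h + cmod y)" by (simp add: mult.assoc)
  next
    fix y :: complex assume a: "cmod y \<le> r"
    have "cmod (F2 (0, y) - (y - y ^ Suc k)) \<le> C3 * cmod y ^ (k + 2)" using 3(3)[of y] a r by simp
    also have "\<dots> \<le> C * cmod y ^ (k + 2)" using C by (intro mult_right_mono) auto
    finally show "cmod (F2 (0, y) - (y - y ^ Suc k)) \<le> C * cmod y ^ (k + 2)" .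
  qed
qed

definition residual :: "complex poly \<Rightarrow> complex \<Rightarrow> complex" where
  "residual p y = F1 (flatpoly k p y, y) - flatpoly k p (F2 (flatpoly k p y, y))"

lemma residual_holomorphic: "\<exists>S. open S \<and> 0 \<in> S \<and> residual p holomorphic_on S"
proof -
  define S where "S = {y. (flatpoly k p y, y) \<in> U}"
  have S: "open S"
    unfolding S_def using open_vimage[OF hol2_open[OF hol(1)], of "\<lambda>y. (flatpoly k p y, y)"]
    by (simp add: vimage_def continuous_on_Pair holomorphic_on_imp_continuous_on flatpoly_holomorphic)
  have c: "(\<lambda>y. f (flatpoly k p y, y)) holomorphic_on S" if "hol2 f U" for f
    by (rule hol_compose_hol2[OF that flatpoly_holomorphic holomorphic_on_ident S]) (simp add: S_def)
  have "(\<lambda>y. flatpoly k p (F2 (flatpoly k p y, y))) holomorphic_on S"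
    using holomorphic_on_compose[OF c[OF hol(2)] flatpoly_holomorphic] by (simp add: o_def)
  then have "residual p holomorphic_on S"
    unfolding residual_def [abs_def] using c[OF hol(1)] by (intro holomorphic_intros)
  moreover have "0 \<in> S" using U0 by (simp add: S_def zero_prod_def)
  ultimately show ?thesis using S by blast
qed

text \<open>Adding s y^N to the curve changes its defect of invariance by (\<lambda> - 1) s y^N up
  to O(y^(N + 1)), because F multiplies x by \<lambda> + O(y) and moves y only by O(y^2). As
  \<lambda> \<noteq> 1, the leading term c y^N of the defect can be cancelled, degree by degree;
  convergence is not at issue.\<close>

lemma center_curve:
  assumes "N \<ge> Suc k" shows "\<exists>p. vanishes N (residual p)"
  using assms
proof (induction N rule: dec_induct)
  case base
  have "residual 0 = (\<lambda>y. F1 (0, y))" by (rule ext) (simp add: residual_def flatpoly_def)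
  then show ?case using fl1 by (metis)
next
  case (step N)
  then obtain p where p: "vanishes N (residual p)" by blast
  obtain S where S: "open S" "0 \<in> S" "residual p holomorphic_on S" using residual_holomorphic by blast
  obtain c where c: "vanishes (Suc N) (\<lambda>y. residual p y - c * y ^ N)"
    using vanishes_leading[OF S(3,1,2) p] by blast
  define s where "s = c / (1 - lam)"
  have s: "c + lam * s - s = 0" using lam(2) by (simp add: s_def field_simps)
  define n where "n = N - Suc k"
  have Nk: "N = Suc k + n" "N \<ge> 2" using step(1) k by (auto simp: n_def)
  define p' where "p' = p + monom s n"
  define \<gamma> \<delta> where "\<gamma> = flatpoly k p" and "\<delta> = flatpoly (N - 1) [:s:]"
  have \<delta>: "\<delta> y = s * y ^ N" for y using Nk(2) by (simp add: \<delta>_def flatpoly_def)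
  have \<gamma>': "flatpoly k p' y = \<gamma> y + \<delta> y" for y
    by (simp add: p'_def \<gamma>_def \<delta> flatpoly_def Nk(1) poly_monom algebra_simps power_add)
  obtain r C where rC: "r > 0" "r \<le> 1/2" "C \<ge> 0" "cball 0 r \<times> cball 0 r \<subseteq> U"
    "\<And>x h y. cmod x \<le> r \<Longrightarrow> cmod (x + h) \<le> r \<Longrightarrow> cmod y \<le> r \<Longrightarrow> cmod (F1 (x + h, y) - F1 (x, y) - dx F1 (0, y) * h) \<le> C * cmod h * (cmod x + cmod h)"
    "\<And>y. cmod y \<le> r \<Longrightarrow> cmod (dx F1 (0, y) - lam) \<le> C * cmod y"
    "\<And>x h y. cmod x \<le> r \<Longrightarrow> cmod (x + h) \<le> r \<Longrightarrow> cmod y \<le> r \<Longrightarrow> cmod (F2 (x + h, y) - F2 (x, y)) \<le> C * cmod h * (cmod x + cmod h + cmod y)"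
    "\<And>y. cmod y \<le> r \<Longrightarrow> cmod (F2 (0, y) - (y - y ^ Suc k)) \<le> C * cmod y ^ (k + 2)"
    by (rule estimates) (rule that; assumption)
  obtain L where L: "L \<ge> 0" "\<And>a. cmod a \<le> 1 \<Longrightarrow> cmod (\<gamma> a) \<le> L * cmod a ^ Suc k"
    "\<And>a b R. cmod a \<le> R \<Longrightarrow> cmod b \<le> R \<Longrightarrow> R \<le> 1 \<Longrightarrow> cmod (\<gamma> a - \<gamma> b) \<le> L * R ^ k * cmod (a - b)"
    unfolding \<gamma>_def using flatpoly_bounds[of k p] by blast
  obtain L' where L': "L' \<ge> 0" "\<And>a b R. cmod a \<le> R \<Longrightarrow> cmod b \<le> R \<Longrightarrow> R \<le> 1 \<Longrightarrow> cmod (\<delta> a - \<delta> b) \<le> L' * R ^ (N - 1) * cmod (a - b)"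
    unfolding \<delta>_def using flatpoly_bounds[of "N - 1" "[:s:]"] by blast
  \<comment> \<open>The bound by 1 / (L + |s| + 1) gives |\<gamma>(y)| + |\<delta>(y)| \<le> |y|,
    and the one by 1 / (4 C + 2) keeps the second coordinate of the image within 2 |y|.\<close>
  define \<rho> where "\<rho> = min r (min (1 / (L + cmod s + 1)) (1 / (4 * C + 2)))"
  have \<rho>: "\<rho> > 0" "\<rho> \<le> r" "\<rho> \<le> 1 / (L + cmod s + 1)" "\<rho> \<le> 1 / (4 * C + 2)"
    using rC L by (auto simp: \<rho>_def add_nonneg_pos)
  define K where "K = 2 * C * cmod s + L * (2 * C * cmod s) + L' * 2 ^ (N - 1) * (4 * C + 2)"
  have "\<forall>\<^sub>F y in nhds 0. cmod (residual p' y - (residual p y + lam * \<delta> y - \<delta> y)) \<le> K * cmod y ^ Suc N"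
    using eventually_cmod_le[OF \<rho>(1)]
  proof eventually_elim
    case (elim y)
    define u where "u = cmod y"
    have u: "0 \<le> u" "u \<le> \<rho>" "u \<le> r" "u \<le> 1/2" using elim \<rho> rC by (auto simp: u_def)
    have u1: "(L + cmod s) * u \<le> 1"
    proof -
      have "(L + cmod s) * u \<le> (L + cmod s + 1) * (1 / (L + cmod s + 1))" using u \<rho> L by (intro mult_mono) auto
      also have "\<dots> = 1" using L norm_ge_zero[of s] by (simp add: add_nonneg_pos less_imp_neq[THEN not_sym])
      finally show ?thesis .
    qed
    have pk: "u ^ m \<le> u ^ 2" if "m \<ge> 2" for m using u that by (intro power_decreasing) auto
    have g\<gamma>: "cmod (\<gamma> y) \<le> L * u ^ 2"
      using L(2)[of y] mult_left_mono[OF pk[of "Suc k"] L(1)] u k by (simp add: u_def)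
    have g\<delta>N: "cmod (\<delta> y) = cmod s * u ^ N" by (simp add: \<delta> norm_mult norm_power u_def)
    have g\<delta>: "cmod (\<delta> y) \<le> cmod s * u ^ 2" unfolding g\<delta>N using pk[OF Nk(2)] by (intro mult_left_mono) auto
    have sm: "cmod (\<gamma> y) + cmod (\<delta> y) \<le> u"
    proof -
      have "cmod (\<gamma> y) + cmod (\<delta> y) \<le> ((L + cmod s) * u) * u" using g\<gamma> g\<delta> by (simp add: power2_eq_square algebra_simps)
      also have "\<dots> \<le> 1 * u" using u1 u by (intro mult_right_mono) auto
      finally show ?thesis by simp
    qed
    have in1: "cmod (\<gamma> y) \<le> r" "cmod (\<gamma> y + \<delta> y) \<le> r" "cmod (0 + (\<gamma> y + \<delta> y)) \<le> r" "cmod (\<gamma> y) \<le> u" "cmod (\<gamma> y + \<delta> y) \<le> u"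
      using sm u norm_ge_zero[of "\<delta> y"] norm_ge_zero[of "\<gamma> y"] norm_triangle_ineq[of "\<gamma> y" "\<delta> y"] unfolding add_0 by linarith+
    define b b0 where "b = F2 (\<gamma> y + \<delta> y, y)" and "b0 = F2 (\<gamma> y, y)"
    have T1: "cmod (F1 (\<gamma> y + \<delta> y, y) - F1 (\<gamma> y, y) - lam * \<delta> y) \<le> 2 * C * cmod s * u ^ Suc N"
    proof -
      have "cmod (F1 (\<gamma> y + \<delta> y, y) - F1 (\<gamma> y, y) - dx F1 (0, y) * \<delta> y) \<le> C * cmod (\<delta> y) * (cmod (\<gamma> y) + cmod (\<delta> y))"
        using rC(5)[OF in1(1,2)] u by (simp add: u_def)
      also have "\<dots> \<le> C * cmod (\<delta> y) * u" using sm rC by (intro mult_left_mono) auto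
      finally have i: "cmod (F1 (\<gamma> y + \<delta> y, y) - F1 (\<gamma> y, y) - dx F1 (0, y) * \<delta> y) \<le> C * cmod (\<delta> y) * u" .
      have ii: "cmod ((dx F1 (0, y) - lam) * \<delta> y) \<le> C * cmod (\<delta> y) * u"
        using mult_right_mono[OF rC(6)[of y], of "cmod (\<delta> y)"] u by (simp add: norm_mult u_def mult_ac)
      have e: "F1 (\<gamma> y + \<delta> y, y) - F1 (\<gamma> y, y) - lam * \<delta> y = (F1 (\<gamma> y + \<delta> y, y) - F1 (\<gamma> y, y) - dx F1 (0, y) * \<delta> y) + (dx F1 (0, y) - lam) * \<delta> y"
        by (simp add: algebra_simps)
      have "cmod (F1 (\<gamma> y + \<delta> y, y) - F1 (\<gamma> y, y) - lam * \<delta> y) \<le> C * cmod (\<delta> y) * u + C * cmod (\<delta> y) * u"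
        unfolding e by (rule norm_triangle_mono[OF i ii])
      then show ?thesis by (simp add: g\<delta>N mult_ac)
    qed
    have db: "cmod (b - b0) \<le> 2 * C * cmod (\<delta> y) * u"
    proof -
      have "cmod (b - b0) \<le> C * cmod (\<delta> y) * (cmod (\<gamma> y) + cmod (\<delta> y) + cmod y)"
        unfolding b_def b0_def using rC(7)[OF in1(1,2)] u by (simp add: u_def)
      also have "\<dots> \<le> C * cmod (\<delta> y) * (2 * u)" using sm rC by (intro mult_left_mono) (auto simp: u_def)
      finally show ?thesis by (simp add: mult_ac)
    qed
    have near: "cmod (F2 (x, y) - y) \<le> (4 * C + 2) * u ^ 2" if x: "cmod x \<le> u" for x
    proof -
      have "cmod (F2 (0 + x, y) - F2 (0, y)) \<le> C * cmod x * (cmod 0 + cmod x + cmod y)"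
        by (rule rC(7)) (use x u rC in \<open>auto simp: u_def\<close>)
      also have "\<dots> \<le> C * u * (2 * u)" using x u rC by (intro mult_mono) (auto simp: u_def)
      finally have i: "cmod (F2 (x, y) - F2 (0, y)) \<le> 2 * C * u ^ 2" by (simp add: power2_eq_square)
      have "cmod (F2 (0, y) - (y - y ^ Suc k)) \<le> C * u ^ (k + 2)" using rC(8)[of y] u by (simp add: u_def)
      also have "\<dots> \<le> C * u ^ 2" using pk[of "k + 2"] rC by (intro mult_left_mono) auto
      finally have ii: "cmod (F2 (0, y) - (y - y ^ Suc k)) \<le> C * u ^ 2" .
      have iii: "cmod (y ^ Suc k) \<le> u ^ 2" using pk[of "Suc k"] k unfolding norm_power u_def by simp
      have e: "F2 (x, y) - y = (F2 (x, y) - F2 (0, y)) + (F2 (0, y) - (y - y ^ Suc k)) - y ^ Suc k" by simp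
      have "cmod (F2 (x, y) - y) \<le> 2 * C * u ^ 2 + C * u ^ 2 + u ^ 2"
        unfolding e by (intro order_trans[OF norm_triangle_ineq4] add_mono order_trans[OF norm_triangle_ineq] i ii iii)
      also have "\<dots> = (3 * C + 1) * u ^ 2" by (simp add: algebra_simps)
      also have "\<dots> \<le> (4 * C + 2) * u ^ 2" using rC by (intro mult_right_mono) auto
      finally show ?thesis .
    qed
    have small: "cmod z \<le> 2 * u" if "cmod (z - y) \<le> (4 * C + 2) * u ^ 2" for z
    proof -
      have "(4 * C + 2) * u \<le> (4 * C + 2) * (1 / (4 * C + 2))" using u \<rho> rC by (intro mult_left_mono) auto
      also have "\<dots> = 1" using rC by simp
      finally have "(4 * C + 2) * u * u \<le> 1 * u" using u by (intro mult_right_mono) auto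
      then have "cmod (z - y) \<le> u" using that by (simp add: power2_eq_square mult.assoc)
      then show ?thesis using norm_triangle_ineq[of "z - y" y] by (simp add: u_def)
    qed
    have nb: "cmod (b - y) \<le> (4 * C + 2) * u ^ 2" "cmod (b0 - y) \<le> (4 * C + 2) * u ^ 2"
      unfolding b_def b0_def using near in1 by auto
    have T2: "cmod (\<gamma> b - \<gamma> b0) \<le> L * (2 * C * cmod s) * u ^ Suc N"
    proof -
      have "cmod (\<gamma> b - \<gamma> b0) \<le> L * (2 * u) ^ k * cmod (b - b0)"
        by (rule L(3)) (use small nb u in auto)
      also have "\<dots> \<le> L * 1 * (2 * C * cmod (\<delta> y) * u)"
        using L u rC by (intro mult_mono db power_le_one) auto
      finally show ?thesis by (simp add: g\<delta>N mult_ac)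
    qed
    have T3: "cmod (\<delta> b - \<delta> y) \<le> L' * 2 ^ (N - 1) * (4 * C + 2) * u ^ Suc N"
    proof -
      have "cmod (\<delta> b - \<delta> y) \<le> L' * (2 * u) ^ (N - 1) * cmod (b - y)"
        by (rule L'(2)) (use small nb u in \<open>auto simp: u_def\<close>)
      also have "\<dots> \<le> L' * (2 * u) ^ (N - 1) * ((4 * C + 2) * u ^ 2)"
        using L' u by (intro mult_left_mono nb) auto
      also have "\<dots> = L' * 2 ^ (N - 1) * (4 * C + 2) * (u ^ (N - 1) * u ^ 2)" by (simp add: power_mult_distrib)
      also have "u ^ (N - 1) * u ^ 2 = u ^ Suc N" using Nk(2) by (simp flip: power_add)
      finally show ?thesis .
    qed
    \<comment> \<open>Three errors: the nonlinearity of F1 in x, the shift of the point at which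
      \<gamma> is evaluated, and the change of \<delta> between y and the image.\<close>
    have "residual p' y - (residual p y + lam * \<delta> y - \<delta> y) =
      (F1 (\<gamma> y + \<delta> y, y) - F1 (\<gamma> y, y) - lam * \<delta> y) - (\<gamma> b - \<gamma> b0) - (\<delta> b - \<delta> y)"
      by (simp add: residual_def \<gamma>' \<gamma>_def[symmetric] b_def b0_def)
    also have "cmod \<dots> \<le> 2 * C * cmod s * u ^ Suc N + L * (2 * C * cmod s) * u ^ Suc N + L' * 2 ^ (N - 1) * (4 * C + 2) * u ^ Suc N"
      by (intro order_trans[OF norm_triangle_ineq4] add_mono T1 T2 T3)
    also have "\<dots> = K * cmod y ^ Suc N" by (simp add: K_def u_def algebra_simps)
    finally show ?case .
  qed
  then have "vanishes (Suc N) (\<lambda>y. residual p' y - (residual p y + lam * \<delta> y - \<delta> y))" by (rule vanishesI)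
  from vanishes_add[OF this c]
  have "vanishes (Suc N) (\<lambda>y. residual p' y - (c + lam * s - s) * y ^ N)"
    by (simp add: \<delta> algebra_simps)
  then show ?case using s by auto
qed

end

lemma infinite_orbit_transfer:
  assumes T: "inj (T :: complex2 \<Rightarrow> complex2)" "isCont T 0" "T 0 = 0" and semi: "\<And>z. T (G z) = F (T z)"
    and orb: "\<And>\<epsilon>::real. \<epsilon> > 0 \<Longrightarrow> infinite_orbit_in G (ball 0 \<epsilon>)"
    and "\<epsilon> > 0"
  shows "infinite_orbit_in F (ball 0 \<epsilon>)"
proof -
  obtain d where d: "d > 0" "\<And>z. dist z 0 < d \<Longrightarrow> dist (T z) (T 0) < \<epsilon>"
    using T(2) \<open>\<epsilon> > 0\<close> unfolding continuous_at_eps_delta by blast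
  obtain p where p: "\<And>n. (G ^^ n) p \<in> ball 0 d" "infinite (range (\<lambda>n. (G ^^ n) p))" using orb[OF d(1)] by blast
  have it: "(F ^^ n) (T p) = T ((G ^^ n) p)" for n by (induction n) (simp_all add: semi)
  have "(F ^^ n) (T p) \<in> ball 0 \<epsilon>" for n
    using d(2)[of "(G ^^ n) p"] p(1)[of n] T(3) by (simp add: it dist_commute)
  moreover have "infinite (range (\<lambda>n. (F ^^ n) (T p)))"
  proof
    assume "finite (range (\<lambda>n. (F ^^ n) (T p)))"
    then have "finite (T ` range (\<lambda>n. (G ^^ n) p))" by (simp add: it image_image)
    then show False using p(2) finite_imageD[OF _ inj_on_subset[OF T(1)]] by blast
  qed
  ultimately show ?thesis by blast
qed

context center_germ
begin

text \<open>The shear x - \<gamma>(y) along a curve with defect O(|y|^(M + k + 1)) brings F into the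
  form of \<open>petal_orbit\<close>: for |x| \<le> |y|^M, the first component is
  \<open>dx F1 (0, y)\<close> x up to that order.\<close>

theorem petal:
  assumes \<theta>: "0 < \<theta>" "\<theta> \<le> 1 / (2 * real k)" and A: "C0 \<ge> 0" "\<rho>0 > 0" "\<And>y. y \<noteq> 0 \<Longrightarrow> cmod y < \<rho>0 \<Longrightarrow> \<bar>Arg y\<bar> \<le> \<theta> \<Longrightarrow> cmod (dx F1 (0, y)) \<ge> 1 - C0 * cmod y ^ k"
    and \<epsilon>: "\<epsilon> > 0"
  shows "infinite_orbit_in (\<lambda>p. (F1 p, F2 p)) (ball 0 \<epsilon>)"
proof -
  \<comment> \<open>The first summand serves the comparison of rates; the rest makes |y|^M at most
    |y|^(k + 1), the order of the curve.\<close>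
  define M where "M = nat \<lceil>2 * C0 + 6\<rceil> + k + 2"
  have M: "real M \<ge> 2 * C0 + 6" "M \<ge> k + 2" unfolding M_def by linarith+
  obtain p where p: "vanishes (M + k + 1) (residual p)" using center_curve[of "M + k + 1"] by auto
  define \<gamma> where "\<gamma> = flatpoly k p"
  define T where "T z = (fst z + \<gamma> (snd z), snd z)" for z
  define G where "G z = (F1 (T z) - \<gamma> (F2 (T z)), F2 (T z))" for z
  define UG where "UG = {z. T z \<in> U}"
  have \<gamma>hol: "\<gamma> holomorphic_on S" for S by (simp add: \<gamma>_def flatpoly_holomorphic)
  have T2: "hol2m T UNIV"
    unfolding hol2m_def T_def by (auto intro!: hol2_add hol2_fst hol2_snd hol2_compose_hol[OF hol2_snd[OF open_UNIV] \<gamma>hol[of UNIV] open_UNIV])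
  have oUG: "open UG"
    unfolding UG_def using open_vimage[OF hol2_open[OF hol(1)], of T] hol2m_continuous_on[OF T2] by (simp add: vimage_def)
  have T2': "hol2m T UG" by (rule hol2m_subset[OF T2 oUG]) simp
  have FT: "hol2 (\<lambda>z. F1 (T z)) UG" "hol2 (\<lambda>z. F2 (T z)) UG"
    using hol2_compose_map[OF hol(1) T2'] hol2_compose_map[OF hol(2) T2'] by (auto simp: UG_def)
  have G2: "hol2m G UG"
    unfolding hol2m_def G_def by (auto intro!: hol2_diff FT hol2_compose_hol[OF FT(2) \<gamma>hol[of UNIV] open_UNIV])
  obtain r C where rC: "r > 0" "r \<le> 1/2" "C \<ge> 0" "cball 0 r \<times> cball 0 r \<subseteq> U"
    "\<And>x h y. cmod x \<le> r \<Longrightarrow> cmod (x + h) \<le> r \<Longrightarrow> cmod y \<le> r \<Longrightarrow> cmod (F1 (x + h, y) - F1 (x, y) - dx F1 (0, y) * h) \<le> C * cmod h * (cmod x + cmod h)"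
    "\<And>y. cmod y \<le> r \<Longrightarrow> cmod (dx F1 (0, y) - lam) \<le> C * cmod y"
    "\<And>x h y. cmod x \<le> r \<Longrightarrow> cmod (x + h) \<le> r \<Longrightarrow> cmod y \<le> r \<Longrightarrow> cmod (F2 (x + h, y) - F2 (x, y)) \<le> C * cmod h * (cmod x + cmod h + cmod y)"
    "\<And>y. cmod y \<le> r \<Longrightarrow> cmod (F2 (0, y) - (y - y ^ Suc k)) \<le> C * cmod y ^ (k + 2)"
    by (rule estimates) (rule that; assumption)
  obtain L where L: "L \<ge> 0" "\<And>a. cmod a \<le> 1 \<Longrightarrow> cmod (\<gamma> a) \<le> L * cmod a ^ Suc k"
    "\<And>a b R. cmod a \<le> R \<Longrightarrow> cmod b \<le> R \<Longrightarrow> R \<le> 1 \<Longrightarrow> cmod (\<gamma> a - \<gamma> b) \<le> L * R ^ k * cmod (a - b)"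
    unfolding \<gamma>_def using flatpoly_bounds[of k p] by blast
  obtain CR rR where R: "CR \<ge> 0" "rR > 0" "\<And>y. cmod y < rR \<Longrightarrow> cmod (residual p y) \<le> CR * cmod y ^ (M + k + 1)"
    using p unfolding vanishes_def eventually_nhds_metric by auto
  define \<rho> where "\<rho> = Min {r, \<rho>0, rR, 1 / (L + 1), 1 / (3 * C + 1)}"
  have "\<rho> > 0" using rC A R L by (simp add: \<rho>_def add_nonneg_pos)
  moreover have "\<rho> \<le> r" "\<rho> \<le> \<rho>0" "\<rho> \<le> rR" "\<rho> \<le> 1 / (L + 1)" "\<rho> \<le> 1 / (3 * C + 1)"
    unfolding \<rho>_def by (rule Min_le; simp)+
  ultimately have \<rho>: "\<rho> > 0" "\<rho> \<le> r" "\<rho> \<le> \<rho>0" "\<rho> \<le> rR" "\<rho> \<le> 1 / (L + 1)" "\<rho> \<le> 1 / (3 * C + 1)" by blast+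
  define C1 where "C1 = C * (L + 1) + CR + L * 2 ^ k * (2 * C)"
  define C2 where "C2 = 2 * C * (L + 1) + C"
  define CC where "CC = max C1 C2"
  have CC: "CC \<ge> 0" "C1 \<le> CC" "C2 \<le> CC" using rC L R by (auto simp: CC_def C2_def le_max_iff_disj)
  have reg: "(x, y) \<in> UG \<and> cmod (snd (G (x, y)) - (y - y ^ Suc k)) \<le> CC * cmod y ^ (k + 2) \<and>
      cmod (fst (G (x, y)) - dx F1 (0, y) * x) \<le> CC * cmod y ^ (M + k + 1)"
    if y: "y \<noteq> 0" "cmod y < \<rho>" "\<bar>Arg y\<bar> \<le> \<theta>" and x: "cmod x \<le> cmod y ^ M" for x y
  proof -
    define u where "u = cmod y"
    have u: "0 \<le> u" "u \<le> \<rho>" "u \<le> r" "u \<le> 1/2" "u < rR" using y \<rho> rC by (auto simp: u_def)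
    have pk: "u ^ m \<le> u ^ n" if "n \<le> m" for m n using u that by (intro power_decreasing) auto
    have xk: "cmod x \<le> u ^ Suc k" "cmod x \<le> u ^ M" using x pk[of "Suc k" M] M by (auto simp: u_def)
    have gk: "cmod (\<gamma> y) \<le> L * u ^ Suc k" using L(2)[of y] u by (simp add: u_def)
    have xg: "cmod x + cmod (\<gamma> y) \<le> (L + 1) * u ^ Suc k" using xk(1) gk by (simp add: algebra_simps)
    have Lu: "(L + 1) * u ^ Suc k \<le> u"
    proof -
      have "(L + 1) * u \<le> (L + 1) * (1 / (L + 1))" using u \<rho> L by (intro mult_left_mono) auto
      also have "\<dots> = 1" using L by simp
      finally have "((L + 1) * u) * u \<le> 1 * u" using u by (intro mult_right_mono) auto
      moreover have "(L + 1) * u ^ Suc k \<le> (L + 1) * u ^ 2" using pk[of 2 "Suc k"] k L by (intro mult_left_mono) auto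
      ultimately show ?thesis by (simp add: power2_eq_square mult.assoc)
    qed
    have in1: "cmod (\<gamma> y) \<le> u" "cmod (\<gamma> y + x) \<le> u" "cmod (\<gamma> y) \<le> r" "cmod (\<gamma> y + x) \<le> r"
      using xg Lu norm_ge_zero[of x] norm_ge_zero[of "\<gamma> y"] norm_triangle_ineq[of "\<gamma> y" x] u by linarith+
    have Txy: "T (x, y) = (\<gamma> y + x, y)" by (simp add: T_def add.commute)
    have inU: "(x, y) \<in> UG" unfolding UG_def using rC(4) in1 u by (auto simp: Txy u_def)
    define b b0 where "b = F2 (\<gamma> y + x, y)" and "b0 = F2 (\<gamma> y, y)"
    have near: "cmod (F2 (z, y) - F2 (0, y)) \<le> 2 * C * u * cmod z" if "cmod z \<le> u" for z
    proof -
      have "cmod (F2 (0 + z, y) - F2 (0, y)) \<le> C * cmod z * (cmod 0 + cmod z + cmod y)"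
        by (rule rC(7)) (use that u rC in \<open>auto simp: u_def\<close>)
      also have "\<dots> \<le> C * cmod z * (2 * u)" using that u rC by (intro mult_left_mono) (auto simp: u_def)
      finally show ?thesis by (simp add: mult_ac)
    qed
    have base: "cmod (F2 (0, y) - (y - y ^ Suc k)) \<le> C * u ^ (k + 2)" using rC(8)[of y] u by (simp add: u_def)
    have two: "cmod (F2 (z, y)) \<le> 2 * u" if z: "cmod z \<le> u" for z
    proof -
      have "F2 (z, y) = (F2 (z, y) - F2 (0, y)) + (F2 (0, y) - (y - y ^ Suc k)) + (y - y ^ Suc k)" by simp
      then have "cmod (F2 (z, y)) \<le> cmod (F2 (z, y) - F2 (0, y)) + cmod (F2 (0, y) - (y - y ^ Suc k)) + (cmod y + cmod (y ^ Suc k))"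
        by (metis (no_types) norm_triangle_ineq norm_triangle_ineq4 norm_triangle_mono)
      moreover have "cmod (F2 (z, y) - F2 (0, y)) \<le> 2 * C * u * u"
        using near[OF z] mult_left_mono[OF z, of "2 * C * u"] u rC by simp
      moreover have "C * u ^ (k + 2) \<le> C * u ^ 2" using pk[of 2 "k + 2"] rC by (intro mult_left_mono) auto
      moreover have "cmod (y ^ Suc k) \<le> u ^ 2" using pk[of 2 "Suc k"] k unfolding norm_power u_def by simp
      ultimately have "cmod (F2 (z, y)) \<le> u + (3 * C + 1) * u * u" using base by (simp add: u_def[symmetric] power2_eq_square algebra_simps)
      also have "(3 * C + 1) * u * u \<le> 1 * u"
      proof (rule mult_right_mono)
        have "(3 * C + 1) * u \<le> (3 * C + 1) * (1 / (3 * C + 1))" using u \<rho> rC by (intro mult_left_mono) auto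
        also have "\<dots> = 1" using rC by simp
        finally show "(3 * C + 1) * u \<le> 1" .
      qed (rule u(1))
      finally show ?thesis by simp
    qed
    have i: "cmod (F1 (\<gamma> y + x, y) - F1 (\<gamma> y, y) - dx F1 (0, y) * x) \<le> C * (L + 1) * u ^ (M + k + 1)"
    proof -
      have "cmod (F1 (\<gamma> y + x, y) - F1 (\<gamma> y, y) - dx F1 (0, y) * x) \<le> C * cmod x * (cmod (\<gamma> y) + cmod x)"
        using rC(5)[OF in1(3,4)] u by (simp add: u_def)
      also have "\<dots> \<le> C * u ^ M * ((L + 1) * u ^ Suc k)"
        using xg xk rC u by (intro mult_mono) (auto simp: add.commute)
      finally show ?thesis by (simp add: power_add mult_ac)
    qed
    have ii: "cmod (residual p y) \<le> CR * u ^ (M + k + 1)" using R(3)[of y] u by (simp add: u_def)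
    have iii: "cmod (\<gamma> b - \<gamma> b0) \<le> L * 2 ^ k * (2 * C) * u ^ (M + k + 1)"
    proof -
      have "cmod (b - b0) \<le> C * cmod x * (cmod (\<gamma> y) + cmod x + cmod y)"
        unfolding b_def b0_def using rC(7)[OF in1(3,4)] u by (simp add: u_def)
      also have "\<dots> \<le> C * u ^ M * (2 * u)"
      proof (intro mult_mono)
        show "cmod (\<gamma> y) + cmod x + cmod y \<le> 2 * u" using xg Lu by (simp add: u_def)
      qed (use xk rC u in auto)
      finally have d: "cmod (b - b0) \<le> C * u ^ M * (2 * u)" .
      have "cmod (\<gamma> b - \<gamma> b0) \<le> L * (2 * u) ^ k * cmod (b - b0)"
        by (rule L(3)) (use two in1 u in \<open>auto simp: b_def b0_def\<close>)
      also have "\<dots> \<le> L * (2 * u) ^ k * (C * u ^ M * (2 * u))" using L u d by (intro mult_left_mono) auto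
      also have "\<dots> = L * 2 ^ k * (2 * C) * u ^ (M + k + 1)" by (simp add: power_mult_distrib power_add mult_ac)
      finally show ?thesis .
    qed
    have e1: "fst (G (x, y)) - dx F1 (0, y) * x = (F1 (\<gamma> y + x, y) - F1 (\<gamma> y, y) - dx F1 (0, y) * x) + residual p y - (\<gamma> b - \<gamma> b0)"
      by (simp add: G_def Txy residual_def \<gamma>_def[symmetric] b_def b0_def)
    have "cmod (fst (G (x, y)) - dx F1 (0, y) * x) \<le> C * (L + 1) * u ^ (M + k + 1) + CR * u ^ (M + k + 1) + L * 2 ^ k * (2 * C) * u ^ (M + k + 1)"
      unfolding e1 by (intro order_trans[OF norm_triangle_ineq4] add_mono order_trans[OF norm_triangle_ineq] i ii iii)
    also have "\<dots> = C1 * u ^ (M + k + 1)" by (simp add: C1_def algebra_simps)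
    also have "\<dots> \<le> CC * u ^ (M + k + 1)" using CC u by (intro mult_right_mono) auto
    finally have f1: "cmod (fst (G (x, y)) - dx F1 (0, y) * x) \<le> CC * u ^ (M + k + 1)" .
    have e2: "snd (G (x, y)) - (y - y ^ Suc k) = (F2 (\<gamma> y + x, y) - F2 (0, y)) + (F2 (0, y) - (y - y ^ Suc k))"
      by (simp add: G_def Txy)
    have iv: "cmod (F2 (\<gamma> y + x, y) - F2 (0, y)) \<le> 2 * C * (L + 1) * u ^ (k + 2)"
    proof -
      have "cmod (F2 (\<gamma> y + x, y) - F2 (0, y)) \<le> 2 * C * u * cmod (\<gamma> y + x)" by (rule near[OF in1(2)])
      also have "\<dots> \<le> 2 * C * u * ((L + 1) * u ^ Suc k)"
        using xg norm_triangle_ineq[of "\<gamma> y" x] u rC by (intro mult_left_mono) auto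
      finally show ?thesis by (simp add: algebra_simps)
    qed
    have "cmod (snd (G (x, y)) - (y - y ^ Suc k)) \<le> 2 * C * (L + 1) * u ^ (k + 2) + C * u ^ (k + 2)"
      unfolding e2 by (rule norm_triangle_mono[OF iv base])
    also have "\<dots> = C2 * u ^ (k + 2)" by (simp add: C2_def algebra_simps)
    also have "\<dots> \<le> CC * u ^ (k + 2)" using CC u by (intro mult_right_mono) auto
    finally show ?thesis using f1 inU by (simp add: u_def)
  qed
  have Ahol: "(\<lambda>y. dx F1 (0, y)) holomorphic_on ball 0 \<rho>"
    by (rule holomorphic_on_subset[OF hol2_slice_y[OF hol2_dx[OF hol(1)]]]) (use rC(1,4) \<rho>(2) in auto)
  have orb: "infinite_orbit_in G (ball 0 \<epsilon>)" if "\<epsilon> > 0" for \<epsilon> :: real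
    by (rule petal_orbit[OF G2 k \<theta> Ahol \<rho>(1) CC(1) A(1) M(1) reg _ that]) (use A(3) \<rho>(3) in auto)
  show ?thesis
  proof (rule infinite_orbit_transfer[of T G])
    show "inj T" by (auto simp: inj_def T_def)
    show "isCont T 0" using hol2m_continuous_on[OF T2] continuous_on_eq_continuous_at[OF open_UNIV] by blast
    show "T 0 = 0" by (simp add: T_def \<gamma>_def zero_prod_def)
    show "T (G z) = (F1 (T z), F2 (T z))" for z unfolding T_def[of "G z"] by (simp add: G_def)
  qed (use orb \<epsilon> in auto)
qed

end

section \<open>Inverse germs, scaling and the choice of a direction\<close>

lemma filterlim_times_nhds_0: "filterlim (\<lambda>y::complex. c * y) (nhds 0) (nhds 0)"
  using tendsto_mult_right_zero[OF filterlim_ident] by auto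

lemma vanishes_scale: assumes "vanishes N g" shows "vanishes N (\<lambda>y. g (c * y))"
proof -
  obtain C where C: "C \<ge> 0" "\<forall>\<^sub>F y in nhds 0. cmod (g y) \<le> C * cmod y ^ N" using assms by (auto simp: vanishes_def)
  from eventually_compose_filterlim[OF C(2) filterlim_times_nhds_0]
  have "\<forall>\<^sub>F y in nhds 0. cmod (g (c * y)) \<le> (C * cmod c ^ N) * cmod y ^ N"
    by eventually_elim (simp add: norm_mult power_mult_distrib mult_ac)
  then show ?thesis by (rule vanishesI)
qed

lemma vanishes_mult: assumes "vanishes M f" "vanishes N g" shows "vanishes (M + N) (\<lambda>y. f y * g y)"
proof -
  obtain C where C: "C \<ge> 0" "\<forall>\<^sub>F y in nhds 0. cmod (f y) \<le> C * cmod y ^ M" using assms(1) by (auto simp: vanishes_def)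
  obtain D where D: "D \<ge> 0" "\<forall>\<^sub>F y in nhds 0. cmod (g y) \<le> D * cmod y ^ N" using assms(2) by (auto simp: vanishes_def)
  have "\<forall>\<^sub>F y in nhds 0. cmod (f y * g y) \<le> (C * D) * cmod y ^ (M + N)"
    using C(2) D(2)
  proof eventually_elim
    case (elim y)
    have "cmod (f y * g y) \<le> (C * cmod y ^ M) * (D * cmod y ^ N)"
      unfolding norm_mult using elim C(1) by (intro mult_mono) auto
    then show ?case by (simp add: power_add mult_ac)
  qed
  then show ?thesis by (rule vanishesI)
qed

lemma vanishes_power: "vanishes n (\<lambda>y. c * y ^ n)"
  by (rule vanishesI[of _ "cmod c"]) (auto simp: norm_mult norm_power)

lemma vanishes_const: "vanishes 0 (\<lambda>y. c)"
  using vanishes_power[of 0 c] by simp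

lemma vanishes_at_0: assumes "vanishes (Suc n) f" shows "f 0 = 0"
proof -
  obtain C where "\<forall>\<^sub>F y in nhds 0. cmod (f y) \<le> C * cmod y ^ Suc n" using assms by (auto simp: vanishes_def)
  from eventually_nhds_x_imp_x[OF this] show ?thesis by simp
qed

lemma vanishes_norm_sum:
  assumes "vanishes (Suc n) m" shows "vanishes 1 (\<lambda>y. complex_of_real (cmod y + cmod (m y)))"
proof -
  obtain K where "\<forall>\<^sub>F y in nhds 0. cmod (m y) \<le> K * cmod y ^ 1"
    using vanishes_mono[OF assms, of 1] by (auto simp: vanishes_def)
  then have "\<forall>\<^sub>F y in nhds 0. cmod (complex_of_real (cmod y + cmod (m y))) \<le> (K + 1) * cmod y ^ 1"
    by eventually_elim (simp add: algebra_simps del: of_real_add)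
  then show ?thesis by (rule vanishesI)
qed

lemma vanishes_bounded_compose:
  assumes "vanishes N b" "C \<ge> 0" "\<forall>\<^sub>F y in nhds 0. cmod (f y) \<le> C * cmod (b y)"
  shows "vanishes N f"
proof -
  obtain D where D: "\<forall>\<^sub>F y in nhds 0. cmod (b y) \<le> D * cmod y ^ N" using assms(1) by (auto simp: vanishes_def)
  have "\<forall>\<^sub>F y in nhds 0. cmod (f y) \<le> (C * D) * cmod y ^ N"
    using D assms(3)
  proof eventually_elim
    case (elim y)
    then have "cmod (f y) \<le> C * (D * cmod y ^ N)" using mult_left_mono[OF elim(1) assms(2)] by linarith
    then show ?case by (simp add: mult.assoc)
  qed
  then show ?thesis by (rule vanishesI)
qed

lemma vanishes_1:
  assumes "g holomorphic_on S" "open S" "0 \<in> S" "g 0 = 0" shows "vanishes 1 g"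
proof -
  have "\<forall>\<^sub>F y in nhds 0. dist (g y) (g 0) < 1" by (rule tendstoD[OF holomorphic_on_tendsto[OF assms(1-3)]]) simp
  then have "vanishes 0 g"
    by (intro vanishesI[of _ 1]) (auto elim!: eventually_mono simp: assms(4))
  from vanishes_leading[OF assms(1-3) this] obtain c where c: "vanishes (Suc 0) (\<lambda>y. g y - c * y ^ 0)" by blast
  from vanishes_at_0[OF this] have "c = 0" using assms(4) by simp
  with c show ?thesis by simp
qed

lemma vanishes_cases:
  assumes g: "g holomorphic_on S" "open S" "0 \<in> S" "vanishes m g"
  shows "vanishes n g \<or> (\<exists>j a. m \<le> j \<and> j < n \<and> a \<noteq> 0 \<and> vanishes (Suc j) (\<lambda>y. g y - a * y ^ j))"
proof (induction n)
  case 0 show ?case using vanishes_mono[OF g(4)] by simp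
next
  case (Suc n)
  show ?case
  proof (cases "vanishes n g \<and> m \<le> n")
    case True
    then obtain c where c: "vanishes (Suc n) (\<lambda>y. g y - c * y ^ n)" using vanishes_leading[OF g(1-3)] by blast
    then show ?thesis using True by (cases "c = 0") auto
  next
    case False
    then show ?thesis using Suc vanishes_mono[OF g(4), of "Suc n"] less_Suc_eq by (metis not_less_eq_eq le_SucI)
  qed
qed

text \<open>Cauchy's estimate on the disc of radius |y| around y; at y = 0 the derivative is read
  from the difference quotient.\<close>

lemma vanishes_deriv:
  assumes e: "e holomorphic_on S" "open S" "0 \<in> S" "vanishes (Suc k) e" and k: "k \<ge> 1"
  shows "vanishes k (deriv e)"
proof -
  obtain C where C: "C \<ge> 0" "\<forall>\<^sub>F y in nhds 0. cmod (e y) \<le> C * cmod y ^ Suc k" using e(4) by (auto simp: vanishes_def)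
  have "\<forall>\<^sub>F y in nhds 0. y \<in> S \<and> cmod (e y) \<le> C * cmod y ^ Suc k"
    using C(2) eventually_nhds_in_open[OF e(2,3)] by eventually_elim simp
  then obtain d where d: "d > 0" "\<And>y. dist y 0 < d \<Longrightarrow> y \<in> S \<and> cmod (e y) \<le> C * cmod y ^ Suc k"
    unfolding eventually_nhds_metric by blast
  have b: "cmod (deriv e y) \<le> C * (cmod y + s) ^ Suc k / s" if s: "s > 0" "cmod y + s < d" for y s
  proof -
    have "cmod z < d" "cmod z \<le> cmod y + s" if "z \<in> cball y s" for z
      using that s norm_triangle_sub[of z y] by (auto simp: dist_norm norm_minus_commute)
    note z = this
    have "cmod ((deriv ^^ 1) e y / fact 1) \<le> (C * (cmod y + s) ^ Suc k) / s ^ 1"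
    proof (rule cauchy_coeff_bound[OF e(1,2) _ s(1)])
      show "cball y s \<subseteq> S" using z(1) d(2) by auto
      fix w assume w: "w \<in> cball y s"
      have "cmod (e w) \<le> C * cmod w ^ Suc k" using d(2)[of w] z(1)[OF w] by simp
      also have "\<dots> \<le> C * (cmod y + s) ^ Suc k" using z(2)[OF w] C(1) by (intro mult_left_mono power_mono) auto
      finally show "cmod (e w) \<le> C * (cmod y + s) ^ Suc k" .
    qed
    then show ?thesis by simp
  qed
  have e0: "deriv e 0 = 0"
  proof -
    have "(e has_field_derivative deriv e 0) (at 0)" using e by (intro holomorphic_derivI)
    moreover have "(e has_field_derivative 0) (at 0)"
    proof -
      have "((\<lambda>y. e y / y) \<longlongrightarrow> 0) (at 0)"
      proof (rule Lim_null_comparison)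
        show "\<forall>\<^sub>F y in at 0. cmod (e y / y) \<le> C * cmod y ^ k"
          using C(2) unfolding eventually_at_filter by eventually_elim (auto simp: norm_divide field_simps)
        have "((\<lambda>y. C * cmod y ^ k) \<longlongrightarrow> C * cmod (0::complex) ^ k) (at 0)" by (intro tendsto_intros)
        then show "((\<lambda>y. C * cmod y ^ k) \<longlongrightarrow> 0) (at (0::complex))" using k by (simp add: power_0_left)
      qed
      then show ?thesis using vanishes_at_0[OF e(4)] by (simp add: has_field_derivative_iff)
    qed
    ultimately show ?thesis by (rule DERIV_unique)
  qed
  have "\<forall>\<^sub>F y in nhds 0. cmod (deriv e y) \<le> (C * 2 ^ Suc k) * cmod y ^ k"
    using eventually_cmod_less[OF half_gt_zero[OF d(1)]]
  proof eventually_elim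
    case (elim y)
    show ?case
    proof (cases "y = 0")
      case True then show ?thesis using e0 C(1) by simp
    next
      case False
      then have "cmod (deriv e y) \<le> C * (cmod y + cmod y) ^ Suc k / cmod y" using b[of "cmod y" y] elim by simp
      also have "\<dots> = (C * 2 ^ Suc k) * cmod y ^ k" using False by (simp add: mult_2[symmetric] power_mult_distrib)
      finally show ?thesis .
    qed
  qed
  then show ?thesis by (rule vanishesI)
qed

lemma eventually_slice:
  assumes "\<forall>\<^sub>F p in nhds (0::complex2). P p" shows "\<forall>\<^sub>F y in nhds 0. P (0, y)"
proof -
  have "((\<lambda>y. (0::complex, y::complex)) \<longlongrightarrow> (0, 0)) (nhds 0)" by (intro tendsto_intros filterlim_ident)
  then have "filterlim (\<lambda>y. (0::complex, y::complex)) (nhds 0) (nhds 0)" by (simp add: zero_prod_def)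
  from eventually_compose_filterlim[OF assms this] show ?thesis .
qed

text \<open>Insert F(0, y) = (e, y + b) with e, b = O(y^(k + 1)) into G(F) = id and expand G around
  (0, y). The displacement of the inverse has the opposite leading coefficient, so repelling
  directions of F attract for the inverse, and the multipliers are reciprocal up to O(y^k).\<close>

lemma inverse_germ_data:
  assumes F: "hol2 F1 U" "hol2 F2 U" "0 \<in> U" "F1 0 = 0" "F2 0 = 0" and k: "k \<ge> 1"
    and fl: "vanishes (Suc k) (\<lambda>y. F1 (0, y))" "vanishes (k + 2) (\<lambda>y. F2 (0, y) - (y + \<beta> * y ^ Suc k))"
    and G: "hol2 G1 V" "hol2 G2 V" "0 \<in> V"
    and inv: "\<forall>\<^sub>F p in nhds 0. G1 (F1 p, F2 p) = fst p \<and> G2 (F1 p, F2 p) = snd p"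
    and dG2: "dx G2 0 = 0" "dy G2 0 = 1"
  shows "vanishes (Suc k) (\<lambda>y. G1 (0, y))" "vanishes (k + 2) (\<lambda>y. G2 (0, y) - (y + (- \<beta>) * y ^ Suc k))"
    "vanishes k (\<lambda>y. dx G1 (0, y) * dx F1 (0, y) - 1)"
proof -
  define e b where "e y = F1 (0, y)" and "b y = F2 (0, y) - y" for y
  have e: "vanishes (Suc k) e" using fl(1) by (simp add: e_def[abs_def])
  have b': "vanishes (k + 2) (\<lambda>y. b y - \<beta> * y ^ Suc k)"
    using fl(2) by (simp add: b_def algebra_simps)
  then have b: "vanishes (Suc k) b"
    using vanishes_add[OF vanishes_mono[of "k + 2" "\<lambda>y. b y - \<beta> * y ^ Suc k" "Suc k"] vanishes_power[of "Suc k" \<beta>]] by simp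
  \<comment> \<open>A common majorant of e and b, made complex-valued so that
    \<open>vanishes\<close> applies.\<close>
  define m where "m y = complex_of_real (cmod (e y) + cmod (b y))" for y
  have m: "vanishes (Suc k) m" and cm: "cmod (m y) = cmod (e y) + cmod (b y)" for y
  proof -
    obtain C D where "\<forall>\<^sub>F y in nhds 0. cmod (e y) \<le> C * cmod y ^ Suc k" "\<forall>\<^sub>F y in nhds 0. cmod (b y) \<le> D * cmod y ^ Suc k"
      using e b by (auto simp: vanishes_def)
    then have "\<forall>\<^sub>F y in nhds 0. cmod (m y) \<le> (C + D) * cmod y ^ Suc k"
      by eventually_elim (auto simp: m_def algebra_simps simp del: of_real_add)
    then show "vanishes (Suc k) m" by (rule vanishesI)
    show "cmod (m y) = cmod (e y) + cmod (b y)" by (simp add: m_def del: of_real_add)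
  qed
  have "(g \<longlongrightarrow> 0) (nhds 0)" if "g = (\<lambda>y. h (0, y))" "h 0 = 0" "hol2 h U" for g h
    using holomorphic_on_tendsto[OF hol2_slice_y[OF that(3), of 0] open_slice_y[OF hol2_open[OF that(3)]], of 0] that(1,2) F(3)
    by (simp add: zero_prod_def)
  note wlim = this[OF refl F(4,1)] this[OF refl F(5,2)]
  have small: "\<forall>\<^sub>F y in nhds 0. cmod (e y) \<le> r \<and> cmod (y + b y) \<le> r \<and> cmod y \<le> r" if "r > 0" for r
    using tendstoD[OF wlim(1) that] tendstoD[OF wlim(2) that] eventually_cmod_le[OF that]
    by eventually_elim (auto simp: e_def b_def)
  have inv0: "\<forall>\<^sub>F y in nhds 0. G1 (e y, y + b y) = 0 \<and> G2 (e y, y + b y) = y"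
    using eventually_slice[OF inv] by (simp add: e_def b_def)
  have lip: "vanishes (Suc k) (\<lambda>y. g (e y, y + b y) - g (0, y))" if g: "hol2 g V" for g
  proof -
    obtain r C where r: "r > 0" "C \<ge> 0" "\<And>x x' y y'. cmod x \<le> r \<Longrightarrow> cmod x' \<le> r \<Longrightarrow> cmod y \<le> r \<Longrightarrow> cmod y' \<le> r \<Longrightarrow>
      cmod (g (x, y) - g (x', y')) \<le> C * (cmod (x - x') + cmod (y - y'))"
      using hol2_lipschitz[OF g G(3)] by blast
    have "\<forall>\<^sub>F y in nhds 0. cmod (g (e y, y + b y) - g (0, y)) \<le> C * cmod (m y)"
      using small[OF r(1)]
    proof eventually_elim
      case (elim y)
      then show ?case using r(3)[of "e y" 0 "y + b y" y] r(1) by (simp add: cm)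
    qed
    then show ?thesis by (rule vanishes_bounded_compose[OF m r(2)])
  qed
  show v1: "vanishes (Suc k) (\<lambda>y. G1 (0, y))"
  proof (rule vanishes_cong)
    show "vanishes (Suc k) (\<lambda>y. (- 1) * (G1 (e y, y + b y) - G1 (0, y)))" by (rule vanishes_cmult[OF lip[OF G(1)]])
    show "\<forall>\<^sub>F y in nhds 0. (- 1) * (G1 (e y, y + b y) - G1 (0, y)) = G1 (0, y)" using inv0 by eventually_elim simp
  qed
  show "vanishes (k + 2) (\<lambda>y. G2 (0, y) - (y + (- \<beta>) * y ^ Suc k))"
  proof -
    from hol2_dx_lipschitz[OF G(2,3)]
    obtain r C where r: "r > 0" "C \<ge> 0" "\<And>x h y. cmod x \<le> r \<Longrightarrow> cmod (x + h) \<le> r \<Longrightarrow> cmod y \<le> r \<Longrightarrow>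
       cmod (G2 (x + h, y) - G2 (x, y) - dx G2 (0, y) * h) \<le> C * cmod h * (cmod x + cmod h)"
      "\<And>y. cmod y \<le> r \<Longrightarrow> cmod (dx G2 (0, y) - dx G2 (0, 0)) \<le> C * cmod y" by blast
    \<comment> \<open>G2 on the axis is read as a function of the first variable, so that
      \<open>hol2_dx_lipschitz\<close> gives a second-order estimate in y.\<close>
    define V' where "V' = {y. (0, y) \<in> V} \<times> (UNIV :: complex set)"
    have oy: "open {y. (0, y) \<in> V}" by (rule open_slice_y[OF hol2_open[OF G(2)]])
    have V': "open V'" "0 \<in> V'" using oy G(3) by (auto simp: V'_def zero_prod_def open_Times)
    have hs: "hol2 (\<lambda>p. G2 (0, fst p)) V'"
      by (rule hol2_compose_hol[OF hol2_fst[OF V'(1)] hol2_slice_y[OF G(2)] oy]) (auto simp: V'_def)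
    from hol2_dx_lipschitz[OF hs V'(2)]
    obtain s D where s: "s > 0" "D \<ge> 0" "\<And>x h y. cmod x \<le> s \<Longrightarrow> cmod (x + h) \<le> s \<Longrightarrow> cmod y \<le> s \<Longrightarrow>
       cmod (G2 (0, x + h) - G2 (0, x) - dx (\<lambda>p. G2 (0, fst p)) (0, y) * h) \<le> D * cmod h * (cmod x + cmod h)" by auto
    have d1: "dx (\<lambda>p. G2 (0, fst p)) (0, 0) = 1" using dG2(2) by (simp add: dx_def dy_def zero_prod_def)
    have A1: "vanishes (Suc k + 1) (\<lambda>y. G2 (e y, y + b y) - G2 (0, y + b y))"
    proof (rule vanishes_bounded_compose[of _ "\<lambda>y. m y * complex_of_real (cmod y + cmod (m y))"])
      have "vanishes 1 (\<lambda>y. complex_of_real (cmod y + cmod (m y)))" by (rule vanishes_norm_sum[OF m])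
      then show "vanishes (Suc k + 1) (\<lambda>y. m y * complex_of_real (cmod y + cmod (m y)))" by (rule vanishes_mult[OF m])
      show "\<forall>\<^sub>F y in nhds 0. cmod (G2 (e y, y + b y) - G2 (0, y + b y)) \<le> (2 * C) * cmod (m y * complex_of_real (cmod y + cmod (m y)))"
        using small[OF r(1)]
      proof eventually_elim
        case (elim y)
        have i: "cmod (G2 (e y, y + b y) - G2 (0, y + b y) - dx G2 (0, y + b y) * e y) \<le> C * cmod (e y) * cmod (e y)"
          using r(3)[of 0 "e y" "y + b y"] elim r(1) by simp
        have ii: "cmod (dx G2 (0, y + b y) * e y) \<le> C * cmod (y + b y) * cmod (e y)"
          using r(4)[of "y + b y"] elim dG2(1) by (simp add: zero_prod_def norm_mult mult_right_mono)
        have eq: "G2 (e y, y + b y) - G2 (0, y + b y) = (G2 (e y, y + b y) - G2 (0, y + b y) - dx G2 (0, y + b y) * e y) + dx G2 (0, y + b y) * e y" by simp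
        have le: "cmod (e y) \<le> cmod (m y)" "cmod (y + b y) \<le> cmod y + cmod (m y)"
          using norm_triangle_ineq[of y "b y"] norm_ge_zero[of "e y"] norm_ge_zero[of "b y"] unfolding cm by linarith+
        have "cmod (G2 (e y, y + b y) - G2 (0, y + b y)) \<le> C * cmod (e y) * cmod (e y) + C * cmod (y + b y) * cmod (e y)"
          by (subst eq) (rule norm_triangle_mono[OF i ii])
        also have "\<dots> \<le> C * cmod (m y) * (cmod y + cmod (m y)) + C * (cmod y + cmod (m y)) * cmod (m y)"
          using le r(2) norm_ge_zero[of y] by (intro add_mono mult_mono) (auto intro: order_trans)
        also have "\<dots> = (2 * C) * (cmod (m y) * (cmod y + cmod (m y)))" by (simp add: algebra_simps)
        finally show ?case by (simp add: norm_mult del: of_real_add)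
      qed
    qed (use r in simp)
    have A2: "vanishes (Suc k + 1) (\<lambda>y. G2 (0, y + b y) - G2 (0, y) - b y)"
    proof (rule vanishes_bounded_compose[of _ "\<lambda>y. b y * complex_of_real (cmod y + cmod (b y))"])
      have "vanishes 1 (\<lambda>y. complex_of_real (cmod y + cmod (b y)))" by (rule vanishes_norm_sum[OF b])
      then show "vanishes (Suc k + 1) (\<lambda>y. b y * complex_of_real (cmod y + cmod (b y)))" by (rule vanishes_mult[OF b])
      show "\<forall>\<^sub>F y in nhds 0. cmod (G2 (0, y + b y) - G2 (0, y) - b y) \<le> D * cmod (b y * complex_of_real (cmod y + cmod (b y)))"
        using small[OF s(1)]
      proof eventually_elim
        case (elim y)
        then show ?case using s(3)[of y "b y" 0] s(1) by (simp add: d1 norm_mult mult.assoc del: of_real_add)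
      qed
    qed (use s in simp)
    have b'': "vanishes (Suc k + 1) (\<lambda>y. b y - \<beta> * y ^ Suc k)" using b' by (simp add: add_2_eq_Suc')
    have "vanishes (k + 2) (\<lambda>y. (- 1) * (G2 (e y, y + b y) - G2 (0, y + b y)) - (G2 (0, y + b y) - G2 (0, y) - b y) - (b y - \<beta> * y ^ Suc k))"
      using vanishes_diff[OF vanishes_diff[OF vanishes_cmult[OF A1, of "-1"] A2] b''] by (simp add: add_2_eq_Suc')
    then show ?thesis
      by (rule vanishes_cong[rotated]) (use inv0 in eventually_elim, simp)
  qed
  show "vanishes k (\<lambda>y. dx G1 (0, y) * dx F1 (0, y) - 1)"
  proof -
    have dG: "hol2 (dx G1) V" "hol2 (dy G1) V" using G by (auto intro: hol2_dx hol2_dy)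
    have chain: "\<forall>\<^sub>F y in nhds 0. dx G1 (e y, y + b y) * dx F1 (0, y) + dy G1 (e y, y + b y) * dx F2 (0, y) = 1"
    proof -
      obtain W where W: "open W" "0 \<in> W" "\<And>p. p \<in> W \<Longrightarrow> G1 (F1 p, F2 p) = fst p"
        using inv unfolding eventually_nhds by blast
      define W' where "W' = {p \<in> U. (F1 p, F2 p) \<in> V} \<inter> W"
      have W': "open W'" "0 \<in> W'"
        using open_preimage_pair[OF F(1,2) hol2_open[OF G(1)]] W F G(3) by (auto simp: W'_def zero_prod_def)
      from eventually_slice[OF eventually_nhds_in_open[OF W']] show ?thesis
      proof eventually_elim
        case (elim y)
        then have p: "(0, y) \<in> U" "(F1 (0, y), F2 (0, y)) \<in> V" by (auto simp: W'_def)
        have d: "((\<lambda>p. G1 (F1 p, F2 p)) has_derivative (\<lambda>h.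
            (dx G1 (F1 (0, y), F2 (0, y)) * dx F1 (0, y) + dy G1 (F1 (0, y), F2 (0, y)) * dx F2 (0, y)) * fst h
          + (dx G1 (F1 (0, y), F2 (0, y)) * dy F1 (0, y) + dy G1 (F1 (0, y), F2 (0, y)) * dy F2 (0, y)) * snd h)) (at (0, y))"
          by (rule has_derivative_compose_pair[OF hol2_has_derivative[OF F(1) p(1)] hol2_has_derivative[OF F(2) p(1)] hol2_has_derivative[OF G(1) p(2)]])
        have "(fst has_derivative (\<lambda>h. 1 * fst h + 0 * snd h)) (at (0::complex, y))"
          by (auto intro!: derivative_eq_intros)
        then have "((\<lambda>p. G1 (F1 p, F2 p)) has_derivative (\<lambda>h. 1 * fst h + 0 * snd h)) (at (0, y))"
          by (rule has_derivative_transform_within_open[OF _ W'(1) elim]) (use W(3) in \<open>auto simp: W'_def\<close>)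
        from has_derivative_dx_dy(1)[OF this] has_derivative_dx_dy(1)[OF d]
        show ?case by (simp add: e_def b_def)
      qed
    qed
    \<comment> \<open>On the axis \<open>dy G1\<close> is the derivative of a function of order k +
      1, so the second term of the chain rule is O(y^k).\<close>
    have vy: "vanishes k (\<lambda>y. dy G1 (0, y))"
      using vanishes_deriv[OF hol2_slice_y[OF G(1), of 0] open_slice_y[OF hol2_open[OF G(1)]] _ v1 k] G(3)
      by (simp add: dy_def zero_prod_def)
    have bd: "vanishes 0 (\<lambda>y. g (0, y))" if g: "hol2 g W" "0 \<in> W" for g W
    proof -
      have "(\<lambda>y. g (0, y) - g (0, 0)) holomorphic_on {y. (0, y) \<in> W}"
        by (intro holomorphic_intros hol2_slice_y g)
      from vanishes_mono[OF vanishes_1[OF this open_slice_y[OF hol2_open[OF g(1)]]], of 0] g(2)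
      have "vanishes 0 (\<lambda>y. g (0, y) - g (0, 0))" by (simp add: zero_prod_def)
      from vanishes_add[OF this vanishes_const[of "g (0, 0)"]] show ?thesis by simp
    qed
    have 1: "vanishes k (\<lambda>y. dx G1 (e y, y + b y) - dx G1 (0, y))" "vanishes k (\<lambda>y. dy G1 (e y, y + b y) - dy G1 (0, y))"
      using lip[OF dG(1)] lip[OF dG(2)] by (auto elim: vanishes_mono)
    have 2: "vanishes k (\<lambda>y. dy G1 (e y, y + b y))" using vanishes_add[OF 1(2) vy] by simp
    have "vanishes k (\<lambda>y. (- 1) * ((dx G1 (e y, y + b y) - dx G1 (0, y)) * dx F1 (0, y)) - dy G1 (e y, y + b y) * dx F2 (0, y))"
      using vanishes_diff[OF vanishes_cmult[OF vanishes_mult[OF 1(1) bd[OF hol2_dx[OF F(1)] F(3)]], of "-1"]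
        vanishes_mult[OF 2 bd[OF hol2_dx[OF F(2)] F(3)]]] by simp
    then show ?thesis
    proof (rule vanishes_cong[rotated])
      show "\<forall>\<^sub>F y in nhds 0. (- 1) * ((dx G1 (e y, y + b y) - dx G1 (0, y)) * dx F1 (0, y)) - dy G1 (e y, y + b y) * dx F2 (0, y)
        = dx G1 (0, y) * dx F1 (0, y) - 1"
        using chain
      proof eventually_elim
        case (elim y)
        then have "dy G1 (e y, y + b y) * dx F2 (0, y) = 1 - dx G1 (e y, y + b y) * dx F1 (0, y)" by (simp add: algebra_simps)
        then show ?case by (simp only:) (simp add: algebra_simps)
      qed
    qed
  qed
qed

text \<open>The substitution of c y for y multiplies \<beta> by c^k. Each root c of \<beta> c^k = -1
  thus turns an attracting direction into the positive real axis of
  \<open>center_germ\<close>.\<close>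

lemma scaled_petal:
  assumes F: "hol2 F1 U" "hol2 F2 U" "0 \<in> U" and k: "k \<ge> 1" and l: "dx F1 0 \<noteq> 1" "dx F2 0 = 0"
    and fl: "vanishes (Suc k) (\<lambda>y. F1 (0, y))" "vanishes (k + 2) (\<lambda>y. F2 (0, y) - (y + \<beta> * y ^ Suc k))"
    and c: "\<beta> * c ^ k = - 1"
    and \<theta>: "0 < \<theta>" "\<theta> \<le> 1 / (2 * real k)" and A: "C0 \<ge> 0" "\<rho>0 > 0"
      "\<And>y. y \<noteq> 0 \<Longrightarrow> cmod y < \<rho>0 \<Longrightarrow> \<bar>Arg y\<bar> \<le> \<theta> \<Longrightarrow> cmod (dx F1 (0, c * y)) \<ge> 1 - C0 * cmod y ^ k"
    and \<epsilon>: "\<epsilon> > 0"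
  shows "infinite_orbit_in (\<lambda>p. (F1 p, F2 p)) (ball 0 \<epsilon>)"
proof -
  have c0: "c \<noteq> 0" using c k by (auto simp: power_0_left)
  define T where "T z = (fst z, c * snd z)" for z :: complex2
  define G1 G2 where "G1 z = F1 (T z)" and "G2 z = F2 (T z) / c" for z
  define UG where "UG = {z. T z \<in> U}"
  have T: "hol2m T UNIV" unfolding hol2m_def T_def by (auto intro!: hol2_fst hol2_mult hol2_const hol2_snd)
  have oUG: "open UG"
    unfolding UG_def using open_vimage[OF hol2_open[OF F(1)], of T] hol2m_continuous_on[OF T] by (simp add: vimage_def)
  have T': "hol2m T UG" by (rule hol2m_subset[OF T oUG]) simp
  have h: "hol2 G1 UG" "hol2 (\<lambda>z. F2 (T z)) UG" unfolding G1_def[abs_def]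
    using hol2_compose_map[OF F(1) T'] hol2_compose_map[OF F(2) T'] by (auto simp: UG_def)
  have h2: "hol2 G2 UG" unfolding G2_def[abs_def] by (rule hol2_divide[OF h(2) hol2_const[OF oUG]]) (use c0 in auto)
  have d1: "dx G1 (0, y) = dx F1 (0, c * y)" for y by (simp add: G1_def[abs_def] dx_def T_def)
  have d2: "dx G2 0 = 0"
  proof -
    have "((\<lambda>x. F2 (x, snd (0::complex2))) has_field_derivative dx F2 0) (at (fst (0::complex2)))"
      using has_derivative_slice_x[OF hol2_has_derivative[OF F(2), of "(0, 0)"]] F(3) by (simp add: zero_prod_def)
    then have "((\<lambda>x. F2 (x, 0)) has_field_derivative 0) (at 0)" by (simp add: l(2))
    from DERIV_cdivide[OF this, of c] show ?thesis
      by (auto simp: dx_def G2_def[abs_def] T_def intro!: DERIV_imp_deriv)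
  qed
  interpret center_germ G1 G2 UG "dx F1 0" k
  proof
    show "0 \<in> UG" using F(3) by (simp add: UG_def T_def zero_prod_def)
    show "dx G1 0 = dx F1 0" using d1[of 0] by (simp add: zero_prod_def)
    show "vanishes (Suc k) (\<lambda>y. G1 (0, y))" using vanishes_scale[OF fl(1), of c] by (simp add: G1_def T_def)
    have "vanishes (k + 2) (\<lambda>y. (1 / c) * (F2 (0, c * y) - (c * y + \<beta> * (c * y) ^ Suc k)))"
      by (rule vanishes_cmult[OF vanishes_scale[OF fl(2)]])
    moreover have "(1 / c) * (F2 (0, c * y) - (c * y + \<beta> * (c * y) ^ Suc k)) = G2 (0, y) - (y - y ^ Suc k)" for y
    proof -
      have "\<beta> * (c * y) ^ Suc k = (\<beta> * c ^ k) * c * y ^ Suc k" by (simp add: power_mult_distrib)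
      then show ?thesis using c0 by (simp add: c G2_def T_def field_simps)
    qed
    ultimately show "vanishes (k + 2) (\<lambda>y. G2 (0, y) - (y - y ^ Suc k))" by simp
  qed (use h h2 k l d2 in auto)
  show ?thesis
  proof (rule infinite_orbit_transfer[of T "\<lambda>p. (G1 p, G2 p)" "\<lambda>p. (F1 p, F2 p)"])
    show "inj T" using c0 by (auto simp: T_def inj_on_def prod_eq_iff)
    show "isCont T 0" using hol2m_continuous_on[OF T] continuous_on_eq_continuous_at[OF open_UNIV, of T] by blast
    show "T (G1 z, G2 z) = (F1 (T z), F2 (T z))" for z using c0 by (simp add: G1_def G2_def) (simp add: T_def)
    show "infinite_orbit_in (\<lambda>p. (G1 p, G2 p)) (ball 0 e)" if "e > 0" for e
      by (rule petal[OF \<theta> A(1,2) _ that]) (use A(3) d1 in auto)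
  qed (use \<epsilon> in \<open>auto simp: T_def zero_prod_def\<close>)
qed

text \<open>The hypothesis of \<open>petal\<close> on the multiplier, for the direction c: in a thin
  sector it contracts by no more than the shrinking of |y|^M can outweigh.\<close>

definition sector_bound :: "(complex \<Rightarrow> complex) \<Rightarrow> complex \<Rightarrow> nat \<Rightarrow> bool" where
  "sector_bound A c k \<longleftrightarrow> (\<exists>\<theta> \<rho> C. 0 < \<theta> \<and> \<theta> \<le> 1 / (2 * real k) \<and> \<rho> > 0 \<and> C \<ge> 0 \<and>
     (\<forall>y. y \<noteq> 0 \<and> cmod y < \<rho> \<and> \<bar>Arg y\<bar> \<le> \<theta> \<longrightarrow> cmod (A (c * y)) \<ge> 1 - C * cmod y ^ k))"

lemma sector_bound_eventually:
  assumes "k \<ge> 1" "C \<ge> 0" "\<forall>\<^sub>F y in nhds 0. cmod (A (c * y)) \<ge> 1 - C * cmod y ^ k"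
  shows "sector_bound A c k"
proof -
  obtain d where "d > 0" "\<And>y. cmod y < d \<Longrightarrow> cmod (A (c * y)) \<ge> 1 - C * cmod y ^ k"
    using assms(3) unfolding eventually_nhds_metric by auto
  then show ?thesis unfolding sector_bound_def using assms(1,2)
    by (intro exI[of _ "1 / (2 * real k)"] exI[of _ d] exI[of _ C]) auto
qed

lemma sector_bound_expanding:
  assumes "k \<ge> 1" "A holomorphic_on S" "open S" "0 \<in> S" "cmod (A 0) > 1"
  shows "sector_bound A c k"
proof (rule sector_bound_eventually[of _ 0])
  have "\<forall>\<^sub>F y in nhds 0. 1 < cmod (A y)"
    by (rule order_tendstoD(1)[OF tendsto_norm[OF holomorphic_on_tendsto[OF assms(2-4)]] assms(5)])
  from eventually_compose_filterlim[OF this filterlim_times_nhds_0[of c]]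
  show "\<forall>\<^sub>F y in nhds 0. cmod (A (c * y)) \<ge> 1 - 0 * cmod y ^ k" by eventually_elim simp
qed (use assms in auto)

lemma sector_bound_flat:
  assumes "k \<ge> 1" "cmod lam = 1" "vanishes k (\<lambda>y. A y / lam - 1)"
  shows "sector_bound A c k"
proof -
  obtain C where C: "C \<ge> 0" "\<forall>\<^sub>F y in nhds 0. cmod (A (c * y) / lam - 1) \<le> C * cmod y ^ k"
    using vanishes_scale[OF assms(3), of c] by (auto simp: vanishes_def)
  show ?thesis
  proof (rule sector_bound_eventually[OF assms(1) C(1)])
    show "\<forall>\<^sub>F y in nhds 0. cmod (A (c * y)) \<ge> 1 - C * cmod y ^ k"
      using C(2)
    proof eventually_elim
      case (elim y)
      then show ?case using norm_triangle_ineq2[of 1 "1 - A (c * y) / lam"] assms(2)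
        by (simp add: norm_divide norm_minus_commute)
    qed
  qed
qed

text \<open>In a thin sector around c, the term a y^j has positive real part and dominates the
  error, so the modulus of the multiplier is at least 1 there and the constant C can be 0.\<close>

lemma sector_bound_leading:
  assumes k: "k \<ge> 1" and lam: "cmod lam = 1" and v: "vanishes (Suc j) (\<lambda>y. A y / lam - 1 - a * y ^ j)"
    and pos: "Re (a * c ^ j) > 0"
  shows "sector_bound A c k"
proof -
  define z where "z = a * c ^ j"
  obtain C where C: "C \<ge> 0" "\<forall>\<^sub>F y in nhds 0. cmod (A (c * y) / lam - 1 - a * (c * y) ^ j) \<le> C * cmod y ^ Suc j"
    using vanishes_scale[OF v, of c] by (auto simp: vanishes_def)
  then obtain d where d: "d > 0" "\<And>y. cmod y < d \<Longrightarrow> cmod (A (c * y) / lam - 1 - a * (c * y) ^ j) \<le> C * cmod y ^ Suc j"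
    unfolding eventually_nhds_metric by auto
  define \<delta> where "\<delta> = Re z / 2"
  have \<delta>: "\<delta> > 0" "Re z > \<delta>" using pos by (auto simp: \<delta>_def z_def)
  have "isCont (\<lambda>\<phi>. Re (z * cis (real j * \<phi>))) 0" by simp
  then have "((\<lambda>\<phi>. Re (z * cis (real j * \<phi>))) \<longlongrightarrow> Re z) (nhds 0)"
    using tendsto_at_iff_tendsto_nhds[of "\<lambda>\<phi>. Re (z * cis (real j * \<phi>))" 0] by (simp add: isCont_def)
  from order_tendstoD(1)[OF this \<delta>(2)] obtain t where t: "t > 0" "\<And>\<phi>. \<bar>\<phi>\<bar> < t \<Longrightarrow> \<delta> < Re (z * cis (real j * \<phi>))"
    unfolding eventually_nhds_metric by (auto simp: dist_real_def)
  define \<theta> where "\<theta> = min (t / 2) (1 / (2 * real k))"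
  define \<rho> where "\<rho> = min d (\<delta> / (C + 1))"
  show ?thesis unfolding sector_bound_def
  proof (rule exI[of _ \<theta>], rule exI[of _ \<rho>], rule exI[of _ 0], intro conjI allI impI)
    fix y :: complex assume y: "y \<noteq> 0 \<and> cmod y < \<rho> \<and> \<bar>Arg y\<bar> \<le> \<theta>"
    define R where "R = A (c * y) / lam - 1 - a * (c * y) ^ j"
    have R: "cmod R \<le> C * cmod y ^ Suc j" unfolding R_def using y by (intro d) (simp add: \<rho>_def)
    have yp: "y ^ j = complex_of_real (cmod y ^ j) * cis (real j * Arg y)"
      by (metis rcis_cmod_Arg DeMoivre2 rcis_def mult.commute)
    have "z * y ^ j = complex_of_real (cmod y ^ j) * (z * cis (real j * Arg y))" by (simp only: yp mult_ac)
    then have "Re (z * y ^ j) = cmod y ^ j * Re (z * cis (real j * Arg y))" by (simp only: Re_complex_of_real times_complex.sel Im_complex_of_real mult_zero_left diff_0_right)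
    moreover have "Re (z * cis (real j * Arg y)) \<ge> \<delta>" using t(2)[of "Arg y"] y t(1) by (simp add: \<theta>_def)
    ultimately have 1: "Re (z * y ^ j) \<ge> cmod y ^ j * \<delta>" by (simp add: mult_left_mono)
    have "C * cmod y \<le> (C + 1) * cmod y" by (simp add: mult_right_mono)
    also have "\<dots> \<le> \<delta>" using y C(1) by (simp add: \<rho>_def field_simps)
    finally have "(C * cmod y) * cmod y ^ j \<le> \<delta> * cmod y ^ j" by (rule mult_right_mono) simp
    then have 2: "cmod R \<le> cmod y ^ j * \<delta>" using R by (simp add: mult_ac)
    have "A (c * y) / lam = 1 + z * y ^ j + R" by (simp add: R_def z_def power_mult_distrib)
    then have "Re (A (c * y) / lam) \<ge> 1" using 1 2 abs_Re_le_cmod[of R] by simp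
    then have "cmod (A (c * y) / lam) \<ge> 1" using abs_Re_le_cmod[of "A (c * y) / lam"] by linarith
    then show "cmod (A (c * y)) \<ge> 1 - 0 * cmod y ^ k" using lam by (simp add: norm_divide)
  qed (use t d \<delta> C k in \<open>auto simp: \<theta>_def \<rho>_def\<close>)
qed

text \<open>The powers of w = cis (\<pi> (k + j) / k) with l < 2 k sum to 0. If no real part were
  positive, all would vanish; then z and z w would both be imaginary, although w is not real. The
  exponent k + j combines the j-th power of a direction with the sign (-1)^l that separates
  directions of F from those of the inverse.\<close>

lemma root_of_unity_direction:
  fixes z :: complex
  assumes j: "0 < j" "j < k" and z: "z \<noteq> 0"
  shows "\<exists>l. Re (z * cis (pi * real l * real (k + j) / real k)) > 0"
proof (rule ccontr)
  define w where "w = cis (pi * real (k + j) / real k)"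
  have wp: "w ^ l = cis (pi * real l * real (k + j) / real k)" for l unfolding w_def Complex.DeMoivre by (intro arg_cong[where f = cis]) simp
  assume "\<nexists>l. Re (z * cis (pi * real l * real (k + j) / real k)) > 0"
  then have n: "Re (z * w ^ l) \<le> 0" for l using wp by (simp add: not_less)
  have im: "Im w \<noteq> 0"
  proof -
    have "pi * real (k + j) / real k = pi + pi * (real j / real k)" using j by (simp add: field_simps)
    moreover have "0 < pi * (real j / real k)" "pi * (real j / real k) < pi" using j by (simp_all add: field_simps)
    ultimately show ?thesis using sin_gt_zero[of "pi * (real j / real k)"] by (simp add: w_def sin_add)
  qed
  have "w ^ (2 * k) = cis (2 * pi * real (k + j))" unfolding wp using j by (intro arg_cong[where f = cis]) simp
  also have "\<dots> = 1" by (rule cis_multiple_2pi) (rule Ints_of_nat)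
  finally have "(\<Sum>l<2 * k. w ^ l) = 0" using geometric_sum[of w "2 * k"] im by (cases "w = 1") auto
  then have "(\<Sum>l<2 * k. z * w ^ l) = 0" by (simp add: sum_distrib_left[symmetric])
  then have "(\<Sum>l<2 * k. - Re (z * w ^ l)) = 0" using Re_sum[of "\<lambda>l. z * w ^ l" "{..<2 * k}"] by (simp only: sum_negf) simp
  then have all: "Re (z * w ^ l) = 0" if "l < 2 * k" for l
    using sum_nonneg_eq_0_iff[of "{..<2 * k}" "\<lambda>l. - Re (z * w ^ l)"] n that by auto
  have "Re z = 0" "Re (z * w) = 0" using all[of 0] all[of 1] j by auto
  then show False using im z by (auto simp: complex_eq_iff)
qed

text \<open>If g were O(y^n) for every n, Cauchy's estimates would make its Taylor series zero; so
  some monomial leads, with exponent at least 2.\<close>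

lemma finite_order:
  assumes g: "g holomorphic_on S" "open S" "0 \<in> S" "vanishes 2 g" and nz: "\<not> (\<forall>\<^sub>F y in nhds 0. g y = 0)"
  shows "\<exists>k\<ge>1. \<exists>a. a \<noteq> 0 \<and> vanishes (k + 2) (\<lambda>y. g y - a * y ^ Suc k)"
proof -
  obtain R where R: "R > 0" "ball 0 R \<subseteq> S" using g(2,3) open_contains_ball by blast
  have "\<exists>n. \<not> vanishes n g"
  proof (rule ccontr)
    assume all: "\<nexists>n. \<not> vanishes n g"
    have d0: "(deriv ^^ n) g 0 = 0" for n
    proof -
      obtain C where C: "C \<ge> 0" "\<forall>\<^sub>F y in nhds 0. cmod (g y) \<le> C * cmod y ^ Suc n" using all unfolding vanishes_def by blast
      then obtain d where d: "d > 0" "\<And>y. cmod y < d \<Longrightarrow> cmod (g y) \<le> C * cmod y ^ Suc n"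
        unfolding eventually_nhds_metric by auto
      have b: "cmod ((deriv ^^ n) g 0 / fact n) \<le> C * s" if s: "s > 0" "s < min R d" for s
      proof -
        have "cmod ((deriv ^^ n) g 0 / fact n) \<le> (C * s ^ Suc n) / s ^ n"
        proof (rule cauchy_coeff_bound[OF g(1,2) _ s(1)])
          show "cball 0 s \<subseteq> S" using R(2) s by auto
          fix w :: complex assume w: "w \<in> cball 0 s"
          then have "cmod (g w) \<le> C * cmod w ^ Suc n" using d(2)[of w] s by simp
          also have "\<dots> \<le> C * s ^ Suc n" using w C(1) by (intro mult_left_mono power_mono) auto
          finally show "cmod (g w) \<le> C * s ^ Suc n" .
        qed
        then show ?thesis using s by simp
      qed
      have "cmod ((deriv ^^ n) g 0 / fact n) \<le> 0"
      proof (rule tendsto_lowerbound)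
        have "((\<lambda>s. C * s) \<longlongrightarrow> C * 0) (at_right 0)" by (intro tendsto_intros)
        then show "((\<lambda>s. C * s) \<longlongrightarrow> 0) (at_right 0)" by simp
        show "\<forall>\<^sub>F s in at_right 0. cmod ((deriv ^^ n) g 0 / fact n) \<le> C * s"
          using b R d by (auto simp: eventually_at_right intro!: exI[of _ "min R d"])
      qed simp
      then show ?thesis by simp
    qed
    have "g y = 0" if "y \<in> ball 0 R" for y
      by (rule holomorphic_fun_eq_0_on_ball[OF holomorphic_on_subset[OF g(1) R(2)] that d0])
    then have "\<forall>\<^sub>F y in nhds 0. g y = 0" using eventually_nhds_in_open[of "ball 0 R" 0] R(1) by (auto elim: eventually_mono)
    with nz show False by simp
  qed
  then obtain n j a where j: "2 \<le> j" "a \<noteq> 0" "vanishes (Suc j) (\<lambda>y. g y - a * y ^ j)" using vanishes_cases[OF g] by blast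
  obtain k where "j = Suc (Suc k)" using j(1) by (auto simp: numeral_2_eq_2 dest: Suc_le_D)
  then show ?thesis using j by (intro exI[of _ "Suc k"]) auto
qed

text \<open>If |\<lambda>| \<noteq> 1, then F or its inverse expands transversally and any
  attracting direction serves. If |\<lambda>| = 1, the relative deviation of the multiplier is
  either O(y^k), harmless in every direction, or has a leading term a y^j with j < k;
  \<open>root_of_unity_direction\<close> then yields a direction of F with Re (a c^j) > 0 or one of
  the inverse with Re (-a c^j) > 0.\<close>

lemma parabolic_center_infinite_orbit:
  assumes F: "hol2 F1 U" "hol2 F2 U" "0 \<in> U" "F1 0 = 0" "F2 0 = 0"
    and dF: "dx F1 0 = lam" "lam \<noteq> 1" "lam \<noteq> 0" "dx F2 0 = 0"
    and k: "k \<ge> 1" and \<beta>: "\<beta> \<noteq> 0"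
    and fl: "vanishes (Suc k) (\<lambda>y. F1 (0, y))" "vanishes (k + 2) (\<lambda>y. F2 (0, y) - (y + \<beta> * y ^ Suc k))"
    and G: "hol2 G1 V" "hol2 G2 V" "0 \<in> V"
    and inv: "\<forall>\<^sub>F p in nhds 0. G1 (F1 p, F2 p) = fst p \<and> G2 (F1 p, F2 p) = snd p"
    and dG: "dx G2 0 = 0" "dy G2 0 = 1"
  shows "(\<forall>\<epsilon>>0. infinite_orbit_in (\<lambda>p. (F1 p, F2 p)) (ball 0 \<epsilon>))
       \<or> (\<forall>\<epsilon>>0. infinite_orbit_in (\<lambda>p. (G1 p, G2 p)) (ball 0 \<epsilon>))"
    (is "?F \<or> ?G")
proof -
  note inv_data = inverse_germ_data[OF F k fl G inv dG]
  define A B where "A y = dx F1 (0, y)" and "B y = dx G1 (0, y)" for y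
  have AB: "vanishes k (\<lambda>y. B y * A y - 1)" using inv_data(3) by (simp add: A_def B_def)
  then obtain k' where k': "k = Suc k'" and AB': "vanishes (Suc k') (\<lambda>y. B y * A y - 1)" using k by (cases k) auto
  have A0: "A 0 = lam" using dF(1) by (simp add: A_def zero_prod_def)
  have B0: "B 0 = 1 / lam" using vanishes_at_0[OF AB'] dF(3) by (simp add: A0 field_simps)
  have dG1: "dx G1 0 \<noteq> 1" using B0 dF(2,3) by (simp add: B_def zero_prod_def)
  define SF SG where "SF = {y. (0::complex, y) \<in> U}" and "SG = {y. (0::complex, y) \<in> V}"
  have SF: "A holomorphic_on SF" "open SF" "0 \<in> SF"
    unfolding A_def[abs_def] SF_def using hol2_slice_y[OF hol2_dx[OF F(1)]] open_slice_y[OF hol2_open[OF F(1)]] F(3)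
    by (auto simp: zero_prod_def)
  have SG: "B holomorphic_on SG" "open SG" "0 \<in> SG"
    unfolding B_def[abs_def] SG_def using hol2_slice_y[OF hol2_dx[OF G(1)]] open_slice_y[OF hol2_open[OF G(1)]] G(3)
    by (auto simp: zero_prod_def)
  have viaF: ?F if c: "\<beta> * c ^ k = - 1" and b: "sector_bound A c k" for c
  proof -
    obtain \<theta> \<rho> C where t: "0 < \<theta>" "\<theta> \<le> 1 / (2 * real k)" "C \<ge> 0" "\<rho> > 0"
      "\<And>y. y \<noteq> 0 \<Longrightarrow> cmod y < \<rho> \<Longrightarrow> \<bar>Arg y\<bar> \<le> \<theta> \<Longrightarrow> cmod (dx F1 (0, c * y)) \<ge> 1 - C * cmod y ^ k"
      using b unfolding sector_bound_def A_def by blast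
    show ?thesis using scaled_petal[OF F(1-3) k _ dF(4) fl c t] dF(1,2) by blast
  qed
  have viaG: ?G if c: "(- \<beta>) * c ^ k = - 1" and b: "sector_bound B c k" for c
  proof -
    obtain \<theta> \<rho> C where t: "0 < \<theta>" "\<theta> \<le> 1 / (2 * real k)" "C \<ge> 0" "\<rho> > 0"
      "\<And>y. y \<noteq> 0 \<Longrightarrow> cmod y < \<rho> \<Longrightarrow> \<bar>Arg y\<bar> \<le> \<theta> \<Longrightarrow> cmod (dx G1 (0, c * y)) \<ge> 1 - C * cmod y ^ k"
      using b unfolding sector_bound_def B_def by blast
    show ?thesis using scaled_petal[OF G(1-3) k dG1 dG(1) inv_data(1,2) c t] by blast
  qed
  have root: "\<exists>c. b * c ^ k = - 1" if "b \<noteq> 0" for b :: complex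
  proof -
    obtain c where "c ^ k = - 1 / b" using nth_root_exists k by (metis less_one linorder_not_less exists_complex_root)
    then show ?thesis using that by (auto simp: field_simps)
  qed
  obtain c0 where c0: "\<beta> * c0 ^ k = - 1" using root[OF \<beta>] by blast
  consider "cmod lam > 1" | "cmod lam < 1" | "cmod lam = 1" by linarith
  then show ?thesis
  proof cases
    case 1
    then show ?thesis using viaF[OF c0 sector_bound_expanding[OF k SF]] A0 by simp
  next
    case 2
    obtain c where c: "(- \<beta>) * c ^ k = - 1" using root[of "- \<beta>"] \<beta> by auto
    show ?thesis using viaG[OF c sector_bound_expanding[OF k SG]] B0 2 dF(3) by (simp add: norm_divide)
  next
    case 3
    define h where "h y = A y / lam - 1" for y
    have h: "h holomorphic_on SF" "vanishes 1 h"
    proof -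
      show *: "h holomorphic_on SF" unfolding h_def[abs_def] using dF(3) by (intro holomorphic_intros SF) auto
      show "vanishes 1 h" by (rule vanishes_1[OF * SF(2,3)]) (use A0 dF(3) in \<open>simp add: h_def\<close>)
    qed
    from vanishes_cases[OF h(1) SF(2,3) h(2), of k] show ?thesis
    proof (elim disjE exE conjE)
      assume "vanishes k h"
      then show ?thesis using viaF[OF c0 sector_bound_flat[OF k 3]] by (simp add: h_def[abs_def])
    next
      fix j a assume j: "1 \<le> j" "j < k" and a: "a \<noteq> 0" and v: "vanishes (Suc j) (\<lambda>y. h y - a * y ^ j)"
      define g where "g y = B y / (1 / lam) - 1" for y
      have "g holomorphic_on SG" unfolding g_def[abs_def] using dF(3) by (intro holomorphic_intros SG) auto
      then have g1: "vanishes 1 g" by (rule vanishes_1[OF _ SG(2,3)]) (use B0 dF(3) in \<open>simp add: g_def\<close>)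
      have vj: "vanishes j h" using vanishes_add[OF vanishes_mono[OF v, of j] vanishes_power[of j a]] by simp
      \<comment> \<open>From B A = 1 + O(y^k) and j < k, the relative multipliers of F and its
        inverse have opposite leading coefficients.\<close>
      have gv: "vanishes (Suc j) (\<lambda>y. g y - (- a) * y ^ j)"
      proof -
        have "vanishes (Suc j) (\<lambda>y. g y * h y)" using vanishes_mult[OF g1 vj] by simp
        moreover have "vanishes (Suc j) (\<lambda>y. B y * A y - 1)" using vanishes_mono[OF AB] j by simp
        ultimately have "vanishes (Suc j) (\<lambda>y. (B y * A y - 1) - (h y - a * y ^ j) - g y * h y)"
          by (intro vanishes_diff[OF vanishes_diff[OF _ v]])
        moreover have "(B y * A y - 1) - (h y - a * y ^ j) - g y * h y = g y - (- a) * y ^ j" for y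
          using dF(3) by (simp add: g_def h_def field_simps)
        ultimately show ?thesis by simp
      qed
      \<comment> \<open>The 2 k-th roots of unity: even l give attracting directions of F, odd l
        those of the inverse.\<close>
      define r where "r l = cis (pi * real l / real k)" for l
      have rk: "r l ^ k = (- 1) ^ l" for l
      proof -
        have "r l ^ k = cis (real l * pi)" unfolding r_def Complex.DeMoivre using k by (intro arg_cong[where f = cis]) simp
        also have "\<dots> = (- 1) ^ l" by (simp only: Complex.DeMoivre[symmetric] cis_pi)
        finally show ?thesis .
      qed
      obtain l where l: "Re ((a * c0 ^ j) * cis (pi * real l * real (k + j) / real k)) > 0"
      proof -
        have "c0 \<noteq> 0" using c0 k by (auto simp: power_0_left)
        then show ?thesis using root_of_unity_direction[of j k "a * c0 ^ j"] j a that by auto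
      qed
      define c where "c = c0 * r l"
      have e: "(a * c0 ^ j) * cis (pi * real l * real (k + j) / real k) = (- 1) ^ l * (a * c ^ j)"
      proof -
        have "cis (pi * real l * real (k + j) / real k) = r l ^ (k + j)" by (simp add: r_def Complex.DeMoivre mult_ac)
        then show ?thesis by (simp add: c_def power_mult_distrib power_add rk mult_ac)
      qed
      have ck: "\<beta> * c ^ k = - ((- 1) ^ l)"
      proof -
        have "\<beta> * c ^ k = (\<beta> * c0 ^ k) * r l ^ k" by (simp add: c_def power_mult_distrib)
        then show ?thesis by (simp add: c0 rk)
      qed
      have pos: "Re ((- 1) ^ l * (a * c ^ j)) > 0" using l unfolding e .
      show ?thesis
      proof (cases "even l")
        case True
        then have "Re (a * c ^ j) > 0" "\<beta> * c ^ k = - 1" using pos ck by simp_all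
        from viaF[OF this(2) sector_bound_leading[OF k 3 v[unfolded h_def] this(1)]] show ?thesis ..
      next
        case False
        then have p: "Re ((- a) * c ^ j) > 0" "(- \<beta>) * c ^ k = - 1" using pos ck by simp_all
        have "cmod (1 / lam) = 1" using 3 by (simp add: norm_divide)
        from viaG[OF p(2) sector_bound_leading[OF k this gv[unfolded g_def] p(1)]] show ?thesis ..
      qed
    qed
  qed
qed

text \<open>The displacement g on the axis has order at least 2, as \<open>dy F2 0 = 1\<close>, and
  it has a leading term since it is not identically 0. The bound of F1 by the displacement carries
  this order over to F1.\<close>

theorem center_infinite_orbit:
  assumes F: "hol2 F1 U" "hol2 F2 U" "0 \<in> U" "F1 0 = 0" "F2 0 = 0"
    and dF: "dx F1 0 \<noteq> 1" "dx F1 0 \<noteq> 0" "dx F2 0 = 0" "dy F2 0 = 1"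
    and c: "C \<ge> 0" "\<forall>\<^sub>F y in nhds 0. cmod (F1 (0, y)) \<le> C * cmod (F2 (0, y) - y)"
    and nz: "\<not> (\<forall>\<^sub>F y in nhds 0. F2 (0, y) = y)"
    and G: "hol2 G1 V" "hol2 G2 V" "0 \<in> V"
    and inv: "\<forall>\<^sub>F p in nhds 0. G1 (F1 p, F2 p) = fst p \<and> G2 (F1 p, F2 p) = snd p"
    and dG: "dx G2 0 = 0" "dy G2 0 = 1"
  shows "(\<forall>\<epsilon>>0. infinite_orbit_in (\<lambda>p. (F1 p, F2 p)) (ball 0 \<epsilon>))
       \<or> (\<forall>\<epsilon>>0. infinite_orbit_in (\<lambda>p. (G1 p, G2 p)) (ball 0 \<epsilon>))"
proof -
  define S where "S = {y. (0::complex, y) \<in> U}"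
  define g where "g y = F2 (0, y) - y" for y
  have S: "open S" "0 \<in> S" unfolding S_def using open_slice_y[OF hol2_open[OF F(1)]] F(3) by (auto simp: zero_prod_def)
  have gh: "g holomorphic_on S" unfolding g_def[abs_def] S_def by (intro holomorphic_intros hol2_slice_y[OF F(2)])
  have "vanishes 1 g" by (rule vanishes_1[OF gh S]) (use F(5) in \<open>simp add: g_def zero_prod_def\<close>)
  then obtain b where b: "vanishes 2 (\<lambda>y. g y - b * y ^ 1)" using vanishes_leading[OF gh S, of 1] by (auto simp: numeral_2_eq_2)
  have "deriv (\<lambda>y. g y - b * y) 0 = 0"
  proof -
    have "vanishes 1 (deriv (\<lambda>y. g y - b * y))"
      by (rule vanishes_deriv[of _ S]) (use b gh S in \<open>auto intro!: holomorphic_intros simp: numeral_2_eq_2\<close>)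
    from vanishes_at_0[OF this[unfolded One_nat_def]] show ?thesis .
  qed
  moreover have "((\<lambda>y. g y - b * y) has_field_derivative (1 - 1 - b)) (at 0)"
  proof -
    have "((\<lambda>y. F2 (0, y)) has_field_derivative dy F2 (0, 0)) (at 0)"
      using has_derivative_slice_y[OF hol2_has_derivative[OF F(2), of "(0, 0)"]] F(3) by (simp add: zero_prod_def)
    then have "((\<lambda>y. F2 (0, y)) has_field_derivative 1) (at 0)" using dF(4) by (simp add: zero_prod_def)
    then show ?thesis unfolding g_def by (auto intro!: derivative_eq_intros)
  qed
  ultimately have "b = 0" by (simp add: DERIV_imp_deriv)
  with b have "vanishes 2 g" by simp
  moreover have "\<not> (\<forall>\<^sub>F y in nhds 0. g y = 0)" using nz by (simp add: g_def)
  ultimately obtain k \<beta> where k: "k \<ge> 1" "\<beta> \<noteq> 0" "vanishes (k + 2) (\<lambda>y. g y - \<beta> * y ^ Suc k)"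
    using finite_order[OF gh S] by blast
  have "vanishes (Suc k) g"
    using vanishes_add[OF vanishes_mono[OF k(3), of "Suc k"] vanishes_power[of "Suc k" \<beta>]] by simp
  then have v1: "vanishes (Suc k) (\<lambda>y. F1 (0, y))"
    by (rule vanishes_bounded_compose[OF _ c(1)]) (use c(2) in \<open>simp add: g_def\<close>)
  have v2: "vanishes (k + 2) (\<lambda>y. F2 (0, y) - (y + \<beta> * y ^ Suc k))"
    using k(3) by (simp add: g_def algebra_simps)
  show ?thesis by (rule parabolic_center_infinite_orbit[OF F refl dF(1-3) k(1,2) v1 v2 G inv dG])
qed

subsection \<open>Infinite orbits near a curve of fixed points\<close>

lemma infinite_range_orbit:
  assumes "inj g" shows "infinite (range (g :: nat \<Rightarrow> 'a))"
  using assms finite_imageD infinite_UNIV_nat by blast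

text \<open>The weighted distance V cannot increase, because the contraction of x by \<rho> pays for
  the drift of y by at most M |x|. The coordinate x stays nonzero and decreases strictly in modulus,
  so the iterates are distinct.\<close>

lemma contraction_infinite_orbit:
  assumes F: "hol2m F D" "(0, y0) \<in> D" "\<And>y. (0, y) \<in> D \<Longrightarrow> F (0, y) = (0, y)"
    and mult: "0 < cmod (dx (\<lambda>z. fst (F z)) (0, y0))" "cmod (dx (\<lambda>z. fst (F z)) (0, y0)) < 1" and e: "e > 0"
  shows "infinite_orbit_in F (ball (0, y0) e)"
proof -
  have F12: "hol2 (\<lambda>z. fst (F z)) D" "hol2 (\<lambda>z. snd (F z)) D" using F(1) by (auto simp: hol2m_def)
  have oD: "open D" by (rule hol2m_open[OF F(1)])
  obtain E1 where E1: "hol2 E1 D" "\<And>p. p \<in> D \<Longrightarrow> fst (F p) = fst p * E1 p" "\<And>y. E1 (0, y) = dx (\<lambda>z. fst (F z)) (0, y)"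
    using hol2_divide_fst[OF F12(1)] F(3) by auto
  obtain E2 where E2: "hol2 E2 D" "\<And>p. p \<in> D \<Longrightarrow> snd (F p) - snd p = fst p * E2 p"
    using hol2_divide_fst[OF hol2_diff[OF F12(2) hol2_snd[OF oD]]] F(3) by auto
  define \<rho> where "\<rho> = (cmod (E1 (0, y0)) + 1) / 2"
  define M where "M = cmod (E2 (0, y0)) + 1"
  have \<rho>: "cmod (E1 (0, y0)) < \<rho>" "\<rho> < 1" "\<rho> > 0"
    using mult norm_ge_zero[of "E1 (0, y0)"] by (simp_all add: \<rho>_def E1(3) del: norm_ge_zero zero_less_norm_iff)
  have M: "cmod (E2 (0, y0)) < M" "M \<ge> 1" by (auto simp: M_def)
  have t: "(E1 \<longlongrightarrow> E1 (0, y0)) (nhds (0, y0))" "(E2 \<longlongrightarrow> E2 (0, y0)) (nhds (0, y0))"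
    using hol2_continuous_on[OF E1(1)] hol2_continuous_on[OF E2(1)] F(2) oD by (auto intro: continuous_on_open_tendsto)
  have "\<forall>\<^sub>F p in nhds (0, y0). p \<in> D \<and> cmod (E1 p) < \<rho> \<and> 0 < cmod (E1 p) \<and> cmod (E2 p) < M"
    using eventually_nhds_in_open[OF oD F(2)] order_tendstoD(2)[OF tendsto_norm[OF t(1)] \<rho>(1)]
      order_tendstoD(1)[OF tendsto_norm[OF t(1)], of 0] mult(1) order_tendstoD(2)[OF tendsto_norm[OF t(2)] M(1)]
    by (auto simp: E1(3) eventually_conj_iff)
  then obtain d where d: "d > 0" "\<And>p. dist p (0, y0) < d \<Longrightarrow> p \<in> D \<and> cmod (E1 p) < \<rho> \<and> 0 < cmod (E1 p) \<and> cmod (E2 p) < M"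
    unfolding eventually_nhds_metric by blast
  define d' where "d' = min d e"
  have d': "d' > 0" "d' \<le> d" "d' \<le> e" using d e by (auto simp: d'_def)
  \<comment> \<open>The solution of K \<rho> + M = K, the balance between contraction and
    drift.\<close>
  define K where "K = M / (1 - \<rho>)"
  have K: "K \<ge> 1" "K * \<rho> + M = K" using M \<rho> by (auto simp: K_def field_simps)
  define V where "V p = K * cmod (fst p) + cmod (snd p - y0)" for p :: complex2
  have dV: "dist p (0, y0) \<le> V p" for p
  proof -
    have "dist p (0, y0) \<le> cmod (fst p) + cmod (snd p - y0)"
      using norm_Pair_le[of "fst p" "snd p - y0"] by (cases p) (simp add: dist_norm)
    also have "\<dots> \<le> V p" using K(1) mult_right_mono[of 1 K "cmod (fst p)"] by (simp add: V_def)
    finally show ?thesis .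
  qed
  have step: "V (F p) < d' \<and> fst (F p) \<noteq> 0 \<and> cmod (fst (F p)) < cmod (fst p)" if p: "V p < d'" "fst p \<noteq> 0" for p
  proof -
    have q: "p \<in> D" "cmod (E1 p) < \<rho>" "0 < cmod (E1 p)" "cmod (E2 p) < M" using d(2)[of p] dV[of p] p d' by auto
    have x: "cmod (fst (F p)) = cmod (fst p) * cmod (E1 p)" by (simp add: E1(2)[OF q(1)] norm_mult)
    have "snd (F p) - y0 = (snd p - y0) + fst p * E2 p" using E2(2)[OF q(1)] by (simp add: algebra_simps)
    then have "cmod (snd (F p) - y0) \<le> cmod (snd p - y0) + cmod (fst p) * cmod (E2 p)"
      using norm_triangle_ineq[of "snd p - y0" "fst p * E2 p"] by (simp only: norm_mult)
    also have "\<dots> \<le> cmod (snd p - y0) + cmod (fst p) * M" using q(4) by (intro add_left_mono mult_left_mono) auto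
    finally have y: "cmod (snd (F p) - y0) \<le> cmod (snd p - y0) + cmod (fst p) * M" .
    have "K * cmod (fst (F p)) \<le> K * (cmod (fst p) * \<rho>)" unfolding x using q(2) K(1) by (intro mult_left_mono) auto
    with y have "V (F p) \<le> cmod (snd p - y0) + (K * \<rho> + M) * cmod (fst p)" by (simp add: V_def algebra_simps)
    then have "V (F p) \<le> V p" by (simp add: K(2) V_def)
    moreover have "cmod (fst p) * cmod (E1 p) < cmod (fst p) * 1" using q \<rho> p(2) by (intro mult_strict_left_mono) auto
    ultimately show ?thesis using p q(3) x by auto
  qed
  define p0 where "p0 = (complex_of_real (d' / (2 * K)), y0)"
  have p0: "V p0 < d'" "fst p0 \<noteq> 0" using d' K by (auto simp: p0_def V_def norm_divide norm_mult)
  have all: "V ((F ^^ n) p0) < d' \<and> fst ((F ^^ n) p0) \<noteq> 0" for n by (induction n) (use p0 step in auto)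
  have "strict_mono (\<lambda>n. - cmod (fst ((F ^^ n) p0)))"
    unfolding strict_mono_Suc_iff using step all by simp
  then have "inj (\<lambda>n. - cmod (fst ((F ^^ n) p0)))" by (rule strict_mono_imp_inj_on)
  then have "inj (\<lambda>n. (F ^^ n) p0)" by (auto simp: inj_def)
  then have "infinite (range (\<lambda>n. (F ^^ n) p0))" by (rule infinite_range_orbit)
  moreover have "(F ^^ n) p0 \<in> ball (0, y0) e" for n
    using dV[of "(F ^^ n) p0"] all[of n] d' by (simp add: dist_commute)
  ultimately show ?thesis by blast
qed

lemma powers_distinct:
  fixes lam :: complex
  assumes "\<And>n. n > 0 \<Longrightarrow> lam ^ n \<noteq> 1" "lam \<noteq> 0" shows "inj (\<lambda>n. lam ^ n)"
proof -
  have "i = j" if "lam ^ i = lam ^ j" "i \<le> j" for i j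
  proof (rule ccontr)
    assume "i \<noteq> j"
    then have "lam ^ (j - i) = 1" using that assms(2) power_diff[of lam i j] by simp
    then show False using assms(1)[of "j - i"] \<open>i \<noteq> j\<close> that(2) by simp
  qed
  then show ?thesis unfolding inj_def by (metis nle_le)
qed

text \<open>With first component x (\<lambda> + x E2) and second component y + x b, the requirement
  that F act on t \<mapsto> (t \<xi>, \<eta>) as t \<mapsto> \<lambda> t is the system of
  \<open>Bruno_curve\<close> for a = E2 / \<lambda>. A small t \<noteq> 0 has an infinite orbit
  because the powers of \<lambda> are distinct and t \<xi>(t) is injective near 0.\<close>

lemma Bruno_infinite_orbit:
  assumes F: "hol2m F D" "0 \<in> D" "\<And>y. (0, y) \<in> D \<Longrightarrow> F (0, y) = (0, y)"
    "\<And>y. (0, y) \<in> D \<Longrightarrow> dx (\<lambda>z. fst (F z)) (0, y) = lam"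
    and lam: "Bruno lam" "\<And>n. n > 0 \<Longrightarrow> lam ^ n \<noteq> 1" and e: "e > 0"
  shows "infinite_orbit_in F (ball 0 e)"
proof -
  have nl: "cmod lam = 1" using lam(1) by (simp add: Bruno_def)
  then have l0: "lam \<noteq> 0" by auto
  have F12: "hol2 (\<lambda>z. fst (F z)) D" "hol2 (\<lambda>z. snd (F z)) D" using F(1) by (auto simp: hol2m_def)
  have oD: "open D" by (rule hol2m_open[OF F(1)])
  obtain E1 where E1: "hol2 E1 D" "\<And>p. p \<in> D \<Longrightarrow> fst (F p) = fst p * E1 p" "\<And>y. E1 (0, y) = dx (\<lambda>z. fst (F z)) (0, y)"
    using hol2_divide_fst[OF F12(1)] F(3) by auto
  obtain E2 where E2: "hol2 E2 D" "\<And>p. p \<in> D \<Longrightarrow> E1 p - lam = fst p * E2 p"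
    using hol2_divide_fst[OF hol2_diff[OF E1(1) hol2_const[OF oD]], of lam] F(4) E1(3) by auto
  obtain b where b: "hol2 b D" "\<And>p. p \<in> D \<Longrightarrow> snd (F p) - snd p = fst p * b p"
    using hol2_divide_fst[OF hol2_diff[OF F12(2) hol2_snd[OF oD]]] F(3) by auto
  have a: "hol2 (\<lambda>p. (1 / lam) * E2 p) D" by (intro hol2_mult hol2_const oD E2)
  obtain \<xi> \<eta> r where r: "r > 0" "\<xi> holomorphic_on ball 0 r" "\<eta> holomorphic_on ball 0 r" "\<xi> 0 = 1" "\<eta> 0 = 0"
    "\<And>t. t \<in> ball 0 r \<Longrightarrow> \<xi> (lam * t) - \<xi> t = t * (\<xi> t ^ 2 * ((1 / lam) * E2 (t * \<xi> t, \<eta> t)))"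
    "\<And>t. t \<in> ball 0 r \<Longrightarrow> \<eta> (lam * t) - \<eta> t = t * (\<xi> t * b (t * \<xi> t, \<eta> t))"
    using Bruno_curve[OF lam a b(1) F(2)] by blast
  define \<phi> where "\<phi> t = (t * \<xi> t, \<eta> t)" for t
  have semi: "F (\<phi> t) = \<phi> (lam * t)" if "t \<in> ball 0 r" "\<phi> t \<in> D" for t
  proof -
    have "fst (F (\<phi> t)) = t * \<xi> t * (lam + t * \<xi> t * E2 (\<phi> t))"
      using E1(2)[OF that(2)] E2(2)[OF that(2)] by (simp add: \<phi>_def algebra_simps)
    also have "\<dots> = lam * t * (\<xi> t + t * (\<xi> t ^ 2 * ((1 / lam) * E2 (\<phi> t))))"
      using l0 by (simp add: field_simps power2_eq_square)
    also have "\<dots> = lam * t * \<xi> (lam * t)" using r(6)[OF that(1)] by (simp add: \<phi>_def algebra_simps)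
    finally have "fst (F (\<phi> t)) = fst (\<phi> (lam * t))" by (simp add: \<phi>_def)
    moreover have "snd (F (\<phi> t)) = snd (\<phi> (lam * t))"
      using b(2)[OF that(2)] r(7)[OF that(1)] by (simp add: \<phi>_def algebra_simps)
    ultimately show ?thesis by (rule prod_eqI)
  qed
  have h: "(\<lambda>t. t * \<xi> t) holomorphic_on ball 0 r" by (intro holomorphic_intros r)
  have "((\<lambda>t. t * \<xi> t) has_field_derivative (1 * \<xi> 0 + 0 * deriv \<xi> 0)) (at 0)"
    using holomorphic_derivI[OF r(2), of 0] r(1) by (auto intro!: derivative_eq_intros)
  then have "deriv (\<lambda>t. t * \<xi> t) 0 \<noteq> 0" using r(4) DERIV_imp_deriv by fastforce
  then obtain s where s: "s > 0" "ball 0 s \<subseteq> ball (0::complex) r" "inj_on (\<lambda>t. t * \<xi> t) (ball 0 s)"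
    by (rule has_complex_derivative_locally_injective[OF h centre_in_ball[THEN iffD2, OF r(1)] open_ball]) (rule that; assumption)
  have \<phi>c: "continuous_on (ball 0 r) \<phi>" unfolding \<phi>_def
    by (intro continuous_on_Pair continuous_intros holomorphic_on_imp_continuous_on r)
  have "(\<phi> \<longlongrightarrow> 0) (nhds 0)" using continuous_on_open_tendsto[OF \<phi>c open_ball, of 0] r(1,5) by (simp add: \<phi>_def zero_prod_def)
  moreover have "open (D \<inter> ball 0 e)" "0 \<in> D \<inter> ball 0 e" using oD F(2) e by auto
  ultimately have "\<forall>\<^sub>F t in nhds 0. \<phi> t \<in> D \<inter> ball 0 e" by (rule topological_tendstoD)
  then obtain d where d: "d > 0" "\<And>t. cmod t < d \<Longrightarrow> \<phi> t \<in> D \<and> \<phi> t \<in> ball 0 e"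
    unfolding eventually_nhds_metric by auto
  define t where "t = complex_of_real (min d s / 2)"
  have ct: "cmod t = min d s / 2" using d s unfolding t_def norm_of_real by simp
  then have t: "t \<noteq> 0" "cmod t < d" "cmod t < s" using d s by auto
  have n: "cmod (lam ^ n * t) = cmod t" for n by (simp add: norm_mult norm_power nl)
  have rs: "cmod z < s \<Longrightarrow> z \<in> ball 0 r" for z using s(2) by (auto simp: subset_iff)
  have it: "(F ^^ n) (\<phi> t) = \<phi> (lam ^ n * t)" for n
  proof (induction n)
    case (Suc n)
    then show ?case using semi[of "lam ^ n * t"] d(2)[of "lam ^ n * t"] n[of n] t rs by (simp add: mult.assoc)
  qed simp
  have "inj (\<lambda>n. \<phi> (lam ^ n * t))"
  proof (rule injI)
    fix i j assume "\<phi> (lam ^ i * t) = \<phi> (lam ^ j * t)"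
    then have "lam ^ i * t * \<xi> (lam ^ i * t) = lam ^ j * t * \<xi> (lam ^ j * t)" by (simp add: \<phi>_def)
    moreover have "lam ^ i * t \<in> ball 0 s" "lam ^ j * t \<in> ball 0 s" using n[of i] n[of j] t(3) by auto
    ultimately have "lam ^ i * t = lam ^ j * t" by (rule inj_onD[OF s(3)])
    then have "lam ^ i = lam ^ j" using t(1) by simp
    then show "i = j" by (rule injD[OF powers_distinct[OF lam(2) l0], rotated])
  qed
  then have "infinite (range (\<lambda>n. \<phi> (lam ^ n * t)))" by (rule infinite_range_orbit)
  then have "infinite (range (\<lambda>n. (F ^^ n) (\<phi> t)))" by (simp add: it)
  moreover have "(F ^^ n) (\<phi> t) \<in> ball 0 e" for n using d(2)[of "lam ^ n * t"] n[of n] t by (simp add: it)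
  ultimately show ?thesis by blast
qed

lemma vanishes_all:
  assumes g: "g holomorphic_on S" "open S" "0 \<in> S" and v: "\<And>n. vanishes n g"
  shows "\<forall>\<^sub>F y in nhds 0. g y = 0"
proof (rule ccontr)
  assume "\<not> ?thesis"
  from finite_order[OF g v this] obtain k a where k: "k \<ge> 1" "a \<noteq> 0" "vanishes (k + 2) (\<lambda>y. g y - a * y ^ Suc k)" by blast
  obtain C where C: "\<forall>\<^sub>F y in nhds 0. cmod (g y - (g y - a * y ^ Suc k)) \<le> C * cmod y ^ (k + 2)"
    using vanishes_diff[OF v k(3)] unfolding vanishes_def by blast
  then obtain d where d: "d > 0" "\<And>y. cmod y < d \<Longrightarrow> cmod (a * y ^ Suc k) \<le> C * cmod y ^ (k + 2)"
    unfolding eventually_nhds_metric by auto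
  have "cmod a \<le> C * r" if "0 < r" "r < d" for r
  proof -
    have "cmod a * r ^ Suc k \<le> (C * r) * r ^ Suc k"
      using d(2)[of "complex_of_real r"] that by (simp add: norm_mult norm_power mult_ac)
    then show ?thesis using that by (simp add: mult_le_cancel_right)
  qed
  then have "\<forall>\<^sub>F r in at_right 0. cmod a \<le> C * r" using d(1) by (auto simp: eventually_at_right intro!: exI[of _ d])
  moreover have "((\<lambda>r. C * r) \<longlongrightarrow> C * 0) (at_right 0)" by (intro tendsto_intros)
  ultimately have "cmod a \<le> C * 0" by (intro tendsto_lowerbound[of "\<lambda>r. C * r" _ "at_right 0"]) auto
  with k(2) show False by simp
qed

text \<open>An analytic curve \<open>g = 0\<close> that is formally invariant carries an honest one-dimensional
  restriction of \<open>F\<close>.\<close>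

lemma invariant_curve_infinite_orbit:
  assumes F: "hol2m F U" "0 \<in> U" "F 0 = 0" "dy (\<lambda>z. fst (F z)) 0 = 0"
    and lam: "dx (\<lambda>z. fst (F z)) 0 = lam" "cmod lam = 1" "\<And>n. n > 0 \<Longrightarrow> lam ^ n \<noteq> 1"
    and g: "hol2 g N" "0 \<in> N" "g 0 = 0" "dy g 0 \<noteq> 0"
    and inv: "compose2 (taylor2 g 0) (taylor_map F 0) = taylor2 g 0 * w" and e: "e > 0"
  shows "infinite_orbit_in F (ball 0 e)"
proof -
  have oN: "open N" by (rule hol2_open[OF g(1)])
  \<comment> \<open>In the coordinates (x, g) the curve is the axis g = 0, and c below parametrises
    it by x.\<close>
  define \<Phi> where "\<Phi> z = (fst z, g z)" for z
  have \<Phi>: "hol2m \<Phi> N" "\<Phi> 0 = 0" using g oN by (auto simp: \<Phi>_def hol2m_def hol2_fst zero_prod_def)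
  have "dx (\<lambda>z::complex2. fst z) 0 = 1" "dy (\<lambda>z::complex2. fst z) 0 = 0" by (simp_all add: dx_def dy_def)
  then obtain N' M where NM: "N' \<subseteq> N" "representative \<Phi> N' M"
    using ex_representative[OF \<Phi>(1) g(2) \<Phi>(2)] g(4) unfolding \<Phi>_def fst_conv snd_conv by auto
  define \<Psi> where "\<Psi> = inv_into N' \<Phi>"
  note rep = representative_inv[OF NM(2), folded \<Psi>_def]
  have h\<Psi>: "hol2m \<Psi> M" "open N'" "open M" "0 \<in> N'" using NM(2) by (auto simp: representative_iff \<Psi>_def)
  define S where "S = {x. (x, 0::complex) \<in> M}"
  have S: "open S" "0 \<in> S" unfolding S_def using open_slice_x[OF h\<Psi>(3)] rep(1) by (auto simp: zero_prod_def)
  define c where "c x = \<Psi> (x, 0)" for x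
  have cS: "fst (c x) = x" "g (c x) = 0" "c x \<in> N'" if "x \<in> S" for x
    using rep(4,6)[of "(x, 0)"] that by (auto simp: S_def c_def \<Phi>_def)
  have c0: "c 0 = 0" using rep(2) by (simp add: c_def zero_prod_def)
  have ch: "(\<lambda>x. fst (c x)) holomorphic_on S" "(\<lambda>x. snd (c x)) holomorphic_on S"
    unfolding c_def S_def using hol2_slice_x[of "\<lambda>z. fst (\<Psi> z)" M 0] hol2_slice_x[of "\<lambda>z. snd (\<Psi> z)" M 0] h\<Psi>(1)
    by (auto simp: hol2m_def)
  have cc: "continuous_on S c"
  proof -
    have "continuous_on S (\<lambda>x. (fst (c x), snd (c x)))" using ch by (intro continuous_on_Pair holomorphic_on_imp_continuous_on)
    then show ?thesis by simp
  qed
  have lim: "filterlim c (nhds 0) (nhds 0)"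
    using continuous_on_open_tendsto[OF cc S] c0 by simp
  have oFN: "open {z \<in> U. F z \<in> N'}"
    using open_preimage_pair[of "\<lambda>z. fst (F z)" U "\<lambda>z. snd (F z)" N'] F(1) h\<Psi>(2) by (simp add: hol2m_def)
  define T where "T = {x \<in> S. c x \<in> U \<and> F (c x) \<in> N'}"
  have T: "open T" "0 \<in> T"
  proof -
    have "T = S \<inter> c -` {z \<in> U. F z \<in> N'}" by (auto simp: T_def)
    then show "open T" using continuous_open_preimage[OF cc S(1) oFN] by simp
    show "0 \<in> T" using S c0 F h\<Psi> by (simp add: T_def)
  qed
  have oFN': "open {z \<in> U. F z \<in> N}"
    using open_preimage_pair[of "\<lambda>z. fst (F z)" U "\<lambda>z. snd (F z)" N] F(1) oN by (simp add: hol2m_def)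
  have gF: "hol2 (\<lambda>z. g (F z)) {z \<in> U. F z \<in> N}"
    by (rule hol2_compose_map[OF g(1) hol2m_subset[OF F(1) oFN']]) auto
  have slice: "(\<lambda>x. k (c x)) holomorphic_on T" if "hol2 k K" "\<And>x. x \<in> T \<Longrightarrow> c x \<in> K" for k K
  proof -
    have 1: "(\<lambda>p. k (\<Psi> p)) = (\<lambda>p. k (\<Psi> p))" ..
    have oP: "open {p \<in> M. \<Psi> p \<in> K}"
      using open_preimage_pair[of "\<lambda>z. fst (\<Psi> z)" M "\<lambda>z. snd (\<Psi> z)" K] h\<Psi>(1) hol2_open[OF that(1)] by (simp add: hol2m_def)
    have "hol2 (\<lambda>p. k (\<Psi> p)) {p \<in> M. \<Psi> p \<in> K}"
      by (rule hol2_compose_map[OF that(1) hol2m_subset[OF h\<Psi>(1) oP]]) auto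
    from hol2_slice_x[OF this, of 0] have "(\<lambda>x. k (c x)) holomorphic_on {x. (x, 0) \<in> {p \<in> M. \<Psi> p \<in> K}}" by (simp add: c_def)
    then show ?thesis by (rule holomorphic_on_subset) (use that(2) in \<open>auto simp: T_def S_def c_def\<close>)
  qed
  have kT: "(\<lambda>x. g (F (c x))) holomorphic_on T" by (rule slice[OF gF]) (use NM(1) in \<open>auto simp: T_def\<close>)
  have vc: "\<exists>L\<ge>0. \<forall>\<^sub>F x in nhds 0. norm (c x) \<le> L * cmod x"
  proof -
    obtain L where L: "L \<ge> 0" "\<forall>\<^sub>F x in nhds 0. cmod (snd (c x)) \<le> L * cmod x ^ 1"
      using vanishes_1[OF ch(2) S] c0 by (auto simp: vanishes_def)
    have "\<forall>\<^sub>F x in nhds 0. norm (c x) \<le> (1 + L) * cmod x"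
      using L(2) eventually_nhds_in_open[OF S]
    proof eventually_elim
      case (elim x)
      have "norm (c x) \<le> cmod (fst (c x)) + cmod (snd (c x))" using norm_Pair_le[of "fst (c x)" "snd (c x)"] by simp
      then show ?case using elim cS(1)[of x] by (simp add: algebra_simps)
    qed
    then show ?thesis using L(1) by (intro exI[of _ "1 + L"]) auto
  qed
  then obtain L where L: "L \<ge> 0" "\<forall>\<^sub>F x in nhds 0. norm (c x) \<le> L * cmod x" by blast
  \<comment> \<open>Invariance says g(F) = g w with a merely formal w. Replacing w by its polynomial
    of degree below n leaves an error O(|z|^n); on the curve g vanishes, so g(F(c x)) is O(x^n) for
    every n.\<close>
  have k0: "\<forall>\<^sub>F x in nhds 0. g (F (c x)) = 0"
  proof (rule vanishes_all[OF kT T])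
    fix n
    define P where "P z = g (F z) - g z * pol n w z" for z
    have m: "0 \<in> {z \<in> U. F z \<in> N}" using F g by simp
    have oI: "open ({z \<in> U. F z \<in> N} \<inter> N)" using oFN' oN by blast
    have gF': "hol2 (\<lambda>z. g (F z)) ({z \<in> U. F z \<in> N} \<inter> N)" by (rule hol2_subset[OF gF oI]) simp
    have gw: "hol2 (\<lambda>z. g z * pol n w z) ({z \<in> U. F z \<in> N} \<inter> N)"
      by (intro hol2_mult hol2_subset[OF g(1) oI] hol2_pol oI) simp
    have Ph: "hol2 P ({z \<in> U. F z \<in> N} \<inter> N)" unfolding P_def[abs_def] by (intro hol2_diff gF' gw)
    have m': "0 \<in> {z \<in> U. F z \<in> N} \<inter> N" using m g(2) by simp
    have "taylor2 (\<lambda>z. g (F z)) 0 = taylor2 g 0 * w"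
      using taylor2_compose_map[OF g(1) F(1,2)] F(3) g(2) inv by simp
    moreover have "taylor2 (\<lambda>z. g z * pol n w z) 0 = taylor2 g 0 * taylor2 (pol n w) 0"
      by (rule taylor2_mult[OF g(1) hol2_pol[OF oN] g(2)])
    ultimately have "taylor2 P 0 = taylor2 g 0 * w - taylor2 g 0 * taylor2 (pol n w) 0"
      unfolding P_def[abs_def] using taylor2_diff[OF gF' gw m'] by simp
    moreover have "agree n (taylor2 g 0 * w) (taylor2 g 0 * taylor2 (pol n w) 0)"
      by (rule agree_mult[OF agree_refl agree_sym[OF taylor2_pol]])
    ultimately have "pol n (taylor2 P 0) z = 0" for z by (simp add: pol_def agree_def)
    then obtain C where C: "\<forall>\<^sub>F z in nhds 0. cmod (P z) \<le> C * norm z ^ n"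
      using taylor2_bigo[OF Ph m', of n] by auto
    have "\<forall>\<^sub>F x in nhds 0. cmod (g (F (c x))) \<le> (\<bar>C\<bar> * L ^ n) * cmod x ^ n"
      using eventually_compose_filterlim[OF C lim] L(2) eventually_nhds_in_open[OF S]
    proof eventually_elim
      case (elim x)
      have "cmod (g (F (c x))) \<le> C * norm (c x) ^ n" using elim(1) cS(2)[OF elim(3)] by (simp add: P_def)
      also have "\<dots> \<le> \<bar>C\<bar> * norm (c x) ^ n" by (intro mult_right_mono) auto
      also have "\<dots> \<le> \<bar>C\<bar> * (L * cmod x) ^ n" using elim(2) by (intro mult_left_mono power_mono) auto
      finally show ?case by (simp add: power_mult_distrib mult.assoc)
    qed
    then show "vanishes n (\<lambda>x. g (F (c x)))" by (rule vanishesI)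
  qed
  define f where "f x = fst (F (c x))" for x
  have fT: "f holomorphic_on T" unfolding f_def
    by (rule slice[of "\<lambda>z. fst (F z)" U]) (use F(1) in \<open>auto simp: hol2m_def T_def\<close>)
  have f0: "f 0 = 0" using c0 F(3) by (simp add: f_def)
  have df: "deriv f 0 = lam"
  proof -
    have d2: "((\<lambda>x. snd (c x)) has_field_derivative deriv (\<lambda>x. snd (c x)) 0) (at 0)"
      by (rule holomorphic_derivI[OF ch(2) S])
    have "(c has_derivative (\<lambda>h. (h, deriv (\<lambda>x. snd (c x)) 0 * h))) (at 0)"
    proof -
      have "((\<lambda>x. (x, snd (c x))) has_derivative (\<lambda>h. (h, deriv (\<lambda>x. snd (c x)) 0 * h))) (at 0)"
        using has_derivative_Pair[OF has_derivative_ident d2[unfolded has_field_derivative_def]] by (simp add: mult.commute)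
      then show ?thesis
        by (rule has_derivative_transform_within_open[OF _ S]) (use cS in \<open>auto simp: prod_eq_iff\<close>)
    qed
    moreover have "((\<lambda>z. fst (F z)) has_derivative (\<lambda>h. lam * fst h + 0 * snd h)) (at (c 0))"
      using hol2_has_derivative[of "\<lambda>z. fst (F z)" U 0] F lam(1) by (simp add: hol2m_def c0)
    ultimately have "(f has_derivative (\<lambda>h. lam * h)) (at 0)"
      unfolding f_def using has_derivative_compose[of c _ 0 UNIV "\<lambda>z. fst (F z)"] by fastforce
    then have "(f has_field_derivative lam) (at 0)" by (simp add: has_field_derivative_def)
    then show ?thesis by (rule DERIV_imp_deriv)
  qed
  have "\<forall>\<^sub>F x in nhds 0. g (F (c x)) = 0 \<and> x \<in> T \<and> f x \<in> S \<and> c x \<in> ball 0 e"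
  proof -
    have "(f \<longlongrightarrow> 0) (nhds 0)"
      using holomorphic_on_tendsto[OF fT T] f0 by simp
    from topological_tendstoD[OF this S] topological_tendstoD[OF lim open_ball, of 0 e] k0 eventually_nhds_in_open[OF T] e
    show ?thesis by (simp add: eventually_conj_iff)
  qed
  then obtain d where d: "d > 0" "\<And>x. cmod x < d \<Longrightarrow> g (F (c x)) = 0 \<and> x \<in> T \<and> f x \<in> S \<and> c x \<in> ball 0 e"
    unfolding eventually_nhds_metric by auto
  have semi: "F (c x) = c (f x)" if "cmod x < d" for x
  proof -
    have x: "g (F (c x)) = 0" "F (c x) \<in> N'" "f x \<in> S" using d(2)[OF that] by (auto simp: T_def)
    then have "\<Phi> (F (c x)) = (f x, 0)" by (simp add: \<Phi>_def f_def)
    then show ?thesis using rep(3)[OF x(2)] by (simp add: c_def)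
  qed
  obtain z where z: "\<And>n. (f ^^ n) z \<in> ball 0 d" "infinite (range (\<lambda>n. (f ^^ n) z))"
    using indifferent_fixed_point_infinite_orbit[OF fT T f0 _ _ d(1)] df lam(2,3) by auto
  have it: "(F ^^ n) (c z) = c ((f ^^ n) z)" for n
  proof (induction n)
    case (Suc n)
    then show ?case using semi[of "(f ^^ n) z"] z(1)[of n] by simp
  qed simp
  have "(f ^^ n) z = fst ((F ^^ n) (c z))" for n
    using d(2)[of "(f ^^ n) z"] z(1)[of n] cS(1) by (simp add: it T_def)
  then have "range (\<lambda>n. (f ^^ n) z) = fst ` range (\<lambda>n. (F ^^ n) (c z))" by (auto simp: image_image)
  then have "infinite (range (\<lambda>n. (F ^^ n) (c z)))" using z(2) by auto
  moreover have "(F ^^ n) (c z) \<in> ball 0 e" for n using d(2)[of "(f ^^ n) z"] z(1)[of n] by (simp add: it)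
  ultimately show ?thesis by blast
qed

section \<open>Normalised germs with finite orbits\<close>

lemma left_inverse_derivative:
  assumes F: "hol2m F U" "p \<in> U" and G: "hol2m G V" "F p \<in> V" and inv: "\<forall>\<^sub>F q in nhds p. G (F q) = q"
  shows "dx (\<lambda>z. fst (G z)) (F p) * dx (\<lambda>z. fst (F z)) p + dy (\<lambda>z. fst (G z)) (F p) * dx (\<lambda>z. snd (F z)) p = 1"
    "dx (\<lambda>z. snd (G z)) (F p) * dx (\<lambda>z. fst (F z)) p + dy (\<lambda>z. snd (G z)) (F p) * dx (\<lambda>z. snd (F z)) p = 0"
    "dx (\<lambda>z. snd (G z)) (F p) * dy (\<lambda>z. fst (F z)) p + dy (\<lambda>z. snd (G z)) (F p) * dy (\<lambda>z. snd (F z)) p = 1"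
proof -
  have *: "dx h (F p) * dx (\<lambda>z. fst (F z)) p + dy h (F p) * dx (\<lambda>z. snd (F z)) p = dx (\<lambda>q. h (F q)) p"
    "dx h (F p) * dy (\<lambda>z. fst (F z)) p + dy h (F p) * dy (\<lambda>z. snd (F z)) p = dy (\<lambda>q. h (F q)) p" if "hol2 h V" for h
  proof -
    have h: "hol2 (\<lambda>z. fst (F z)) U" "hol2 (\<lambda>z. snd (F z)) U" using F by (auto simp: hol2m_def)
    have "((\<lambda>q. h (fst (F q), snd (F q))) has_derivative (\<lambda>k. (dx h (F p) * dx (\<lambda>z. fst (F z)) p + dy h (F p) * dx (\<lambda>z. snd (F z)) p) * fst k
      + (dx h (F p) * dy (\<lambda>z. fst (F z)) p + dy h (F p) * dy (\<lambda>z. snd (F z)) p) * snd k)) (at p)"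
      by (rule has_derivative_compose_pair[OF hol2_has_derivative[OF h(1) F(2)] hol2_has_derivative[OF h(2) F(2)]])
        (use hol2_has_derivative[OF that G(2)] in simp)
    from has_derivative_dx_dy[OF this] show "dx h (F p) * dx (\<lambda>z. fst (F z)) p + dy h (F p) * dx (\<lambda>z. snd (F z)) p = dx (\<lambda>q. h (F q)) p"
      "dx h (F p) * dy (\<lambda>z. fst (F z)) p + dy h (F p) * dy (\<lambda>z. snd (F z)) p = dy (\<lambda>q. h (F q)) p" by simp_all
  qed
  have G12: "hol2 (\<lambda>z. fst (G z)) V" "hol2 (\<lambda>z. snd (G z)) V" using G by (auto simp: hol2m_def)
  have "\<exists>W. open W \<and> p \<in> W \<and> (\<forall>q\<in>W. G (F q) = q)" using inv unfolding eventually_nhds by blast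
  then obtain W where W: "open W" "p \<in> W" "\<And>q. q \<in> W \<Longrightarrow> G (F q) = q" by blast
  have "(fst has_derivative (\<lambda>h. 1 * fst h + 0 * snd h)) (at p)" "(snd has_derivative (\<lambda>h. 0 * fst h + 1 * snd h)) (at p)"
    by (auto intro!: derivative_eq_intros)
  then have "((\<lambda>q. fst (G (F q))) has_derivative (\<lambda>h. 1 * fst h + 0 * snd h)) (at p)"
     "((\<lambda>q. snd (G (F q))) has_derivative (\<lambda>h. 0 * fst h + 1 * snd h)) (at p)"
    using W(3) by (auto elim!: has_derivative_transform_within_open[OF _ W(1,2)])
  from this[THEN has_derivative_dx_dy(1)] this[THEN has_derivative_dx_dy(2)]
  show "dx (\<lambda>z. fst (G z)) (F p) * dx (\<lambda>z. fst (F z)) p + dy (\<lambda>z. fst (G z)) (F p) * dx (\<lambda>z. snd (F z)) p = 1"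
    "dx (\<lambda>z. snd (G z)) (F p) * dx (\<lambda>z. fst (F z)) p + dy (\<lambda>z. snd (G z)) (F p) * dx (\<lambda>z. snd (F z)) p = 0"
    "dx (\<lambda>z. snd (G z)) (F p) * dy (\<lambda>z. fst (F z)) p + dy (\<lambda>z. snd (G z)) (F p) * dy (\<lambda>z. snd (F z)) p = 1"
    using *(1)[OF G12(1)] *[OF G12(2)] by simp_all
qed

text \<open>\<open>bound\<close> controls the displacement off the axis by the displacement along
  it; the coordinates are chosen to provide this. \<open>fin\<close> speaks only of orbits that
  remain in a small ball.\<close>

locale tame_germ =
  fixes F G :: "complex2 \<Rightarrow> complex2" and U V and lam :: complex
  assumes F: "hol2m F U" "0 \<in> U" "F 0 = 0" and G: "hol2m G V" "0 \<in> V"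
    and inv: "\<forall>\<^sub>F p in nhds 0. G (F p) = p"
    and dF: "dx (\<lambda>z. fst (F z)) 0 = lam" "dy (\<lambda>z. fst (F z)) 0 = 0" "dx (\<lambda>z. snd (F z)) 0 = 0" "dy (\<lambda>z. snd (F z)) 0 = 1"
    and lam: "\<And>n. n > 0 \<Longrightarrow> lam ^ n \<noteq> 1" "lam \<noteq> 0"
    and bound: "\<exists>C\<ge>0. \<forall>\<^sub>F y in nhds 0. cmod (fst (F (0, y))) \<le> C * cmod (snd (F (0, y)) - y)"
    and fin: "\<exists>\<epsilon>>0. \<not> infinite_orbit_in F (ball 0 \<epsilon>) \<and> \<not> infinite_orbit_in G (ball 0 \<epsilon>)"
begin

lemma F12: "hol2 (\<lambda>z. fst (F z)) U" "hol2 (\<lambda>z. snd (F z)) U" using F by (auto simp: hol2m_def)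
lemma G12: "hol2 (\<lambda>z. fst (G z)) V" "hol2 (\<lambda>z. snd (G z)) V" using G by (auto simp: hol2m_def)

text \<open>A displacement in y that is not identically 0 contradicts
  \<open>center_infinite_orbit\<close>; once it vanishes, \<open>bound\<close> makes the
  displacement in x vanish too.\<close>

lemma center_fixed: "\<forall>\<^sub>F y in nhds 0. F (0, y) = (0, y)"
proof -
  obtain \<epsilon> where \<epsilon>: "\<epsilon> > 0" "\<not> infinite_orbit_in F (ball 0 \<epsilon>)" "\<not> infinite_orbit_in G (ball 0 \<epsilon>)" using fin by blast
  obtain C where C: "C \<ge> 0" "\<forall>\<^sub>F y in nhds 0. cmod (fst (F (0, y))) \<le> C * cmod (snd (F (0, y)) - y)" using bound by blast
  note d = left_inverse_derivative(2,3)[OF F(1,2) G(1), unfolded F(3), OF G(2) inv]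
  have dG: "dx (\<lambda>z. snd (G z)) 0 = 0" "dy (\<lambda>z. snd (G z)) 0 = 1" using d dF lam(2) by simp_all
  have "\<forall>\<^sub>F y in nhds 0. snd (F (0, y)) = y"
  proof (rule ccontr)
    assume "\<not> ?thesis"
    moreover have "\<forall>\<^sub>F p in nhds 0. fst (G (fst (F p), snd (F p))) = fst p \<and> snd (G (fst (F p), snd (F p))) = snd p"
      using inv by eventually_elim simp
    moreover have "lam \<noteq> 1" using lam(1)[of 1] by simp
    ultimately have "(\<forall>\<epsilon>>0. infinite_orbit_in F (ball 0 \<epsilon>))
       \<or> (\<forall>\<epsilon>>0. infinite_orbit_in G (ball 0 \<epsilon>))"
      using center_infinite_orbit[OF F12 F(2) _ _ _ _ dF(3,4) C _ G12 G(2) _ dG] F(3) dF(1) lam(2) by simp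
    then show False using \<epsilon> by blast
  qed
  with C(2) show ?thesis by eventually_elim (simp add: prod_eq_iff)
qed

text \<open>A multiplier of modulus other than 1 at a nearby fixed point makes F or its inverse
  contract towards the fixed curve. So the multiplier, holomorphic in y, has constant modulus and is
  constant by the maximum principle.\<close>

lemma center_multiplier: "\<forall>\<^sub>F y in nhds 0. dx (\<lambda>z. fst (F z)) (0, y) = lam" "cmod lam = 1"
proof -
  obtain \<epsilon> where \<epsilon>: "\<epsilon> > 0" "\<not> infinite_orbit_in F (ball 0 \<epsilon>)" "\<not> infinite_orbit_in G (ball 0 \<epsilon>)" using fin by blast
  define \<alpha> where "\<alpha> y = dx (\<lambda>z. fst (F z)) (0, y)" for y
  define S where "S = {y. (0::complex, y) \<in> U}"
  have S: "open S" "0 \<in> S" unfolding S_def using open_slice_y[OF hol2m_open[OF F(1)]] F(2) by (auto simp: zero_prod_def)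
  have \<alpha>h: "\<alpha> holomorphic_on S" unfolding \<alpha>_def[abs_def] S_def by (rule hol2_slice_y[OF hol2_dx[OF F12(1)]])
  have \<alpha>0: "\<alpha> 0 = lam" using dF(1) by (simp add: \<alpha>_def zero_prod_def)
  have t: "(\<alpha> \<longlongrightarrow> lam) (nhds 0)" using holomorphic_on_tendsto[OF \<alpha>h S] by (simp add: \<alpha>0)
  have nz: "\<forall>\<^sub>F y in nhds 0. \<alpha> y \<noteq> 0" by (rule tendsto_imp_eventually_ne[OF t lam(2)])
  have inv0: "\<forall>\<^sub>F y in nhds 0. \<forall>\<^sub>F q in nhds (0, y). G (F q) = q"
    by (rule eventually_slice) (use inv in \<open>simp add: eventually_eventually\<close>)
  have ball: "\<forall>\<^sub>F y in nhds 0. cmod y < \<epsilon> / 2" by (rule eventually_cmod_less) (use \<epsilon>(1) in simp)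
  have oV: "\<forall>\<^sub>F y in nhds 0. (0, y) \<in> V" by (rule eventually_slice[OF eventually_nhds_in_open[OF hol2m_open[OF G(1)] G(2)]])
  have "\<forall>\<^sub>F y in nhds 0. F (0, y) = (0, y) \<and> \<alpha> y \<noteq> 0 \<and> cmod y < \<epsilon> / 2 \<and> y \<in> S \<and> (0, y) \<in> V \<and> (\<forall>\<^sub>F q in nhds (0, y). G (F q) = q)"
    using center_fixed nz ball eventually_nhds_in_open[OF S] inv0 oV by (simp add: eventually_conj_iff)
  then obtain d where d: "d > 0" "\<And>y. cmod y < d \<Longrightarrow> F (0, y) = (0, y)" "\<And>y. cmod y < d \<Longrightarrow> \<alpha> y \<noteq> 0"
    "\<And>y. cmod y < d \<Longrightarrow> cmod y < \<epsilon> / 2" "\<And>y. cmod y < d \<Longrightarrow> y \<in> S" "\<And>y. cmod y < d \<Longrightarrow> (0, y) \<in> V"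
    "\<And>y. cmod y < d \<Longrightarrow> \<forall>\<^sub>F q in nhds (0, y). G (F q) = q"
    unfolding eventually_nhds_metric by auto
  have Gf: "G (0, y) = (0, y)" if "cmod y < d" for y using eventually_nhds_x_imp_x[OF d(7)[OF that]] d(2)[OF that] by simp
  have near: "ball (0::complex, y) (\<epsilon> / 2) \<subseteq> ball 0 \<epsilon>" if "cmod y < d" for y
  proof
    fix q assume "q \<in> ball (0::complex, y) (\<epsilon> / 2)"
    moreover have "dist 0 (0::complex, y) < \<epsilon> / 2" using d(4)[OF that] by (simp add: zero_prod_def dist_Pair_Pair)
    ultimately show "q \<in> ball 0 \<epsilon>" using dist_triangle[of 0 q "(0, y)"] unfolding mem_ball by linarith
  qed
  define B where "B = {p :: complex2. cmod (snd p) < d}"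
  have B: "open B" unfolding B_def by (intro open_Collect_less continuous_intros)
  \<comment> \<open>Half of \<epsilon> is spent on the position of (0, y), half on the orbit around
    it.\<close>
  have no: False if "hol2m H D" "\<And>y. cmod y < d \<Longrightarrow> H (0, y) = (0, y)" "(0, y) \<in> D" "cmod y < d"
    "0 < cmod (dx (\<lambda>z. fst (H z)) (0, y))" "cmod (dx (\<lambda>z. fst (H z)) (0, y)) < 1"
    "\<not> infinite_orbit_in H (ball 0 \<epsilon>)" for H D y
  proof -
    have o: "open (D \<inter> B)" using hol2m_open[OF that(1)] B by blast
    have "infinite_orbit_in H (ball (0, y) (\<epsilon> / 2))"
      by (rule contraction_infinite_orbit[OF hol2m_subset[OF that(1) o] _ _ that(5,6)]) (use that(2-4) \<epsilon>(1) in \<open>auto simp: B_def\<close>)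
    then show False using near[OF that(4)] that(7) by blast
  qed
  have one: "cmod (\<alpha> y) = 1" if y: "cmod y < d" for y
  proof (rule ccontr)
    assume "cmod (\<alpha> y) \<noteq> 1"
    then consider "cmod (\<alpha> y) < 1" | "cmod (\<alpha> y) > 1" by linarith
    then show False
    proof cases
      case 1
      show False
        by (rule no[OF F(1) d(2), of y]) (use y 1 d(3,5)[OF y] \<epsilon>(2) in \<open>auto simp: \<alpha>_def S_def\<close>)
    next
      case 2
      have yU: "(0, y) \<in> U" using d(5)[OF y] by (simp add: S_def)
      have "dy (\<lambda>z. fst (G z)) (0, y) = 0"
      proof -
        have "((\<lambda>y. fst (G (0, y))) has_field_derivative 0) (at y)"
          by (rule has_field_derivative_transform_within_open[of "\<lambda>_. 0" _ _ "ball 0 d"]) (use y Gf in auto)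
        then show ?thesis by (simp add: dy_def DERIV_imp_deriv)
      qed
      then have m: "dx (\<lambda>z. fst (G z)) (0, y) * \<alpha> y = 1"
        using left_inverse_derivative(1)[OF F(1) yU G(1), unfolded d(2)[OF y], OF d(6)[OF y] d(7)[OF y]] by (simp add: \<alpha>_def)
      then have "cmod (dx (\<lambda>z. fst (G z)) (0, y)) * cmod (\<alpha> y) = 1" by (metis norm_mult norm_one)
      then have "cmod (dx (\<lambda>z. fst (G z)) (0, y)) = 1 / cmod (\<alpha> y)" using 2 by (subst eq_divide_eq) auto
      moreover have "0 < 1 / cmod (\<alpha> y)" "1 / cmod (\<alpha> y) < 1" using 2 by (auto simp: divide_simps)
      ultimately show False
        by (intro no[OF G(1) Gf d(6)[OF y] y]) (use \<epsilon>(3) in auto)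
    qed
  qed
  show "cmod lam = 1" using one[of 0] d(1) \<alpha>0 by simp
  have "\<alpha> constant_on ball 0 d"
    by (rule maximum_modulus_principle[of \<alpha> _ "ball 0 d" 0])
      (use one d \<alpha>h in \<open>auto intro: holomorphic_on_subset\<close>)
  then have "\<alpha> y = lam" if "cmod y < d" for y using that d(1) \<alpha>0 unfolding constant_on_def by (metis mem_ball_0 norm_zero)
  then have "\<forall>\<^sub>F y in nhds 0. \<alpha> y = lam" unfolding eventually_nhds_metric using d(1) by auto
  then show "\<forall>\<^sub>F y in nhds 0. dx (\<lambda>z. fst (F z)) (0, y) = lam" by (simp add: \<alpha>_def)
qed

text \<open>A neighbourhood of a piece of the axis whose image has second coordinate in the same
  disc, so that coefficients holomorphic on this disc can be evaluated at p and at F p.\<close>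

definition center_domain :: "real \<Rightarrow> complex2 set \<Rightarrow> bool" where
  "center_domain s D \<longleftrightarrow> s > 0 \<and> open D \<and> D \<subseteq> U \<and> D \<subseteq> UNIV \<times> ball 0 s \<and> (\<forall>p\<in>D. snd (F p) \<in> ball 0 s) \<and>
    (\<forall>y\<in>ball 0 s. (0, y) \<in> D) \<and> (\<forall>y. (0, y) \<in> D \<longrightarrow> F (0, y) = (0, y) \<and> dx (\<lambda>z. fst (F z)) (0, y) = lam)"

lemma center_domainD:
  assumes "center_domain s D"
  shows "s > 0" "open D" "D \<subseteq> U" "D \<subseteq> UNIV \<times> ball 0 s" "\<And>p. p \<in> D \<Longrightarrow> snd (F p) \<in> ball 0 s"
    "\<And>y. y \<in> ball 0 s \<Longrightarrow> (0, y) \<in> D" "\<And>y. (0, y) \<in> D \<Longrightarrow> F (0, y) = (0, y)"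
    "\<And>y. (0, y) \<in> D \<Longrightarrow> dx (\<lambda>z. fst (F z)) (0, y) = lam"
  using assms unfolding center_domain_def by blast+

lemma center_domain_exists: "\<exists>s D. center_domain s D"
proof -
  have "\<forall>\<^sub>F y in nhds 0. F (0, y) = (0, y) \<and> dx (\<lambda>z. fst (F z)) (0, y) = lam \<and> (0, y) \<in> U"
    using center_fixed center_multiplier(1) eventually_slice[OF eventually_nhds_in_open[OF hol2m_open[OF F(1)] F(2)]]
    by (simp add: eventually_conj_iff)
  then obtain s where s: "s > 0" "\<And>y. cmod y < s \<Longrightarrow> F (0, y) = (0, y) \<and> dx (\<lambda>z. fst (F z)) (0, y) = lam \<and> (0, y) \<in> U"
    unfolding eventually_nhds_metric by auto
  define D where "D = {p \<in> U. (fst (F p), snd (F p)) \<in> UNIV \<times> ball 0 s} \<inter> UNIV \<times> ball 0 s"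
  have "open D" unfolding D_def by (intro open_Int open_preimage_pair F12 open_Times) auto
  then have "center_domain s D" unfolding center_domain_def using s by (auto simp: D_def)
  then show ?thesis by blast
qed

theorem not_Bruno: "\<not> Bruno lam"
proof
  assume B: "Bruno lam"
  obtain \<epsilon> where \<epsilon>: "\<epsilon> > 0" "\<not> infinite_orbit_in F (ball 0 \<epsilon>)" using fin by blast
  obtain s D where "center_domain s D" using center_domain_exists by blast
  note D = center_domainD[OF this]
  have "0 \<in> D" using D(6)[of 0] D(1) by (simp add: zero_prod_def)
  from Bruno_infinite_orbit[OF hol2m_subset[OF F(1) D(2,3)] this D(7,8) B lam(1) \<epsilon>(1)] show False using \<epsilon>(2) by blast
qed

text \<open>The first series starts from x with \<kappa> = \<lambda>, and \<lambda>^n \<noteq>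
  \<lambda> for n > 1; the second starts from y with \<kappa> = 1. The relations are recorded at
  every (0, y), not only at the origin, because each level of the second series serves as a curve
  through its own fixed point.\<close>

theorem transversal_conjugacy:
  obtains s X Y where "s > 0" "\<And>j. X j holomorphic_on ball 0 s" "\<And>j. Y j holomorphic_on ball 0 s"
    "X 0 = (\<lambda>_. 0)" "X 1 = (\<lambda>_. 1)" "Y 0 = (\<lambda>y. y)"
    "\<And>y. y \<in> ball 0 s \<Longrightarrow> F (0, y) = (0, y)"
    "\<And>y. y \<in> ball 0 s \<Longrightarrow> compose2 (ser X y) (taylor_map F (0, y)) = fps_const (fps_const lam) * ser X y"
    "\<And>y. y \<in> ball 0 s \<Longrightarrow> compose2 (ser Y y) (taylor_map F (0, y)) = ser Y y"
proof -
  obtain s D where "center_domain s D" using center_domain_exists by blast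
  note D = center_domainD[OF this]
  have FD: "hol2m F D" by (rule hol2m_subset[OF F(1) D(2,3)])
  then have FD12: "hol2 (\<lambda>z. fst (F z)) D" "hol2 (\<lambda>z. snd (F z)) D" by (auto simp: hol2m_def)
  obtain E3 where E3: "hol2 E3 D" "\<And>p. p \<in> D \<Longrightarrow> snd (F p) - snd p = fst p * E3 p"
    using hol2_divide_fst[OF hol2_diff[OF FD12(2) hol2_snd[OF D(2)]]] D(7) by auto
  obtain E1 where E1: "hol2 E1 D" "\<And>p. p \<in> D \<Longrightarrow> fst (F p) = fst p * E1 p" "\<And>y. E1 (0, y) = dx (\<lambda>z. fst (F z)) (0, y)"
    using hol2_divide_fst[OF FD12(1)] D(7) by auto
  obtain E2 where E2: "hol2 E2 D" "\<And>p. p \<in> D \<Longrightarrow> E1 p - lam = fst p * E2 p"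
    using hol2_divide_fst[OF hol2_diff[OF E1(1) hol2_const[OF D(2)]], of lam] D(8) E1(3) by auto
  have "\<exists>Y. (\<forall>j\<le>0. Y j = (\<lambda>y. y)) \<and> (\<forall>j. Y j holomorphic_on ball 0 s) \<and>
    (\<forall>N\<ge>0. \<exists>E. hol2 E D \<and> (\<forall>p\<in>D. psum N Y (F p) - 1 * psum N Y p = fst p ^ Suc N * E p))"
    by (rule transversal_series[OF open_ball FD D(5,4,7,6,8) _ E3(1)]) (use E3 lam in \<open>auto simp: psum_def\<close>)
  then obtain Y where Y: "Y 0 = (\<lambda>y. y)" "\<And>j. Y j holomorphic_on ball 0 s"
    "\<And>N. N \<ge> 0 \<Longrightarrow> \<exists>E. hol2 E D \<and> (\<forall>p\<in>D. psum N Y (F p) - 1 * psum N Y p = fst p ^ Suc N * E p)" by blast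
  have nl: "lam ^ n \<noteq> lam" if "n > 1" for n
  proof
    assume "lam ^ n = lam"
    then have "lam * lam ^ (n - 1) = lam * 1" using that by (simp flip: power_Suc)
    then have "lam ^ (n - 1) = 1" using lam(2) mult_left_cancel by blast
    then show False using lam(1)[of "n - 1"] that by simp
  qed
  have bX: "psum 1 (\<lambda>j y. if j = 0 then 0 else 1) (F p) - lam * psum 1 (\<lambda>j y. if j = 0 then 0 else 1) p = fst p ^ Suc 1 * E2 p" if "p \<in> D" for p
  proof -
    have "E1 p = lam + fst p * E2 p" using E2(2)[OF that] by (simp add: algebra_simps)
    then have "fst (F p) = fst p * (lam + fst p * E2 p)" using E1(2)[OF that] by simp
    then show ?thesis by (simp add: psum_def algebra_simps)
  qed
  have "\<exists>X. (\<forall>j\<le>1. X j = (\<lambda>y. if j = 0 then 0 else 1)) \<and> (\<forall>j. X j holomorphic_on ball 0 s) \<and>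
    (\<forall>N\<ge>1. \<exists>E. hol2 E D \<and> (\<forall>p\<in>D. psum N X (F p) - lam * psum N X p = fst p ^ Suc N * E p))"
    by (rule transversal_series[OF open_ball FD D(5,4,7,6,8) _ E2(1) bX nl]) auto
  then obtain X where X: "\<forall>j\<le>1. X j = (\<lambda>y. if j = 0 then 0 else 1)" "\<And>j. X j holomorphic_on ball 0 s"
    "\<And>N. N \<ge> 1 \<Longrightarrow> \<exists>E. hol2 E D \<and> (\<forall>p\<in>D. psum N X (F p) - lam * psum N X p = fst p ^ Suc N * E p)" by blast
  show ?thesis
  proof (rule that[OF D(1) X(2) Y(2)])
    show "X 0 = (\<lambda>_. 0)" "X 1 = (\<lambda>_. 1)" "Y 0 = (\<lambda>y. y)" using X(1) Y(1) by auto
    fix y :: complex assume y: "y \<in> ball 0 s"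
    show "F (0, y) = (0, y)" using D(6,7) y by blast
    show "compose2 (ser X y) (taylor_map F (0, y)) = fps_const (fps_const lam) * ser X y"
      by (rule ser_semiconjugacy[OF X(2) open_ball y FD D(6)[OF y] D(7)[OF D(6)[OF y]] D(5,4) X(3)])
    have "compose2 (ser Y y) (taylor_map F (0, y)) = fps_const (fps_const 1) * ser Y y"
      by (rule ser_semiconjugacy[OF Y(2) open_ball y FD D(6)[OF y] D(7)[OF D(6)[OF y]] D(5,4) Y(3)])
    then show "compose2 (ser Y y) (taylor_map F (0, y)) = ser Y y" by simp
  qed
qed

text \<open>After translation of (0, y) to the origin the multiplier is again \<lambda>, of modulus
  1, so \<open>invariant_curve_infinite_orbit\<close> applies; its orbit stays in the ball around 0
  in which such orbits are excluded.\<close>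

theorem no_invariant_analytic_curve:
  "\<forall>\<^sub>F y in nhds 0. \<forall>g N w. hol2 g N \<and> (0, y) \<in> N \<and> g (0, y) = 0 \<and> dy g (0, y) \<noteq> 0 \<longrightarrow>
     compose2 (taylor2 g (0, y)) (taylor_map F (0, y)) \<noteq> taylor2 g (0, y) * w"
proof -
  obtain \<epsilon> where \<epsilon>: "\<epsilon> > 0" "\<not> infinite_orbit_in F (ball 0 \<epsilon>)" using fin by blast
  obtain s D where "center_domain s D" using center_domain_exists by blast
  note D = center_domainD[OF this]
  have "min s (\<epsilon> / 2) > 0" using D(1) \<epsilon>(1) by simp
  from eventually_cmod_less[OF this] show ?thesis
  proof (eventually_elim, intro allI impI)
    fix y g N w assume y: "cmod y < min s (\<epsilon> / 2)"
    assume "hol2 g N \<and> (0, y) \<in> N \<and> g (0, y) = 0 \<and> dy g (0, y) \<noteq> 0"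
    then have g: "hol2 g N" "(0, y) \<in> N" "g (0, y) = 0" "dy g (0, y) \<noteq> 0" by auto
    show "compose2 (taylor2 g (0, y)) (taylor_map F (0, y)) \<noteq> taylor2 g (0, y) * w"
    proof
      assume inv: "compose2 (taylor2 g (0, y)) (taylor_map F (0, y)) = taylor2 g (0, y) * w"
      define q where "q = (0::complex, y)"
      define F' where "F' z = F (q + z) - q" for z
      have qD: "q \<in> D" and Fq: "F q = q" using D(6,7)[of y] y by (auto simp: q_def)
      define U' where "U' = {z. q + z \<in> D}"
      have FD: "hol2m F D" by (rule hol2m_subset[OF F(1) D(2,3)])
      have oU': "open U'" unfolding U'_def using hol2_open[OF hol2_shift[of "\<lambda>z. fst (F z)" D q]] FD by (simp add: hol2m_def)
      have F': "hol2m F' U'" using FD unfolding hol2m_def F'_def U'_def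
        by (auto intro!: hol2_diff hol2_shift[of "\<lambda>z. fst (F z)" D q] hol2_shift[of "\<lambda>z. snd (F z)" D q] hol2_const oU'[unfolded U'_def])
      have U'0: "0 \<in> U'" and F'0: "F' 0 = 0" using qD Fq by (auto simp: U'_def F'_def)
      have "(F has_derivative (\<lambda>h. (lam * fst h + dy (\<lambda>z. fst (F z)) q * snd h, dx (\<lambda>z. snd (F z)) q * fst h + dy (\<lambda>z. snd (F z)) q * snd h))) (at q)"
        using hol2m_has_derivative[OF FD qD] D(8)[of y] qD by (simp add: q_def)
      have d1: "dx (\<lambda>z. fst (F' z)) 0 = lam"
      proof -
        have "((\<lambda>x. fst (F (x, y))) has_field_derivative lam) (at 0)"
          using has_derivative_slice_x[OF hol2_has_derivative[of "\<lambda>z. fst (F z)" D "(0, y)"]] FD qD D(8)[of y] by (simp add: hol2m_def q_def)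
        then show ?thesis by (simp add: dx_def F'_def q_def DERIV_imp_deriv)
      qed
      have d2: "dy (\<lambda>z. fst (F' z)) 0 = 0"
      proof -
        have "((\<lambda>t. fst (F (0, y + t))) has_field_derivative 0) (at 0)"
        proof (rule has_field_derivative_transform_within_open[of "\<lambda>_. 0" _ _ "ball 0 (s - cmod y)"])
          fix t :: complex assume "t \<in> ball 0 (s - cmod y)"
          then have "y + t \<in> ball 0 s" using norm_triangle_ineq[of y t] by simp
          then show "0 = fst (F (0, y + t))" using D(6,7) by simp
        qed (use y in auto)
        then show ?thesis by (simp add: dy_def F'_def q_def DERIV_imp_deriv)
      qed
      have tF: "taylor_map F' 0 = taylor_map F q"
        using taylor2_shift[of "\<lambda>z. fst (F z - F q)" q] taylor2_shift[of "\<lambda>z. snd (F z - F q)" q] F'0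
        by (simp add: taylor_map_def F'_def Fq)
      have g': "hol2 (\<lambda>z. g (q + z)) {z. q + z \<in> N}" by (rule hol2_shift[OF g(1)])
      have tg: "taylor2 (\<lambda>z. g (q + z)) 0 = taylor2 g q" by (rule taylor2_shift[symmetric])
      have dg: "dy (\<lambda>z. g (q + z)) 0 \<noteq> 0"
      proof -
        have "((\<lambda>v. g (0, v)) has_field_derivative dy g (0, y)) (at (y + 0))"
          using has_derivative_slice_y[OF hol2_has_derivative[OF g(1,2)]] by simp
        then have "((\<lambda>t. g (0, y + t)) has_field_derivative dy g (0, y)) (at 0)"
          using DERIV_shift[of "\<lambda>v. g (0, v)" _ 0 y] by (simp add: add.commute)
        then show ?thesis using g(4) by (simp add: dy_def q_def DERIV_imp_deriv)
      qed
      have inv': "compose2 (taylor2 (\<lambda>z. g (q + z)) 0) (taylor_map F' 0) = taylor2 (\<lambda>z. g (q + z)) 0 * w"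
        unfolding tg tF using inv by (simp add: q_def)
      have "0 \<in> {z. q + z \<in> N}" "g (q + 0) = 0" "\<epsilon> / 2 > 0" using g \<epsilon>(1) by (auto simp: q_def)
      from invariant_curve_infinite_orbit[OF F' U'0 F'0 d2 d1 center_multiplier(2) lam(1) g' this(1,2) dg inv' this(3)]
      obtain p where p: "\<And>n. (F' ^^ n) p \<in> ball 0 (\<epsilon> / 2)" "infinite (range (\<lambda>n. (F' ^^ n) p))" by auto
      have it: "(F ^^ n) (q + p) = q + (F' ^^ n) p" for n
        by (induction n) (simp_all add: F'_def)
      have "(F ^^ n) (q + p) \<in> ball 0 \<epsilon>" for n
      proof -
        have "norm q < \<epsilon> / 2" using y by (simp add: q_def)
        then show ?thesis using p(1)[of n] norm_triangle_ineq[of q "(F' ^^ n) p"] unfolding it mem_ball_0 by linarith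
      qed
      then have "finite (range (\<lambda>n. (F ^^ n) (q + p)))" using \<epsilon>(2) by blast
      then have "finite (range (\<lambda>n. q + (F' ^^ n) p))" by (simp add: it)
      then have "finite ((\<lambda>z. z - q) ` range (\<lambda>n. q + (F' ^^ n) p))" by (rule finite_imageI)
      then show False using p(2) by (simp add: image_image)
    qed
  qed
qed

end

subsection \<open>Straightening coordinates\<close>

text \<open>The rows (v2, -v1) and (-u2, u1) annihilate one eigenvector each; that they are left
  eigenvectors for the other eigenvalue follows from the trace 1 + \<lambda>.\<close>

lemma left_eigenvectors:
  fixes a b c d lam :: complex
  assumes v: "(v1, v2) \<noteq> 0" "a * v1 + b * v2 = v1" "c * v1 + d * v2 = v2"
    and u: "(u1, u2) \<noteq> 0" "a * u1 + b * u2 = lam * u1" "c * u1 + d * u2 = lam * u2" and lam: "lam \<noteq> 1"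
  shows "\<exists>l11 l12 l21 l22. l11 * l22 - l12 * l21 \<noteq> 0 \<and> l11 * a + l12 * c = lam * l11 \<and> l11 * b + l12 * d = lam * l12 \<and>
    l21 * a + l22 * c = l21 \<and> l21 * b + l22 * d = l22"
proof -
  define \<Delta> where "\<Delta> = u1 * v2 - u2 * v1"
  have "\<Delta> \<noteq> 0"
  proof
    assume "\<Delta> = 0"
    then have e: "u1 * v2 = u2 * v1" by (simp add: \<Delta>_def)
    have "(lam - 1) * (u1 * v1) = (lam * u1) * v1 - u1 * v1" by (simp add: algebra_simps)
    also have "\<dots> = (a * u1 + b * u2) * v1 - u1 * (a * v1 + b * v2)" by (simp only: v(2) u(2))
    also have "\<dots> = b * (u2 * v1 - u1 * v2)" by (simp add: algebra_simps)
    finally have "(lam - 1) * (u1 * v1) = 0" by (simp add: e)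
    moreover have "(lam - 1) * (u2 * v2) = 0"
    proof -
      have "(lam - 1) * (u2 * v2) = (lam * u2) * v2 - u2 * v2" by (simp add: algebra_simps)
      also have "\<dots> = (c * u1 + d * u2) * v2 - u2 * (c * v1 + d * v2)" by (simp only: v(3) u(3))
      also have "\<dots> = c * (u1 * v2 - u2 * v1)" by (simp add: algebra_simps)
      finally show ?thesis by (simp add: e)
    qed
    moreover have "(lam - 1) * (u1 * v2) = 0"
    proof -
      have "(lam - 1) * (u1 * v2) = lam * (u1 * v2) - u1 * v2" by (simp add: algebra_simps)
      also have "\<dots> = (lam * u2) * v1 - u1 * v2" by (simp add: e)
      also have "\<dots> = (c * u1 + d * u2) * v1 - u1 * (c * v1 + d * v2)" by (simp only: v(3) u(3))
      also have "\<dots> = d * (u2 * v1 - u1 * v2)" by (simp add: algebra_simps)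
      finally show ?thesis by (simp add: e)
    qed
    ultimately show False using lam v(1) u(1) e by (auto simp: zero_prod_def)
  qed
  moreover have "(a + d) * \<Delta> = (1 + lam) * \<Delta>"
  proof -
    have "(a + d) * \<Delta> = (a * u1 + b * u2) * v2 - u2 * (a * v1 + b * v2) + u1 * (c * v1 + d * v2) - (c * u1 + d * u2) * v1"
      by (simp add: \<Delta>_def algebra_simps)
    also have "\<dots> = (1 + lam) * \<Delta>" unfolding v(2,3) u(2,3) by (simp add: \<Delta>_def algebra_simps)
    finally show ?thesis .
  qed
  ultimately have tr: "a + d = 1 + lam" by simp
  have "v2 * a + - v1 * c = (a + d - 1) * v2 - ((c * v1 + d * v2) - v2)" by (simp add: algebra_simps)
  then have 1: "v2 * a + - v1 * c = lam * v2" unfolding v(3) tr by simp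
  have "v2 * b + - v1 * d = (a * v1 + b * v2) - (a + d) * v1" by (simp add: algebra_simps)
  then have 2: "v2 * b + - v1 * d = lam * - v1" unfolding v(2) tr by (simp add: algebra_simps)
  have "- u2 * a + u1 * c = (c * u1 + d * u2) - (a + d) * u2" by (simp add: algebra_simps)
  then have 3: "- u2 * a + u1 * c = - u2" unfolding u(3) tr by (simp add: algebra_simps)
  have "- u2 * b + u1 * d = (a + d) * u1 - (a * u1 + b * u2)" by (simp add: algebra_simps)
  then have 4: "- u2 * b + u1 * d = u1" unfolding u(2) tr by (simp add: algebra_simps)
  have "v2 * u1 - - v1 * - u2 \<noteq> 0" using \<open>\<Delta> \<noteq> 0\<close> by (simp add: \<Delta>_def mult.commute)
  then show ?thesis using 1 2 3 4 by blast
qed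

lemma hol2m_preimage_open: "hol2m F U \<Longrightarrow> open W \<Longrightarrow> open {p \<in> U. F p \<in> W}"
  using open_preimage_pair[of "\<lambda>z. fst (F z)" U "\<lambda>z. snd (F z)" W] by (simp add: hol2m_def)

lemma hol2m_tendsto: "hol2m F U \<Longrightarrow> p \<in> U \<Longrightarrow> filterlim F (nhds (F p)) (nhds p)"
  by (rule continuous_on_open_tendsto[OF hol2m_continuous_on hol2m_open])

text \<open>\<open>pos_orbit\<close> lists iterates as long as they stay in A. For a point that
  never leaves B the conjugate orbit never leaves A, so the list is the whole orbit.\<close>

lemma conjugate_orbit_finite:
  assumes \<phi>: "inj_on \<phi> B" "\<And>p. p \<in> B \<Longrightarrow> \<phi> p \<in> A \<and> \<phi> (S p) = T (\<phi> p)"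
    and fin: "\<And>q. q \<in> A \<Longrightarrow> finite (pos_orbit T A q)" and p: "\<And>n. (S ^^ n) p \<in> B"
  shows "finite (range (\<lambda>n. (S ^^ n) p))"
proof -
  have it: "(T ^^ n) (\<phi> p) = \<phi> ((S ^^ n) p)" for n
    by (induction n) (use \<phi>(2) p in auto)
  have "\<phi> p \<in> A" using p[of 0] \<phi>(2) by simp
  moreover have "\<phi> ` range (\<lambda>n. (S ^^ n) p) \<subseteq> pos_orbit T A (\<phi> p)"
  proof
    fix q assume "q \<in> \<phi> ` range (\<lambda>n. (S ^^ n) p)"
    then obtain n where n: "q = (T ^^ n) (\<phi> p)" using it by auto
    have "\<forall>k\<le>n. (T ^^ k) (\<phi> p) \<in> A" using it \<phi>(2) p by simp
    then show "q \<in> pos_orbit T A (\<phi> p)" using n unfolding pos_orbit_def by blast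
  qed
  ultimately have "finite (\<phi> ` range (\<lambda>n. (S ^^ n) p))" using fin finite_subset by blast
  moreover have "range (\<lambda>n. (S ^^ n) p) \<subseteq> B" using p by auto
  ultimately show ?thesis using finite_imageD inj_on_subset[OF \<phi>(1)] by blast
qed

text \<open>With \<open>\<ell>\<^sub>1\<close>, \<open>\<ell>\<^sub>2\<close> dual to the eigenvectors, the coordinates are
  \<open>\<psi>(p) = (\<ell>\<^sub>1(F p - p) / (\<lambda> - 1), \<ell>\<^sub>2 p)\<close>: fixed points lie on \<open>{x = 0}\<close>,
  and there \<open>F p - p\<close> is controlled by its second component.\<close>

theorem straightening_coordinates:
  assumes rep: "representative F U V" and A: "A \<subseteq> U \<inter> V" "0 \<in> interior A" "finite_orbits_in F U A"
    and spec: "Spec (frechet_derivative F (at 0)) = {1, lam}" and lam: "\<And>n. n > 0 \<Longrightarrow> lam ^ n \<noteq> 1"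
  shows "\<exists>\<psi> U1 V1 U' V'. representative \<psi> U1 V1 \<and> U1 \<subseteq> U \<and> (\<forall>p\<in>U1. F p = p \<longrightarrow> fst (\<psi> p) = 0) \<and>
    U' \<subseteq> V1 \<and> (\<forall>p\<in>U'. F (inv_into U1 \<psi> p) \<in> U1) \<and>
    tame_germ (\<lambda>p. \<psi> (F (inv_into U1 \<psi> p))) (\<lambda>p. \<psi> (inv_into U F (inv_into U1 \<psi> p))) U' V' lam"
proof -
  have l1: "lam \<noteq> 1" using lam[of 1] by simp
  define F' where "F' = inv_into U F"
  note r = representative_inv[OF rep, folded F'_def]
  have F: "hol2m F U" "hol2m F' V" "open U" "open V" "0 \<in> U" "F 0 = 0" using rep by (auto simp: representative_iff F'_def)
  have F12: "hol2 (\<lambda>z. fst (F z)) U" "hol2 (\<lambda>z. snd (F z)) U" using F by (auto simp: hol2m_def)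
  define a b c d where "a = dx (\<lambda>z. fst (F z)) 0" and "b = dy (\<lambda>z. fst (F z)) 0"
    and "c = dx (\<lambda>z. snd (F z)) 0" and "d = dy (\<lambda>z. snd (F z)) 0"
  have F1': "((\<lambda>z. fst (F z)) has_derivative (\<lambda>h. a * fst h + b * snd h)) (at 0)"
    and F2': "((\<lambda>z. snd (F z)) has_derivative (\<lambda>h. c * fst h + d * snd h)) (at 0)"
    using hol2_has_derivative[OF F12(1) F(5)] hol2_has_derivative[OF F12(2) F(5)] by (simp_all add: a_def b_def c_def d_def)
  have DF: "(F has_derivative (\<lambda>h. (a * fst h + b * snd h, c * fst h + d * snd h))) (at 0)"
    using has_derivative_Pair[OF F1' F2'] by simp
  have fd: "frechet_derivative F (at 0) = (\<lambda>h. (a * fst h + b * snd h, c * fst h + d * snd h))"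
    using frechet_derivative_at[OF DF] by simp
  have "1 \<in> Spec (frechet_derivative F (at 0))" "lam \<in> Spec (frechet_derivative F (at 0))" using spec by auto
  then obtain v u where vu: "v \<noteq> 0" "(a * fst v + b * snd v, c * fst v + d * snd v) = cscale 1 v"
    "u \<noteq> 0" "(a * fst u + b * snd u, c * fst u + d * snd u) = cscale lam u" unfolding Spec_def fd by blast
  \<comment> \<open>The derivative of the inverse germ is a left inverse of that of F, so 0 is not
    an eigenvalue.\<close>
  have l0: "lam \<noteq> 0"
  proof
    assume "lam = 0"
    then have z: "(a * fst u + b * snd u, c * fst u + d * snd u) = 0" using vu(4) by (simp add: cscale_def zero_prod_def)
    obtain G' where G': "(F' has_derivative G') (at (F 0))" using hol2m_has_derivative[OF F(2) r(1)] F(6) by auto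
    have "((\<lambda>z. F' (F z)) has_derivative (\<lambda>h. G' (a * fst h + b * snd h, c * fst h + d * snd h))) (at 0)"
      by (rule has_derivative_compose[OF DF G'])
    moreover have "((\<lambda>z. F' (F z)) has_derivative (\<lambda>h. h)) (at 0)"
      by (rule has_derivative_transform_within_open[OF has_derivative_ident F(3,5)]) (use r in auto)
    ultimately have "(\<lambda>h. G' (a * fst h + b * snd h, c * fst h + d * snd h)) = (\<lambda>h. h)" by (rule has_derivative_unique)
    from fun_cong[OF this, of u] have "u = G' 0" using z by simp
    also have "\<dots> = 0" using linear_0[OF has_derivative_linear[OF G']] .
    finally show False using vu(3) by simp
  qed
  obtain l11 l12 l21 l22 where l: "l11 * l22 - l12 * l21 \<noteq> 0" "l11 * a + l12 * c = lam * l11" "l11 * b + l12 * d = lam * l12"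
    "l21 * a + l22 * c = l21" "l21 * b + l22 * d = l22"
  proof -
    have "(fst v, snd v) \<noteq> 0" "a * fst v + b * snd v = fst v" "c * fst v + d * snd v = snd v"
      "(fst u, snd u) \<noteq> 0" "a * fst u + b * snd u = lam * fst u" "c * fst u + d * snd u = lam * snd u"
      using vu unfolding cscale_def by (metis mult_1 fst_conv snd_conv prod.collapse)+
    from left_eigenvectors[OF this l1] show ?thesis using that by blast
  qed
  \<comment> \<open>As (l11, l12) is a left eigenvector for \<lambda>, the bracket has derivative
    \<lambda> - 1 times this form at 0; the division leaves the form itself.\<close>
  define \<psi>1 where "\<psi>1 p = (l11 * (fst (F p) - fst p) + l12 * (snd (F p) - snd p)) * (1 / (lam - 1))" for p
  define \<psi>2 where "\<psi>2 p = l21 * fst p + l22 * snd p" for p :: complex2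
  define \<psi> where "\<psi> p = (\<psi>1 p, \<psi>2 p)" for p
  have h\<psi>: "hol2 \<psi>1 U" "hol2 \<psi>2 U" unfolding \<psi>1_def[abs_def] \<psi>2_def[abs_def]
    by (intro hol2_mult hol2_add hol2_diff F12 hol2_const hol2_fst hol2_snd F)+
  have \<psi>0: "\<psi>1 0 = 0" "\<psi>2 0 = 0" using F(6) by (simp_all add: \<psi>1_def \<psi>2_def zero_prod_def)
  have \<psi>1': "(\<psi>1 has_derivative (\<lambda>h. l11 * fst h + l12 * snd h)) (at 0)"
  proof -
    have "(\<psi>1 has_derivative (\<lambda>h. (l11 * ((a * fst h + b * snd h) - fst h) + l12 * ((c * fst h + d * snd h) - snd h)) * (1 / (lam - 1)))) (at 0)"
      unfolding \<psi>1_def[abs_def]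
      by (intro has_derivative_mult_left has_derivative_add has_derivative_mult_right
          has_derivative_diff[OF F1' has_derivative_fst[OF has_derivative_ident]] has_derivative_diff[OF F2' has_derivative_snd[OF has_derivative_ident]])
    moreover have "(l11 * ((a * x + b * y) - x) + l12 * ((c * x + d * y) - y)) * (1 / (lam - 1)) = l11 * x + l12 * y" for x y
    proof -
      have "l11 * ((a * x + b * y) - x) + l12 * ((c * x + d * y) - y) = (l11 * a + l12 * c) * x + (l11 * b + l12 * d) * y - (l11 * x + l12 * y)"
        by (simp add: algebra_simps)
      also have "\<dots> = (lam - 1) * (l11 * x + l12 * y)" unfolding l by (simp add: algebra_simps)
      finally show ?thesis using l1 by simp
    qed
    ultimately show ?thesis by simp
  qed
  have \<psi>2': "(\<psi>2 has_derivative (\<lambda>h. l21 * fst h + l22 * snd h)) (at 0)"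
    unfolding \<psi>2_def[abs_def] by (auto intro!: derivative_eq_intros)
  have "hol2m \<psi> U" using h\<psi> by (simp add: hol2m_def \<psi>_def)
  moreover have "\<psi> 0 = 0" using \<psi>0 by (simp add: \<psi>_def zero_prod_def)
  moreover have "dx (\<lambda>z. fst (\<psi> z)) 0 * dy (\<lambda>z. snd (\<psi> z)) 0 - dy (\<lambda>z. fst (\<psi> z)) 0 * dx (\<lambda>z. snd (\<psi> z)) 0 \<noteq> 0"
    using has_derivative_dx_dy[OF \<psi>1'] has_derivative_dx_dy[OF \<psi>2'] l(1) by (simp add: \<psi>_def)
  ultimately obtain U1 V1 where U1: "U1 \<subseteq> U" "representative \<psi> U1 V1" using ex_representative F(5) by blast
  define \<phi> where "\<phi> = inv_into U1 \<psi>"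
  note s = representative_inv[OF U1(2), folded \<phi>_def]
  have \<psi>\<phi>: "hol2m \<psi> U1" "hol2m \<phi> V1" "open U1" "open V1" "0 \<in> U1" "\<psi> 0 = 0"
    using U1(2) by (auto simp: representative_iff \<phi>_def)
  have F\<phi>: "hol2m (\<lambda>p. F (\<phi> p)) V1" by (rule hol2m_compose[OF F(1) \<psi>\<phi>(2)]) (use s U1 in auto)
  define U' where "U' = {p \<in> V1. F (\<phi> p) \<in> U1}"
  have oU': "open U'" unfolding U'_def by (rule hol2m_preimage_open[OF F\<phi> \<psi>\<phi>(3)])
  define W where "W = {p \<in> V1. \<phi> p \<in> V}"
  have oW: "open W" unfolding W_def by (rule hol2m_preimage_open[OF \<psi>\<phi>(2) F(4)])
  have G\<phi>: "hol2m (\<lambda>p. F' (\<phi> p)) W" by (rule hol2m_compose[OF F(2) hol2m_subset[OF \<psi>\<phi>(2) oW]]) (auto simp: W_def)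
  define V' where "V' = {p \<in> W. F' (\<phi> p) \<in> U1}"
  have oV': "open V'" unfolding V'_def by (rule hol2m_preimage_open[OF G\<phi> \<psi>\<phi>(3)])
  define Fh where "Fh p = \<psi> (F (\<phi> p))" for p
  define Gh where "Gh p = \<psi> (F' (\<phi> p))" for p
  have hFh: "hol2m Fh U'" unfolding Fh_def[abs_def]
    by (rule hol2m_compose[OF \<psi>\<phi>(1) hol2m_subset[OF F\<phi> oU']]) (auto simp: U'_def)
  have hGh: "hol2m Gh V'" unfolding Gh_def[abs_def]
    by (rule hol2m_compose[OF \<psi>\<phi>(1) hol2m_subset[OF G\<phi> oV']]) (auto simp: V'_def)
  have U'0: "0 \<in> U'" "0 \<in> V'" using s F \<psi>\<phi> r by (auto simp: U'_def V'_def W_def)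
  have Fh0: "Fh 0 = 0" using s F \<psi>\<phi> by (simp add: Fh_def)
  have conjF: "\<phi> (Fh p) = F (\<phi> p)" if "p \<in> U'" for p using that s by (simp add: U'_def Fh_def)
  have conjG: "\<phi> (Gh p) = F' (\<phi> p)" if "p \<in> V'" for p using that s by (simp add: V'_def Gh_def)
  have inv: "Gh (Fh p) = p" if "p \<in> U'" for p
  proof -
    have p: "p \<in> V1" using that by (simp add: U'_def)
    then have "\<phi> p \<in> U" using s(6) U1(1) by blast
    then show ?thesis using conjF[OF that] s(4)[OF p] r(3) by (simp add: Gh_def)
  qed
  have Fh12: "hol2 (\<lambda>z. fst (Fh z)) U'" "hol2 (\<lambda>z. snd (Fh z)) U'" using hFh by (auto simp: hol2m_def)
  have der: "(h has_derivative (\<lambda>k. dx h 0 * fst k + dy h 0 * snd k)) (at 0) \<Longrightarrow>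
      ((\<lambda>p. h (\<psi>1 p, \<psi>2 p)) has_derivative (\<lambda>k. (dx h 0 * l11 + dy h 0 * l21) * fst k + (dx h 0 * l12 + dy h 0 * l22) * snd k)) (at 0)" for h
    by (rule has_derivative_compose_pair[OF \<psi>1' \<psi>2']) (simp add: \<psi>0 flip: zero_prod_def)
  have der': "(h has_derivative (\<lambda>k. x * fst k + y * snd k)) (at 0) \<Longrightarrow>
      ((\<lambda>p. h (fst (F p), snd (F p))) has_derivative (\<lambda>k. (x * a + y * c) * fst k + (x * b + y * d) * snd k)) (at 0)" for h x y
    by (rule has_derivative_compose_pair[OF F1' F2']) (simp add: F(6) flip: zero_prod_def)
  have eqc: "Fh (\<psi> p) = \<psi> (F p)" if "p \<in> U1" for p using s(3)[OF that] by (simp add: Fh_def)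
  \<comment> \<open>Differentiating \<open>Fh (\<psi> p) = \<psi> (F p)\<close> yields the
    derivative of \<open>Fh\<close> without that of the inverse of \<psi>.\<close>
  have co: "dx (\<lambda>z. h (Fh z)) 0 * l11 + dy (\<lambda>z. h (Fh z)) 0 * l21 = x * a + y * c"
       "dx (\<lambda>z. h (Fh z)) 0 * l12 + dy (\<lambda>z. h (Fh z)) 0 * l22 = x * b + y * d"
    if "hol2 (\<lambda>z. h (Fh z)) U'" "((\<lambda>p. h (\<psi> p)) has_derivative (\<lambda>k. x * fst k + y * snd k)) (at 0)" for h x y
  proof -
    have A: "((\<lambda>p. h (Fh (\<psi>1 p, \<psi>2 p))) has_derivative (\<lambda>k. (dx (\<lambda>z. h (Fh z)) 0 * l11 + dy (\<lambda>z. h (Fh z)) 0 * l21) * fst k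
       + (dx (\<lambda>z. h (Fh z)) 0 * l12 + dy (\<lambda>z. h (Fh z)) 0 * l22) * snd k)) (at 0)"
      by (rule der[OF hol2_has_derivative[OF that(1) U'0(1)]])
    have "((\<lambda>p. h (\<psi> (fst (F p), snd (F p)))) has_derivative (\<lambda>k. (x * a + y * c) * fst k + (x * b + y * d) * snd k)) (at 0)"
      by (rule der'[OF that(2)])
    then have "((\<lambda>p. h (Fh (\<psi>1 p, \<psi>2 p))) has_derivative (\<lambda>k. (x * a + y * c) * fst k + (x * b + y * d) * snd k)) (at 0)"
      by (rule has_derivative_transform_within_open[OF _ \<psi>\<phi>(3,5)]) (use eqc in \<open>simp add: \<psi>_def\<close>)
    from has_derivative_dx_dy[OF this] has_derivative_dx_dy[OF A]
    show "dx (\<lambda>z. h (Fh z)) 0 * l11 + dy (\<lambda>z. h (Fh z)) 0 * l21 = x * a + y * c"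
       "dx (\<lambda>z. h (Fh z)) 0 * l12 + dy (\<lambda>z. h (Fh z)) 0 * l22 = x * b + y * d" by simp_all
  qed
  have D1: "dx (\<lambda>z. fst (Fh z)) 0 = lam" "dy (\<lambda>z. fst (Fh z)) 0 = 0"
    and D2: "dx (\<lambda>z. snd (Fh z)) 0 = 0" "dy (\<lambda>z. snd (Fh z)) 0 = 1"
  proof -
    have solve: "x = \<mu> \<and> y = \<nu>" if "x * l11 + y * l21 = \<mu> * l11 + \<nu> * l21" "x * l12 + y * l22 = \<mu> * l12 + \<nu> * l22" for x y \<mu> \<nu>
    proof -
      have "(x - \<mu>) * (l11 * l22 - l12 * l21) = 0" using that by algebra
      moreover have "(y - \<nu>) * (l11 * l22 - l12 * l21) = 0" using that by algebra
      ultimately show ?thesis using l(1) by simp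
    qed
    have "((\<lambda>p. fst (\<psi> p)) has_derivative (\<lambda>k. l11 * fst k + l12 * snd k)) (at 0)"
      "((\<lambda>p. snd (\<psi> p)) has_derivative (\<lambda>k. l21 * fst k + l22 * snd k)) (at 0)" using \<psi>1' \<psi>2' by (simp_all add: \<psi>_def)
    from co[OF Fh12(1) this(1)] co[OF Fh12(2) this(2)]
    show "dx (\<lambda>z. fst (Fh z)) 0 = lam" "dy (\<lambda>z. fst (Fh z)) 0 = 0" "dx (\<lambda>z. snd (Fh z)) 0 = 0" "dy (\<lambda>z. snd (Fh z)) 0 = 1"
      using solve[of "dx (\<lambda>z. fst (Fh z)) 0" "dy (\<lambda>z. fst (Fh z)) 0" lam 0]
        solve[of "dx (\<lambda>z. snd (Fh z)) 0" "dy (\<lambda>z. snd (Fh z)) 0" 0 1] by (simp_all add: l)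
  qed
  have bound: "\<exists>C\<ge>0. \<forall>\<^sub>F y in nhds 0. cmod (fst (Fh (0, y))) \<le> C * cmod (snd (Fh (0, y)) - y)"
  proof -
    obtain \<rho> C where C: "\<rho> > 0" "C \<ge> 0" "\<And>x x' y y'. cmod x \<le> \<rho> \<Longrightarrow> cmod x' \<le> \<rho> \<Longrightarrow> cmod y \<le> \<rho> \<Longrightarrow> cmod y' \<le> \<rho> \<Longrightarrow>
      cmod (\<psi>1 (x, y) - \<psi>1 (x', y')) \<le> C * (cmod (x - x') + cmod (y - y'))"
      using hol2_lipschitz[OF h\<psi>(1) F(5)] by blast
    define K where "K = (cmod l12 + cmod l11) / cmod (l11 * l22 - l12 * l21)"
    have "\<forall>\<^sub>F p in nhds 0. p \<in> U' \<and> \<phi> p \<in> ball 0 \<rho> \<and> F (\<phi> p) \<in> ball 0 \<rho>"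
      using eventually_nhds_in_open[OF oU' U'0(1)] topological_tendstoD[OF hol2m_tendsto[OF \<psi>\<phi>(2) s(1)] open_ball, of 0 \<rho>]
        topological_tendstoD[OF hol2m_tendsto[OF F\<phi> s(1)] open_ball, of 0 \<rho>] C(1)
      by (simp add: eventually_conj_iff s(2) F(6))
    from eventually_slice[OF this]
    have "\<forall>\<^sub>F y in nhds 0. cmod (fst (Fh (0, y))) \<le> (C * K) * cmod (snd (Fh (0, y)) - y)"
    proof eventually_elim
      case (elim y)
      define p where "p = \<phi> (0, y)"
      have pn: "(0, y) \<in> V1" using elim by (simp add: U'_def)
      have "\<psi> p = (0, y)" using s(4)[OF pn] by (simp add: p_def)
      then have p0: "\<psi>1 p = 0" "\<psi>2 p = y" by (simp_all add: \<psi>_def)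
      define x1 x2 where "x1 = fst (F p) - fst p" and "x2 = snd (F p) - snd p"
      have "norm p < \<rho>" "norm (F p) < \<rho>" using elim by (simp_all add: p_def)
      then have sm: "cmod (fst p) \<le> \<rho>" "cmod (snd p) \<le> \<rho>" "cmod (fst (F p)) \<le> \<rho>" "cmod (snd (F p)) \<le> \<rho>"
        using norm_pair_bounds[of p] norm_pair_bounds[of "F p"] by linarith+
      have f1: "cmod (fst (Fh (0, y))) \<le> C * (cmod x1 + cmod x2)"
        using C(3)[OF sm(3,1,4,2)] p0(1) by (simp add: Fh_def \<psi>_def p_def[symmetric] x1_def x2_def)
      have f2: "snd (Fh (0, y)) - y = l21 * x1 + l22 * x2"
        using p0(2) by (simp add: Fh_def \<psi>_def p_def[symmetric] x1_def x2_def \<psi>2_def algebra_simps)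
      \<comment> \<open>Where \<psi>1 vanishes, one linear form of the displacement F p - p is 0. By
        Cramer's rule the displacement is then a multiple of the other form w, which is the
        displacement in y.\<close>
      have z: "l11 * x1 + l12 * x2 = 0" using p0(1) l1 by (simp add: \<psi>1_def x1_def x2_def)
      define w where "w = l21 * x1 + l22 * x2"
      define \<Delta> where "\<Delta> = l11 * l22 - l12 * l21"
      have "x1 * \<Delta> = - l12 * w" unfolding w_def \<Delta>_def using z by algebra
      moreover have "x2 * \<Delta> = l11 * w" unfolding w_def \<Delta>_def using z by algebra
      ultimately have "cmod (x1 * \<Delta>) = cmod (- l12 * w)" "cmod (x2 * \<Delta>) = cmod (l11 * w)" by simp_all
      then have "cmod x1 * cmod \<Delta> = cmod l12 * cmod w" "cmod x2 * cmod \<Delta> = cmod l11 * cmod w" by (simp_all add: norm_mult)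
      then have "(cmod x1 + cmod x2) * cmod \<Delta> = (cmod l12 + cmod l11) * cmod w" by (simp add: distrib_right)
      moreover have "cmod \<Delta> > 0" using l(1) by (simp add: \<Delta>_def)
      ultimately have "cmod x1 + cmod x2 = K * cmod w" by (simp add: K_def \<Delta>_def[symmetric] field_simps)
      then show ?case using f1 by (simp add: f2 w_def mult.assoc)
    qed
    moreover have "C * K \<ge> 0" using C(2) by (simp add: K_def)
    ultimately show ?thesis by blast
  qed
  have fin: "\<exists>\<epsilon>>0. \<not> infinite_orbit_in Fh (ball 0 \<epsilon>) \<and> \<not> infinite_orbit_in Gh (ball 0 \<epsilon>)"
  proof -
    have "\<forall>\<^sub>F p in nhds 0. p \<in> U' \<and> p \<in> V' \<and> \<phi> p \<in> interior A"
      using eventually_nhds_in_open[OF oU' U'0(1)] eventually_nhds_in_open[OF oV' U'0(2)]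
        topological_tendstoD[OF hol2m_tendsto[OF \<psi>\<phi>(2) s(1)] open_interior, of A] A(2)
      by (simp add: eventually_conj_iff s(2))
    then have "\<forall>\<^sub>F p in nhds 0. p \<in> U' \<and> p \<in> V' \<and> \<phi> p \<in> A"
      by eventually_elim (use interior_subset[of A] in blast)
    then obtain \<epsilon> where \<epsilon>: "\<epsilon> > 0" "\<And>p. p \<in> ball 0 \<epsilon> \<Longrightarrow> p \<in> U' \<and> p \<in> V' \<and> \<phi> p \<in> A"
      unfolding eventually_nhds_metric by (auto simp: dist_commute)
    have "inj_on \<phi> V1" by (rule inj_on_inverseI[of _ \<psi>]) (use s in auto)
    then have inj: "inj_on \<phi> (ball 0 \<epsilon>)" by (rule inj_on_subset) (use \<epsilon>(2) in \<open>auto simp: U'_def\<close>)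
    have po: "finite (pos_orbit F A q)" "finite (pos_orbit F' A q)" if "q \<in> A" for q
      using A(3) that by (auto simp: finite_orbits_in_def F'_def)
    have "finite (range (\<lambda>n. (Fh ^^ n) p))" if "\<forall>n. (Fh ^^ n) p \<in> ball 0 \<epsilon>" for p
      by (rule conjugate_orbit_finite[OF inj _ po(1)]) (use \<epsilon>(2) conjF that in auto)
    moreover have "finite (range (\<lambda>n. (Gh ^^ n) p))" if "\<forall>n. (Gh ^^ n) p \<in> ball 0 \<epsilon>" for p
      by (rule conjugate_orbit_finite[OF inj _ po(2)]) (use \<epsilon>(2) conjG that in auto)
    ultimately show ?thesis using \<epsilon>(1) by blast
  qed
  have "tame_germ Fh Gh U' V' lam"
    by unfold_locales (use hFh hGh U'0 Fh0 D1 D2 lam l0 bound fin inv eventually_nhds_in_open[OF oU' U'0(1)] in \<open>auto elim: eventually_mono\<close>)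
  moreover have "fst (\<psi> p) = 0" if "F p = p" for p using that by (simp add: \<psi>_def \<psi>1_def)
  moreover have "U' \<subseteq> V1" "\<forall>p\<in>U'. F (\<phi> p) \<in> U1" by (auto simp: U'_def)
  ultimately show ?thesis using U1 unfolding Fh_def Gh_def \<phi>_def F'_def by blast
qed

section \<open>Formal conjugacy and formal curves for the original germ\<close>

lemma compose2_const: "compose2 (fps_const (fps_const c)) G = fps_const (fps_const c)"
proof (rule fps2_eqI)
  fix m n
  have *: "coeff2 (fps_const (fps_const c)) i j = (if i = 0 then if j = 0 then c else 0 else 0)" for i j by simp
  have "coeff2 (compose2 (fps_const (fps_const c)) G) m n =
    (\<Sum>i\<le>m + n. if i = 0 then \<Sum>j\<le>m + n - i. if j = 0 then c * coeff2 (fst G ^ i * snd G ^ j) m n else 0 else 0)"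
    unfolding compose2_def fps_nth_Abs_fps * by (intro sum.cong refl) (auto simp: if_distrib[of "\<lambda>x. x * _"] cong: if_cong)
  also have "\<dots> = c * coeff2 1 m n" by (subst sum.delta, simp, simp)
  also have "\<dots> = coeff2 (fps_const (fps_const c)) m n" by simp
  finally show "coeff2 (compose2 (fps_const (fps_const c)) G) m n = coeff2 (fps_const (fps_const c)) m n" .
qed

lemma compose2_coeff_00: "coeff2 (compose2 f G) 0 0 = coeff2 f 0 0"
  by (simp add: compose2_def)

lemma principal_ideal_eq_iff: "principal_ideal f = principal_ideal g \<longleftrightarrow> f dvd g \<and> g dvd f"
proof
  assume "principal_ideal f = principal_ideal g"
  moreover have "f \<in> principal_ideal f" "g \<in> principal_ideal g" unfolding principal_ideal_def by (auto intro: exI[of _ 1])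
  ultimately show "f dvd g \<and> g dvd f" unfolding principal_ideal_def dvd_def by blast
next
  assume "f dvd g \<and> g dvd f"
  then obtain u v where "g = f * u" "f = g * v" unfolding dvd_def by blast
  then show "principal_ideal f = principal_ideal g" unfolding principal_ideal_def by (metis (no_types) mult.assoc)
qed

text \<open>Generators of the same ideal divide each other and substitution is multiplicative, so it
  is enough that one generator is fixed.\<close>

lemma invariant_curve_at_principal_ideal:
  assumes "F p = p" "compose2 f (taylor_map F p) = f"
  shows "invariant_curve_at F p (principal_ideal f)"
  unfolding invariant_curve_at_def
proof (intro conjI allI impI)
  fix g assume "principal_ideal f = principal_ideal g"
  then have "f dvd g" "g dvd f" by (auto simp: principal_ideal_eq_iff)
  then obtain u where u: "g = f * u" by (auto simp: dvd_def)
  have "compose2 g (taylor_map F p) = f * compose2 u (taylor_map F p)" by (simp add: u compose2_mult assms(2))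
  then show "g dvd compose2 g (taylor_map F p)" using \<open>g dvd f\<close> by simp
qed (rule assms)

lemma taylor_map_linear: "taylor_map (\<lambda>(x, y). (lam * x, y)) 0 = (fps_const (fps_const lam) * fps_X, fps_const fps_X)"
proof -
  have "taylor2 (\<lambda>z. lam * fst z) 0 = fps_const (fps_const lam) * taylor2 (\<lambda>z. fst z) 0"
    by (rule taylor2_cmult[OF hol2_fst[OF open_UNIV]]) simp
  then show ?thesis using taylor2_fst[of 0] taylor2_snd[of 0]
    by (simp add: taylor_map_def split_def)
qed

text \<open>The components of H are eigenvectors of substitution by F; composing with the inverse of
  H leaves the two coordinates with the factors \<lambda> and 1.\<close>

lemma formally_conjugated_by_linear:
  assumes H: "formal_diffeo H" and F: "compose2 (fst H) F = fps_const (fps_const lam) * fst H" "compose2 (snd H) F = snd H"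
  shows "formally_conjugated_by H F (taylor_map (\<lambda>(x, y). (lam * x, y)) 0)"
proof -
  obtain K where K: "formal_diffeo K" "compose_map H K = id_map" "compose_map K H = id_map" using formal_inverse[OF H] by blast
  have "compose2 (fst H) K = fps_X" "compose2 (snd H) K = fps_const fps_X" using K(2) by (simp_all add: compose_map_def id_map_def)
  then have "compose_map (compose_map H F) K = taylor_map (\<lambda>(x, y). (lam * x, y)) 0"
    unfolding compose_map_def[of H F] F by (simp add: compose_map_def compose2_cmult taylor_map_linear)
  then show ?thesis using K unfolding formally_conjugated_by_def by blast
qed

text \<open>A multiple g v of a series g without constant term has the linear part of g times the
  constant term of v.\<close>

lemma fps2_dvd_coeff_01:
  assumes "coeff2 f 0 0 = 0" "coeff2 f 0 1 \<noteq> 0" "f dvd g" "g dvd f"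
  shows "coeff2 g 0 0 = 0" "coeff2 g 0 1 \<noteq> 0"
proof -
  obtain u v where u: "g = f * u" and v: "f = g * v" using assms(3,4) unfolding dvd_def by blast
  show g0: "coeff2 g 0 0 = 0" unfolding u using assms(1) by (simp add: coeff2_mult)
  show "coeff2 g 0 1 \<noteq> 0"
  proof
    assume "coeff2 g 0 1 = 0"
    then have "coeff2 (g * v) 0 1 = 0" using g0 by (simp add: coeff2_mult)
    then show False using assms(2) v by simp
  qed
qed

lemma transversally_convergent_ser:
  assumes "s > 0" "\<And>j. h j holomorphic_on ball 0 s" shows "transversally_convergent (ser h 0)"
  unfolding transversally_convergent_def
  by (rule exI[of _ "ball 0 s"], rule exI[of _ h]) (use assms in \<open>simp add: ser_def\<close>)

text \<open>Everything is transported by \<psi> from the normalised germ \<open>Fh\<close>: the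
  fixed points form \<psi> = (0, y), the conjugacy is the pair of series composed with \<psi>, and
  the formal curves are level sets of the second series.\<close>

lemma representative_conjugacy:
  assumes rep: "representative F U V" and A: "A \<subseteq> U \<inter> V" "0 \<in> interior A" "finite_orbits_in F U A"
    and spec: "Spec (frechet_derivative F (at 0)) = {1, lam}" and lam: "\<forall>n::nat. n > 0 \<longrightarrow> lam ^ n \<noteq> 1"
  shows "\<not> Bruno lam \<and> smooth_curve_germ (Fix F) \<and>
    (\<exists>H. formal_diffeo H \<and>
       formally_conjugated_by H (taylor_map F 0) (taylor_map (\<lambda>(x, y). (lam * x, y)) 0) \<and>
       transversally_formal H (Fix F)) \<and>
    (\<forall>\<^sub>F p in nhds 0. p \<in> Fix F \<longrightarrow>
       (\<exists>C. smooth_formal_curve C \<and> invariant_curve_at F p C \<and> divergent_curve C))"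
proof -
  obtain \<psi> U1 V1 U' V' where c: "representative \<psi> U1 V1" "U1 \<subseteq> U" "\<And>p. p \<in> U1 \<Longrightarrow> F p = p \<Longrightarrow> fst (\<psi> p) = 0"
    "U' \<subseteq> V1" "\<And>p. p \<in> U' \<Longrightarrow> F (inv_into U1 \<psi> p) \<in> U1"
    and tame: "tame_germ (\<lambda>p. \<psi> (F (inv_into U1 \<psi> p))) (\<lambda>p. \<psi> (inv_into U F (inv_into U1 \<psi> p))) U' V' lam"
    using straightening_coordinates[OF assms(1-5)] lam by blast
  define \<phi> where "\<phi> = inv_into U1 \<psi>"
  define Fh where "Fh = (\<lambda>p. \<psi> (F (\<phi> p)))"
  interpret tame_germ Fh "\<lambda>p. \<psi> (inv_into U F (\<phi> p))" U' V' lam using tame by (simp add: Fh_def \<phi>_def)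
  note s = representative_inv[OF c(1), folded \<phi>_def]
  have h: "hol2m F U" "F 0 = 0" using rep by (auto simp: representative_iff)
  have \<psi>\<phi>: "hol2m \<psi> U1" "hol2m \<phi> V1" "open U1" "open V1" "0 \<in> U1" "\<psi> 0 = 0"
    using c(1) by (auto simp: representative_iff \<phi>_def)
  have FU1: "F (\<phi> p) \<in> U1" if "p \<in> U'" for p using c(5)[OF that] by (simp add: \<phi>_def)
  obtain s0 X Y where XY: "s0 > 0" "\<And>j. X j holomorphic_on ball 0 s0" "\<And>j. Y j holomorphic_on ball 0 s0"
    "X 0 = (\<lambda>_. 0)" "X 1 = (\<lambda>_. 1)" "Y 0 = (\<lambda>y. y)"
    "\<And>y. y \<in> ball 0 s0 \<Longrightarrow> Fh (0, y) = (0, y)"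
    "\<And>y. y \<in> ball 0 s0 \<Longrightarrow> compose2 (ser X y) (taylor_map Fh (0, y)) = fps_const (fps_const lam) * ser X y"
    "\<And>y. y \<in> ball 0 s0 \<Longrightarrow> compose2 (ser Y y) (taylor_map Fh (0, y)) = ser Y y"
    by (rule transversal_conjugacy) (rule that; assumption)
  have semi: "compose_map (taylor_map \<psi> p) (taylor_map F p) = compose_map (taylor_map Fh (\<psi> p)) (taylor_map \<psi> p)"
    if p: "p \<in> U1" "F p = p" "\<psi> p \<in> U'" for p
  proof -
    have "taylor_map (\<lambda>z. \<psi> (F z)) p = taylor_map (\<lambda>z. Fh (\<psi> z)) p"
      by (rule taylor_map_cong, rule eventually_mono[OF eventually_nhds_in_open[OF \<psi>\<phi>(3) p(1)]]) (simp add: Fh_def s)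
    then show ?thesis
      using taylor_map_compose[OF \<psi>\<phi>(1) h(1), of p] taylor_map_compose[OF F(1) \<psi>\<phi>(1), of p] p c(2) by auto
  qed
  have str: "straightens \<psi> (Fix F)"
  proof -
    have "\<forall>\<^sub>F p in nhds 0. p \<in> U1 \<and> \<psi> p \<in> U' \<and> \<psi> p \<in> ball 0 s0"
      using eventually_nhds_in_open[OF \<psi>\<phi>(3,5)] topological_tendstoD[OF hol2m_tendsto[OF \<psi>\<phi>(1,5)] hol2m_open[OF F(1)]]
        topological_tendstoD[OF hol2m_tendsto[OF \<psi>\<phi>(1,5)] open_ball, of 0 s0] F(2) XY(1)
      by (simp add: eventually_conj_iff \<psi>\<phi>(6))
    then show ?thesis unfolding straightens_def
    proof eventually_elim
      case (elim p)
      show ?case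
      proof
        assume "p \<in> Fix F" then show "fst (\<psi> p) = 0" using c(3) elim by (simp add: Fix_def)
      next
        assume f0: "fst (\<psi> p) = 0"
        define y where "y = snd (\<psi> p)"
        have py: "\<psi> p = (0, y)" using f0 by (simp add: y_def prod_eq_iff)
        have "y \<in> ball 0 s0" using elim by (simp add: py)
        then have e: "Fh (\<psi> p) = \<psi> p" using XY(7) py by simp
        have "F p \<in> U1" using FU1[of "\<psi> p"] elim s(3) by simp
        moreover have "\<psi> (F p) = \<psi> p" using e elim s(3) by (simp add: Fh_def)
        ultimately have "F p = p" using s(3) elim by metis
        then show "p \<in> Fix F" by (simp add: Fix_def)
      qed
    qed
  qed
  define Hh where "Hh = (ser X 0, ser Y 0)"
  have Hh: "formal_diffeo Hh"
    using fun_cong[OF XY(4)] XY(4-6) by (simp add: Hh_def formal_diffeo_def coeff2_ser)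
  \<comment> \<open>Composed with the inverse of \<psi> this gives back \<open>Hh\<close>, whose
    coefficients are holomorphic in y; that is transversal formality.\<close>
  define H where "H = compose_map Hh (taylor_map \<psi> 0)"
  have T: "compose_map (taylor_map \<psi> p) (taylor_map \<phi> (\<psi> p)) = id_map" "compose_map (taylor_map \<phi> (\<psi> p)) (taylor_map \<psi> p) = id_map"
    if "p \<in> U1" for p using representative_taylor_map[OF c(1) that] by (simp_all add: \<phi>_def)
  have H: "formal_diffeo H"
  proof -
    obtain K where K: "formal_diffeo K" "compose_map K Hh = id_map" using formal_inverse[OF Hh] by blast
    have "compose_map (compose_map (taylor_map \<phi> 0) K) H = compose_map (taylor_map \<phi> 0) (compose_map (compose_map K Hh) (taylor_map \<psi> 0))"
      unfolding H_def using formal_diffeo_zc[OF K(1)] formal_diffeo_zc[OF Hh] by (simp add: compose_map_assoc zc_compose_map)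
    also have "\<dots> = id_map" using T(2)[OF \<psi>\<phi>(5)] by (simp add: K(2) compose_map_id_left \<psi>\<phi>(6))
    finally show ?thesis
      by (intro formal_diffeo_left_inverse[of H "compose_map (taylor_map \<phi> 0) K"])
        (auto simp: H_def intro: zc_compose_map formal_diffeo_zc Hh)
  qed
  have cf: "compose2 (compose2 f (taylor_map \<psi> p)) (taylor_map F p) = compose2 (compose2 f (taylor_map Fh (\<psi> p))) (taylor_map \<psi> p)"
    if "p \<in> U1" "F p = p" "\<psi> p \<in> U'" for f p by (simp add: compose2_assoc semi[OF that])
  have p0: "0 \<in> U1" "F 0 = 0" "\<psi> 0 \<in> U'" using \<psi>\<phi> h(2) F(2) by simp_all
  have z0: "(0::complex2) = (0, 0)" by (simp add: zero_prod_def)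
  have "formally_conjugated_by H (taylor_map F 0) (taylor_map (\<lambda>(x, y). (lam * x, y)) 0)"
    using cf[OF p0, of "ser X 0"] cf[OF p0, of "ser Y 0"] XY(8)[of 0] XY(9)[of 0] XY(1)
    by (intro formally_conjugated_by_linear H) (simp_all add: H_def Hh_def compose_map_def \<psi>\<phi>(6) compose2_cmult z0[symmetric])
  moreover have "transversally_formal H (Fix F)"
  proof -
    have "compose_map H (taylor_map \<phi> 0) = Hh"
      using T(1)[OF \<psi>\<phi>(5)] by (simp add: H_def compose_map_assoc compose_map_id_right \<psi>\<phi>(6))
    then show ?thesis unfolding transversally_formal_def
      using c(1) str transversally_convergent_ser[OF XY(1,2)] transversally_convergent_ser[OF XY(1,3)]
      by (intro exI[of _ \<psi>] exI[of _ U1] exI[of _ V1]) (simp add: \<phi>_def[symmetric] Hh_def)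
  qed
  moreover have "smooth_curve_germ (Fix F)" using str c(1) by (auto simp: smooth_curve_germ_def Diff0_def)
  moreover have "\<forall>\<^sub>F p in nhds 0. p \<in> Fix F \<longrightarrow>
       (\<exists>C. smooth_formal_curve C \<and> invariant_curve_at F p C \<and> divergent_curve C)"
  proof -
    define bad where "bad y \<longleftrightarrow> (\<forall>g N w. hol2 g N \<and> (0, y) \<in> N \<and> g (0, y) = 0 \<and> dy g (0, y) \<noteq> 0 \<longrightarrow>
     compose2 (taylor2 g (0, y)) (taylor_map Fh (0, y)) \<noteq> taylor2 g (0, y) * w)" for y
    have "\<forall>\<^sub>F y in nhds 0. bad y" using no_invariant_analytic_curve by (simp add: bad_def)
    then obtain d where d: "d > 0" "\<And>y. cmod y < d \<Longrightarrow> bad y" unfolding eventually_nhds_metric by auto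
    define m where "m = min s0 d"
    have "\<forall>\<^sub>F p in nhds 0. p \<in> U1 \<and> \<psi> p \<in> U' \<and> \<psi> p \<in> ball 0 m"
      using eventually_nhds_in_open[OF \<psi>\<phi>(3,5)] topological_tendstoD[OF hol2m_tendsto[OF \<psi>\<phi>(1,5)] hol2m_open[OF F(1)]]
        topological_tendstoD[OF hol2m_tendsto[OF \<psi>\<phi>(1,5)] open_ball, of 0 m] F(2) XY(1) d(1)
      by (simp add: eventually_conj_iff \<psi>\<phi>(6) m_def)
    then show ?thesis
    proof (eventually_elim, intro impI)
      fix p assume p: "p \<in> U1 \<and> \<psi> p \<in> U' \<and> \<psi> p \<in> ball 0 m" and "p \<in> Fix F"
      then have Fp: "F p = p" by (simp add: Fix_def)
      define y where "y = snd (\<psi> p)"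
      have q: "\<psi> p = (0, y)" using c(3)[of p] p Fp by (simp add: y_def prod_eq_iff)
      have y: "y \<in> ball 0 s0" "bad y" using p d(2)[of y] by (simp_all add: q m_def)
      define T where "T = taylor_map \<psi> p"
      define T' where "T' = taylor_map \<phi> (0, y)"
      have TT: "compose_map T T' = id_map" "compose_map T' T = id_map" "zc T" "zc T'"
        using T[of p] p by (simp_all add: T_def T'_def q)
      \<comment> \<open>The second series is a formal first integral; subtracting its value at (0,
        y) gives the invariant level through this fixed point.\<close>
      define f where "f = ser Y y - fps_const (fps_const y)"
      have f1: "coeff2 f 0 0 = 0" "coeff2 f 0 1 \<noteq> 0" using XY(6) by (simp_all add: f_def coeff2_ser)
      have fF: "compose2 f (taylor_map Fh (0, y)) = f" using XY(9)[OF y(1)] by (simp add: f_def compose2_diff compose2_const)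
      define f0 where "f0 = compose2 f T"
      have f0F: "compose2 f0 (taylor_map F p) = f0" using cf[of p f] p Fp fF by (simp add: f0_def T_def q)
      have f_eq: "compose2 f0 T' = f" using TT by (simp add: f0_def compose2_assoc compose2_id)
      have "coeff2 f0 0 0 = 0" using f1 by (simp add: f0_def compose2_coeff_00)
      moreover have "coeff2 f0 1 0 \<noteq> 0 \<or> coeff2 f0 0 1 \<noteq> 0"
        using f1(2) compose2_coeff_01[of f0 T'] by (auto simp: f_eq)
      ultimately have "smooth_formal_curve (principal_ideal f0)" unfolding smooth_formal_curve_def by blast
      moreover have "invariant_curve_at F p (principal_ideal f0)" by (rule invariant_curve_at_principal_ideal[where f = f0, OF Fp f0F])
      moreover have "divergent_curve (principal_ideal f0)" unfolding divergent_curve_def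
      proof
        assume "\<exists>g. convergent2 g \<and> principal_ideal f0 = principal_ideal g"
        then obtain g where g: "convergent2 g" "f0 dvd g" "g dvd f0" by (auto simp: principal_ideal_eq_iff)
        obtain G0 r where G0: "r > 0" "hol2 G0 (ball 0 r)" "taylor2 G0 0 = g" using convergent2_hol2[OF g(1)] by blast
        have dv: "f dvd compose2 g T'" "compose2 g T' dvd f"
        proof -
          obtain u v where uv: "g = f0 * u" "f0 = g * v" using g(2,3) unfolding dvd_def by blast
          have "compose2 g T' = f * compose2 u T'" unfolding uv(1) compose2_mult[OF TT(4)] f_eq ..
          then show "f dvd compose2 g T'" by simp
          have "f = compose2 g T' * compose2 v T'" unfolding f_eq[symmetric] uv(2) by (rule compose2_mult[OF TT(4)])
          then show "compose2 g T' dvd f" by (metis dvd_triv_left)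
        qed
        note gc = fps2_dvd_coeff_01[OF f1 dv]
        \<comment> \<open>The convergent generator is a function in coordinates centred at p; k is
          the same function in the original coordinates.\<close>
        define k where "k z = G0 (- p + z)" for z
        have hk: "hol2 k {z. - p + z \<in> ball 0 r}" unfolding k_def[abs_def] by (rule hol2_shift[OF G0(2)])
        define N where "N = {z \<in> V1. \<phi> z \<in> {z. - p + z \<in> ball 0 r}}"
        have oN: "open N" unfolding N_def by (rule hol2m_preimage_open[OF \<psi>\<phi>(2) hol2_open[OF hk]])
        have hg: "hol2 (\<lambda>z. k (\<phi> z)) N" by (rule hol2_compose_map[OF hk hol2m_subset[OF \<psi>\<phi>(2) oN]]) (auto simp: N_def)
        have \<phi>q: "\<phi> (0, y) = p" using s(3)[of p] p by (simp add: q)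
        have qN: "(0, y) \<in> N" using s(5)[of p] p G0(1) by (simp add: N_def \<phi>q q)
        have tg: "taylor2 (\<lambda>z. k (\<phi> z)) (0, y) = compose2 g T'"
        proof -
          have "taylor2 k p = g" using taylor2_shift[of k p] G0(3) by (simp add: k_def)
          then show ?thesis
            using taylor2_compose_map[OF hk hol2m_subset[OF \<psi>\<phi>(2) oN] qN] G0(1) by (auto simp: N_def T'_def \<phi>q)
        qed
        have k0: "k (\<phi> (0, y)) = 0" "dy (\<lambda>z. k (\<phi> z)) (0, y) \<noteq> 0"
          using gc coeff2_taylor2_00[of "\<lambda>z. k (\<phi> z)" "(0, y)"] coeff2_taylor2_01[of "\<lambda>z. k (\<phi> z)" "(0, y)"] by (simp_all add: tg)
        \<comment> \<open>The analytic generator is an associate of f, which is fixed by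
          substitution, so substitution multiplies it by a formal w; \<open>bad\<close> excludes
          exactly this.\<close>
        obtain u v where uv: "compose2 g T' = f * u" "f = compose2 g T' * v" using dv unfolding dvd_def by blast
        have "compose2 (compose2 g T') (taylor_map Fh (0, y)) = f * compose2 u (taylor_map Fh (0, y))"
          by (simp add: uv(1) compose2_mult fF)
        also have "\<dots> = compose2 g T' * (v * compose2 u (taylor_map Fh (0, y)))" by (subst uv(2)) (simp add: mult.assoc)
        finally have "compose2 (taylor2 (\<lambda>z. k (\<phi> z)) (0, y)) (taylor_map Fh (0, y)) =
            taylor2 (\<lambda>z. k (\<phi> z)) (0, y) * (v * compose2 u (taylor_map Fh (0, y)))" by (simp add: tg)
        then show False using y(2) hg qN k0 unfolding bad_def by blast
      qed
      ultimately show "\<exists>C. smooth_formal_curve C \<and> invariant_curve_at F p C \<and> divergent_curve C" by blast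
    qed
  qed
  ultimately show ?thesis using not_Bruno H by blast
qed

text \<open>The representative G with finite orbits may differ from F away from 0, but the notions
  involved depend only on germs, at 0 or at points near 0.\<close>

theorem proposition2:
  fixes F :: "complex \<times> complex \<Rightarrow> complex \<times> complex" and lam :: complex
  assumes "F \<in> Diff0"
    and "finite_orbits_property F"
    and "Spec (frechet_derivative F (at 0)) = {1, lam}"
    and "\<forall>n::nat. n > 0 \<longrightarrow> lam ^ n \<noteq> 1"
  shows "\<not> Bruno lam \<and>
    smooth_curve_germ (Fix F) \<and>
    (\<exists>H. formal_diffeo H \<and>
       formally_conjugated_by H (taylor_map F 0) (taylor_map (\<lambda>(x, y). (lam * x, y)) 0) \<and>
       transversally_formal H (Fix F)) \<and>
    (\<forall>\<^sub>F p in nhds 0. p \<in> Fix F \<longrightarrow>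
       (\<exists>C. smooth_formal_curve C \<and> invariant_curve_at F p C \<and> divergent_curve C))"
proof -
  obtain G U V A where G: "representative G U V" "\<forall>\<^sub>F p in nhds 0. G p = F p"
    "A \<subseteq> U \<inter> V" "0 \<in> interior A" "finite_orbits_in G U A"
    using assms(2) unfolding finite_orbits_property_def by blast
  have hG: "hol2m G U" "0 \<in> U" using G(1) by (auto simp: representative_iff)
  have fd: "frechet_derivative G (at 0) = frechet_derivative F (at 0)"
  proof -
    obtain D where D: "(G has_derivative D) (at 0)" using hol2m_has_derivative[OF hG] by blast
    obtain W where "open W" "0 \<in> W" "\<And>p. p \<in> W \<Longrightarrow> G p = F p" using G(2) unfolding eventually_nhds by blast
    then have "(F has_derivative D) (at 0)" by (rule has_derivative_transform_within_open[OF D])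
    then show ?thesis using frechet_derivative_at D by metis
  qed
  have fix_iff: "\<forall>\<^sub>F p in nhds 0. p \<in> Fix G \<longleftrightarrow> p \<in> Fix F" using G(2) by eventually_elim (simp add: Fix_def)
  have str: "straightens \<psi> (Fix G) \<longleftrightarrow> straightens \<psi> (Fix F)" for \<psi>
    unfolding straightens_def by (rule eventually_subst, rule eventually_mono[OF fix_iff]) simp
  have T: "taylor_map G 0 = taylor_map F 0" by (rule taylor_map_cong[OF G(2)])
  note main = representative_conjugacy[OF G(1,3,4,5) assms(3)[folded fd] assms(4)]
  \<comment> \<open>Functions equal near 0 are equal near every p close to 0, hence have the same
    Taylor maps there.\<close>
  have "\<forall>\<^sub>F p in nhds 0. \<forall>\<^sub>F q in nhds p. G q = F q" using G(2) by (simp add: eventually_eventually)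
  then have inv: "\<forall>\<^sub>F p in nhds 0. \<forall>C. invariant_curve_at G p C \<longleftrightarrow> invariant_curve_at F p C"
  proof eventually_elim
    case (elim p)
    from taylor_map_cong[OF elim] eventually_nhds_x_imp_x[OF elim] show ?case by (simp add: invariant_curve_at_def)
  qed
  have "\<forall>\<^sub>F p in nhds 0. p \<in> Fix F \<longrightarrow>
       (\<exists>C. smooth_formal_curve C \<and> invariant_curve_at F p C \<and> divergent_curve C)"
    using main[THEN conjunct2, THEN conjunct2, THEN conjunct2] inv fix_iff by eventually_elim blast
  then show ?thesis
    using main unfolding smooth_curve_germ_def transversally_formal_def str T by blast
qed

end
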